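(* Let $0<\gamma<3\le p<+\infty$. Suppose that $(\mathbf{u},\mathbf{B})$ is a smooth solution (with associated pressure $\Pi$) of the stationary incompressible Hall-MHD equations on $\mathbb{R}^3$, $$\begin{cases} -\Delta \mathbf{u}+\operatorname{div}(\mathbf{u}\otimes\mathbf{u})+\nabla\Pi-\operatorname{curl}\mathbf{B}\times\mathbf{B}=0,\\ -\Delta\mathbf{B}+\operatorname{curl}(\mathbf{B}\times\mathbf{u})+\operatorname{curl}(\operatorname{curl}\mathbf{B}\times\mathbf{B})=0,\\ \operatorname{div}\mathbf{u}=\operatorname{div}\mathbf{B}=0,\end{cases}$$ with $\nabla\mathbf{B}\in L^2(\mathbb{R}^3)$, $\mathbf{u}\in M^p_{\gamma,0}(\mathbb{R}^3)$ and $\mathbf{B}\in M^p_\gamma(\mathbb{R}^3)$. If $(p,\gamma)$ is such that $\eta(p,\gamma)=\frac{\gamma}{p}+\frac23-\frac3p=0$, then $\mathbf{u}=\mathbf{B}=0$ on $\mathbb{R}^3$.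
   Context: Here $\mathbf{u},\mathbf{B}:\mathbb{R}^3\to\mathbb{R}^3$ are the velocity and magnetic fields and $\Pi:\mathbb{R}^3\to\mathbb{R}$ is the pressure. Local Morrey spaces: for $\gamma\ge0$ and $1<p<+\infty$, $M^p_\gamma(\mathbb{R}^3)$ is the set of $f\in L^p_{loc}(\mathbb{R}^3)$ such that $$\|f\|_{M^p_\gamma}=\sup_{R\ge1}\Big(R^{-\gamma}\int_{B(0,R)}|f(x)|^p\,dx\Big)^{1/p}<+\infty,$$ where $B(0,R)$ is the ball of radius $R$ centered at $0$. The space $M^p_{\gamma,0}(\mathbb{R}^3)$ is the subspace of all $f\in M^p_\gamma(\mathbb{R}^3)$ such that $$\lim_{R\to+\infty}\Big(R^{-\gamma}\int_{\frac R2\le|x|\le R}|f(x)|^p\,dx\Big)^{1/p}=0.$$ A vector field belongs to one of these spaces if its components do. *)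

theory Defs
  imports "HOL-Analysis.Analysis"
begin

section \<open>Differential operators on three-dimensional Euclidean space\<close>

definition partial :: "3 \<Rightarrow> (real^3 \<Rightarrow> 'a::real_normed_vector) \<Rightarrow> real^3 \<Rightarrow> 'a"
  where "partial i f x = frechet_derivative f (at x) (axis i 1)"

text \<open>Functions of class \<open>C\<^sup>k\<close> on the whole space. Differentiability at every point is the
  existence of the Frechet derivative, so \<^const>\<open>partial\<close> is never applied to a function
  whose derivative does not exist.\<close>

primrec Ck :: "nat \<Rightarrow> (real^3 \<Rightarrow> 'a::real_normed_vector) \<Rightarrow> bool"
  where
    "Ck 0 f \<longleftrightarrow> continuous_on UNIV f"
  | "Ck (Suc k) f \<longleftrightarrow> (\<forall>x. f differentiable (at x)) \<and> (\<forall>i. Ck k (partial i f))"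

definition smooth :: "(real^3 \<Rightarrow> 'a::real_normed_vector) \<Rightarrow> bool"
  where "smooth f \<longleftrightarrow> (\<forall>k. Ck k f)"

definition grad :: "(real^3 \<Rightarrow> real) \<Rightarrow> real^3 \<Rightarrow> real^3"
  where "grad f x = (\<chi> i. partial i f x)"

definition divg :: "(real^3 \<Rightarrow> real^3) \<Rightarrow> real^3 \<Rightarrow> real"
  where "divg v x = (\<Sum>i\<in>UNIV. partial i (\<lambda>y. v y $ i) x)"

definition curl :: "(real^3 \<Rightarrow> real^3) \<Rightarrow> real^3 \<Rightarrow> real^3"
  where "curl v x = vector
    [partial 2 (\<lambda>y. v y $ 3) x - partial 3 (\<lambda>y. v y $ 2) x,
     partial 3 (\<lambda>y. v y $ 1) x - partial 1 (\<lambda>y. v y $ 3) x,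
     partial 1 (\<lambda>y. v y $ 2) x - partial 2 (\<lambda>y. v y $ 1) x]"

definition laplacian :: "(real^3 \<Rightarrow> 'a::real_normed_vector) \<Rightarrow> real^3 \<Rightarrow> 'a"
  where "laplacian f x = (\<Sum>j\<in>UNIV. partial j (partial j f) x)"

definition tensor :: "real^3 \<Rightarrow> real^3 \<Rightarrow> real^3^3"
  where "tensor a b = (\<chi> i j. a $ i * b $ j)"

text \<open>The divergence of a matrix field is taken row by row.\<close>

definition divg_matrix :: "(real^3 \<Rightarrow> real^3^3) \<Rightarrow> real^3 \<Rightarrow> real^3"
  where "divg_matrix T x = (\<chi> i. divg (\<lambda>y. T y $ i) x)"

section \<open>Lebesgue and local Morrey spaces\<close>

definition Lp :: "real \<Rightarrow> (real^3 \<Rightarrow> real) set"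
  where "Lp p = {f \<in> borel_measurable lebesgue. integrable lebesgue (\<lambda>x. \<bar>f x\<bar> powr p)}"

definition Lp_loc :: "real \<Rightarrow> (real^3 \<Rightarrow> real) set"
  where "Lp_loc p = {f \<in> borel_measurable lebesgue.
    \<forall>K. compact K \<longrightarrow> set_integrable lebesgue K (\<lambda>x. \<bar>f x\<bar> powr p)}"

text \<open>Intended for \<open>f \<in> Lp_loc p\<close>, where the integrals are genuine and finite; the
  supremum may be infinite.\<close>

definition morrey_norm :: "real \<Rightarrow> real \<Rightarrow> (real^3 \<Rightarrow> real) \<Rightarrow> ennreal"
  where "morrey_norm p \<gamma> f = (SUP R\<in>{1..}. ennreal
    ((R powr (-\<gamma>) * (LINT x:ball 0 R|lebesgue. \<bar>f x\<bar> powr p)) powr (1 / p)))"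

definition morrey :: "real \<Rightarrow> real \<Rightarrow> (real^3 \<Rightarrow> real) set"
  where "morrey p \<gamma> = {f \<in> Lp_loc p. morrey_norm p \<gamma> f < \<infinity>}"

definition morrey0 :: "real \<Rightarrow> real \<Rightarrow> (real^3 \<Rightarrow> real) set"
  where "morrey0 p \<gamma> = {f \<in> morrey p \<gamma>.
    ((\<lambda>R. (R powr (-\<gamma>) * (LINT x:{x. R / 2 \<le> norm x \<and> norm x \<le> R}|lebesgue.
        \<bar>f x\<bar> powr p)) powr (1 / p)) \<longlongrightarrow> 0) at_top}"

definition vec_in :: "(real^3 \<Rightarrow> real^3) \<Rightarrow> (real^3 \<Rightarrow> real) set \<Rightarrow> bool"
  where "vec_in v X \<longleftrightarrow> (\<forall>i. (\<lambda>x. v x $ i) \<in> X)"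

section \<open>Stationary incompressible Hall-MHD equations\<close>

definition hall_mhd_solution ::
    "(real^3 \<Rightarrow> real^3) \<Rightarrow> (real^3 \<Rightarrow> real^3) \<Rightarrow> (real^3 \<Rightarrow> real) \<Rightarrow> bool"
  where "hall_mhd_solution u B P \<longleftrightarrow>
    (\<forall>x. - laplacian u x + divg_matrix (\<lambda>y. tensor (u y) (u y)) x + grad P x
          - cross3 (curl B x) (B x) = 0) \<and>
    (\<forall>x. - laplacian B x + curl (\<lambda>y. cross3 (B y) (u y)) x
          + curl (\<lambda>y. cross3 (curl B y) (B y)) x = 0) \<and>
    (\<forall>x. divg u x = 0) \<and> (\<forall>x. divg B x = 0)"

definition \<eta> :: "real \<Rightarrow> real \<Rightarrow> real"
  where "\<eta> p \<gamma> = \<gamma> / p + 2 / 3 - 3 / p"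

end

theory Submission
  imports Defs
begin

text \<open>
  The condition \<open>\<eta> p \<gamma> = 0\<close> means \<open>\<gamma> = 3 - 2 p / 3\<close>. Young's inequality at the amplitude
  \<open>R powr (- 2 / 3)\<close> then turns the Morrey hypotheses, for every admissible \<open>p\<close>, into the same scale invariant
  facts: the integrals of \<open>|u|\<^sup>3\<close> and \<open>|B|\<^sup>3\<close> over the ball of radius \<open>R\<close> are \<open>O(R)\<close>, and the integral of \<open>|u|\<^sup>3\<close>
  over the annulus \<open>R / 2 \<le> |x| \<le> R\<close> is \<open>o(R)\<close> (\<open>morrey_cube_growth\<close>, \<open>morrey0_annulus_cube\<close>).

  In the local energy identity (\<open>local_energy_identity\<close>) the Hall term does no work, and the exchange of
  energy between \<open>u\<close> and \<open>B\<close> cancels. Multiplied by a cutoff \<open>\<phi>\<close> at scale \<open>R\<close> and integrated, it bounds the integral of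
  \<open>\<phi> (|\<nabla>u|\<^sup>2 + |\<nabla>B|\<^sup>2)\<close> by four terms that live on the annulus or carry \<open>R powr (-2)\<close>.
  The viscous term is \<open>O(R powr (-1/3))\<close>. The cubic terms each contain a factor \<open>u\<close>, which is \<open>o(1)\<close> on the annulus.
  The Hall flux \<open>|\<nabla>B| |B|\<^sup>2 / R\<close> is small because \<open>\<nabla>B\<close> is square integrable and because, by a Sobolev type
  argument, the integral of \<open>|B|\<^sup>4\<close> over the ball is \<open>O(R\<^sup>2)\<close> (\<open>fourth_power_growth\<close>).

  The remaining term is the integral of \<open>Q u \<bullet> \<nabla>\<phi>\<close>, where \<open>Q = P + |B|\<^sup>2 / 2\<close> solves
  \<open>\<Delta>Q = - \<Sum> \<partial>\<^sub>i \<partial>\<^sub>j (u\<^sub>i u\<^sub>j - B\<^sub>i B\<^sub>j)\<close>. It needs a bound of Calderon--Zygmund type with the exponents \<open>3\<close> and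
  \<open>3/2\<close>, local and without loss (\<open>pressure_estimate\<close>). Both factors are averaged at the scales
  \<open>h, 8 h, 64 h, \<dots>, R\<close> with a radial kernel. By the mean value formula (\<open>avg_bump_minus_id\<close>) the change of the pairing from
  one scale to the next is a pairing of \<open>\<Delta>Q\<close>, hence of second derivatives of the stress, with the averaged test function.
  One derivative is put on either factor, where it falls on the last kernel and produces a mean oscillation.
  The product of the two mean oscillations is at most the gap in Jensen's inequality for the convex Bellman function
  \<open>(q\<^sup>2 + p) powr (3/2)\<close> (\<open>bellman_gap\<close>), and these gaps telescope over the scales. What is left at
  the top scale is estimated by moving all derivatives onto kernels of size \<open>R\<close>.

  Letting \<open>R\<close> tend to infinity gives \<open>\<nabla>u = \<nabla>B = 0\<close>, and constants with cubes of integral \<open>O(R)\<close> vanish.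
\<close>

section \<open>Calculus with partial derivatives\<close>

lemma partial_eqI:
  assumes "(f has_derivative f') (at x)"
  shows "partial i f x = f' (axis i 1)"
  unfolding partial_def using frechet_derivative_at[OF assms] by simp

lemma has_derivative_partials:
  fixes f :: "real^3 \<Rightarrow> real"
  assumes "f differentiable (at x)"
  shows "(f has_derivative (\<lambda>v. \<Sum>i\<in>UNIV. v $ i * partial i f x)) (at x)"
proof -
  obtain f' where f': "(f has_derivative f') (at x)"
    using assms unfolding differentiable_def by blast
  have lin: "linear f'"
    using f' has_derivative_linear by blast
  have "f' v = (\<Sum>i\<in>UNIV. v $ i * partial i f x)" for v
  proof -
    have "f' v = f' (\<Sum>i\<in>UNIV. v $ i *\<^sub>R axis i 1)"
      using basis_expansion[of v] by (simp add: scalar_mult_eq_scaleR)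
    also have "\<dots> = (\<Sum>i\<in>UNIV. v $ i * f' (axis i 1))"
      by (simp add: linear_sum[OF lin] linear_scale[OF lin])
    finally show ?thesis using partial_eqI[OF f'] by simp
  qed
  then show ?thesis using f' by (metis (no_types, lifting) ext)
qed

lemma sum_axis_mult: "(\<Sum>i\<in>UNIV. (axis k 1 :: real^3) $ i * f i) = f k"
proof -
  have "(axis k 1 :: real^3) $ i * f i = (if i = k then f i else 0)" for i by (simp add: axis_def)
  then show ?thesis by simp
qed

lemma partial_const [simp]: "partial i (\<lambda>x. c) x = 0"
  by (rule partial_eqI[of _ "\<lambda>x. 0", simplified]) simp

lemma partial_component [simp]: "partial i (\<lambda>x::real^3. x $ j) x = (if i = j then 1 else 0)"
proof -
  have "((\<lambda>x::real^3. x $ j) has_derivative (\<lambda>x. x $ j)) (at x)"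
    by (rule bounded_linear.has_derivative[OF bounded_linear_vec_nth has_derivative_ident])
  from partial_eqI[OF this, of i] show ?thesis by (auto simp: axis_def)
qed

lemma partial_vec_component:
  fixes v :: "real^3 \<Rightarrow> real^3"
  assumes "v differentiable (at x)"
  shows "partial i v x $ k = partial i (\<lambda>y. v y $ k) x"
proof -
  obtain v' where v': "(v has_derivative v') (at x)"
    using assms unfolding differentiable_def by blast
  have "((\<lambda>y. v y $ k) has_derivative (\<lambda>y. v' y $ k)) (at x)"
    by (rule bounded_linear.has_derivative[OF bounded_linear_vec_nth v'])
  from partial_eqI[OF this] partial_eqI[OF v'] show ?thesis by metis
qed

context
  fixes f g :: "real^3 \<Rightarrow> real" and x :: "real^3"
  assumes f: "f differentiable (at x)" and g: "g differentiable (at x)"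
begin

lemma partial_add: "partial i (\<lambda>y. f y + g y) x = partial i f x + partial i g x"
  using partial_eqI[OF has_derivative_add[OF has_derivative_partials[OF f] has_derivative_partials[OF g]], of i]
  by (simp add: sum_axis_mult)

lemma partial_diff: "partial i (\<lambda>y. f y - g y) x = partial i f x - partial i g x"
  using partial_eqI[OF has_derivative_diff[OF has_derivative_partials[OF f] has_derivative_partials[OF g]], of i]
  by (simp add: sum_axis_mult)

lemma partial_mult: "partial i (\<lambda>y. f y * g y) x = f x * partial i g x + partial i f x * g x"
  using partial_eqI[OF has_derivative_mult[OF has_derivative_partials[OF f] has_derivative_partials[OF g]], of i]
  by (simp add: sum_axis_mult)

end

lemma partial_cmult:
  fixes f :: "real^3 \<Rightarrow> real"
  assumes "f differentiable (at x)"
  shows "partial i (\<lambda>y. c * f y) x = c * partial i f x"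
  using partial_mult[of "\<lambda>_. c" x f i] assms by simp

lemma partial_sum:
  fixes f :: "'a \<Rightarrow> real^3 \<Rightarrow> real"
  assumes "finite A" "\<And>a. a \<in> A \<Longrightarrow> f a differentiable (at x)"
  shows "partial i (\<lambda>y. \<Sum>a\<in>A. f a y) x = (\<Sum>a\<in>A. partial i (f a) x)"
  using assms
proof (induction A rule: finite_induct)
  case (insert a A)
  have "(\<lambda>y. \<Sum>a\<in>A. f a y) differentiable (at x)"
    using insert by (intro differentiable_sum) auto
  then show ?case using insert by (simp add: partial_add)
qed simp

lemma partial_affine:
  fixes f :: "real^3 \<Rightarrow> real"
  assumes "f differentiable (at (x + c *\<^sub>R y))"
  shows "partial i (\<lambda>y. f (x + c *\<^sub>R y)) y = c * partial i f (x + c *\<^sub>R y)"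
proof -
  have "((\<lambda>y. x + c *\<^sub>R y) has_derivative (\<lambda>v. c *\<^sub>R v)) (at y)"
    by (auto intro!: derivative_eq_intros)
  from partial_eqI[OF has_derivative_compose[OF this has_derivative_partials[OF assms]], of i]
  show ?thesis by (simp add: mult.assoc sum_axis_mult flip: sum_distrib_left)
qed

lemma has_real_derivative_along_axis:
  fixes f :: "real^3 \<Rightarrow> real"
  assumes "f differentiable (at (x + a *\<^sub>R axis i 1))"
  shows "((\<lambda>a. f (x + a *\<^sub>R axis i 1)) has_real_derivative partial i f (x + a *\<^sub>R axis i 1)) (at a)"
proof -
  have "((\<lambda>a. x + a *\<^sub>R axis i 1) has_derivative (\<lambda>t. t *\<^sub>R axis i 1)) (at a)"
    by (auto intro!: derivative_eq_intros)
  from has_derivative_compose[OF this has_derivative_partials[OF assms]]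
  show ?thesis by (simp add: has_field_derivative_def mult.assoc sum_axis_mult mult.commute[of _ "partial i f _"] flip: sum_distrib_left)
qed

lemma has_real_derivative_along_line:
  fixes f :: "real^3 \<Rightarrow> real"
  assumes "f differentiable (at (x + a *\<^sub>R v))"
  shows "((\<lambda>a. f (x + a *\<^sub>R v)) has_real_derivative
    (\<Sum>i\<in>UNIV. v $ i * partial i f (x + a *\<^sub>R v))) (at a)"
proof -
  have "((\<lambda>a. x + a *\<^sub>R v) has_derivative (\<lambda>t. t *\<^sub>R v)) (at a)"
    by (auto intro!: derivative_eq_intros)
  from has_derivative_compose[OF this has_derivative_partials[OF assms]]
  have "((\<lambda>a. f (x + a *\<^sub>R v)) has_derivative
    (\<lambda>t. \<Sum>i\<in>UNIV. (t *\<^sub>R v) $ i * partial i f (x + a *\<^sub>R v))) (at a)" .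
  moreover have "(\<lambda>t. \<Sum>i\<in>UNIV. (t *\<^sub>R v) $ i * partial i f (x + a *\<^sub>R v)) =
     (*) (\<Sum>i\<in>UNIV. v $ i * partial i f (x + a *\<^sub>R v))"
    by (rule ext) (simp add: sum_distrib_right mult_ac sum_distrib_left)
  ultimately show ?thesis by (simp add: has_field_derivative_def)
qed

lemma partial_compose_real:
  fixes f :: "real^3 \<Rightarrow> real"
  assumes "(k has_real_derivative k') (at (f x))" "f differentiable (at x)"
  shows "(\<lambda>y. k (f y)) differentiable (at x)" "partial i (\<lambda>y. k (f y)) x = k' * partial i f x"
proof -
  note d = has_derivative_compose[OF has_derivative_partials[OF assms(2)] assms(1)[unfolded has_field_derivative_def]]
  show "(\<lambda>y. k (f y)) differentiable (at x)" using d unfolding differentiable_def by blast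
  show "partial i (\<lambda>y. k (f y)) x = k' * partial i f x"
    using partial_eqI[OF d, of i] by (simp add: sum_axis_mult)
qed

subsection \<open>Functions of class \<open>C\<^sup>k\<close>\<close>

lemma Ck_SucD: "Ck (Suc k) f \<Longrightarrow> Ck k f"
proof (induction k arbitrary: f)
  case 0
  then show ?case
    by (simp add: continuous_at_imp_continuous_on differentiable_imp_continuous_within)
next
  case (Suc k)
  then show ?case by (metis Ck.simps(2))
qed

lemma Ck_mono: "Ck k f \<Longrightarrow> j \<le> k \<Longrightarrow> Ck j f"
proof (induction "k - j" arbitrary: j)
  case (Suc d)
  then have "Ck (Suc j) f" by (metis Suc_diff_Suc Suc_leI diff_Suc_1 diff_is_0_eq nat_le_linear not_less_eq_eq zero_less_Suc zero_less_diff diff_Suc_Suc Suc_inject)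
  then show ?case by (rule Ck_SucD)
qed simp

lemma Ck_continuous: "Ck k f \<Longrightarrow> continuous_on UNIV f"
  using Ck_mono[of k f 0] by simp

lemma Ck_differentiable: "Ck k f \<Longrightarrow> 0 < k \<Longrightarrow> f differentiable (at x)"
  by (cases k) auto

lemma smooth_Ck: "smooth f \<Longrightarrow> Ck k f"
  by (simp add: smooth_def)

lemma Ck_const [simp]: "Ck k (\<lambda>x. c)"
proof (induction k arbitrary: c)
  case (Suc k)
  have "partial i (\<lambda>x. c) = (\<lambda>x. 0)" for i by (rule ext) simp
  then show ?case using Suc by simp
qed simp

lemma Ck_component [simp]: "Ck k (\<lambda>x::real^3. x $ j)"
proof (cases k)
  case 0 then show ?thesis by (simp add: continuous_intros)
next
  case (Suc k)
  have "partial i (\<lambda>x::real^3. x $ j) = (\<lambda>x. if i = j then 1 else 0)" for i by (rule ext) simp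
  moreover have "(\<lambda>x::real^3. x $ j) differentiable (at x)" for x
    by (simp add: bounded_linear_imp_differentiable bounded_linear_vec_nth)
  ultimately show ?thesis using Suc by simp
qed

lemma Ck_add:
  fixes f g :: "real^3 \<Rightarrow> real"
  shows "Ck k f \<Longrightarrow> Ck k g \<Longrightarrow> Ck k (\<lambda>x. f x + g x)"
proof (induction k arbitrary: f g)
  case 0 then show ?case by (simp add: continuous_intros)
next
  case (Suc k)
  have "partial i (\<lambda>x. f x + g x) = (\<lambda>x. partial i f x + partial i g x)" for i
    using Suc.prems by (intro ext partial_add) auto
  then show ?case using Suc by simp
qed

lemma Ck_mult:
  fixes f g :: "real^3 \<Rightarrow> real"
  shows "Ck k f \<Longrightarrow> Ck k g \<Longrightarrow> Ck k (\<lambda>x. f x * g x)"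
proof (induction k arbitrary: f g)
  case 0 then show ?case by (simp add: continuous_intros)
next
  case (Suc k)
  have "partial i (\<lambda>x. f x * g x) = (\<lambda>x. f x * partial i g x + partial i f x * g x)" for i
    using Suc.prems by (intro ext partial_mult) auto
  moreover have "Ck k f" "Ck k g" using Suc.prems Ck_SucD by blast+
  ultimately show ?case using Suc by (simp add: Ck_add)
qed

lemma Ck_cmult:
  fixes f :: "real^3 \<Rightarrow> real"
  shows "Ck k f \<Longrightarrow> Ck k (\<lambda>x. c * f x)"
  by (intro Ck_mult) auto

lemma Ck_minus:
  fixes f :: "real^3 \<Rightarrow> real"
  shows "Ck k f \<Longrightarrow> Ck k (\<lambda>x. - f x)"
  using Ck_cmult[of k f "-1"] by simp

lemma Ck_diff:
  fixes f g :: "real^3 \<Rightarrow> real"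
  shows "Ck k f \<Longrightarrow> Ck k g \<Longrightarrow> Ck k (\<lambda>x. f x - g x)"
  using Ck_add[of k f "\<lambda>x. - g x"] by (simp add: Ck_minus)

lemma Ck_sum:
  fixes f :: "'a \<Rightarrow> real^3 \<Rightarrow> real"
  assumes "\<And>a. a \<in> A \<Longrightarrow> Ck k (f a)"
  shows "Ck k (\<lambda>x. \<Sum>a\<in>A. f a x)"
  using assms by (induction A rule: infinite_finite_induct) (auto simp: Ck_add)

lemma Ck_power:
  fixes f :: "real^3 \<Rightarrow> real"
  shows "Ck k f \<Longrightarrow> Ck k (\<lambda>x. f x ^ n)"
  by (induction n) (auto simp: Ck_mult)

lemma Ck_compose_real:
  fixes f :: "real^3 \<Rightarrow> real" and h :: "nat \<Rightarrow> real \<Rightarrow> real"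
  assumes "\<And>j t. j < k \<Longrightarrow> (h j has_real_derivative h (Suc j) t) (at t)"
    and "continuous_on UNIV (h k)" and "Ck k f"
  shows "Ck k (\<lambda>x. h 0 (f x))"
  using assms
proof (induction k arbitrary: h)
  case 0
  then show ?case
    by simp (metis continuous_on_compose2 subset_UNIV)
next
  case (Suc k)
  have d: "(h 0 has_real_derivative h 1 (f x)) (at (f x))" for x using Suc.prems(1)[of 0] by simp
  have fd: "f differentiable (at x)" for x using Suc.prems by simp
  have "Ck k (\<lambda>x. h (Suc 0) (f x))"
    using Suc.IH[of "\<lambda>j. h (Suc j)"] Suc.prems Ck_SucD by auto
  then have "Ck k (\<lambda>x. h 1 (f x) * partial i f x)" for i
    using Suc.prems by (intro Ck_mult) auto
  moreover have "partial i (\<lambda>x. h 0 (f x)) = (\<lambda>x. h 1 (f x) * partial i f x)" for i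
    by (rule ext) (rule partial_compose_real(2)[OF d fd])
  ultimately show ?case using partial_compose_real(1)[OF d fd] by simp
qed

lemma Ck_vec_component:
  fixes v :: "real^3 \<Rightarrow> real^3"
  shows "Ck k v \<Longrightarrow> Ck k (\<lambda>x. v x $ j)"
proof (induction k arbitrary: v)
  case 0 then show ?case by (simp add: continuous_intros)
next
  case (Suc k)
  have d: "v differentiable (at x)" for x using Suc.prems by simp
  have "partial i (\<lambda>x. v x $ j) = (\<lambda>x. partial i v x $ j)" for i
    by (rule ext) (rule partial_vec_component[OF d, symmetric])
  moreover have "(\<lambda>x. v x $ j) differentiable (at x)" for x
    using d[of x] bounded_linear.has_derivative[OF bounded_linear_vec_nth] unfolding differentiable_def by blast
  ultimately show ?case using Suc by simp
qed

lemma Ck_affine: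
  fixes f :: "real^3 \<Rightarrow> real"
  shows "Ck k f \<Longrightarrow> Ck k (\<lambda>y. f (x + c *\<^sub>R y))"
proof (induction k arbitrary: f)
  case 0
  have "continuous_on UNIV (\<lambda>y. x + c *\<^sub>R y)" by (intro continuous_intros)
  with 0 show ?case by simp (metis continuous_on_compose2 subset_UNIV)
next
  case (Suc k)
  have fd: "f differentiable (at x)" for x using Suc.prems by simp
  have "(\<lambda>y. f (x + c *\<^sub>R y)) differentiable (at y)" for y
    by (rule differentiable_compose[OF fd])
       (auto simp: differentiable_def intro!: exI derivative_eq_intros)
  moreover have "partial i (\<lambda>y. f (x + c *\<^sub>R y)) = (\<lambda>y. c * partial i f (x + c *\<^sub>R y))" for i
    by (rule ext) (rule partial_affine[OF fd])
  moreover have "Ck k (\<lambda>y. c * partial i f (x + c *\<^sub>R y))" for i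
    using Suc by (intro Ck_cmult) auto
  ultimately show ?case by simp
qed

text \<open>Equality of mixed partial derivatives: the second difference of \<open>f\<close> over a small square is,
  by the mean value theorem applied in either order, a value of either mixed derivative
  near \<open>x\<close>.\<close>

lemma second_difference_mean_value:
  fixes f :: "real^3 \<Rightarrow> real"
  assumes "Ck 2 f" "0 < t"
  shows "\<exists>y. norm (y - x) \<le> 2 * t \<and>
    f (x + t *\<^sub>R axis i 1 + t *\<^sub>R axis j 1) - f (x + t *\<^sub>R axis i 1) - f (x + t *\<^sub>R axis j 1) + f x
      = t^2 * partial j (partial i f) y"
proof -
  have fd: "f differentiable (at z)" and pd: "partial i f differentiable (at z)" for z
    using assms(1) by (simp_all add: numeral_2_eq_2)
  define p where "p a = f (x + t *\<^sub>R axis j 1 + a *\<^sub>R axis i 1) - f (x + a *\<^sub>R axis i 1)" for a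
  have "(p has_real_derivative (partial i f (x + t *\<^sub>R axis j 1 + a *\<^sub>R axis i 1) - partial i f (x + a *\<^sub>R axis i 1))) (at a)" for a
    unfolding p_def by (intro DERIV_diff has_real_derivative_along_axis fd)
  from MVT2[OF \<open>0 < t\<close> this] obtain a where a: "0 < a" "a < t"
    "p t - p 0 = t * (partial i f (x + t *\<^sub>R axis j 1 + a *\<^sub>R axis i 1) - partial i f (x + a *\<^sub>R axis i 1))"
    by auto
  have "((\<lambda>c. partial i f (x + a *\<^sub>R axis i 1 + c *\<^sub>R axis j 1)) has_real_derivative
     partial j (partial i f) (x + a *\<^sub>R axis i 1 + c *\<^sub>R axis j 1)) (at c)" for c
    by (intro has_real_derivative_along_axis pd)
  from MVT2[OF \<open>0 < t\<close> this] obtain c where c: "0 < c" "c < t"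
    "partial i f (x + a *\<^sub>R axis i 1 + t *\<^sub>R axis j 1) - partial i f (x + a *\<^sub>R axis i 1)
     = t * partial j (partial i f) (x + a *\<^sub>R axis i 1 + c *\<^sub>R axis j 1)"
    by auto
  have "norm (a *\<^sub>R axis i (1::real) + c *\<^sub>R axis j 1 :: real^3) \<le> a + c"
    using a(1) c(1) by (intro order_trans[OF norm_triangle_ineq]) (simp add: norm_axis_1)
  moreover have "f (x + t *\<^sub>R axis i 1 + t *\<^sub>R axis j 1) - f (x + t *\<^sub>R axis i 1) - f (x + t *\<^sub>R axis j 1) + f x = p t - p 0"
    unfolding p_def by (simp add: algebra_simps)
  ultimately show ?thesis
    using a c by (intro exI[of _ "x + a *\<^sub>R axis i 1 + c *\<^sub>R axis j 1"]) (simp add: algebra_simps power2_eq_square)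
qed

lemma partial_commute:
  fixes f :: "real^3 \<Rightarrow> real"
  assumes "Ck 2 f"
  shows "partial i (partial j f) x = partial j (partial i f) x"
proof (rule ccontr)
  assume ne: "partial i (partial j f) x \<noteq> partial j (partial i f) x"
  define e where "e = \<bar>partial i (partial j f) x - partial j (partial i f) x\<bar> / 2"
  have "e > 0" using ne by (simp add: e_def)
  have cont: "continuous_on UNIV (partial i (partial j f))" "continuous_on UNIV (partial j (partial i f))"
    using assms by (simp_all add: numeral_2_eq_2)
  obtain d where d: "d > 0" "\<And>y. dist y x < d \<Longrightarrow> dist (partial i (partial j f) y) (partial i (partial j f) x) < e"
    using cont(1) \<open>e > 0\<close> unfolding continuous_on_iff by (metis UNIV_I)
  obtain d' where d': "d' > 0" "\<And>y. dist y x < d' \<Longrightarrow> dist (partial j (partial i f) y) (partial j (partial i f) x) < e"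
    using cont(2) \<open>e > 0\<close> unfolding continuous_on_iff by (metis UNIV_I)
  define t where "t = min d d' / 3"
  have t: "t > 0" "2 * t < d" "2 * t < d'" using d(1) d'(1) by (auto simp: t_def)
  obtain y where y: "norm (y - x) \<le> 2 * t"
    "f (x + t *\<^sub>R axis i 1 + t *\<^sub>R axis j 1) - f (x + t *\<^sub>R axis i 1) - f (x + t *\<^sub>R axis j 1) + f x
      = t^2 * partial j (partial i f) y"
    using second_difference_mean_value[OF assms t(1)] by blast
  obtain z where z: "norm (z - x) \<le> 2 * t"
    "f (x + t *\<^sub>R axis j 1 + t *\<^sub>R axis i 1) - f (x + t *\<^sub>R axis j 1) - f (x + t *\<^sub>R axis i 1) + f x
      = t^2 * partial i (partial j f) z"
    using second_difference_mean_value[OF assms t(1)] by blast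
  have "t^2 * partial j (partial i f) y = t^2 * partial i (partial j f) z"
    using y(2) z(2) by (simp add: algebra_simps)
  then have "partial j (partial i f) y = partial i (partial j f) z" using t(1) by simp
  moreover have "dist (partial j (partial i f) y) (partial j (partial i f) x) < e"
    using d'(2)[of y] y(1) t by (simp add: dist_norm)
  moreover have "dist (partial i (partial j f) z) (partial i (partial j f) x) < e"
    using d(2)[of z] z(1) t by (simp add: dist_norm)
  ultimately have "\<bar>partial i (partial j f) x - partial j (partial i f) x\<bar> < 2 * e"
    unfolding dist_real_def by arith
  then show False unfolding e_def by simp
qed

section \<open>Integrals of continuous functions with compact support\<close>

definition csupp :: "real \<Rightarrow> ('a::euclidean_space \<Rightarrow> real) \<Rightarrow> bool"
  where "csupp r f \<longleftrightarrow> continuous_on UNIV f \<and> (\<forall>x. r < norm x \<longrightarrow> f x = 0)"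

lemma csupp_continuous: "csupp r f \<Longrightarrow> continuous_on UNIV f"
  and csupp_zero: "csupp r f \<Longrightarrow> r < norm x \<Longrightarrow> f x = 0"
  by (auto simp: csupp_def)

lemma csupp_mono: "csupp r f \<Longrightarrow> r \<le> s \<Longrightarrow> csupp s f"
  by (auto simp: csupp_def)

lemma csupp_integrable:
  assumes "csupp r f"
  shows "integrable lborel f"
proof -
  have "integrable lborel (\<lambda>x. indicator (cball 0 r) x *\<^sub>R f x)"
    using assms by (intro borel_integrable_compact) (auto simp: csupp_def intro: continuous_on_subset)
  moreover have "(\<lambda>x. indicator (cball 0 r) x *\<^sub>R f x) = f"
    using assms by (auto simp: csupp_def indicator_def fun_eq_iff not_le)
  ultimately show ?thesis by simp
qed

lemma csupp_bounded:
  assumes "csupp r f"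
  obtains C where "0 \<le> C" "\<And>x. \<bar>f x\<bar> \<le> C"
proof -
  have "compact (f ` cball 0 r)"
    using assms by (intro compact_continuous_image) (auto simp: csupp_def intro: continuous_on_subset)
  then obtain C where C: "\<And>x. x \<in> cball 0 r \<Longrightarrow> \<bar>f x\<bar> \<le> C"
    by (metis (no_types, lifting) bounded_iff compact_imp_bounded imageI real_norm_def)
  have "\<bar>f x\<bar> \<le> \<bar>C\<bar>" for x
    using C[of x] csupp_zero[OF assms, of x] by (cases "norm x \<le> r") auto
  then show ?thesis using that[of "\<bar>C\<bar>"] by auto
qed

lemma csupp_mult_left:
  "csupp r f \<Longrightarrow> continuous_on UNIV g \<Longrightarrow> csupp r (\<lambda>x. g x * f x)"
  and csupp_mult_right:
  "csupp r f \<Longrightarrow> continuous_on UNIV g \<Longrightarrow> csupp r (\<lambda>x. f x * g x)"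
  by (auto simp: csupp_def intro!: continuous_intros)

lemma csupp_add: "csupp r f \<Longrightarrow> csupp r g \<Longrightarrow> csupp r (\<lambda>x. f x + g x)"
  and csupp_diff: "csupp r f \<Longrightarrow> csupp r g \<Longrightarrow> csupp r (\<lambda>x. f x - g x)"
  and csupp_abs: "csupp r f \<Longrightarrow> csupp r (\<lambda>x. \<bar>f x\<bar>)"
  by (auto simp: csupp_def intro!: continuous_intros)

lemma csupp_partial:
  fixes f :: "real^3 \<Rightarrow> real"
  assumes "Ck 1 f" "csupp r f"
  shows "csupp r (partial i f)"
proof -
  have "partial i f x = 0" if "r < norm x" for x
  proof -
    have "((\<lambda>y. 0) has_derivative (\<lambda>y. 0)) (at x)" by simp
    then have "(f has_derivative (\<lambda>y. 0)) (at x)"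
    proof (rule has_derivative_transform_within_open)
      show "open {y::real^3. r < norm y}" by (intro open_Collect_less continuous_intros)
    qed (use that assms(2) in \<open>auto simp: csupp_def\<close>)
    from partial_eqI[OF this, of i] show ?thesis by simp
  qed
  then show ?thesis using assms(1) by (simp add: csupp_def)
qed

lemma integral_translate:
  fixes f :: "'a::euclidean_space \<Rightarrow> real"
  assumes "continuous_on UNIV f"
  shows "(\<integral>x. f (x + c) \<partial>lborel) = (\<integral>x. f x \<partial>lborel)"
proof -
  have [measurable]: "f \<in> borel_measurable borel" using assms by (rule borel_measurable_continuous_onI)
  have "(\<integral>x. f x \<partial>lborel) = (\<integral>x. f x \<partial>distr lborel borel ((+) c))" by (simp add: lborel_distr_plus)
  also have "\<dots> = (\<integral>x. f (c + x) \<partial>lborel)" by (subst integral_distr) auto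
  finally show ?thesis by (simp add: add.commute)
qed

lemma integral_reflect_lborel:
  fixes f :: "real^3 \<Rightarrow> real"
  assumes "continuous_on UNIV f"
  shows "(\<integral>x. f (- x) \<partial>lborel) = (\<integral>x. f x \<partial>lborel)"
proof -
  have [measurable]: "f \<in> borel_measurable borel" using assms by (rule borel_measurable_continuous_onI)
  have "(\<integral>x. f x \<partial>lborel) = (\<integral>x. f x \<partial>distr lborel borel (\<lambda>x. 0 + (-1) *\<^sub>R x))"
    using lborel_affine[of "-1::real" "0::real^3"] by (simp add: density_1)
  also have "\<dots> = (\<integral>x. f (- x) \<partial>lborel)" by (subst integral_distr) auto
  finally show ?thesis by simp
qed

lemma Fubini_csupp:
  fixes k :: "'a::euclidean_space \<Rightarrow> 'b::euclidean_space \<Rightarrow> real"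
  assumes "continuous_on UNIV (\<lambda>(x, y). k x y)"
    and "\<And>x y. r < norm x \<Longrightarrow> k x y = 0" "\<And>x y. s < norm y \<Longrightarrow> k x y = 0"
  shows "(\<integral>x. (\<integral>y. k x y \<partial>lborel) \<partial>lborel) = (\<integral>y. (\<integral>x. k x y \<partial>lborel) \<partial>lborel)"
proof -
  have "csupp (\<bar>r\<bar> + \<bar>s\<bar>) (\<lambda>(x, y). k x y)"
  proof -
    have "k x y = 0" if "\<bar>r\<bar> + \<bar>s\<bar> < norm (x, y)" for x y
    proof (cases "r < norm x \<or> s < norm y")
      case False
      then have "norm (x, y) \<le> \<bar>r\<bar> + \<bar>s\<bar>"
        using norm_Pair_le[of x y] by linarith
      then show ?thesis using that by linarith
    qed (use assms in auto)
    then show ?thesis using assms(1) by (auto simp: csupp_def)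
  qed
  then have "integrable (lborel \<Otimes>\<^sub>M lborel) (\<lambda>(x, y). k x y)"
    by (simp only: lborel_prod csupp_integrable)
  from lborel_pair.Fubini_integral[OF this] show ?thesis by simp
qed

subsection \<open>Integration by parts\<close>

text \<open>Translation invariance makes the integrals of all difference quotients vanish.\<close>

lemma integral_partial_eq_0:
  fixes f :: "real^3 \<Rightarrow> real"
  assumes f: "Ck 1 f" "csupp r f"
  shows "(\<integral>x. partial i f x \<partial>lborel) = 0"
proof -
  have fd: "f differentiable (at x)" for x using f by simp
  have cont: "continuous_on UNIV f" "continuous_on UNIV (partial i f)" using f by (simp_all add: csupp_def)
  have [measurable]: "f \<in> borel_measurable borel" "partial i f \<in> borel_measurable borel"
    using cont by (simp_all add: borel_measurable_continuous_onI)
  obtain C where C: "0 \<le> C" "\<And>x. \<bar>partial i f x\<bar> \<le> C"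
    using csupp_bounded[OF csupp_partial[OF f]] by blast
  define q where "q n x = real (Suc n) * (f (x + (1 / real (Suc n)) *\<^sub>R axis i 1) - f x)" for n x
  have mv: "\<exists>c. 0 < c \<and> c < t \<and> f (x + t *\<^sub>R axis i 1) - f x = t * partial i f (x + c *\<^sub>R axis i 1)"
    if "0 < t" for x t
    using MVT2[OF that has_real_derivative_along_axis[OF fd, of x]] by auto
  have shift: "norm x \<le> norm (x + t *\<^sub>R axis i 1) + 1" if "0 \<le> t" "t \<le> 1" for x :: "real^3" and t
  proof -
    have "norm x \<le> norm (x + t *\<^sub>R axis i 1) + norm (t *\<^sub>R axis i (1::real) :: real^3)"
      by (metis norm_triangle_sub add_diff_cancel_left' add.commute norm_minus_commute)
    then show ?thesis using that by (simp add: norm_axis_1)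
  qed
  have "(\<lambda>n. \<integral>x. q n x \<partial>lborel) \<longlonglongrightarrow> (\<integral>x. partial i f x \<partial>lborel)"
  proof (rule integral_dominated_convergence)
    show "integrable lborel (\<lambda>x. C * indicator (cball 0 (r + 1)) x :: real)"
      by (intro integrable_mult_right integrable_real_indicator) (use emeasure_lborel_cball_finite[of 0 "r + 1"] in \<open>auto simp: top.not_eq_extremum\<close>)
    show "AE x in lborel. (\<lambda>n. q n x) \<longlonglongrightarrow> partial i f x"
    proof (intro AE_I2)
      fix x
      have "((\<lambda>a. f (x + a *\<^sub>R axis i 1)) has_real_derivative partial i f x) (at 0)"
        using has_real_derivative_along_axis[of f x 0 i] fd by simp
      then have "((\<lambda>h. (f (x + h *\<^sub>R axis i 1) - f x) / h) \<longlongrightarrow> partial i f x) (at 0)"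
        by (simp add: DERIV_def)
      moreover have "filterlim (\<lambda>n. 1 / real (Suc n)) (at 0) sequentially"
        by (rule filterlim_atI) (use lim_1_over_real_power[of 1] LIMSEQ_inverse_real_of_nat in \<open>auto simp: inverse_eq_divide\<close>)
      ultimately have "(\<lambda>n. (f (x + (1 / real (Suc n)) *\<^sub>R axis i 1) - f x) / (1 / real (Suc n))) \<longlonglongrightarrow> partial i f x"
        by (rule filterlim_compose)
      then show "(\<lambda>n. q n x) \<longlonglongrightarrow> partial i f x" unfolding q_def by (simp add: mult.commute)
    qed
    show "AE x in lborel. norm (q n x) \<le> C * indicator (cball 0 (r + 1)) x" for n
    proof (intro AE_I2)
      fix x
      obtain c where c: "f (x + (1 / real (Suc n)) *\<^sub>R axis i 1) - f x = (1 / real (Suc n)) * partial i f (x + c *\<^sub>R axis i 1)"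
        using mv[of "1 / real (Suc n)" x] by auto
      have b: "\<bar>q n x\<bar> \<le> C" unfolding q_def c using C(2) by (simp add: abs_mult)
      show "norm (q n x) \<le> C * indicator (cball 0 (r + 1)) x"
      proof (cases "norm x \<le> r + 1")
        case False
        have "norm x \<le> norm (x + (1 / real (Suc n)) *\<^sub>R axis i 1) + 1"
          by (rule shift) simp_all
        then have "r < norm (x + (1 / real (Suc n)) *\<^sub>R axis i 1)" "r < norm x"
          using False by linarith+
        then have "f (x + (1 / real (Suc n)) *\<^sub>R axis i 1) = 0" "f x = 0"
          using csupp_zero[OF f(2)] by blast+
        then have "q n x = 0" unfolding q_def by (simp only: diff_zero mult_zero_right)
        then show ?thesis using C(1) by simp
      qed (use b in simp)
    qed
  qed (auto simp: q_def)
  moreover have "(\<integral>x. q n x \<partial>lborel) = 0" for n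
  proof -
    have "csupp (\<bar>r\<bar> + 1) (\<lambda>x. f (x + (1 / real (Suc n)) *\<^sub>R axis i 1))"
    proof -
      have n1: "norm x \<le> norm (x + (1 / real (Suc n)) *\<^sub>R axis i 1) + 1" for x :: "real^3"
        by (rule shift) simp_all
      have "r < norm (x + (1 / real (Suc n)) *\<^sub>R axis i 1)" if "\<bar>r\<bar> + 1 < norm x" for x :: "real^3"
        using that n1[of x] by linarith
      moreover have "continuous_on UNIV (\<lambda>x. f (x + (1 / real (Suc n)) *\<^sub>R axis i 1))"
        by (rule continuous_on_compose2[OF cont(1)]) (auto intro!: continuous_intros)
      ultimately show ?thesis using csupp_zero[OF f(2)] unfolding csupp_def by blast
    qed
    note int = csupp_integrable[OF this] csupp_integrable[OF f(2)]
    have "(\<integral>x. f (x + (1 / real (Suc n)) *\<^sub>R axis i 1) - f x \<partial>lborel) = 0"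
      by (subst Bochner_Integration.integral_diff[OF int], subst integral_translate[OF cont(1)], rule diff_self)
    moreover have "(\<integral>x. q n x \<partial>lborel) =
        real (Suc n) * (\<integral>x. f (x + (1 / real (Suc n)) *\<^sub>R axis i 1) - f x \<partial>lborel)"
      unfolding q_def by (rule integral_mult_right_zero)
    ultimately show ?thesis by (simp only: mult_zero_right)
  qed
  ultimately have "(\<lambda>n. 0) \<longlonglongrightarrow> (\<integral>x. partial i f x \<partial>lborel)" by (simp only:)
  from LIMSEQ_unique[OF this tendsto_const] show ?thesis .
qed

lemma integration_by_parts:
  fixes f g :: "real^3 \<Rightarrow> real"
  assumes f: "Ck 1 f" and g: "Ck 1 g" "csupp r g"
  shows "(\<integral>x. partial i f x * g x \<partial>lborel) = - (\<integral>x. f x * partial i g x \<partial>lborel)"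
proof -
  have cf: "continuous_on UNIV f" "continuous_on UNIV (partial i f)" using f Ck_continuous[OF f] by simp_all
  have fg: "Ck 1 (\<lambda>x. f x * g x)" "csupp r (\<lambda>x. f x * g x)"
    using csupp_mult_left[OF g(2) cf(1)] Ck_mult[OF f g(1)] by blast+
  have "0 = (\<integral>x. f x * partial i g x + partial i f x * g x \<partial>lborel)"
    using integral_partial_eq_0[OF fg, of i] f g by (simp add: partial_mult)
  also have "\<dots> = (\<integral>x. f x * partial i g x \<partial>lborel) + (\<integral>x. partial i f x * g x \<partial>lborel)"
    by (intro Bochner_Integration.integral_add csupp_integrable[of r] csupp_mult_left csupp_partial g cf)
  finally show ?thesis by simp
qed

section \<open>Averages against a rescaled kernel\<close>

definition avg :: "(real^3 \<Rightarrow> real) \<Rightarrow> real \<Rightarrow> (real^3 \<Rightarrow> real) \<Rightarrow> real^3 \<Rightarrow> real"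
  where "avg w h f x = (\<integral>y. w y * f (x + h *\<^sub>R y) \<partial>lborel)"

lemma integral_eq_cbox:
  assumes "cball 0 r \<subseteq> cbox a b" "csupp r f"
  shows "(\<integral>y. f y \<partial>lborel) = integral (cbox a b) f"
proof -
  have z: "f y = 0" if "y \<notin> cbox a b" for y
  proof -
    have "y \<notin> cball 0 r" using that assms(1) by blast
    then have "r < norm y" by simp
    then show ?thesis by (rule csupp_zero[OF assms(2)])
  qed
  have "(f has_integral (\<integral>y. f y \<partial>lborel)) UNIV"
    by (rule has_integral_integral_lborel[OF csupp_integrable[OF assms(2)]])
  moreover have e: "(\<lambda>y. if y \<in> cbox a b then f y else 0) = f" using z by (intro ext) presburger
  ultimately have "(f has_integral (\<integral>y. f y \<partial>lborel)) (cbox a b)"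
    using has_integral_restrict_UNIV[of "cbox a b" f] by (simp only: e)
  then show ?thesis by (rule integral_unique[symmetric])
qed

lemma cball_in_cbox: obtains a where "cball (0::'a::euclidean_space) r \<subseteq> cbox (- a) a"
proof -
  obtain a where "cball (0::'a) r \<subseteq> cbox (- a) a"
    using bounded_subset_cbox_symmetric[OF bounded_cball] by blast
  then show ?thesis by (rule that)
qed

lemma continuous_on_compose_UNIV:
  "continuous_on UNIV f \<Longrightarrow> continuous_on S g \<Longrightarrow> continuous_on S (\<lambda>x. f (g x))"
  by (rule continuous_on_compose2) auto

lemma continuous_integral_param:
  fixes k :: "'p::topological_space \<Rightarrow> 'b::euclidean_space \<Rightarrow> real"
  assumes "continuous_on UNIV (\<lambda>(p, y). k p y)" "\<And>p y. r < norm y \<Longrightarrow> k p y = 0"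
  shows "continuous_on UNIV (\<lambda>p. \<integral>y. k p y \<partial>lborel)"
proof -
  obtain a where a: "cball (0::'b) r \<subseteq> cbox (- a) a" by (rule cball_in_cbox)
  have "csupp r (k p)" for p
  proof -
    have "continuous_on UNIV (\<lambda>y. (p, y))" by (intro continuous_intros)
    from continuous_on_compose_UNIV[OF assms(1) this] show ?thesis
      using assms(2) by (auto simp: csupp_def)
  qed
  then have "(\<lambda>p. \<integral>y. k p y \<partial>lborel) = (\<lambda>p. integral (cbox (- a) a) (k p))"
    by (intro ext integral_eq_cbox[OF a])
  moreover have "continuous_on UNIV (\<lambda>p. integral (cbox (- a) a) (k p))"
    by (rule integral_continuous_on_param) (rule continuous_on_subset[OF assms(1)], simp)
  ultimately show ?thesis by (simp only:)
qed

lemma integral_swap_csupp: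
  fixes k :: "real \<Rightarrow> 'a::euclidean_space \<Rightarrow> real"
  assumes k: "continuous_on UNIV (\<lambda>(t, x). k t x)" and z: "\<And>t x. r < norm x \<Longrightarrow> k t x = 0"
  shows "(\<integral>x. integral {a..b} (\<lambda>t. k t x) \<partial>lborel) = integral {a..b} (\<lambda>t. \<integral>x. k t x \<partial>lborel)"
proof -
  obtain c where c: "cball (0::'a) r \<subseteq> cbox (- c) c" by (rule cball_in_cbox)
  have "continuous_on UNIV (\<lambda>p::'a \<times> real. (snd p, fst p))" by (intro continuous_intros)
  from continuous_on_compose_UNIV[OF k this]
  have k': "continuous_on UNIV (\<lambda>(x, t). k t x)" by (simp add: split_beta)
  have kt: "csupp r (k t)" for t
  proof -
    have "continuous_on UNIV (\<lambda>x::'a. (t, x))" by (intro continuous_intros)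
    from continuous_on_compose_UNIV[OF k this] show ?thesis using z by (simp add: csupp_def)
  qed
  have "continuous_on UNIV (\<lambda>x. integral (cbox a b) (\<lambda>t. k t x))"
    by (rule integral_continuous_on_param[where f = "\<lambda>x t. k t x"]) (rule continuous_on_subset[OF k'], simp)
  moreover have "integral (cbox a b) (\<lambda>t. k t x) = 0" if "r < norm x" for x
    using z[OF that] by simp
  ultimately have cs: "csupp r (\<lambda>x. integral (cbox a b) (\<lambda>t. k t x))" unfolding csupp_def by blast
  have "(\<integral>x. integral (cbox a b) (\<lambda>t. k t x) \<partial>lborel) = integral (cbox (- c) c) (\<lambda>x. integral (cbox a b) (\<lambda>t. k t x))"
    by (rule integral_eq_cbox[OF c cs])
  also have "\<dots> = integral (cbox a b) (\<lambda>t. integral (cbox (- c) c) (\<lambda>x. k t x))"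
    by (rule integral_swap_continuous) (rule continuous_on_subset[OF k'], simp)
  also have "(\<lambda>t. integral (cbox (- c) c) (\<lambda>x. k t x)) = (\<lambda>t. \<integral>x. k t x \<partial>lborel)"
    by (rule ext) (rule integral_eq_cbox[OF c kt, symmetric])
  finally show ?thesis by simp
qed

lemma csupp_avg_integrand:
  assumes "csupp r w" "continuous_on UNIV f"
  shows "csupp r (\<lambda>y. w y * f (x + h *\<^sub>R y))"
  by (intro csupp_mult_right[OF assms(1)] continuous_on_compose_UNIV[OF assms(2)] continuous_intros)

lemmas avg_integrable = csupp_integrable[OF csupp_avg_integrand]

lemma avg_add:
  "csupp r w \<Longrightarrow> continuous_on UNIV f \<Longrightarrow> continuous_on UNIV g \<Longrightarrow>
    avg w h (\<lambda>x. f x + g x) x = avg w h f x + avg w h g x"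
  unfolding avg_def distrib_left
  by (rule Bochner_Integration.integral_add; rule avg_integrable)

lemma avg_diff:
  "csupp r w \<Longrightarrow> continuous_on UNIV f \<Longrightarrow> continuous_on UNIV g \<Longrightarrow>
    avg w h (\<lambda>x. f x - g x) x = avg w h f x - avg w h g x"
  unfolding avg_def right_diff_distrib
  by (rule Bochner_Integration.integral_diff; rule avg_integrable)

lemma avg_cmult: "avg w h (\<lambda>x. c * f x) x = c * avg w h f x"
  unfolding avg_def by (simp add: mult.left_commute[of _ c])

lemma avg_minus: "avg w h (\<lambda>x. - f x) x = - avg w h f x"
  using avg_cmult[of w h "-1"] by simp

lemma avg_const: "avg w h (\<lambda>x. c) x = c * (\<integral>y. w y \<partial>lborel)"
  unfolding avg_def by simp

lemma avg_sum:
  assumes "csupp r w" "\<And>a. a \<in> A \<Longrightarrow> continuous_on UNIV (f a)"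
  shows "avg w h (\<lambda>x. \<Sum>a\<in>A. f a x) x = (\<Sum>a\<in>A. avg w h (f a) x)"
  using assms(2)
proof (induction A rule: infinite_finite_induct)
  case (insert a A)
  then show ?case using assms(1) by (simp add: avg_add continuous_on_sum)
qed (simp_all add: avg_const)

lemma avg_zero_scale: "avg w 0 f x = (\<integral>y. w y \<partial>lborel) * f x"
  unfolding avg_def by simp

lemma avg_mono:
  assumes "csupp r w" "\<And>y. 0 \<le> w y" "continuous_on UNIV f" "continuous_on UNIV g" "\<And>x. f x \<le> g x"
  shows "avg w h f x \<le> avg w h g x"
  unfolding avg_def
  by (intro integral_mono avg_integrable[OF assms(1)] assms mult_left_mono)

lemma avg_nonneg:
  assumes "\<And>y. 0 \<le> w y" "\<And>x. 0 \<le> f x"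
  shows "0 \<le> avg w h f x"
  unfolding avg_def using assms by (intro Bochner_Integration.integral_nonneg) simp

lemma abs_avg_le: "\<bar>avg w h f x\<bar> \<le> avg (\<lambda>y. \<bar>w y\<bar>) h (\<lambda>x. \<bar>f x\<bar>) x"
  unfolding avg_def abs_mult[symmetric] by (rule integral_abs_bound)

lemma avg_kernel_mono:
  assumes "csupp r w" "csupp r w'" "\<And>y. w y \<le> w' y" "continuous_on UNIV f" "\<And>x. 0 \<le> f x"
  shows "avg w h f x \<le> avg w' h f x"
  unfolding avg_def
  by (intro integral_mono avg_integrable[OF assms(1)] avg_integrable[OF assms(2)] assms(3-5) mult_right_mono)

lemma avg_jointly_continuous:
  assumes "csupp r w" "continuous_on UNIV f"
  shows "continuous_on UNIV (\<lambda>(h, x). avg w h f x)"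
proof -
  have "continuous_on UNIV (\<lambda>p. \<integral>y. w y * f (snd p + fst p *\<^sub>R y) \<partial>lborel)"
  proof (rule continuous_integral_param)
    have "continuous_on UNIV (\<lambda>q. w (snd q) * f (snd (fst q) + fst (fst q) *\<^sub>R snd q))"
      by (intro continuous_intros continuous_on_compose_UNIV[OF assms(2)] continuous_on_compose_UNIV[OF csupp_continuous[OF assms(1)]])
    then show "continuous_on UNIV (\<lambda>(p, y). w y * f (snd p + fst p *\<^sub>R y))" by (simp add: split_beta)
  qed (use assms in \<open>auto simp: csupp_def\<close>)
  then show ?thesis by (simp add: avg_def split_beta)
qed

lemma continuous_avg:
  assumes "csupp r w" "continuous_on UNIV f"
  shows "continuous_on UNIV (avg w h f)"
proof -
  have "continuous_on UNIV (\<lambda>x. (h, x))" by (intro continuous_intros)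
  from continuous_on_compose_UNIV[OF avg_jointly_continuous[OF assms] this] show ?thesis by simp
qed

lemma continuous_avg_scale:
  assumes "csupp r w" "continuous_on UNIV f"
  shows "continuous_on UNIV (\<lambda>h. avg w h f x)"
proof -
  have "continuous_on UNIV (\<lambda>h. (h, x))" by (intro continuous_intros)
  from continuous_on_compose_UNIV[OF avg_jointly_continuous[OF assms] this] show ?thesis by simp
qed

lemma avg_commute:
  assumes "csupp r w" "csupp r' w'" "continuous_on UNIV f"
  shows "avg w h (avg w' h' f) x = avg w' h' (avg w h f) x"
proof -
  let ?k = "\<lambda>y z. w y * w' z * f (x + h *\<^sub>R y + h' *\<^sub>R z)"
  have "continuous_on UNIV (\<lambda>p. ?k (fst p) (snd p))"
    by (intro continuous_intros continuous_on_compose_UNIV[OF assms(3)] continuous_on_compose_UNIV[OF csupp_continuous[OF assms(1)]]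
      continuous_on_compose_UNIV[OF csupp_continuous[OF assms(2)]])
  then have "(\<integral>y. (\<integral>z. ?k y z \<partial>lborel) \<partial>lborel) = (\<integral>z. (\<integral>y. ?k y z \<partial>lborel) \<partial>lborel)"
    using assms by (intro Fubini_csupp[of _ r r']) (auto simp: csupp_def split_beta)
  then show ?thesis
    unfolding avg_def by (simp add: ac_simps flip: integral_mult_right_zero)
qed

text \<open>An even kernel gives a self-adjoint averaging operator; compact support of one factor suffices.\<close>

lemma integral_avg_mult:
  assumes "csupp r w" "\<And>y. w (- y) = w y" "continuous_on UNIV f" "csupp s g"
  shows "(\<integral>x. avg w h f x * g x \<partial>lborel) = (\<integral>x. f x * avg w h g x \<partial>lborel)"
proof -
  note cont = csupp_continuous[OF assms(1)] assms(3) csupp_continuous[OF assms(4)]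
  let ?k = "\<lambda>x y. w y * f (x + h *\<^sub>R y) * g x"
  let ?l = "\<lambda>x y. w y * f x * g (x - h *\<^sub>R y)"
  have k: "continuous_on UNIV (\<lambda>p. ?k (fst p) (snd p))" and l: "continuous_on UNIV (\<lambda>p. ?l (fst p) (snd p))"
    by (intro continuous_intros continuous_on_compose_UNIV[OF cont(1)] continuous_on_compose_UNIV[OF cont(2)] continuous_on_compose_UNIV[OF cont(3)])+
  have l0: "?l x y = 0" if "\<bar>s\<bar> + \<bar>h\<bar> * \<bar>r\<bar> < norm x" for x y
  proof (cases "norm y \<le> r")
    case True
    have "norm x \<le> norm (x - h *\<^sub>R y) + norm (h *\<^sub>R y)" by (metis norm_triangle_sub add.commute)
    moreover have "norm (h *\<^sub>R y) \<le> \<bar>h\<bar> * \<bar>r\<bar>" using True by (auto intro!: mult_left_mono)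
    ultimately show ?thesis using that csupp_zero[OF assms(4), of "x - h *\<^sub>R y"] by auto
  qed (use csupp_zero[OF assms(1)] in auto)
  have tr: "(\<integral>x. ?k x y \<partial>lborel) = (\<integral>x. ?l x y \<partial>lborel)" for y
  proof -
    have "continuous_on UNIV (\<lambda>x. ?l x y)"
      by (intro continuous_intros continuous_on_compose_UNIV[OF cont(2)] continuous_on_compose_UNIV[OF cont(3)])
    from integral_translate[OF this, of "h *\<^sub>R y"] show ?thesis by simp
  qed
  have refl: "(\<integral>y. w y * g (x - h *\<^sub>R y) \<partial>lborel) = avg w h g x" for x
  proof -
    have "continuous_on UNIV (\<lambda>y. w y * g (x + h *\<^sub>R y))"
      by (intro continuous_intros continuous_on_compose_UNIV[OF cont(1)] continuous_on_compose_UNIV[OF cont(3)])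
    from integral_reflect_lborel[OF this] show ?thesis unfolding avg_def by (simp add: assms(2))
  qed
  have "(\<integral>x. avg w h f x * g x \<partial>lborel) = (\<integral>x. (\<integral>y. ?k x y \<partial>lborel) \<partial>lborel)"
    unfolding avg_def by (simp flip: integral_mult_left_zero)
  also have "\<dots> = (\<integral>y. (\<integral>x. ?k x y \<partial>lborel) \<partial>lborel)"
    using k assms by (intro Fubini_csupp[of _ s r]) (auto simp: csupp_def split_beta)
  also have "\<dots> = (\<integral>y. (\<integral>x. ?l x y \<partial>lborel) \<partial>lborel)" by (simp only: tr)
  also have "\<dots> = (\<integral>x. (\<integral>y. ?l x y \<partial>lborel) \<partial>lborel)"
  proof (rule Fubini_csupp[symmetric])
    show "continuous_on UNIV (\<lambda>(x, y). ?l x y)" using l by (simp add: split_beta)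
    show "?l x y = 0" if "\<bar>s\<bar> + \<bar>h\<bar> * \<bar>r\<bar> < norm x" for x y using l0[OF that] .
    show "?l x y = 0" if "r < norm y" for x y using csupp_zero[OF assms(1) that] by simp
  qed
  also have "\<dots> = (\<integral>x. f x * (\<integral>y. w y * g (x - h *\<^sub>R y) \<partial>lborel) \<partial>lborel)"
    by (simp add: mult.assoc mult.left_commute flip: integral_mult_right_zero)
  finally show ?thesis by (simp only: refl)
qed

lemma csupp_avg:
  assumes "csupp r w" "csupp s f" "0 \<le> h"
  shows "csupp (s + h * r) (avg w h f)"
proof -
  have "avg w h f x = 0" if "s + h * r < norm x" for x
  proof -
    have "w y * f (x + h *\<^sub>R y) = 0" for y
    proof (cases "norm y \<le> r")
      case True
      have "norm x \<le> norm (x + h *\<^sub>R y) + norm (h *\<^sub>R y)"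
        by (metis norm_triangle_sub add_diff_cancel_left' add.commute norm_minus_commute)
      moreover have "norm (h *\<^sub>R y) \<le> h * r" using True assms(3) by (auto intro!: mult_left_mono)
      ultimately show ?thesis using that csupp_zero[OF assms(2), of "x + h *\<^sub>R y"] by auto
    qed (use csupp_zero[OF assms(1)] in auto)
    then have "(\<lambda>y. w y * f (x + h *\<^sub>R y)) = (\<lambda>y. 0)" by (rule ext)
    then show ?thesis unfolding avg_def by simp
  qed
  then show ?thesis using continuous_avg[OF assms(1) csupp_continuous[OF assms(2)]] by (auto simp: csupp_def)
qed

lemma integral_avg:
  assumes "csupp r w" "\<And>y. w (- y) = w y" "csupp s f"
  shows "(\<integral>x. avg w h f x \<partial>lborel) = (\<integral>y. w y \<partial>lborel) * (\<integral>x. f x \<partial>lborel)"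
  using integral_avg_mult[where f = "\<lambda>_. 1" and h = h, OF assms(1,2) continuous_on_const assms(3)]
  by (simp add: avg_const)

lemma avg_cong_ball:
  assumes "csupp r w" "0 \<le> h" "\<And>y. norm y \<le> s + h * r \<Longrightarrow> f y = g y" "norm x \<le> s"
  shows "avg w h f x = avg w h g x"
proof -
  have "w y * f (x + h *\<^sub>R y) = w y * g (x + h *\<^sub>R y)" for y
  proof (cases "norm y \<le> r")
    case True
    have "norm (x + h *\<^sub>R y) \<le> norm x + norm (h *\<^sub>R y)" by (rule norm_triangle_ineq)
    moreover have "norm (h *\<^sub>R y) \<le> h * r" using True assms(2) by (auto intro!: mult_left_mono)
    ultimately show ?thesis using assms(3)[of "x + h *\<^sub>R y"] assms(4) by auto
  qed (use csupp_zero[OF assms(1)] in auto)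
  then have "(\<lambda>y. w y * f (x + h *\<^sub>R y)) = (\<lambda>y. w y * g (x + h *\<^sub>R y))" by (rule ext)
  then show ?thesis unfolding avg_def by simp
qed

lemma
  assumes w: "csupp r w" and f: "Ck 1 f"
  shows avg_differentiable: "avg w h f differentiable (at x)"
    and partial_avg: "partial i (avg w h f) x = avg w h (partial i f) x"
proof -
  obtain a where a: "cball (0::real^3) r \<subseteq> cbox (- a) a" by (rule cball_in_cbox)
  have fd: "f differentiable (at x)" for x using f by simp
  have cf: "continuous_on UNIV f" "continuous_on UNIV (partial i f)" for i using f Ck_continuous[OF f] by simp_all
  note cw = csupp_continuous[OF w]
  define D where "D x y = w y *\<^sub>R (\<Sum>i\<in>UNIV. partial i f (x + h *\<^sub>R y) *\<^sub>R blinfun_inner_right (axis i (1::real) :: real^3))" for x y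
  have eq: "avg w h f x = integral (cbox (- a) a) (\<lambda>y. w y * f (x + h *\<^sub>R y))" for x
    unfolding avg_def by (rule integral_eq_cbox[OF a csupp_avg_integrand[OF w cf(1)]])
  have contD: "continuous_on S (\<lambda>p. D (fst p) (snd p))" for S
    unfolding D_def
    by (intro continuous_intros continuous_on_compose_UNIV[OF cf(2)] continuous_on_compose_UNIV[OF cw])
  have D: "((\<lambda>x. integral (cbox (- a) a) (\<lambda>y. w y * f (x + h *\<^sub>R y))) has_derivative
     blinfun_apply (integral (cbox (- a) a) (D x))) (at x)" for x
  proof (rule leibniz_rule[where U = UNIV, simplified])
    show "((\<lambda>x. w y * f (x + h *\<^sub>R y)) has_derivative blinfun_apply (D x y)) (at x)" for x y
    proof -
      have "((\<lambda>x. x + h *\<^sub>R y) has_derivative (\<lambda>v. v)) (at x)" by (auto intro!: derivative_eq_intros)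
      from has_derivative_compose[OF this has_derivative_partials[OF fd]]
      have "((\<lambda>x. w y * f (x + h *\<^sub>R y)) has_derivative (\<lambda>v. w y * (\<Sum>i\<in>UNIV. v $ i * partial i f (x + h *\<^sub>R y)))) (at x)"
        by (rule has_derivative_mult_right)
      moreover have "blinfun_apply (D x y) = (\<lambda>v. w y * (\<Sum>i\<in>UNIV. v $ i * partial i f (x + h *\<^sub>R y)))"
        unfolding D_def by (rule ext) (simp add: blinfun.scaleR_left blinfun.sum_left inner_axis' mult.commute)
      ultimately show ?thesis by simp
    qed
    show "(\<lambda>y. w y * f (x + h *\<^sub>R y)) integrable_on cbox (- a) a" for x
      by (intro integrable_continuous continuous_intros continuous_on_compose_UNIV[OF cw] continuous_on_compose_UNIV[OF cf(1)])
    show "continuous_on (UNIV \<times> cbox (- a) a) (\<lambda>(x, y). D x y)"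
      using contD by (simp add: split_beta)
  qed
  have eq': "avg w h f = (\<lambda>x. integral (cbox (- a) a) (\<lambda>y. w y * f (x + h *\<^sub>R y)))"
    using eq by (rule ext)
  show "avg w h f differentiable (at x)"
    unfolding eq' differentiable_def using D by blast
  have "partial i (avg w h f) x = blinfun_apply (integral (cbox (- a) a) (D x)) (axis i 1)"
    unfolding eq' by (rule partial_eqI[OF D])
  also have "\<dots> = integral (cbox (- a) a) (\<lambda>y. blinfun_apply (D x y) (axis i 1))"
  proof (rule blinfun_apply_integral)
    show "D x integrable_on cbox (- a) a"
      by (rule integrable_continuous)
         (use continuous_on_compose_UNIV[OF contD continuous_on_Pair[OF continuous_on_const continuous_on_id]] in simp)
  qed
  also have "(\<lambda>y. blinfun_apply (D x y) (axis i 1)) = (\<lambda>y. w y * partial i f (x + h *\<^sub>R y))"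
    unfolding D_def
    by (rule ext) (simp add: blinfun.scaleR_left blinfun.sum_left inner_axis' sum_axis_mult mult.commute[of "partial _ _ _" "axis _ _ $ _"])
  also have "integral (cbox (- a) a) \<dots> = avg w h (partial i f) x"
    unfolding avg_def by (rule integral_eq_cbox[OF a csupp_avg_integrand[OF w cf(2)], symmetric])
  finally show "partial i (avg w h f) x = avg w h (partial i f) x" .
qed

lemma Ck_avg:
  assumes "csupp r w"
  shows "Ck k f \<Longrightarrow> Ck k (avg w h f)"
proof (induction k arbitrary: f)
  case 0
  then show ?case using continuous_avg[OF assms] by simp
next
  case (Suc k)
  have f1: "Ck 1 f" using Suc.prems by (rule Ck_mono) simp
  have "partial i (avg w h f) = avg w h (partial i f)" for i
    by (rule ext) (rule partial_avg[OF assms f1])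
  then show ?case using Suc avg_differentiable[OF assms f1] by simp
qed

text \<open>A derivative of the averaged function costs one inverse power of the scale and no regularity: it falls on the kernel.\<close>

lemma avg_partial_eq_partial_kernel:
  assumes w: "csupp r w" "Ck 1 w" and f: "Ck 1 f" and "0 < h"
  shows "avg w h (partial i f) x = - (1 / h) * avg (partial i w) h f x"
proof -
  have fd: "f differentiable (at x)" for x using f by simp
  have "(\<integral>y. partial i (\<lambda>y. f (x + h *\<^sub>R y)) y * w y \<partial>lborel) = - (\<integral>y. f (x + h *\<^sub>R y) * partial i w y \<partial>lborel)"
    by (rule integration_by_parts[OF Ck_affine[OF f] w(2,1)])
  then have "h * (\<integral>y. w y * partial i f (x + h *\<^sub>R y) \<partial>lborel) = - (\<integral>y. partial i w y * f (x + h *\<^sub>R y) \<partial>lborel)"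
    by (simp add: partial_affine[OF fd] mult.commute mult.left_commute flip: integral_mult_right_zero)
  then show ?thesis using \<open>0 < h\<close> unfolding avg_def by (simp add: field_simps)
qed

lemma DERIV_avg:
  fixes f :: "real^3 \<Rightarrow> real"
  assumes w: "csupp r w" and f: "Ck 1 f"
  shows "((\<lambda>s. avg w s f x) has_real_derivative (\<Sum>i\<in>UNIV. avg (\<lambda>y. y $ i * w y) s (partial i f) x)) (at s)"
proof -
  have fd: "f differentiable (at z)" for z using f by simp
  have cf: "continuous_on UNIV f" "continuous_on UNIV (partial i f)" for i
    using Ck_continuous[OF f] f by simp_all
  have cw: "continuous_on UNIV w" by (rule csupp_continuous[OF w])
  obtain a where a: "cball (0::real^3) r \<subseteq> cbox (- a) a" by (rule cball_in_cbox)
  let ?G = "\<lambda>s y. \<Sum>i\<in>UNIV. (y $ i * w y) * partial i f (x + s *\<^sub>R y)"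
  have eq: "(\<lambda>s. avg w s f x) = (\<lambda>s. integral (cbox (- a) a) (\<lambda>y. w y * f (x + s *\<^sub>R y)))"
    unfolding avg_def by (rule ext) (rule integral_eq_cbox[OF a csupp_avg_integrand[OF w cf(1)]])
  have d: "((\<lambda>s. avg w s f x) has_real_derivative integral (cbox (- a) a) (?G s)) (at s)"
    unfolding eq
  proof (rule leibniz_rule_field_derivative[where U = UNIV, simplified])
    show "((\<lambda>s. w y * f (x + s *\<^sub>R y)) has_real_derivative ?G s y) (at s)" for s y
      using DERIV_cmult[OF has_real_derivative_along_line[OF fd, of x y s], of "w y"]
      by (simp add: sum_distrib_left mult_ac)
    show "(\<lambda>y. w y * f (x + s *\<^sub>R y)) integrable_on cbox (- a) a" for s
      by (intro integrable_continuous continuous_intros continuous_on_compose_UNIV[OF cw] continuous_on_compose_UNIV[OF cf(1)])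
    show "continuous_on (UNIV \<times> cbox (- a) a) (\<lambda>(s, y). ?G s y)"
      unfolding split_beta
      by (intro continuous_intros continuous_on_compose_UNIV[OF cw] continuous_on_compose_UNIV[OF cf(2)])
  qed
  have cs: "csupp r (\<lambda>y. (y $ i * w y) * partial i f (x + s *\<^sub>R y))" for i
    by (intro csupp_avg_integrand csupp_mult_left w cf) (intro continuous_intros)
  have csG: "csupp r (?G s)"
    using cs csupp_zero[OF w] by (auto simp: csupp_def intro!: continuous_on_sum)
  have "integral (cbox (- a) a) (?G s) = (\<integral>y. ?G s y \<partial>lborel)"
    by (rule integral_eq_cbox[OF a csG, symmetric])
  also have "\<dots> = (\<Sum>i\<in>UNIV. avg (\<lambda>y. y $ i * w y) s (partial i f) x)"
    unfolding avg_def by (rule Bochner_Integration.integral_sum) (rule csupp_integrable[OF cs])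
  finally show ?thesis using d by simp
qed

section \<open>The bump kernel and its potential\<close>

definition bump_mass :: real
  where "bump_mass = (\<integral>y. (max 0 (1 - (norm (y::real^3))\<^sup>2))^2 \<partial>lborel)"

definition bump :: "real^3 \<Rightarrow> real"
  where "bump y = (max 0 (1 - (norm y)\<^sup>2))^2 / bump_mass"

text \<open>The gradient of \<^term>\<open>bump_pot\<close> is \<open>- y bump y\<close>; this makes the mean value formula below explicit.\<close>

definition bump_pot :: "real^3 \<Rightarrow> real"
  where "bump_pot y = (max 0 (1 - (norm y)\<^sup>2))^3 / (6 * bump_mass)"

lemma norm_sq_sum: "(norm (y::real^3))\<^sup>2 = (\<Sum>i\<in>UNIV. (y $ i)^2)"
  by (simp add: norm_vec_def L2_set_def sum_nonneg)

lemma Ck_norm_sq: "Ck k (\<lambda>y::real^3. (norm y)\<^sup>2)"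
  unfolding norm_sq_sum by (intro Ck_sum Ck_power Ck_component)

lemma partial_norm_sq: "partial i (\<lambda>y::real^3. (norm y)\<^sup>2) x = 2 * x $ i"
proof -
  have d: "(\<lambda>y::real^3. y $ j) differentiable (at x)" for j
    using Ck_differentiable[OF Ck_component[of 1]] by simp
  have dm: "(\<lambda>y::real^3. y $ j * y $ j) differentiable (at x)" for j
    using Ck_differentiable[OF Ck_mult[OF Ck_component[of 1 j] Ck_component[of 1 j]]] by simp
  have "partial i (\<lambda>y. \<Sum>j\<in>UNIV. y $ j * y $ j) x = (\<Sum>j\<in>UNIV. partial i (\<lambda>y. y $ j * y $ j) x)"
    by (rule partial_sum) (use dm in auto)
  also have "\<dots> = (\<Sum>j\<in>UNIV. if i = j then 2 * x $ j else 0)"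
    by (rule sum.cong) (auto simp: partial_mult[OF d d])
  finally show ?thesis unfolding norm_sq_sum by (simp add: power2_eq_square)
qed

lemma has_derivative_pos_part_power:
  assumes "0 < n"
  shows "((\<lambda>t. (max 0 t)^(Suc n)) has_real_derivative real (Suc n) * (max 0 t)^n) (at t)"
proof -
  consider "t < 0" | "t = 0" | "t > 0" by linarith
  then show ?thesis
  proof cases
    case 1
    have "((\<lambda>t. 0) has_real_derivative 0) (at t)" by simp
    then have "((\<lambda>t. (max 0 t)^(Suc n)) has_real_derivative 0) (at t)"
      by (rule has_field_derivative_transform_within_open[of _ _ _ "{..<0}"]) (use 1 in auto)
    then show ?thesis using 1 assms by (simp add: zero_power)
  next
    case 3
    have "((\<lambda>t. t^(Suc n)) has_real_derivative real (Suc n) * t^n) (at t)"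
      using DERIV_pow[of "Suc n" t] by simp
    then have "((\<lambda>t. (max 0 t)^(Suc n)) has_real_derivative real (Suc n) * t^n) (at t)"
      by (rule has_field_derivative_transform_within_open[of _ _ _ "{0<..}"]) (use 3 in auto)
    then show ?thesis using 3 by simp
  next
    case 2
    have "((\<lambda>h::real. (max 0 h)^(Suc n) / h) \<longlongrightarrow> 0) (at 0)"
    proof (rule Lim_null_comparison)
      show "\<forall>\<^sub>F h::real in at 0. norm ((max 0 h)^(Suc n) / h) \<le> \<bar>h\<bar>^n"
        by (rule always_eventually) (auto simp: max_def)
      have "((\<lambda>h::real. \<bar>h\<bar>^n) \<longlongrightarrow> \<bar>0\<bar>^n) (at 0)" by (intro tendsto_intros)
      then show "((\<lambda>h::real. \<bar>h\<bar>^n) \<longlongrightarrow> 0) (at 0)" using assms by (simp only: abs_zero zero_power)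
    qed
    then show ?thesis using 2 assms by (simp add: DERIV_def zero_power)
  qed
qed

lemma bump_integrand_csupp: "csupp 1 (\<lambda>y::real^3. (max 0 (1 - (norm y)\<^sup>2))^n)" if "0 < n"
proof -
  have "continuous_on UNIV (\<lambda>y::real^3. (max 0 (1 - (norm y)\<^sup>2))^n)" by (intro continuous_intros)
  moreover have "(max 0 (1 - (norm y)\<^sup>2))^n = 0" if "1 < norm y" for y :: "real^3"
  proof -
    have "1 \<le> (norm y)\<^sup>2" using that by (simp add: one_le_power)
    then show ?thesis using \<open>0 < n\<close> by (simp add: max_def)
  qed
  ultimately show ?thesis unfolding csupp_def by blast
qed

lemma bump_mass_pos: "0 < bump_mass"
proof -
  let ?f = "\<lambda>y::real^3. (max 0 (1 - (norm y)\<^sup>2))^2"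
  have int: "integrable lborel ?f" by (rule csupp_integrable[OF bump_integrand_csupp]) simp
  have fin: "emeasure lborel (ball (0::real^3) (1/2)) < \<infinity>"
    using emeasure_lborel_ball_finite[of "0::real^3" "1/2"] by (simp add: top.not_eq_extremum)
  have "0 < measure lborel (ball (0::real^3) (1/2))"
    using content_ball_pos[of "1/2" "0::real^3"] by simp
  then have "0 < (\<integral>y. indicator (ball (0::real^3) (1/2)) y * (1/4 :: real) \<partial>lborel)"
    by simp
  also have "\<dots> \<le> (\<integral>y. ?f y \<partial>lborel)"
  proof (rule integral_mono[OF _ int])
    show "integrable lborel (\<lambda>y. indicator (ball (0::real^3) (1/2)) y * (1/4::real))"
      using fin by (intro integrable_mult_left integrable_real_indicator) auto
    show "indicator (ball 0 (1/2)) y * (1/4) \<le> ?f y" for y :: "real^3"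
    proof (cases "norm y < 1/2")
      case True
      have "(norm y)\<^sup>2 \<le> (1/2)\<^sup>2" using True by (intro power_mono) auto
      then have "(norm y)\<^sup>2 \<le> 1/2" by (simp add: power_divide)
      then have "1/2 \<le> max 0 (1 - (norm y)\<^sup>2)" by (simp add: le_max_iff_disj)
      then have "(1/2)\<^sup>2 \<le> ?f y" by (rule power_mono) simp
      then show ?thesis using True by (simp add: power2_eq_square)
    qed simp
  qed
  finally show ?thesis unfolding bump_mass_def .
qed

lemma bump_csupp: "csupp 1 bump" and bump_pot_csupp: "csupp 1 bump_pot"
  using csupp_mult_left[OF bump_integrand_csupp[of 2] continuous_on_const, of "1 / bump_mass"]
    csupp_mult_left[OF bump_integrand_csupp[of 3] continuous_on_const, of "1 / (6 * bump_mass)"]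
  by (simp_all add: bump_def[abs_def] bump_pot_def[abs_def])

lemma bump_nonneg: "0 \<le> bump y" and bump_pot_nonneg: "0 \<le> bump_pot y"
  using bump_mass_pos by (simp_all add: bump_def bump_pot_def)

lemma bump_even: "bump (- y) = bump y"
  by (simp add: bump_def)

lemma bump_integral: "(\<integral>y. bump y \<partial>lborel) = 1"
  using bump_mass_pos unfolding bump_def by (simp add: bump_mass_def)

lemma Ck_bump: "Ck 1 bump"
proof -
  let ?h = "\<lambda>j::nat. if j = 0 then (\<lambda>t::real. (max 0 t)^2) else (\<lambda>t. 2 * max 0 t)"
  have "Ck 1 (\<lambda>y::real^3. ?h 0 (1 - (norm y)\<^sup>2))"
  proof (rule Ck_compose_real[where h = "?h" and k = 1])
    show "(?h j has_real_derivative ?h (Suc j) t) (at t)" if "j < 1" for j t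
      using that has_derivative_pos_part_power[of 1 t] by (simp add: numeral_2_eq_2)
  qed (auto intro!: continuous_intros simp del: One_nat_def Ck.simps intro: Ck_diff Ck_norm_sq)
  then have "Ck 1 (\<lambda>y. (1 / bump_mass) * ?h 0 (1 - (norm y)\<^sup>2))" by (rule Ck_cmult)
  then show ?thesis by (simp add: bump_def[abs_def])
qed

lemma Ck_bump_pot: "Ck 1 bump_pot"
  and partial_bump_pot: "partial i bump_pot y = - (y $ i * bump y)"
proof -
  let ?k = "\<lambda>t::real. (max 0 t)^3 / (6 * bump_mass)"
  have k: "(?k has_real_derivative (3 * (max 0 t)^2) / (6 * bump_mass)) (at t)" for t
    using DERIV_cdivide[OF has_derivative_pos_part_power[of 2 t], of "6 * bump_mass"]
    by (simp add: numeral_3_eq_3)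
  have C: "Ck 1 (\<lambda>y::real^3. 1 - (norm y)\<^sup>2)" by (intro Ck_diff Ck_const Ck_norm_sq)
  have d: "(\<lambda>y::real^3. 1 - (norm y)\<^sup>2) differentiable (at y)" for y using C by simp
  have dn: "(\<lambda>y::real^3. (norm y)\<^sup>2) differentiable (at y)" for y using Ck_norm_sq[of 1] by simp
  have eq: "bump_pot = (\<lambda>y. ?k (1 - (norm y)\<^sup>2))" by (simp add: bump_pot_def[abs_def])
  have p1: "partial i (\<lambda>y::real^3. 1 - (norm y)\<^sup>2) y = - 2 * y $ i" for y i
    using partial_diff[OF differentiable_const dn, of i 1 y] by (simp add: partial_norm_sq)
  have p: "partial i bump_pot y = - (y $ i * bump y)" for y i
    unfolding eq partial_compose_real(2)[OF k d] p1 by (simp add: bump_def)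
  then show "partial i bump_pot y = - (y $ i * bump y)" .
  have "partial i bump_pot = (\<lambda>y. - (y $ i * bump y))" for i using p by (rule ext)
  moreover have "continuous_on UNIV (\<lambda>y. - (y $ i * bump y))" for i
    using csupp_continuous[OF bump_csupp] by (intro continuous_intros)
  moreover have "bump_pot differentiable (at y)" for y
    unfolding eq by (rule partial_compose_real(1)[OF k d])
  ultimately show "Ck 1 bump_pot" by simp
qed

lemma partial_bump_csupp: "csupp 1 (partial i bump)"
  by (rule csupp_partial[OF Ck_bump bump_csupp])

lemma partial_bump_integral: "(\<integral>y. partial i bump y \<partial>lborel) = 0"
  by (rule integral_partial_eq_0[OF Ck_bump bump_csupp])

lemma bump_lower: "1 / (4 * bump_mass) \<le> bump y" if "norm y \<le> 1/2"
proof -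
  have "(norm y)\<^sup>2 \<le> (1/2)\<^sup>2" using that by (intro power_mono) auto
  then have "(norm y)\<^sup>2 \<le> 1/2" by (simp add: power_divide)
  then have "1/2 \<le> max 0 (1 - (norm y)\<^sup>2)" by (simp add: le_max_iff_disj)
  then have "(1/2)\<^sup>2 \<le> (max 0 (1 - (norm y)\<^sup>2))^2" by (rule power_mono) simp
  from divide_right_mono[OF this less_imp_le[OF bump_mass_pos]] show ?thesis
    unfolding bump_def by (simp only: power_divide) simp
qed

lemma kernel_bound:
  obtains K where "0 < K" "\<And>y. bump y \<le> K" "\<And>y. bump_pot y \<le> K" "\<And>i y. \<bar>partial i bump y\<bar> \<le> K"
proof -
  obtain C1 where C1: "0 \<le> C1" "\<And>x. \<bar>bump x\<bar> \<le> C1" using csupp_bounded[OF bump_csupp] by blast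
  obtain C2 where C2: "0 \<le> C2" "\<And>x. \<bar>bump_pot x\<bar> \<le> C2" using csupp_bounded[OF bump_pot_csupp] by blast
  have "\<forall>i. \<exists>C\<ge>0. \<forall>x. \<bar>partial i bump x\<bar> \<le> C" using csupp_bounded[OF partial_bump_csupp] by metis
  then obtain C3 where C3: "\<And>i. 0 \<le> C3 i" "\<And>i x. \<bar>partial i bump x\<bar> \<le> C3 i" by metis
  have C3s: "\<bar>partial i bump x\<bar> \<le> sum C3 UNIV" for i x
    using C3(2)[of i x] member_le_sum[of i UNIV C3] C3(1) by simp
  have "0 \<le> sum C3 UNIV" using C3(1) by (simp add: sum_nonneg)
  show ?thesis
  proof (rule that[of "1 + C1 + C2 + sum C3 UNIV"])
    show "0 < 1 + C1 + C2 + sum C3 UNIV" using C1(1) C2(1) \<open>0 \<le> sum C3 UNIV\<close> by linarith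
    show "bump y \<le> 1 + C1 + C2 + sum C3 UNIV" for y using C1(2)[of y] C1(1) C2(1) \<open>0 \<le> sum C3 UNIV\<close> by linarith
    show "bump_pot y \<le> 1 + C1 + C2 + sum C3 UNIV" for y using C2(2)[of y] C1(1) C2(1) \<open>0 \<le> sum C3 UNIV\<close> by linarith
    show "\<bar>partial i bump y\<bar> \<le> 1 + C1 + C2 + sum C3 UNIV" for i y using C3s[of i y] C1(1) C2(1) by linarith
  qed
qed

text \<open>The mean value formula. Differentiating the average in the scale produces \<open>y bump y = - grad bump_pot\<close>,
  and an integration by parts turns it into the Laplacian.\<close>

lemma avg_bump_minus_id:
  fixes Q :: "real^3 \<Rightarrow> real"
  assumes Q: "Ck 2 Q" and "0 \<le> h"
  shows "((\<lambda>s. s * avg bump_pot s (laplacian Q) x) has_integral (avg bump h Q x - Q x)) {0..h}"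
proof -
  have Q1: "Ck 1 Q" using Q by (rule Ck_mono) simp
  have Qi: "Ck 1 (partial i Q)" for i using Q by (simp add: numeral_2_eq_2)
  have Qd: "partial i Q differentiable (at z)" for i z using Qi[of i] by simp
  have cQ: "continuous_on UNIV (partial j (partial i Q))" for i j using Qi[of i] by simp
  have G: "(\<Sum>i\<in>UNIV. avg (\<lambda>y. y $ i * bump y) s (partial i Q) x) = s * avg bump_pot s (laplacian Q) x" for s
  proof -
    have "avg (\<lambda>y. y $ i * bump y) s (partial i Q) x = s * avg bump_pot s (partial i (partial i Q)) x" for i
    proof -
      have "(\<integral>y. partial i (\<lambda>y. partial i Q (x + s *\<^sub>R y)) y * bump_pot y \<partial>lborel)
        = - (\<integral>y. partial i Q (x + s *\<^sub>R y) * partial i bump_pot y \<partial>lborel)"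
        by (rule integration_by_parts[OF Ck_affine[OF Qi] Ck_bump_pot bump_pot_csupp])
      then have "(\<integral>y. s * (bump_pot y * partial i (partial i Q) (x + s *\<^sub>R y)) \<partial>lborel) =
         (\<integral>y. (y $ i * bump y) * partial i Q (x + s *\<^sub>R y) \<partial>lborel)"
        by (simp add: partial_affine[OF Qd] partial_bump_pot mult_ac)
      then show ?thesis unfolding avg_def by simp
    qed
    then have "(\<Sum>i\<in>UNIV. avg (\<lambda>y. y $ i * bump y) s (partial i Q) x) =
        s * avg bump_pot s (\<lambda>x. \<Sum>i\<in>UNIV. partial i (partial i Q) x) x"
      by (simp add: avg_sum[OF bump_pot_csupp cQ] sum_distrib_left)
    then show ?thesis by (simp add: laplacian_def[abs_def])
  qed
  have "((\<lambda>s. s * avg bump_pot s (laplacian Q) x) has_integral (avg bump h Q x - avg bump 0 Q x)) {0..h}"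
  proof (rule fundamental_theorem_of_calculus[OF \<open>0 \<le> h\<close>])
    show "((\<lambda>s. avg bump s Q x) has_vector_derivative s * avg bump_pot s (laplacian Q) x) (at s within {0..h})" for s
      using DERIV_avg[OF bump_csupp Q1, of x s] unfolding G
      by (simp add: has_real_derivative_iff_has_vector_derivative has_vector_derivative_at_within)
  qed
  then show ?thesis by (simp add: avg_zero_scale bump_integral)
qed

section \<open>A Bellman function for the exponents three and three halves\<close>

text \<open>Of size \<open>|q|\<^sup>3 + p powr (3/2)\<close>, and so convex that the geometric mean of its second derivatives in \<open>q\<close> and in \<open>p\<close>
  stays above the mixed one by a fixed amount. Such functions bound martingale transforms on \<open>L\<^sup>3\<close>.\<close>

definition bellman :: "real \<Rightarrow> real \<Rightarrow> real"
  where "bellman q p = sqrt (q\<^sup>2 + p) ^ 3"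

lemma bellman_nonneg: "0 \<le> p \<Longrightarrow> 0 \<le> bellman q p"
  by (simp add: bellman_def)

text \<open>In the coordinates \<open>q\<close> and \<open>sqrt (q\<^sup>2 + p)\<close> the function is a cube, and the remainder of its first order expansion is an
  explicit sum of two nonnegative terms.\<close>

lemma bellman_taylor:
  fixes q p q' p' :: real
  assumes "0 \<le> p" "0 \<le> p'"
  defines "s \<equiv> sqrt (q\<^sup>2 + p)" and "t \<equiv> sqrt (q'\<^sup>2 + p')"
  shows "bellman q' p' = bellman q p + 3 * q * s * (q' - q) + (3/2) * s * (p' - p)
    + ((t - s)\<^sup>2 * (t + s / 2) + (3/2) * s * (q' - q)\<^sup>2)"
proof -
  have s: "s\<^sup>2 = q\<^sup>2 + p" and t: "t\<^sup>2 = q'\<^sup>2 + p'" using assms by (simp_all add: s_def t_def)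
  have p: "p = s\<^sup>2 - q\<^sup>2" "p' = t\<^sup>2 - q'\<^sup>2" using s t by simp_all
  have "t ^ 3 = s ^ 3 + 3 * q * s * (q' - q) + (3/2) * s * (p' - p)
    + ((t - s)\<^sup>2 * (t + s / 2) + (3/2) * s * (q' - q)\<^sup>2)"
    unfolding p by (simp add: field_simps power2_eq_square power3_eq_cube)
  then show ?thesis by (simp add: bellman_def s_def t_def)
qed

lemma quadratic_nonneg_discriminant:
  fixes a b c :: real
  assumes "\<And>l. 0 \<le> a + 2 * l * b + l\<^sup>2 * c" "0 \<le> c"
  shows "b\<^sup>2 \<le> a * c"
proof (cases "c = 0")
  case True
  have "b = 0"
  proof (rule ccontr)
    assume "b \<noteq> 0"
    then show False using assms(1)[of "- (a + 1) / (2 * b)"] True by (simp add: field_simps)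
  qed
  then show ?thesis using True by simp
next
  case False
  then have "0 < c" using assms(2) by simp
  have "0 \<le> a + 2 * (- b / c) * b + (- b / c)\<^sup>2 * c" by (rule assms(1))
  also have "\<dots> = a - b\<^sup>2 / c" using \<open>0 < c\<close> by (simp add: field_simps power2_eq_square)
  finally show ?thesis using \<open>0 < c\<close> by (simp add: field_simps)
qed

text \<open>Single averages and compositions of averages enter in the same way: as positive normalised linear functionals.\<close>

locale averaging =
  fixes E :: "(real^3 \<Rightarrow> real) \<Rightarrow> real"
  assumes E_add: "continuous_on UNIV f \<Longrightarrow> continuous_on UNIV g \<Longrightarrow> E (\<lambda>x. f x + g x) = E f + E g"
    and E_cmult: "continuous_on UNIV f \<Longrightarrow> E (\<lambda>x. c * f x) = c * E f"
    and E_mono: "continuous_on UNIV f \<Longrightarrow> continuous_on UNIV g \<Longrightarrow> (\<And>x. f x \<le> g x) \<Longrightarrow> E f \<le> E g"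
    and E_one: "E (\<lambda>x. 1) = 1"
begin

lemma E_const: "E (\<lambda>x. c) = c"
  using E_cmult[of "\<lambda>_. 1" c] E_one by simp

lemma E_nonneg: "continuous_on UNIV f \<Longrightarrow> (\<And>x. 0 \<le> f x) \<Longrightarrow> 0 \<le> E f"
  using E_mono[of "\<lambda>_. 0" f] E_const[of 0] by simp

lemma E_diff: "continuous_on UNIV f \<Longrightarrow> continuous_on UNIV g \<Longrightarrow> E (\<lambda>x. f x - g x) = E f - E g"
  using E_add[of f "\<lambda>x. (-1) * g x"] E_cmult[of g "-1"] by (simp add: continuous_intros)

lemma E_Cauchy_Schwarz:
  assumes f: "continuous_on UNIV f" and g: "continuous_on UNIV g"
  shows "(E (\<lambda>x. f x * g x))\<^sup>2 \<le> E (\<lambda>x. (f x)\<^sup>2) * E (\<lambda>x. (g x)\<^sup>2)"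
proof (rule quadratic_nonneg_discriminant)
  fix l
  have "0 \<le> E (\<lambda>x. (f x + l * g x)\<^sup>2)"
    by (rule E_nonneg) (use f g in \<open>auto intro!: continuous_intros\<close>)
  also have "(\<lambda>x. (f x + l * g x)\<^sup>2) = (\<lambda>x. ((f x)\<^sup>2 + (2 * l) * (f x * g x)) + l\<^sup>2 * (g x)\<^sup>2)"
    by (rule ext) (simp add: power2_eq_square algebra_simps)
  also have "E \<dots> = E (\<lambda>x. (f x)\<^sup>2) + 2 * l * E (\<lambda>x. f x * g x) + l\<^sup>2 * E (\<lambda>x. (g x)\<^sup>2)"
    using f g by (simp only: E_add E_cmult continuous_intros)
  finally show "0 \<le> E (\<lambda>x. (f x)\<^sup>2) + 2 * l * E (\<lambda>x. f x * g x) + l\<^sup>2 * E (\<lambda>x. (g x)\<^sup>2)" .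
qed (use g in \<open>auto intro!: E_nonneg continuous_intros\<close>)

lemma E_abs_le_sqrt:
  assumes f: "continuous_on UNIV f"
  shows "E (\<lambda>x. \<bar>f x\<bar>) \<le> sqrt (E (\<lambda>x. (f x)\<^sup>2))"
proof -
  have "(E (\<lambda>x. \<bar>f x\<bar> * 1))\<^sup>2 \<le> E (\<lambda>x. \<bar>f x\<bar>\<^sup>2) * E (\<lambda>x. 1\<^sup>2)"
    by (rule E_Cauchy_Schwarz) (use f in \<open>auto intro!: continuous_intros\<close>)
  then show ?thesis using E_one by (intro real_le_rsqrt) simp
qed

text \<open>Averaging the expansion of \<open>bellman_taylor\<close> at the mean leaves only its remainder. The first of the two terms of the
  remainder bounds the oscillation of \<open>t = sqrt (q\<^sup>2 + p)\<close>, the second that of \<open>q\<close>, and \<open>p = t\<^sup>2 - q\<^sup>2\<close>. Where \<open>q\<close> oscillates by more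
  than \<open>s\<close>, the second term is too weak; there the first one is cubic in the oscillation.\<close>

lemma bellman_gap:
  assumes q: "continuous_on UNIV q" and p: "continuous_on UNIV p" "\<And>x. 0 \<le> p x"
  shows "0 \<le> E (\<lambda>x. bellman (q x) (p x)) - bellman (E q) (E p)" (is "0 \<le> ?D")
    and "E (\<lambda>x. \<bar>q x - E q\<bar>) * E (\<lambda>x. \<bar>p x - E p\<bar>) \<le>
       12 * (E (\<lambda>x. bellman (q x) (p x)) - bellman (E q) (E p))"
proof -
  define a where "a = E q"
  define b where "b = E p"
  define s where "s = sqrt (a\<^sup>2 + b)"
  define t where "t x = sqrt ((q x)\<^sup>2 + p x)" for x
  define D where "D = ?D"
  have b0: "0 \<le> b" unfolding b_def by (rule E_nonneg[OF p])
  have s0: "0 \<le> s" and s2: "s\<^sup>2 = a\<^sup>2 + b" using b0 by (simp_all add: s_def)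
  have t0: "0 \<le> t x" and t2: "(t x)\<^sup>2 = (q x)\<^sup>2 + p x" for x using p(2)[of x] by (simp_all add: t_def)
  have qt: "\<bar>q x\<bar> \<le> t x" for x unfolding t_def using p(2)[of x] by (intro real_le_rsqrt) simp
  have as: "\<bar>a\<bar> \<le> s" unfolding s_def using b0 by (intro real_le_rsqrt) simp
  have ct: "continuous_on UNIV t" unfolding t_def by (intro continuous_intros q p)
  note ci = continuous_intros q p(1) ct
  define R where "R x = (t x - s)\<^sup>2 * (t x + s / 2) + (3/2) * s * (q x - a)\<^sup>2" for x
  have cR: "continuous_on UNIV R" unfolding R_def by (intro ci)
  have D: "D = E R"
  proof -
    have "(\<lambda>x. bellman (q x) (p x)) = (\<lambda>x. bellman a b + (3 * a * s) * (q x - a) + ((3/2) * s) * (p x - b) + R x)"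
      using bellman_taylor[OF b0 p(2)] by (intro ext) (simp add: R_def s_def t_def)
    then have "E (\<lambda>x. bellman (q x) (p x)) = E (\<lambda>x. bellman a b + (3 * a * s) * (q x - a) + ((3/2) * s) * (p x - b) + R x)"
      by (simp only:)
    also have "\<dots> = bellman a b + (3 * a * s) * (E q - a) + ((3/2) * s) * (E p - b) + E R"
      by (simp only: E_add E_cmult E_diff E_const ci cR)
    finally show ?thesis by (simp add: D_def a_def b_def)
  qed
  have R0: "0 \<le> R x" for x unfolding R_def using t0[of x] s0 by simp
  show D0: "0 \<le> ?D" using E_nonneg[OF cR R0] D by (simp add: D_def)
  then have D0: "0 \<le> D" by (simp add: D_def)
  define v where "v = sqrt (E (\<lambda>x. (q x - a)\<^sup>2))"
  have V0: "0 \<le> E (\<lambda>x. (q x - a)\<^sup>2)" by (intro E_nonneg ci) simp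
  have v0: "0 \<le> v" and v2: "v\<^sup>2 = E (\<lambda>x. (q x - a)\<^sup>2)" using V0 by (simp_all add: v_def)
  have sv: "s * v\<^sup>2 \<le> (2/3) * D"
  proof -
    have "((3/2) * s) * E (\<lambda>x. (q x - a)\<^sup>2) = E (\<lambda>x. ((3/2) * s) * (q x - a)\<^sup>2)"
      by (rule E_cmult[symmetric]) (intro ci)
    also have "\<dots> \<le> E R"
      by (rule E_mono) (use t0 s0 in \<open>auto simp: R_def intro!: ci\<close>)
    finally show ?thesis using D v2 by simp
  qed
  have W: "E (\<lambda>x. (t x - s)\<^sup>2 * (t x + s)) \<le> 2 * D"
  proof -
    have "E (\<lambda>x. (t x - s)\<^sup>2 * (t x + s)) \<le> E (\<lambda>x. 2 * R x)"
    proof (rule E_mono)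
      fix x
      have "(t x - s)\<^sup>2 * (t x + s) \<le> (t x - s)\<^sup>2 * (2 * (t x + s / 2))"
        using t0[of x] s0 by (intro mult_left_mono) auto
      moreover have "0 \<le> s * (q x - a)\<^sup>2" using s0 by simp
      ultimately show "(t x - s)\<^sup>2 * (t x + s) \<le> 2 * R x" unfolding R_def by (simp add: algebra_simps)
    qed (intro ci cR)+
    then show ?thesis using E_cmult[OF cR, of 2] D by simp
  qed
  \<comment> \<open>large oscillations of \<open>q\<close>, beyond \<open>4 s\<close>, are seen by the first term of the remainder\<close>
  have cube: "E (\<lambda>x. \<bar>q x - a\<bar>^3) \<le> 8 * D"
  proof -
    have "E (\<lambda>x. \<bar>q x - a\<bar>^3) \<le> E (\<lambda>x. 8 * R x)"
    proof (rule E_mono)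
      fix x
      define z where "z = \<bar>q x - a\<bar>"
      have z: "0 \<le> z" "(q x - a)\<^sup>2 = z\<^sup>2" by (simp_all add: z_def)
      show "\<bar>q x - a\<bar>^3 \<le> 8 * R x"
      proof (cases "z \<le> 4 * s")
        case True
        have "z^3 \<le> 4 * s * z\<^sup>2"
          using mult_right_mono[OF True, of "z\<^sup>2"] by (simp add: power3_eq_cube power2_eq_square mult.assoc)
        moreover have "0 \<le> s * z\<^sup>2" using s0 by simp
        moreover have "0 \<le> (t x - s)\<^sup>2 * (t x + s / 2)" using t0[of x] s0 by simp
        ultimately have "z^3 \<le> 8 * ((t x - s)\<^sup>2 * (t x + s / 2)) + 12 * (s * z\<^sup>2)"
          by (simp only: mult.assoc)
        then show ?thesis unfolding R_def z(2) z_def[symmetric] by (simp add: algebra_simps)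
      next
        case False
        have zt: "z - s \<le> t x" using qt[of x] as unfolding z_def by linarith
        have 1: "z / 2 \<le> t x - s" "z / 2 \<le> t x + s / 2" using zt False s0 by linarith+
        have "(z/2)\<^sup>2 * (z/2) \<le> (t x - s)\<^sup>2 * (t x + s / 2)"
          using 1 z(1) by (intro mult_mono power_mono) auto
        moreover have "0 \<le> s * z\<^sup>2" using s0 by simp
        ultimately show ?thesis unfolding R_def z(2) z_def[symmetric]
          by (simp add: power3_eq_cube power2_eq_square)
      qed
    qed (intro ci cR)+
    then show ?thesis using E_cmult[OF cR, of 8] D by simp
  qed
  have Ez: "E (\<lambda>x. \<bar>q x - a\<bar>) \<le> v" unfolding v_def by (rule E_abs_le_sqrt) (intro ci)
  have Ez0: "0 \<le> E (\<lambda>x. \<bar>q x - a\<bar>)" by (intro E_nonneg ci) simp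
  have v3: "v^3 \<le> 8 * D"
  proof (cases "v = 0")
    case False
    have "(E (\<lambda>x. sqrt \<bar>q x - a\<bar> * (sqrt \<bar>q x - a\<bar>)^3))\<^sup>2
        \<le> E (\<lambda>x. (sqrt \<bar>q x - a\<bar>)\<^sup>2) * E (\<lambda>x. ((sqrt \<bar>q x - a\<bar>)^3)\<^sup>2)"
      by (rule E_Cauchy_Schwarz) (intro ci)+
    moreover have "(\<lambda>x. sqrt \<bar>q x - a\<bar> * (sqrt \<bar>q x - a\<bar>)^3) = (\<lambda>x. (q x - a)\<^sup>2)"
    proof
      fix x
      have "y * y^3 = (y\<^sup>2)\<^sup>2" for y :: real by (simp add: power2_eq_square power3_eq_cube)
      then have "sqrt \<bar>q x - a\<bar> * (sqrt \<bar>q x - a\<bar>)^3 = ((sqrt \<bar>q x - a\<bar>)\<^sup>2)\<^sup>2" .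
      then show "sqrt \<bar>q x - a\<bar> * (sqrt \<bar>q x - a\<bar>)^3 = (q x - a)\<^sup>2" by simp
    qed
    moreover have "(\<lambda>x. ((sqrt \<bar>q x - a\<bar>)^3)\<^sup>2) = (\<lambda>x. \<bar>q x - a\<bar>^3)"
    proof
      fix x
      have "(y^3)\<^sup>2 = (y\<^sup>2)^3" for y :: real by (simp add: power2_eq_square power3_eq_cube)
      then have "((sqrt \<bar>q x - a\<bar>)^3)\<^sup>2 = ((sqrt \<bar>q x - a\<bar>)\<^sup>2)^3" .
      then show "((sqrt \<bar>q x - a\<bar>)^3)\<^sup>2 = \<bar>q x - a\<bar>^3" by (simp only: real_sqrt_pow2[OF abs_ge_zero])
    qed
    ultimately have "(v\<^sup>2)\<^sup>2 \<le> E (\<lambda>x. \<bar>q x - a\<bar>) * E (\<lambda>x. \<bar>q x - a\<bar>^3)" using v2 by simp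
    also have "\<dots> \<le> v * (8 * D)"
      using Ez Ez0 cube v0 by (intro mult_mono E_nonneg ci) auto
    finally have "v * v^3 \<le> v * (8 * D)" by (simp add: power2_eq_square power3_eq_cube mult.assoc)
    then show ?thesis using False v0 by simp
  qed (use D0 in simp)
  \<comment> \<open>the mean of \<open>t\<^sup>2\<close> exceeds \<open>s\<^sup>2\<close> exactly by the variance of \<open>q\<close>\<close>
  have Et: "E t \<le> s + v"
  proof -
    have "E (\<lambda>x. (q x)\<^sup>2) = v\<^sup>2 + a\<^sup>2"
    proof -
      have "(\<lambda>x. (q x)\<^sup>2) = (\<lambda>x. (q x - a)\<^sup>2 + (2 * a) * (q x - a) + a\<^sup>2)"
        by (rule ext) (simp add: power2_eq_square algebra_simps)
      then have "E (\<lambda>x. (q x)\<^sup>2) = E (\<lambda>x. (q x - a)\<^sup>2 + (2 * a) * (q x - a) + a\<^sup>2)" by (simp only:)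
      also have "\<dots> = E (\<lambda>x. (q x - a)\<^sup>2) + (2 * a) * (E q - a) + a\<^sup>2"
        by (simp only: E_add E_cmult E_diff E_const ci)
      finally show ?thesis using v2 by (simp add: a_def)
    qed
    moreover have "E (\<lambda>x. (t x)\<^sup>2) = E (\<lambda>x. (q x)\<^sup>2) + E p"
      unfolding t2 by (simp only: E_add ci)
    ultimately have "E (\<lambda>x. (t x)\<^sup>2) = s\<^sup>2 + v\<^sup>2" using s2 b_def by simp
    moreover have "s\<^sup>2 + v\<^sup>2 \<le> (s + v)\<^sup>2" using s0 v0 by (simp add: power2_sum)
    ultimately have "sqrt (E (\<lambda>x. (t x)\<^sup>2)) \<le> s + v" using s0 v0 by (simp add: real_le_lsqrt)
    moreover have "E t \<le> sqrt (E (\<lambda>x. (t x)\<^sup>2))" using E_abs_le_sqrt[OF ct] t0 by simp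
    ultimately show ?thesis by linarith
  qed
  define Y where "Y = E (\<lambda>x. (t x + s) * \<bar>t x - s\<bar>)"
  have Y0: "0 \<le> Y" unfolding Y_def using t0 s0 by (intro E_nonneg ci) auto
  have Y2: "Y\<^sup>2 \<le> 2 * D * (2 * s + v)"
  proof -
    have ts0: "0 \<le> t x + s" for x using t0[of x] s0 by simp
    have "(E (\<lambda>x. (\<bar>t x - s\<bar> * sqrt (t x + s)) * sqrt (t x + s)))\<^sup>2
        \<le> E (\<lambda>x. (\<bar>t x - s\<bar> * sqrt (t x + s))\<^sup>2) * E (\<lambda>x. (sqrt (t x + s))\<^sup>2)"
      by (rule E_Cauchy_Schwarz) (intro ci)+
    moreover have "(\<lambda>x. (\<bar>t x - s\<bar> * sqrt (t x + s)) * sqrt (t x + s)) = (\<lambda>x. (t x + s) * \<bar>t x - s\<bar>)"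
    proof
      fix x
      have "sqrt (t x + s) * sqrt (t x + s) = t x + s" using ts0 by simp
      then show "(\<bar>t x - s\<bar> * sqrt (t x + s)) * sqrt (t x + s) = (t x + s) * \<bar>t x - s\<bar>"
        by (simp only: mult.assoc) (simp only: mult.commute)
    qed
    moreover have "(\<lambda>x. (\<bar>t x - s\<bar> * sqrt (t x + s))\<^sup>2) = (\<lambda>x. (t x - s)\<^sup>2 * (t x + s))"
      using ts0 by (simp add: power_mult_distrib)
    moreover have "(\<lambda>x. (sqrt (t x + s))\<^sup>2) = (\<lambda>x. t x + s)" using ts0 by simp
    ultimately have "Y\<^sup>2 \<le> E (\<lambda>x. (t x - s)\<^sup>2 * (t x + s)) * E (\<lambda>x. t x + s)" by (simp add: Y_def)
    also have "E (\<lambda>x. t x + s) = E t + s" by (simp only: E_add E_const ci)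
    also have "E (\<lambda>x. (t x - s)\<^sup>2 * (t x + s)) * (E t + s) \<le> (2 * D) * (2 * s + v)"
    proof (rule mult_mono)
      show "0 \<le> E t + s" using E_nonneg[OF ct t0] s0 by simp
    qed (use W Et D0 in auto)
    finally show ?thesis .
  qed
  have Ep: "E (\<lambda>x. \<bar>p x - b\<bar>) \<le> 2 * Y + 2 * s * v"
  proof -
    have "E (\<lambda>x. \<bar>p x - b\<bar>) \<le> E (\<lambda>x. 2 * ((t x + s) * \<bar>t x - s\<bar>) + (2 * s) * \<bar>q x - a\<bar>)"
    proof (rule E_mono)
      fix x
      have "p x - b = (t x + s) * (t x - s) - (q x - a) * (q x + a)"
        using t2[of x] s2 by (simp add: power2_eq_square algebra_simps)
      then have "\<bar>p x - b\<bar> \<le> (t x + s) * \<bar>t x - s\<bar> + \<bar>q x - a\<bar> * \<bar>q x + a\<bar>"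
        using t0[of x] s0 by (simp add: abs_mult order_trans[OF abs_triangle_ineq4])
      moreover have "\<bar>q x - a\<bar> * \<bar>q x + a\<bar> \<le> \<bar>q x - a\<bar> * (2 * s + \<bar>t x - s\<bar>)"
        using qt[of x] as by (intro mult_left_mono) linarith+
      moreover have "\<bar>q x - a\<bar> * \<bar>t x - s\<bar> \<le> (t x + s) * \<bar>t x - s\<bar>"
        using qt[of x] as by (intro mult_right_mono) linarith+
      ultimately show "\<bar>p x - b\<bar> \<le> 2 * ((t x + s) * \<bar>t x - s\<bar>) + (2 * s) * \<bar>q x - a\<bar>"
        by (simp add: algebra_simps)
    qed (intro ci)+
    also have "\<dots> = 2 * Y + (2 * s) * E (\<lambda>x. \<bar>q x - a\<bar>)"
      unfolding Y_def by (simp only: E_add E_cmult ci)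
    finally show ?thesis using mult_left_mono[OF Ez, of "2 * s"] s0 by linarith
  qed
  have vY: "v * Y \<le> 5 * D"
  proof (rule power2_le_imp_le)
    have "(v * Y)\<^sup>2 \<le> v\<^sup>2 * (2 * D * (2 * s + v))"
      using mult_left_mono[OF Y2, of "v\<^sup>2"] by (simp add: power_mult_distrib)
    also have "\<dots> = (2 * D) * (2 * (s * v\<^sup>2) + v^3)" by (simp add: power2_eq_square power3_eq_cube algebra_simps)
    also have "\<dots> \<le> (2 * D) * (2 * ((2/3) * D) + 8 * D)"
      using sv v3 D0 by (intro mult_left_mono) auto
    also have "\<dots> \<le> (5 * D)\<^sup>2" by (simp add: power2_eq_square)
    finally show "(v * Y)\<^sup>2 \<le> (5 * D)\<^sup>2" .
  qed (use D0 in simp)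
  have "E (\<lambda>x. \<bar>q x - a\<bar>) * E (\<lambda>x. \<bar>p x - b\<bar>) \<le> v * (2 * Y + 2 * s * v)"
    by (intro mult_mono Ez Ep v0 E_nonneg ci) simp
  also have "\<dots> = 2 * (v * Y) + 2 * (s * v\<^sup>2)" by (simp add: power2_eq_square algebra_simps)
  also have "\<dots> \<le> 12 * D" using vY sv D0 by linarith
  finally show "E (\<lambda>x. \<bar>q x - E q\<bar>) * E (\<lambda>x. \<bar>p x - E p\<bar>) \<le> 12 * ?D"
    by (simp add: a_def b_def D_def)
qed

end

section \<open>The multiscale bilinear estimate\<close>

lemma avg_mono_local:
  assumes w: "csupp r w" "\<And>y. 0 \<le> w y" and f: "continuous_on UNIV f" and g: "continuous_on UNIV g"
    and le: "\<And>y. norm (y - x) \<le> h * r \<Longrightarrow> f y \<le> g y" and h: "0 \<le> h"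
  shows "avg w h f x \<le> avg w h g x"
  unfolding avg_def
proof (intro integral_mono avg_integrable[OF w(1)] f g)
  fix y
  show "w y * f (x + h *\<^sub>R y) \<le> w y * g (x + h *\<^sub>R y)"
  proof (cases "norm y \<le> r")
    case True
    then have "norm (x + h *\<^sub>R y - x) \<le> h * r" using h by (auto intro!: mult_left_mono)
    then show ?thesis by (intro mult_left_mono le w)
  qed (use csupp_zero[OF w(1)] in auto)
qed

lemma integral_affine3:
  fixes f :: "real^3 \<Rightarrow> real"
  assumes f: "continuous_on UNIV f" and c: "0 < c"
  shows "(\<integral>x. f x \<partial>lborel) = c^3 * (\<integral>x. f (a + c *\<^sub>R x) \<partial>lborel)"
proof -
  have [measurable]: "f \<in> borel_measurable borel" using f by (rule borel_measurable_continuous_onI)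
  have "(\<integral>x. f x \<partial>lborel) = (\<integral>x. f x \<partial>density (distr lborel borel (\<lambda>x. a + c *\<^sub>R x)) (\<lambda>_. ennreal (\<bar>c\<bar> ^ DIM(real^3))))"
    using lborel_affine[of c a] c by simp
  also have "\<dots> = (\<integral>x. \<bar>c\<bar> ^ DIM(real^3) * f x \<partial>distr lborel borel (\<lambda>x. a + c *\<^sub>R x))"
    by (subst integral_density) auto
  also have "\<dots> = (\<integral>x. \<bar>c\<bar> ^ DIM(real^3) * f (a + c *\<^sub>R x) \<partial>lborel)"
    by (subst integral_distr) auto
  finally show ?thesis using c by simp
qed

text \<open>Three consecutive steps of the walk over the scales. Since the scales grow by the factor eight, the last of the three
  kernels covers the supports of all kernels of the two smaller scales, so the composition dominates them pointwise.\<close>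

definition walk3 :: "real \<Rightarrow> (real^3 \<Rightarrow> real) \<Rightarrow> real^3 \<Rightarrow> real"
  where "walk3 h f = avg bump (64 * h) (avg bump (8 * h) (avg bump h f))"

lemma continuous_avg_bump: "continuous_on UNIV f \<Longrightarrow> continuous_on UNIV (avg bump h f)"
  by (rule continuous_avg[OF bump_csupp])

lemma averaging_avg_bump: "averaging (\<lambda>f. avg bump h f x)"
proof
  show "avg bump h f x \<le> avg bump h g x"
    if "continuous_on UNIV f" "continuous_on UNIV g" "\<And>x. f x \<le> g x" for f g
    by (rule avg_mono[OF bump_csupp bump_nonneg that])
qed (simp_all add: avg_add[OF bump_csupp] avg_cmult avg_const bump_integral)

lemma averaging_walk3: "averaging (\<lambda>f. walk3 h f x)"
proof
  fix f g :: "real^3 \<Rightarrow> real" and c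
  assume f: "continuous_on UNIV f"
  have fe: "avg bump h (\<lambda>x. c * f x) = (\<lambda>x. c * avg bump h f x)" for h f c by (rule ext) (rule avg_cmult)
  show "walk3 h (\<lambda>x. c * f x) x = c * walk3 h f x" unfolding walk3_def fe by (rule refl)
  assume g: "continuous_on UNIV g"
  show "walk3 h (\<lambda>x. f x + g x) x = walk3 h f x + walk3 h g x"
  proof -
    have fa: "avg bump h (\<lambda>x. f x + g x) = (\<lambda>x. avg bump h f x + avg bump h g x)"
      if "continuous_on UNIV f" "continuous_on UNIV g" for h f g
      by (rule ext) (rule avg_add[OF bump_csupp that])
    show ?thesis unfolding walk3_def by (simp only: fa continuous_avg_bump f g)
  qed
  assume "\<And>x. f x \<le> g x"
  then show "walk3 h f x \<le> walk3 h g x" unfolding walk3_def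
    by (intro avg_mono[OF bump_csupp bump_nonneg] continuous_avg_bump f g)
next
  show "walk3 h (\<lambda>x. 1) x = 1"
  proof -
    have "avg bump h (\<lambda>x. 1) = (\<lambda>x. 1)" for h by (rule ext) (simp add: avg_const bump_integral)
    then show ?thesis unfolding walk3_def by simp
  qed
qed

text \<open>After rescaling, the support of the small kernel lies where the large bump is bounded below, even if the centres
  differ by \<open>17 h\<close>. This distance is \<open>8 h\<close> for the shift by the outer average plus \<open>9 h\<close> for the two smaller steps of the walk.\<close>

lemma avg_le_avg_bump64:
  assumes w: "csupp 1 w" "\<And>y. 0 \<le> w y" "\<And>y. w y \<le> K" and k: "continuous_on UNIV k" "\<And>x. 0 \<le> k x"
    and h: "0 < h" and dist: "norm (x - x') \<le> 17 * h"
  shows "avg w h k x \<le> (64^3 * 4 * bump_mass * K) * avg bump (64 * h) k x'"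
proof -
  define a where "a = (1 / h) *\<^sub>R (x' - x)"
  have K0: "0 \<le> K" using w(2)[of 0] w(3)[of 0] by linarith
  have "norm a = norm (x - x') / h" using h by (simp add: a_def norm_minus_commute)
  then have na: "norm a \<le> 17" using dist h by (simp add: divide_le_eq)
  have ca: "continuous_on UNIV (\<lambda>y. w y * k (x + h *\<^sub>R y))"
    by (rule csupp_continuous[OF csupp_avg_integrand[OF w(1) k(1)]])
  have arg: "x + h *\<^sub>R (a + 64 *\<^sub>R y) = x' + (64 * h) *\<^sub>R y" for y
    using h by (simp add: a_def algebra_simps)
  have "avg w h k x = 64^3 * (\<integral>y. w (a + 64 *\<^sub>R y) * k (x' + (64 * h) *\<^sub>R y) \<partial>lborel)"
    unfolding avg_def by (subst integral_affine3[OF ca, of 64 a]) (simp_all add: arg)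
  also have "(\<integral>y. w (a + 64 *\<^sub>R y) * k (x' + (64 * h) *\<^sub>R y) \<partial>lborel)
      \<le> (\<integral>y. (4 * bump_mass * K) * (bump y * k (x' + (64 * h) *\<^sub>R y)) \<partial>lborel)"
  proof (rule integral_mono)
    have wz: "w (a + 64 *\<^sub>R y) = 0" if "1/2 < norm y" for y
    proof -
      have "64 * norm y = norm ((a + 64 *\<^sub>R y) - a)" by simp
      also have "\<dots> \<le> norm (a + 64 *\<^sub>R y) + norm a" by (rule norm_triangle_ineq4)
      finally have "64 * norm y \<le> norm (a + 64 *\<^sub>R y) + norm a" .
      then show ?thesis using that na by (intro csupp_zero[OF w(1)]) linarith
    qed
    have "continuous_on UNIV (\<lambda>y. w (a + 64 *\<^sub>R y))"
      by (intro continuous_on_compose_UNIV[OF csupp_continuous[OF w(1)]] continuous_intros)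
    with wz have "csupp (1/2) (\<lambda>y. w (a + 64 *\<^sub>R y))" by (simp add: csupp_def)
    then show "integrable lborel (\<lambda>y. w (a + 64 *\<^sub>R y) * k (x' + (64 * h) *\<^sub>R y))"
      by (rule avg_integrable[OF _ k(1)])
    show "integrable lborel (\<lambda>y. (4 * bump_mass * K) * (bump y * k (x' + (64 * h) *\<^sub>R y)))"
      by (intro integrable_mult_right avg_integrable[OF bump_csupp k(1)])
    fix y
    have "w (a + 64 *\<^sub>R y) \<le> (4 * bump_mass * K) * bump y"
    proof (cases "norm y \<le> 1/2")
      case True
      have "K = (4 * bump_mass * K) * (1 / (4 * bump_mass))" using bump_mass_pos by simp
      also have "\<dots> \<le> (4 * bump_mass * K) * bump y"
        using bump_lower[OF True] K0 bump_mass_pos by (intro mult_left_mono) auto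
      finally show ?thesis using w(3)[of "a + 64 *\<^sub>R y"] by linarith
    next
      case False
      have "0 \<le> (4 * bump_mass * K) * bump y" using K0 bump_mass_pos bump_nonneg by simp
      then show ?thesis using wz[of y] False by simp
    qed
    from mult_right_mono[OF this k(2)]
    show "w (a + 64 *\<^sub>R y) * k (x' + (64 * h) *\<^sub>R y) \<le> (4 * bump_mass * K) * (bump y * k (x' + (64 * h) *\<^sub>R y))"
      by (simp only: mult.assoc)
  qed
  finally show ?thesis unfolding avg_def by simp
qed

lemma walk3_dominates:
  assumes w: "csupp 1 w" "\<And>y. 0 \<le> w y" "\<And>y. w y \<le> K" and k: "continuous_on UNIV k" "\<And>x. 0 \<le> k x"
    and h: "0 < h" and s: "0 \<le> s" "s \<le> 8 * h"
  shows "avg bump s (avg w h k) x \<le> (64^3 * 4 * bump_mass * K) * walk3 h k x"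
proof -
  let ?C = "64^3 * 4 * bump_mass * K"
  have K0: "0 \<le> K" using w(2)[of 0] w(3)[of 0] by linarith
  have C0: "0 \<le> ?C" using K0 bump_mass_pos by simp
  have walk: "walk3 h k x = avg bump h (avg bump (8 * h) (avg bump (64 * h) k)) x"
  proof -
    have c: "avg bump a (avg bump b f) = avg bump b (avg bump a f)" if "continuous_on UNIV f" for a b f
      by (rule ext) (rule avg_commute[OF bump_csupp bump_csupp that])
    show ?thesis unfolding walk3_def
      by (simp only: c[of "avg bump h k" "64 * h" "8 * h"] c[of k "64 * h" h] c[of "avg bump (64 * h) k" "8 * h" h]
        continuous_avg_bump k(1))
  qed
  have ck: "continuous_on UNIV (avg w h k)" by (rule continuous_avg[OF w(1) k(1)])
  have main: "avg w h k z \<le> ?C * walk3 h k x" if z: "norm (z - x) \<le> 8 * h" for z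
  proof -
    have 1: "avg w h k z \<le> ?C * avg bump (64 * h) k x'" if "norm (x' - x) \<le> 9 * h" for x'
    proof -
      have "norm (z - x') = norm ((z - x) - (x' - x))" by simp
      also have "\<dots> \<le> norm (z - x) + norm (x' - x)" by (rule norm_triangle_ineq4)
      finally have "norm (z - x') \<le> 17 * h" using z that by linarith
      then show ?thesis by (intro avg_le_avg_bump64[where K = K] w k h)
    qed
    have 2: "avg w h k z \<le> avg bump (8 * h) (\<lambda>y. ?C * avg bump (64 * h) k y) x'"
      if "norm (x' - x) \<le> h" for x'
    proof -
      have "avg bump (8 * h) (\<lambda>y. avg w h k z) x' \<le> avg bump (8 * h) (\<lambda>y. ?C * avg bump (64 * h) k y) x'"
      proof (rule avg_mono_local[OF bump_csupp bump_nonneg])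
        fix y assume "norm (y - x') \<le> 8 * h * 1"
        moreover have "norm (y - x) \<le> norm (y - x') + norm (x' - x)" by (metis norm_triangle_ineq diff_add_cancel add_diff_eq)
        ultimately show "avg w h k z \<le> ?C * avg bump (64 * h) k y" using that by (intro 1) linarith
      qed (use h k in \<open>auto intro!: continuous_intros continuous_avg_bump\<close>)
      then show ?thesis by (simp add: avg_const bump_integral)
    qed
    have "avg bump h (\<lambda>y. avg w h k z) x \<le> avg bump h (avg bump (8 * h) (\<lambda>y. ?C * avg bump (64 * h) k y)) x"
    proof (rule avg_mono_local[OF bump_csupp bump_nonneg])
      show "avg w h k z \<le> avg bump (8 * h) (\<lambda>y. ?C * avg bump (64 * h) k y) y" if "norm (y - x) \<le> h * 1" for y
        using that by (intro 2) simp
    qed (use h k in \<open>auto intro!: continuous_intros continuous_avg_bump\<close>)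
    moreover have "avg bump (8 * h) (\<lambda>y. ?C * avg bump (64 * h) k y) = (\<lambda>y. ?C * avg bump (8 * h) (avg bump (64 * h) k) y)"
      by (rule ext) (rule avg_cmult)
    ultimately show ?thesis by (simp add: avg_const bump_integral avg_cmult walk)
  qed
  have "avg bump s (avg w h k) x \<le> avg bump s (\<lambda>y. ?C * walk3 h k x) x"
  proof (rule avg_mono_local[OF bump_csupp bump_nonneg ck])
    show "avg w h k z \<le> ?C * walk3 h k x" if "norm (z - x) \<le> s * 1" for z
      using that s by (intro main) linarith
  qed (use s in \<open>auto intro!: continuous_intros\<close>)
  then show ?thesis by (simp add: avg_const bump_integral)
qed

lemma bump_pot_le_bump: "bump_pot y \<le> bump y"
proof -
  define m where "m = max 0 (1 - (norm y)\<^sup>2)"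
  have m: "0 \<le> m" "m \<le> 1" by (simp_all add: m_def)
  have "m^3 \<le> m^2" using m by (simp add: power_decreasing)
  then have "m^3 / 6 \<le> m^2" using m(1) zero_le_power[OF m(1), of 3] by linarith
  then have "m^3 / 6 / bump_mass \<le> m^2 / bump_mass" using bump_mass_pos by (intro divide_right_mono) auto
  then show ?thesis by (simp add: bump_def bump_pot_def m_def)
qed

text \<open>A differentiated kernel has integral zero, so a constant may be subtracted from \<open>f\<close> first.\<close>

lemma derivative_average_le_oscillation:
  assumes w: "w = bump \<or> w = bump_pot" and f: "continuous_on UNIV f" and h: "0 < h" and s: "0 \<le> s" "s \<le> 8 * h"
    and K: "\<And>y. \<bar>partial i bump y\<bar> \<le> K"
  shows "\<bar>avg w s (avg (partial i bump) h f) x\<bar> \<le>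
     (64^3 * 4 * bump_mass * K) * walk3 h (\<lambda>y. \<bar>f y - walk3 h f x\<bar>) x"
proof -
  let ?c = "walk3 h f x" and ?w = "\<lambda>y. \<bar>partial i bump y\<bar>"
  have w1: "csupp 1 w" "\<And>y. 0 \<le> w y" "\<And>y. w y \<le> bump y"
    using w bump_csupp bump_pot_csupp bump_nonneg bump_pot_nonneg bump_pot_le_bump by auto
  have cf: "continuous_on UNIV (\<lambda>y. f y - ?c)" "continuous_on UNIV (\<lambda>y. \<bar>f y - ?c\<bar>)" using f by (auto intro!: continuous_intros)
  have cw: "csupp 1 ?w" by (rule csupp_abs[OF partial_bump_csupp])
  have eq: "avg (partial i bump) h f = avg (partial i bump) h (\<lambda>y. f y - ?c)"
    by (rule ext) (simp add: avg_diff[OF partial_bump_csupp f] avg_const partial_bump_integral)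
  have "\<bar>avg w s (avg (partial i bump) h f) x\<bar> \<le> avg (\<lambda>y. \<bar>w y\<bar>) s (\<lambda>y. \<bar>avg (partial i bump) h (\<lambda>y. f y - ?c) y\<bar>) x"
    unfolding eq by (rule abs_avg_le)
  also have "(\<lambda>y. \<bar>w y\<bar>) = w" using w1(2) by simp
  also have "avg w s (\<lambda>y. \<bar>avg (partial i bump) h (\<lambda>y. f y - ?c) y\<bar>) x \<le> avg w s (avg ?w h (\<lambda>y. \<bar>f y - ?c\<bar>)) x"
    by (rule avg_mono[OF w1(1,2) continuous_on_rabs[OF continuous_avg[OF partial_bump_csupp cf(1)]] continuous_avg[OF cw cf(2)]])
      (rule abs_avg_le)
  also have "\<dots> \<le> avg bump s (avg ?w h (\<lambda>y. \<bar>f y - ?c\<bar>)) x"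
    by (rule avg_kernel_mono[OF w1(1) bump_csupp w1(3) continuous_avg[OF cw cf(2)]]) (rule avg_nonneg; rule abs_ge_zero)
  also have "\<dots> \<le> (64^3 * 4 * bump_mass * K) * walk3 h (\<lambda>y. \<bar>f y - ?c\<bar>) x"
    by (rule walk3_dominates[OF cw _ _ cf(2) _ h s]) (use K in simp_all)
  finally show ?thesis .
qed

lemma csupp_bellman:
  assumes "csupp r q" "csupp r p"
  shows "csupp r (\<lambda>x. bellman (q x) (p x))"
  using assms by (auto simp: csupp_def bellman_def intro!: continuous_intros)

lemma csupp_avg_bump: "csupp r f \<Longrightarrow> 0 \<le> h \<Longrightarrow> csupp (r + h) (avg bump h f)"
  using csupp_avg[OF bump_csupp, of r f h] by simp

lemma integral_avg_bump: "csupp r f \<Longrightarrow> (\<integral>x. avg bump h f x \<partial>lborel) = (\<integral>x. f x \<partial>lborel)"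
  using integral_avg[OF bump_csupp bump_even, of r f h] by (simp add: bump_integral)

lemma csupp_walk3: "csupp r f \<Longrightarrow> 0 \<le> h \<Longrightarrow> csupp (r + 73 * h) (walk3 h f)"
  using csupp_avg_bump[OF csupp_avg_bump[OF csupp_avg_bump[of r f h], of "8 * h"], of "64 * h"]
  unfolding walk3_def by (simp add: algebra_simps)

lemma integral_walk3:
  assumes "csupp r f" "0 \<le> h"
  shows "(\<integral>x. walk3 h f x \<partial>lborel) = (\<integral>x. f x \<partial>lborel)"
  unfolding walk3_def using assms
  by (simp add: integral_avg_bump[OF csupp_avg_bump[OF csupp_avg_bump]] integral_avg_bump[OF csupp_avg_bump] integral_avg_bump)

text \<open>The one-scale bilinear estimate. The right-hand side is a difference of values of one functional before and after three
  steps, so that the sum over all scales stays bounded.\<close>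

definition bilinear_const :: "real \<Rightarrow> bool"
  where "bilinear_const C \<longleftrightarrow> (\<forall>h s s' i j f g r. 0 < h \<longrightarrow> 0 \<le> s \<longrightarrow> s \<le> 8 * h \<longrightarrow> 0 \<le> s' \<longrightarrow> s' \<le> 8 * h \<longrightarrow>
      csupp r f \<longrightarrow> csupp r g \<longrightarrow> (\<forall>x. 0 \<le> f x) \<longrightarrow>
      (\<integral>x. \<bar>avg bump_pot s (avg (partial i bump) h f) x * avg bump s' (avg (partial j bump) h g) x\<bar> \<partial>lborel)
       \<le> C * ((\<integral>x. bellman (g x) (f x) \<partial>lborel) - (\<integral>x. bellman (walk3 h g x) (walk3 h f x) \<partial>lborel)))"

lemma bilinear_const_exists: "\<exists>C>0. bilinear_const C"
proof -
  obtain K where K: "0 < K" "\<And>i y. \<bar>partial i bump y\<bar> \<le> K" using kernel_bound by metis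
  let ?C = "64^3 * 4 * bump_mass * K"
  have C0: "0 < ?C" using K(1) bump_mass_pos by simp
  have "bilinear_const (12 * ?C\<^sup>2)"
    unfolding bilinear_const_def
  proof (intro allI impI)
    fix h s s' r :: real and i j :: 3 and f g :: "real^3 \<Rightarrow> real"
    assume h: "0 < h" and s: "0 \<le> s" "s \<le> 8 * h" and s': "0 \<le> s'" "s' \<le> 8 * h"
      and f: "csupp r f" and g: "csupp r g" and f0: "\<forall>x. 0 \<le> f x"
    have w: "bump_pot = bump \<or> bump_pot = bump_pot" and w': "bump = bump \<or> bump = bump_pot" by simp_all
    note f = f f0[rule_format]
    note cf = csupp_continuous[OF f(1)] and cg = csupp_continuous[OF g]
    let ?b = "\<lambda>x. bellman (g x) (f x)"
    let ?F = "\<lambda>x. avg bump_pot s (avg (partial i bump) h f) x" and ?G = "\<lambda>x. avg bump s' (avg (partial j bump) h g) x"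
    have b: "csupp r ?b" by (rule csupp_bellman[OF g f(1)])
    have bw: "csupp (r + 73 * h) (\<lambda>x. bellman (walk3 h g x) (walk3 h f x))"
      using f g h by (intro csupp_bellman csupp_walk3) auto
    \<comment> \<open>integrating the pointwise bound by the Jensen gap; averages preserve integrals\<close>
    note cw = bump_pot_csupp bump_csupp
    have F: "csupp (r + h * 1 + s * 1) ?F" by (intro csupp_avg cw partial_bump_csupp f less_imp_le[OF h] s)
    have cG: "continuous_on UNIV ?G" by (intro continuous_avg[OF cw(2)] continuous_avg[OF partial_bump_csupp] cg)
    have int: "integrable lborel (\<lambda>x. \<bar>?F x * ?G x\<bar>)"
      by (rule csupp_integrable[OF csupp_abs[OF csupp_mult_right[OF F cG]]])
    have pw: "\<bar>?F x * ?G x\<bar> \<le> (12 * ?C\<^sup>2) * (walk3 h ?b x - bellman (walk3 h g x) (walk3 h f x))" for x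
    proof -
      interpret averaging "\<lambda>f. walk3 h f x" by (rule averaging_walk3)
      have "\<bar>?F x * ?G x\<bar> \<le> (?C * walk3 h (\<lambda>y. \<bar>f y - walk3 h f x\<bar>) x) * (?C * walk3 h (\<lambda>y. \<bar>g y - walk3 h g x\<bar>) x)"
        unfolding abs_mult
        using C0 by (intro mult_mono derivative_average_le_oscillation w w' cf cg h s s' K(2) mult_nonneg_nonneg[OF less_imp_le[OF C0]]
            E_nonneg continuous_intros) auto
      also have "\<dots> = ?C\<^sup>2 * (walk3 h (\<lambda>y. \<bar>g y - walk3 h g x\<bar>) x * walk3 h (\<lambda>y. \<bar>f y - walk3 h f x\<bar>) x)"
        by (simp only: power2_eq_square mult_ac)
      also have "\<dots> \<le> ?C\<^sup>2 * (12 * (walk3 h ?b x - bellman (walk3 h g x) (walk3 h f x)))"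
        by (intro mult_left_mono bellman_gap(2)[OF cg cf f(2)]) simp
      finally show ?thesis by (simp only: mult_ac)
    qed
    have b3: "csupp (r + 73 * h) (walk3 h ?b)" using csupp_walk3[OF b] h by simp
    have "(\<integral>x. \<bar>?F x * ?G x\<bar> \<partial>lborel) \<le> (\<integral>x. (12 * ?C\<^sup>2) * (walk3 h ?b x - bellman (walk3 h g x) (walk3 h f x)) \<partial>lborel)"
      by (rule integral_mono[OF int _ pw]) (intro integrable_mult_right csupp_integrable[OF csupp_diff[OF b3 bw]])
    also have "\<dots> = (12 * ?C\<^sup>2) * ((\<integral>x. walk3 h ?b x \<partial>lborel) - (\<integral>x. bellman (walk3 h g x) (walk3 h f x) \<partial>lborel))"
      using Bochner_Integration.integral_diff[OF csupp_integrable[OF b3] csupp_integrable[OF bw]] by (simp only: integral_mult_right_zero)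
    also have "(\<integral>x. walk3 h ?b x \<partial>lborel) = (\<integral>x. ?b x \<partial>lborel)" using integral_walk3[OF b] h by simp
    finally show "(\<integral>x. \<bar>?F x * ?G x\<bar> \<partial>lborel) \<le> (12 * ?C\<^sup>2) *
      ((\<integral>x. ?b x \<partial>lborel) - (\<integral>x. bellman (walk3 h g x) (walk3 h f x) \<partial>lborel))" .
  qed
  moreover have "0 < 12 * ?C\<^sup>2" by (intro mult_pos_pos zero_less_power C0) simp
  ultimately show ?thesis by blast
qed

lemma bellman_jensen_step:
  assumes f: "csupp r f" "\<And>x. 0 \<le> f x" and g: "csupp r g" and h: "0 \<le> h"
  shows "(\<integral>x. bellman (avg bump h g x) (avg bump h f x) \<partial>lborel) \<le> (\<integral>x. bellman (g x) (f x) \<partial>lborel)"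
proof -
  note cf = csupp_continuous[OF f(1)] and cg = csupp_continuous[OF g]
  let ?b = "\<lambda>x. bellman (g x) (f x)"
  have b: "csupp r ?b" by (rule csupp_bellman[OF g f(1)])
  have "(\<integral>x. bellman (avg bump h g x) (avg bump h f x) \<partial>lborel) \<le> (\<integral>x. avg bump h ?b x \<partial>lborel)"
  proof (rule integral_mono)
    show "integrable lborel (\<lambda>x. bellman (avg bump h g x) (avg bump h f x))"
      by (rule csupp_integrable[OF csupp_bellman[OF csupp_avg_bump[OF g h] csupp_avg_bump[OF f(1) h]]])
    show "integrable lborel (avg bump h ?b)" by (rule csupp_integrable[OF csupp_avg_bump[OF b h]])
    show "bellman (avg bump h g x) (avg bump h f x) \<le> avg bump h ?b x" for x
      using averaging.bellman_gap(1)[OF averaging_avg_bump cg cf f(2), of h x] by simp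
  qed
  then show ?thesis by (simp add: integral_avg_bump[OF b])
qed

section \<open>The pressure estimate\<close>

primrec walk :: "real \<Rightarrow> nat \<Rightarrow> (real^3 \<Rightarrow> real) \<Rightarrow> real^3 \<Rightarrow> real"
  where
    "walk h 0 f = f"
  | "walk h (Suc n) f = avg bump (h * 8 ^ n) (walk h n f)"

lemma continuous_walk: "continuous_on UNIV f \<Longrightarrow> continuous_on UNIV (walk h n f)"
  by (induction n) (simp_all add: continuous_avg_bump)

lemma walk_cmult: "walk h n (\<lambda>x. c * f x) = (\<lambda>x. c * walk h n f x)"
proof (induction n)
  case (Suc n)
  show ?case unfolding walk.simps Suc by (rule ext) (rule avg_cmult)
qed simp

lemma walk_minus: "walk h n (\<lambda>x. - f x) = (\<lambda>x. - walk h n f x)"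
  using walk_cmult[of h n "-1" f] by simp

lemma walk_add:
  "continuous_on UNIV f \<Longrightarrow> continuous_on UNIV g \<Longrightarrow>
    walk h n (\<lambda>x. f x + g x) = (\<lambda>x. walk h n f x + walk h n g x)"
proof (induction n)
  case (Suc n)
  show ?case unfolding walk.simps Suc.IH[OF Suc.prems]
    by (rule ext) (rule avg_add[OF bump_csupp continuous_walk[OF Suc.prems(1)] continuous_walk[OF Suc.prems(2)]])
qed simp

lemma walk_diff:
  "continuous_on UNIV f \<Longrightarrow> continuous_on UNIV g \<Longrightarrow>
    walk h n (\<lambda>x. f x - g x) = (\<lambda>x. walk h n f x - walk h n g x)"
proof (induction n)
  case (Suc n)
  show ?case unfolding walk.simps Suc.IH[OF Suc.prems]
    by (rule ext) (rule avg_diff[OF bump_csupp continuous_walk[OF Suc.prems(1)] continuous_walk[OF Suc.prems(2)]])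
qed simp

lemma walk_sum:
  "finite A \<Longrightarrow> (\<And>a. a \<in> A \<Longrightarrow> continuous_on UNIV (f a)) \<Longrightarrow>
    walk h n (\<lambda>x. \<Sum>a\<in>A. f a x) = (\<lambda>x. \<Sum>a\<in>A. walk h n (f a) x)"
proof (induction A rule: finite_induct)
  case empty
  have "walk h n (\<lambda>x. 0) = (\<lambda>x. 0)" using walk_cmult[of h n 0 "\<lambda>_. 0"] by simp
  then show ?case by simp
next
  case (insert a A)
  then show ?case by (simp add: walk_add continuous_on_sum)
qed

lemma walk_mono:
  assumes "continuous_on UNIV f" "continuous_on UNIV g" "\<And>x. f x \<le> g x"
  shows "walk h n f x \<le> walk h n g x"
  by (induction n arbitrary: x)
    (auto intro!: avg_mono[OF bump_csupp bump_nonneg] continuous_walk assms)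

lemma walk_nonneg: "(\<And>x. 0 \<le> f x) \<Longrightarrow> 0 \<le> walk h n f x"
  by (induction n arbitrary: x) (auto intro!: avg_nonneg bump_nonneg)

lemma abs_walk_le:
  assumes "continuous_on UNIV f" "continuous_on UNIV g" "\<And>x. \<bar>f x\<bar> \<le> g x"
  shows "\<bar>walk h n f x\<bar> \<le> walk h n g x"
proof -
  have 1: "f x \<le> g x" "- f x \<le> g x" for x using assms(3)[of x] by auto
  have "walk h n f x \<le> walk h n g x" by (rule walk_mono[OF assms(1,2) 1(1)])
  moreover have "walk h n (\<lambda>x. - f x) x \<le> walk h n g x"
    by (rule walk_mono[OF _ assms(2) 1(2)]) (intro continuous_intros assms(1))
  ultimately show ?thesis by (simp add: walk_minus)
qed

lemma csupp_walk:
  assumes "csupp r f" "0 \<le> h"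
  shows "csupp (r + h * 8 ^ n / 7) (walk h n f)"
proof (induction n)
  case 0
  show ?case using assms(2) by (auto intro: csupp_mono[OF assms(1)])
next
  case (Suc n)
  have "csupp (r + h * 8 ^ n / 7 + h * 8 ^ n) (walk h (Suc n) f)"
    using csupp_avg_bump[OF Suc, of "h * 8 ^ n"] assms(2) by simp
  moreover have "r + h * 8 ^ n / 7 + h * 8 ^ n = r + h * 8 ^ Suc n / 7" by simp
  ultimately show ?case by (simp only:)
qed

lemma walk_cong_ball:
  fixes f g :: "real^3 \<Rightarrow> real"
  assumes "0 \<le> h"
  shows "(\<And>y. norm y \<le> r + h * 8 ^ n / 7 \<Longrightarrow> f y = g y) \<Longrightarrow> norm x \<le> r \<Longrightarrow> walk h n f x = walk h n g x"
proof (induction n arbitrary: r x)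
  case 0
  have "norm x \<le> r + h * 8 ^ 0 / 7" using 0 assms by simp
  then show ?case using 0 by simp
next
  case (Suc n)
  have "walk h n f y = walk h n g y" if "norm y \<le> r + h * 8 ^ n * 1" for y :: "real^3"
  proof (rule Suc.IH[OF _ that])
    fix y :: "real^3" assume "norm y \<le> r + h * 8 ^ n * 1 + h * 8 ^ n / 7"
    then show "f y = g y" by (intro Suc.prems(1)) (simp add: field_simps)
  qed
  then have "avg bump (h * 8 ^ n) (walk h n f) x = avg bump (h * 8 ^ n) (walk h n g) x"
    using assms Suc.prems(2) by (intro avg_cong_ball[OF bump_csupp, of _ r]) auto
  then show ?case by simp
qed

lemma Ck_walk: "Ck k f \<Longrightarrow> Ck k (walk h n f)"
  by (induction n) (simp_all add: Ck_avg[OF bump_csupp])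

lemma partial_walk:
  assumes "Ck 1 f"
  shows "partial i (walk h n f) = walk h n (partial i f)"
proof (induction n)
  case (Suc n)
  have "partial i (avg bump (h * 8 ^ n) (walk h n f)) = avg bump (h * 8 ^ n) (partial i (walk h n f))"
    by (rule ext) (rule partial_avg[OF bump_csupp Ck_walk[OF assms]])
  then show ?case using Suc by simp
qed simp

lemma laplacian_walk:
  fixes f :: "real^3 \<Rightarrow> real"
  assumes "Ck 2 f"
  shows "laplacian (walk h n f) = walk h n (laplacian f)"
proof -
  have f1: "Ck 1 f" using assms by (rule Ck_mono) simp
  have fi: "Ck 1 (partial i f)" for i using assms by (simp add: numeral_2_eq_2)
  have c: "continuous_on UNIV (partial i (partial i f))" for i using fi[of i] by simp
  have "laplacian (walk h n f) = (\<lambda>x. \<Sum>j\<in>UNIV. walk h n (partial j (partial j f)) x)"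
    unfolding laplacian_def by (simp only: partial_walk[OF f1] partial_walk[OF fi])
  also have "\<dots> = walk h n (\<lambda>x. \<Sum>j\<in>UNIV. partial j (partial j f) x)"
    using c by (subst walk_sum) simp_all
  finally show ?thesis by (simp only: laplacian_def[abs_def])
qed

lemma integral_walk:
  assumes "csupp r f" "0 \<le> h"
  shows "(\<integral>x. walk h n f x \<partial>lborel) = (\<integral>x. f x \<partial>lborel)"
  by (induction n) (simp_all add: integral_avg_bump[OF csupp_walk[OF assms]])

lemma walk3_walk: "walk3 (h * 8 ^ n) (walk h n f) = walk h (n + 3) f"
proof -
  have "64 * (h * 8 ^ n) = h * 8 ^ Suc (Suc n)" "8 * (h * 8 ^ n) = h * 8 ^ Suc n" by simp_all
  then have "walk3 (h * 8 ^ n) (walk h n f) = walk h (Suc (Suc (Suc n))) f" by (simp only: walk3_def walk.simps)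
  then show ?thesis by (simp add: numeral_3_eq_3)
qed

lemma sum_triple_telescope:
  fixes I :: "nat \<Rightarrow> real"
  assumes "\<And>n. 0 \<le> I n" "\<And>n. I (Suc n) \<le> I n"
  shows "(\<Sum>m<M. I m - I (m + 3)) \<le> 3 * I 0"
proof -
  have eq: "(\<Sum>m<M. I m - I (m + 3)) = I 0 + I 1 + I 2 - (I M + I (M + 1) + I (M + 2))"
    by (induction M) (simp_all add: numeral_3_eq_3 numeral_2_eq_2)
  have "I 1 \<le> I 0" using assms(2)[of 0] by simp
  moreover have "I 2 \<le> I 1" using assms(2)[of 1] by (simp add: numeral_2_eq_2)
  ultimately show ?thesis
    unfolding eq using assms(1)[of M] assms(1)[of "M + 1"] assms(1)[of "M + 2"] by linarith
qed

definition cutoff :: "real \<Rightarrow> real^3 \<Rightarrow> real"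
  where "cutoff R x = max 0 (min 1 (2 - norm x / (2 * R)))"

lemma cutoff_bounds: "0 \<le> cutoff R x" "cutoff R x \<le> 1"
  by (simp_all add: cutoff_def)

lemma cutoff_inside: "0 < R \<Longrightarrow> norm x \<le> 2 * R \<Longrightarrow> cutoff R x = 1"
  by (simp add: cutoff_def field_simps)

lemma csupp_cutoff_mult:
  assumes "0 < R" "continuous_on UNIV f"
  shows "csupp (4 * R) (\<lambda>x. cutoff R x * f x)"
  using assms by (auto simp: csupp_def cutoff_def field_simps intro!: continuous_intros)

lemma avg_le_integral:
  assumes w: "csupp 1 w" "\<And>y. w y \<le> K" and f: "csupp r f" "\<And>x. 0 \<le> f x" and h: "0 < h"
  shows "avg w h f x \<le> K / h^3 * (\<integral>x. f x \<partial>lborel)"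
proof -
  have cf: "continuous_on UNIV f" by (rule csupp_continuous[OF f(1)])
  have cs: "csupp ((\<bar>r\<bar> + norm x) / h) (\<lambda>y. f (x + h *\<^sub>R y))"
  proof -
    have "f (x + h *\<^sub>R y) = 0" if "(\<bar>r\<bar> + norm x) / h < norm y" for y
    proof (rule csupp_zero[OF f(1)])
      have "\<bar>r\<bar> + norm x < h * norm y" using that h by (simp add: divide_less_eq mult.commute)
      also have "h * norm y = norm ((x + h *\<^sub>R y) - x)" using h by simp
      also have "\<dots> \<le> norm (x + h *\<^sub>R y) + norm x" by (rule norm_triangle_ineq4)
      finally show "r < norm (x + h *\<^sub>R y)" by linarith
    qed
    moreover have "continuous_on UNIV (\<lambda>y. f (x + h *\<^sub>R y))"
      by (intro continuous_on_compose_UNIV[OF cf] continuous_intros)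
    ultimately show ?thesis by (simp add: csupp_def)
  qed
  have "avg w h f x \<le> (\<integral>y. K * f (x + h *\<^sub>R y) \<partial>lborel)"
    unfolding avg_def
    by (intro integral_mono avg_integrable[OF w(1) cf] integrable_mult_right csupp_integrable[OF cs] mult_right_mono w f)
  also have "\<dots> = K / h^3 * (\<integral>x. f x \<partial>lborel)"
    using h by (subst integral_affine3[OF cf h, of x]) simp
  finally show ?thesis .
qed

text \<open>An abstract pressure problem: \<open>Q\<close> has gradient \<open>\<Delta>w - div H\<close> with \<open>\<Delta>Q = - div div H\<close>, and is tested with a function
  \<open>g\<close> of mean zero supported in the ball of radius \<open>R\<close>. The majorants \<open>U\<close> of \<open>w\<close> and \<open>v\<close> of \<open>H\<close> carry the integral bounds.\<close>

locale pressure_data =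
  fixes Q v U g :: "real^3 \<Rightarrow> real" and w :: "3 \<Rightarrow> real^3 \<Rightarrow> real"
    and H :: "3 \<Rightarrow> 3 \<Rightarrow> real^3 \<Rightarrow> real" and R :: real
  assumes R: "0 < R"
    and Q: "Ck 2 Q" and H: "\<And>i j. Ck 2 (H i j)" and w: "\<And>i. Ck 2 (w i)"
    and v: "continuous_on UNIV v" and U: "continuous_on UNIV U"
    and H_le: "\<And>i j x. \<bar>H i j x\<bar> \<le> v x" and w_le: "\<And>i x. \<bar>w i x\<bar> \<le> U x"
    and g: "Ck 1 g" "csupp R g" "(\<integral>x. g x \<partial>lborel) = 0"
    and grad_Q: "\<And>i x. partial i Q x = laplacian (w i) x - (\<Sum>j\<in>UNIV. partial j (H i j) x)"
    and lap_Q: "\<And>x. laplacian Q x = - (\<Sum>i\<in>UNIV. \<Sum>j\<in>UNIV. partial i (partial j (H i j)) x)"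
begin

lemma H1: "Ck 1 (H i j)" "Ck 1 (partial k (H i j))" "continuous_on UNIV (H i j)"
    "continuous_on UNIV (partial k (H i j))" "continuous_on UNIV (partial l (partial k (H i j)))"
proof -
  show 1: "Ck 1 (H i j)" using H by (rule Ck_mono) simp
  show 2: "Ck 1 (partial k (H i j))" for k using H[of i j] by (simp add: numeral_2_eq_2)
  show "continuous_on UNIV (H i j)" "continuous_on UNIV (partial k (H i j))"
    using 1 2 Ck_continuous by blast+
  show "continuous_on UNIV (partial l (partial k (H i j)))" using 2[of k] by simp
qed

lemma Q1: "Ck 1 Q" "continuous_on UNIV Q" "continuous_on UNIV (partial i Q)" "continuous_on UNIV (laplacian Q)"
proof -
  show 1: "Ck 1 Q" using Q by (rule Ck_mono) simp
  show "continuous_on UNIV Q" using 1 Ck_continuous by blast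
  show "continuous_on UNIV (partial i Q)" using 1 by simp
  have "Ck 1 (partial i Q)" for i using Q by (simp add: numeral_2_eq_2)
  then have "continuous_on UNIV (partial i (partial i Q))" for i by simp
  then show "continuous_on UNIV (laplacian Q)" unfolding laplacian_def by (intro continuous_intros)
qed

lemma g_continuous: "continuous_on UNIV g"
  by (rule csupp_continuous[OF g(2)])

text \<open>The Bellman function needs a nonnegative second argument, so \<open>H\<close> is written as the difference of \<open>v + H\<close> and \<open>v\<close>.\<close>

definition piece :: "3 \<Rightarrow> 3 \<Rightarrow> real^3 \<Rightarrow> real"
  where "piece i j x = cutoff R x * (v x + H i j x)"

definition base :: "real^3 \<Rightarrow> real"
  where "base x = cutoff R x * v x"

lemma v_nonneg: "0 \<le> v x"
  using H_le[of 1 1 x] by linarith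

lemma pieces_csupp: "csupp (4 * R) (piece i j)" "csupp (4 * R) base"
  unfolding piece_def[abs_def] base_def[abs_def]
  by (intro csupp_cutoff_mult R continuous_intros v H1(3))+

lemma pieces_nonneg: "0 \<le> piece i j x" "0 \<le> base x"
  unfolding piece_def base_def using H_le[of i j x] v_nonneg[of x] cutoff_bounds[of R x] by simp_all

text \<open>Only the values of \<open>H\<close> in the ball of radius \<open>2 R\<close> enter, by finite propagation of the walk.\<close>

lemma pieces_diff: "norm x \<le> 2 * R \<Longrightarrow> piece i j x - base x = H i j x"
  by (simp add: piece_def base_def cutoff_inside[OF R])

text \<open>By Jensen's inequality it decreases in \<open>n\<close>; its drops pay for the changes of \<open>pairing\<close> below.\<close>

definition energy :: "real \<Rightarrow> (real^3 \<Rightarrow> real) \<Rightarrow> nat \<Rightarrow> real"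
  where "energy h f n = (\<integral>x. bellman (walk h n g x) (walk h n f x) \<partial>lborel)"

definition gap :: "real \<Rightarrow> nat \<Rightarrow> real"
  where "gap h m = (\<Sum>i\<in>UNIV. \<Sum>j\<in>UNIV.
    (energy h (piece i j) m - energy h (piece i j) (m + 3)) + (energy h base m - energy h base (m + 3)))"

definition pairing :: "real \<Rightarrow> nat \<Rightarrow> real"
  where "pairing h n = (\<integral>x. walk h n Q x * walk h n g x \<partial>lborel)"

text \<open>One derivative stays on the stress, the other goes to the test function by parts. Both functions are averages at the scale
  \<open>k\<close> of the preceding step, so each derivative falls on a kernel and the bilinear estimate applies. The average over the
  next scale and the potential average are absorbed as the outer averages of the bilinear estimate, of scale \<open>0\<close> or \<open>8 k\<close> and of scale \<open>s\<close>.\<close>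

lemma second_derivative_pairing:
  assumes C: "bilinear_const C" and h: "0 < h" and small: "64 * (h * 8 ^ m) \<le> R"
    and s: "0 \<le> s" "s \<le> 8 * (h * 8 ^ m)"
  defines "k \<equiv> h * 8 ^ m"
  shows "\<bar>\<integral>x. avg bump_pot s (partial i (partial j (walk h (Suc m) (H i j)))) x *
          (walk h (Suc m) g x + walk h (Suc (Suc m)) g x) \<partial>lborel\<bar>
     \<le> 2 * C / k\<^sup>2 * ((energy h (piece i j) m - energy h (piece i j) (m + 3)) + (energy h base m - energy h base (m + 3)))"
proof -
  have k: "0 < k" "64 * k \<le> R" using h small by (simp_all add: k_def)
  have s8: "s \<le> 8 * k" using s by (simp add: k_def)
  define gm where "gm = walk h m g"
  define Hm where "Hm = walk h m (H i j)"
  define D where "D l f = avg (partial l bump) k f" for l f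
  define G where "G x = walk h (Suc m) g x + walk h (Suc (Suc m)) g x" for x
  define P where "P s' x = avg bump s' (D i gm) x" for s' x
  define F where "F f x = avg bump_pot s (D j (walk h m f)) x" for f x
  have cgm: "csupp (R + k / 7) gm" unfolding gm_def k_def using csupp_walk[OF g(2), of h m] h by simp
  have Cgm: "Ck 1 gm" unfolding gm_def by (rule Ck_walk[OF g(1)])
  have CHm: "Ck 1 Hm" unfolding Hm_def by (rule Ck_walk[OF H1(1)])
  have cD: "continuous_on UNIV (D l f)" if "continuous_on UNIV f" for l f
    unfolding D_def by (rule continuous_avg[OF partial_bump_csupp that])
  have cF: "continuous_on UNIV (F f)" if "continuous_on UNIV f" for f
    unfolding F_def by (intro continuous_avg[OF bump_pot_csupp] cD continuous_walk that)
  have sD: "csupp (R + k / 7 + k) (D i gm)"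
    unfolding D_def using csupp_avg[OF partial_bump_csupp cgm, of k i] k by simp
  have sP: "csupp (R + 10 * k) (P s')" if "0 \<le> s'" "s' \<le> 8 * k" for s'
    unfolding P_def using csupp_avg_bump[OF sD that(1)] that k by (elim csupp_mono) simp
  have dgn: "partial i (walk h (Suc m) g) = (\<lambda>x. - (1 / k) * D i gm x)"
    unfolding D_def gm_def k_def
  proof
    fix x
    have "partial i (walk h (Suc m) g) x = avg bump (h * 8 ^ m) (partial i (walk h m g)) x"
      using partial_avg[OF bump_csupp Cgm[unfolded gm_def]] by simp
    also have "\<dots> = - (1 / (h * 8 ^ m)) * avg (partial i bump) (h * 8 ^ m) (walk h m g) x"
      using avg_partial_eq_partial_kernel[OF bump_csupp Ck_bump Cgm[unfolded gm_def]] k by (simp add: k_def)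
    finally show "partial i (walk h (Suc m) g) x = - (1 / (h * 8 ^ m)) * avg (partial i bump) (h * 8 ^ m) (walk h m g) x" .
  qed
  have dHn: "partial j (walk h (Suc m) (H i j)) = (\<lambda>x. - (1 / k) * D j Hm x)"
    unfolding D_def Hm_def k_def
  proof
    fix x
    have "partial j (walk h (Suc m) (H i j)) x = avg bump (h * 8 ^ m) (partial j (walk h m (H i j))) x"
      using partial_avg[OF bump_csupp CHm[unfolded Hm_def]] by simp
    also have "\<dots> = - (1 / (h * 8 ^ m)) * avg (partial j bump) (h * 8 ^ m) (walk h m (H i j)) x"
      using avg_partial_eq_partial_kernel[OF bump_csupp Ck_bump CHm[unfolded Hm_def]] k by (simp add: k_def)
    finally show "partial j (walk h (Suc m) (H i j)) x = - (1 / (h * 8 ^ m)) * avg (partial j bump) (h * 8 ^ m) (walk h m (H i j)) x" .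
  qed
  have G1: "Ck 1 G" unfolding G_def by (intro Ck_add Ck_walk g)
  have gd: "walk h n g differentiable (at x)" for n x using Ck_walk[OF g(1), of h n] by simp
  have dG: "partial i G x = - (1 / k) * (P 0 x + P (8 * k) x)" for x
  proof -
    have "partial i (walk h (Suc (Suc m)) g) x = avg bump (8 * k) (partial i (walk h (Suc m) g)) x"
    proof -
      have "walk h (Suc (Suc m)) g = avg bump (8 * k) (walk h (Suc m) g)" by (simp add: k_def mult.left_commute)
      then show ?thesis by (simp only: partial_avg[OF bump_csupp Ck_walk[OF g(1)]])
    qed
    also have "\<dots> = - (1 / k) * P (8 * k) x" unfolding dgn P_def by (rule avg_cmult)
    finally show ?thesis unfolding G_def partial_add[OF gd gd] dgn
      by (simp add: P_def avg_zero_scale bump_integral algebra_simps add_divide_distrib)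
  qed
  have sG: "csupp (R + h * 8 ^ Suc m / 7 + h * 8 ^ Suc (Suc m) / 7) G"
    unfolding G_def by (rule csupp_add; rule csupp_mono[OF csupp_walk[OF g(2) less_imp_le[OF h]]]; use h in simp)
  have H1n: "Ck 1 (partial j (walk h (Suc m) (H i j)))"
    unfolding partial_walk[OF H1(1)] by (rule Ck_walk[OF H1(2)])
  have ibp: "(\<integral>x. avg bump_pot s (partial i (partial j (walk h (Suc m) (H i j)))) x * G x \<partial>lborel)
      = - (1 / k\<^sup>2) * (\<integral>x. avg bump_pot s (D j Hm) x * (P 0 x + P (8 * k) x) \<partial>lborel)"
  proof -
    let ?A = "avg bump_pot s (partial j (walk h (Suc m) (H i j)))"
    have "(\<integral>x. avg bump_pot s (partial i (partial j (walk h (Suc m) (H i j)))) x * G x \<partial>lborel) =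
        (\<integral>x. partial i ?A x * G x \<partial>lborel)"
      by (simp only: partial_avg[OF bump_pot_csupp H1n])
    also have "\<dots> = - (\<integral>x. ?A x * partial i G x \<partial>lborel)"
      by (rule integration_by_parts[OF Ck_avg[OF bump_pot_csupp H1n] G1 sG])
    also have "?A = (\<lambda>x. - (1 / k) * avg bump_pot s (D j Hm) x)"
      unfolding dHn by (rule ext) (rule avg_cmult)
    also have "(\<integral>x. - (1 / k) * avg bump_pot s (D j Hm) x * partial i G x \<partial>lborel) =
      (\<integral>x. (1 / k\<^sup>2) * (avg bump_pot s (D j Hm) x * (P 0 x + P (8 * k) x)) \<partial>lborel)"
      unfolding dG by (rule Bochner_Integration.integral_cong) (simp_all add: power2_eq_square)
    finally show ?thesis by simp
  qed
  \<comment> \<open>all the averages together move a point by less than \<open>R\<close>\<close>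
  have loc: "avg bump_pot s (D j Hm) x = F (piece i j) x - F base x" if x: "norm x \<le> R + 10 * k" for x
  proof -
    have c: "continuous_on UNIV (walk h m (piece i j))" "continuous_on UNIV (walk h m base)"
      using pieces_csupp csupp_continuous by (blast intro: continuous_walk)+
    have "walk h m (H i j) y = walk h m (piece i j) y - walk h m base y" if y: "norm y \<le> R + 19 * k" for y :: "real^3"
    proof -
      have "walk h m (H i j) y = walk h m (\<lambda>x. piece i j x - base x) y"
      proof (rule walk_cong_ball[OF less_imp_le[OF h] _ y])
        fix z :: "real^3" assume "norm z \<le> R + 19 * k + h * 8 ^ m / 7"
        then have "norm z \<le> 2 * R" using k by (simp add: k_def)
        then show "H i j z = piece i j z - base z" by (simp add: pieces_diff)
      qed
      then show ?thesis
        by (simp add: walk_diff[OF csupp_continuous[OF pieces_csupp(1)] csupp_continuous[OF pieces_csupp(2)]])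
    qed
    then have "D j Hm y = D j (\<lambda>z. walk h m (piece i j) z - walk h m base z) y" if "norm y \<le> R + 18 * k" for y
      unfolding D_def Hm_def using that k by (intro avg_cong_ball[OF partial_bump_csupp, of _ "R + 18 * k"]) auto
    then have "D j Hm y = D j (walk h m (piece i j)) y - D j (walk h m base) y" if "norm y \<le> R + 18 * k" for y
      using that unfolding D_def by (simp add: avg_diff[OF partial_bump_csupp c])
    then have "avg bump_pot s (D j Hm) x = avg bump_pot s (\<lambda>y. D j (walk h m (piece i j)) y - D j (walk h m base) y) x"
      using x s8 s by (intro avg_cong_ball[OF bump_pot_csupp, of _ "R + 10 * k"]) auto
    then show ?thesis unfolding F_def by (simp add: avg_diff[OF bump_pot_csupp cD[OF c(1)] cD[OF c(2)]])
  qed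
  have cpb: "continuous_on UNIV (piece i j)" "continuous_on UNIV base"
    using pieces_csupp csupp_continuous by blast+
  have k8: "0 \<le> 8 * k" "8 * k \<le> 8 * k" "0 \<le> (0::real)" "0 \<le> 8 * k" using k by auto
  have int: "csupp (R + 10 * k) (\<lambda>x. \<bar>F f x * P s' x\<bar>)" if "continuous_on UNIV f" "0 \<le> s'" "s' \<le> 8 * k" for f s'
    by (intro csupp_abs csupp_mult_left sP cF that)
  have bil: "(\<integral>x. \<bar>F f x * P s' x\<bar> \<partial>lborel) \<le> C * (energy h f m - energy h f (m + 3))"
    if f: "csupp (4 * R) f" "\<And>x. 0 \<le> f x" and s': "0 \<le> s'" "s' \<le> 8 * k" for f s'
  proof -
    have "csupp (4 * R + k / 7) (walk h m f)" using csupp_walk[OF f(1), of h m] h by (simp add: k_def)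
    moreover have "csupp (4 * R + k / 7) gm" by (rule csupp_mono[OF cgm]) (use R in simp)
    moreover have "\<forall>x. 0 \<le> walk h m f x" by (simp add: walk_nonneg f(2))
    ultimately have "(\<integral>x. \<bar>F f x * P s' x\<bar> \<partial>lborel) \<le>
        C * ((\<integral>x. bellman (gm x) (walk h m f x) \<partial>lborel) - (\<integral>x. bellman (walk3 k gm x) (walk3 k (walk h m f) x) \<partial>lborel))"
      using C k(1) s(1) s8 s' unfolding bilinear_const_def F_def P_def D_def by blast
    then show ?thesis by (simp only: energy_def gm_def k_def walk3_walk)
  qed
  let ?S = "\<lambda>x. (\<bar>F (piece i j) x * P 0 x\<bar> + \<bar>F (piece i j) x * P (8 * k) x\<bar>) + (\<bar>F base x * P 0 x\<bar> + \<bar>F base x * P (8 * k) x\<bar>)"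
  have pw: "\<bar>avg bump_pot s (D j Hm) x * (P 0 x + P (8 * k) x)\<bar> \<le> ?S x" for x
  proof (cases "norm x \<le> R + 10 * k")
    case True
    have "\<bar>(a - b) * (c + d)\<bar> \<le> (\<bar>a * c\<bar> + \<bar>a * d\<bar>) + (\<bar>b * c\<bar> + \<bar>b * d\<bar>)" for a b c d :: real
    proof -
      have "\<bar>(a - b) * (c + d)\<bar> \<le> (\<bar>a\<bar> + \<bar>b\<bar>) * (\<bar>c\<bar> + \<bar>d\<bar>)"
        unfolding abs_mult by (intro mult_mono) auto
      then show ?thesis by (simp add: abs_mult algebra_simps)
    qed
    then show ?thesis unfolding loc[OF True] .
  next
    case False
    then have "P 0 x = 0" "P (8 * k) x = 0" using csupp_zero[OF sP] k8 by auto
    then show ?thesis by simp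
  qed
  have "\<bar>\<integral>x. avg bump_pot s (D j Hm) x * (P 0 x + P (8 * k) x) \<partial>lborel\<bar> \<le> (\<integral>x. ?S x \<partial>lborel)"
  proof (rule order_trans[OF integral_abs_bound integral_mono[OF _ _ pw]])
    have "continuous_on UNIV (avg bump_pot s (D j Hm))"
      by (intro continuous_avg[OF bump_pot_csupp] cD Ck_continuous[OF CHm])
    then show "integrable lborel (\<lambda>x. \<bar>avg bump_pot s (D j Hm) x * (P 0 x + P (8 * k) x)\<bar>)"
      using k8 by (intro csupp_integrable[of "R + 10 * k"] csupp_abs csupp_mult_left csupp_add sP)
    show "integrable lborel ?S"
      using k8 cpb by (intro csupp_integrable[of "R + 10 * k"] csupp_add int)
  qed
  also have "\<dots> = ((\<integral>x. \<bar>F (piece i j) x * P 0 x\<bar> \<partial>lborel) + (\<integral>x. \<bar>F (piece i j) x * P (8 * k) x\<bar> \<partial>lborel)) +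
     ((\<integral>x. \<bar>F base x * P 0 x\<bar> \<partial>lborel) + (\<integral>x. \<bar>F base x * P (8 * k) x\<bar> \<partial>lborel))"
    using csupp_integrable[OF int[OF cpb(1) k8(3,4)]] csupp_integrable[OF int[OF cpb(1) k8(1,2)]]
      csupp_integrable[OF int[OF cpb(2) k8(3,4)]] csupp_integrable[OF int[OF cpb(2) k8(1,2)]]
    by (simp only: Bochner_Integration.integral_add Bochner_Integration.integrable_add)
  also have "\<dots> \<le> 2 * C * ((energy h (piece i j) m - energy h (piece i j) (m + 3)) + (energy h base m - energy h base (m + 3)))"
    using bil[OF pieces_csupp(1) pieces_nonneg(1) k8(3,4), of i j] bil[OF pieces_csupp(1) pieces_nonneg(1) k8(1,2), of i j]
      bil[OF pieces_csupp(2) pieces_nonneg(2) k8(3,4)] bil[OF pieces_csupp(2) pieces_nonneg(2) k8(1,2)]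
    by (simp only: distrib_left mult.assoc)
  finally have fin: "\<bar>\<integral>x. avg bump_pot s (D j Hm) x * (P 0 x + P (8 * k) x) \<partial>lborel\<bar> \<le>
    2 * C * ((energy h (piece i j) m - energy h (piece i j) (m + 3)) + (energy h base m - energy h base (m + 3)))" .
  have "\<bar>- (1 / k\<^sup>2) * (\<integral>x. avg bump_pot s (D j Hm) x * (P 0 x + P (8 * k) x) \<partial>lborel)\<bar> \<le>
      (1 / k\<^sup>2) * (2 * C * ((energy h (piece i j) m - energy h (piece i j) (m + 3)) + (energy h base m - energy h base (m + 3))))"
    unfolding abs_mult using fin k by (intro mult_mono) auto
  then show ?thesis using ibp unfolding G_def by simp
qed

text \<open>With \<open>A\<close> the self-adjoint average of the step, the difference of the pairings \<open>(Q, g)\<close> and \<open>(A Q, A g)\<close> is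
  \<open>(Q - A Q, g + A g)\<close>, and the mean value formula expresses \<open>Q - A Q\<close> by \<open>\<Delta>Q\<close>.\<close>

lemma pairing_step:
  assumes C: "bilinear_const C" and h: "0 < h" and small: "64 * (h * 8 ^ m) \<le> R"
  shows "\<bar>pairing h (Suc m) - pairing h (Suc (Suc m))\<bar> \<le> 64 * C * gap h m"
proof -
  define k where "k = h * 8 ^ m"
  have k: "0 < k" using h by (simp add: k_def)
  define Qn where "Qn = walk h (Suc m) Q"
  define gn where "gn = walk h (Suc m) g"
  define G where "G x = walk h (Suc m) g x + walk h (Suc (Suc m)) g x" for x
  define L where "L = laplacian Qn"
  define J where "J s = (\<integral>x. avg bump_pot s L x * G x \<partial>lborel)" for s
  define r where "r = R + h * 8 ^ Suc m / 7 + h * 8 ^ Suc (Suc m) / 7"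
  have sg: "csupp r (walk h (Suc m) g)" "csupp r (walk h (Suc (Suc m)) g)"
    unfolding r_def by (rule csupp_mono[OF csupp_walk[OF g(2) less_imp_le[OF h]]]; use h in simp)+
  have sG: "csupp r G" unfolding G_def by (rule csupp_add[OF sg])
  have cG: "continuous_on UNIV G" by (rule csupp_continuous[OF sG])
  have Q2: "Ck 2 Qn" unfolding Qn_def by (rule Ck_walk[OF Q])
  have cQ: "continuous_on UNIV Qn" by (rule Ck_continuous[OF Q2])
  have Lw: "L = walk h (Suc m) (laplacian Q)" unfolding L_def Qn_def by (rule laplacian_walk[OF Q])
  have cL: "continuous_on UNIV L" unfolding Lw by (rule continuous_walk[OF Q1(4)])
  have step: "walk h (Suc (Suc m)) f = avg bump (8 * k) (walk h (Suc m) f)" for f by (simp add: k_def mult.left_commute)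
  have diff: "pairing h (Suc m) - pairing h (Suc (Suc m)) = - (\<integral>x. (avg bump (8 * k) Qn x - Qn x) * G x \<partial>lborel)"
  proof -
    let ?A = "avg bump (8 * k)"
    have i1: "integrable lborel (\<lambda>x. Qn x * gn x)" and i2: "integrable lborel (\<lambda>x. ?A Qn x * ?A gn x)"
      and i3: "integrable lborel (\<lambda>x. Qn x * ?A gn x)" and i4: "integrable lborel (\<lambda>x. ?A Qn x * gn x)"
      unfolding gn_def using sg step
      by (auto intro!: csupp_integrable[of r] csupp_mult_left cQ continuous_avg_bump)
    have adj: "(\<integral>x. ?A Qn x * gn x \<partial>lborel) = (\<integral>x. Qn x * ?A gn x \<partial>lborel)"
      unfolding gn_def by (rule integral_avg_mult[OF bump_csupp bump_even cQ sg(1)])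
    have "(\<integral>x. (?A Qn x - Qn x) * G x \<partial>lborel) =
      (\<integral>x. (?A Qn x * gn x - Qn x * gn x) + (?A Qn x * ?A gn x - Qn x * ?A gn x) \<partial>lborel)"
      unfolding G_def step gn_def by (simp add: algebra_simps)
    also have "\<dots> = ((\<integral>x. ?A Qn x * gn x \<partial>lborel) - (\<integral>x. Qn x * gn x \<partial>lborel)) +
        ((\<integral>x. ?A Qn x * ?A gn x \<partial>lborel) - (\<integral>x. Qn x * ?A gn x \<partial>lborel))"
      using i1 i2 i3 i4 by (simp only: Bochner_Integration.integral_add Bochner_Integration.integral_diff Bochner_Integration.integrable_diff)
    finally show ?thesis using adj unfolding pairing_def step Qn_def gn_def by simp
  qed
  have mv: "avg bump (8 * k) Qn x - Qn x = integral {0..8 * k} (\<lambda>s. s * avg bump_pot s L x)" for x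
    using avg_bump_minus_id[OF Q2, of "8 * k" x] k unfolding L_def by (simp add: integral_unique)
  have cpot: "continuous_on UNIV (\<lambda>p. avg bump_pot (fst p) L (snd p))"
    using avg_jointly_continuous[OF bump_pot_csupp cL] by (simp add: split_beta)
  have cj: "continuous_on UNIV (\<lambda>(s, x). s * avg bump_pot s L x * G x)"
    unfolding split_beta by (intro continuous_intros cpot continuous_on_compose_UNIV[OF cG])
  have "(\<integral>x. (avg bump (8 * k) Qn x - Qn x) * G x \<partial>lborel) = (\<integral>x. integral {0..8 * k} (\<lambda>s. s * avg bump_pot s L x * G x) \<partial>lborel)"
    unfolding mv by (simp flip: integral_mult_left)
  also have "\<dots> = integral {0..8 * k} (\<lambda>s. \<integral>x. s * avg bump_pot s L x * G x \<partial>lborel)"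
    by (rule integral_swap_csupp[OF cj, where r = r]) (simp add: csupp_zero[OF sG])
  also have "\<dots> = integral {0..8 * k} (\<lambda>s. s * J s)"
    unfolding J_def by (simp add: mult.assoc)
  finally have swap: "(\<integral>x. (avg bump (8 * k) Qn x - Qn x) * G x \<partial>lborel) = integral {0..8 * k} (\<lambda>s. s * J s)" .
  have cJ: "continuous_on UNIV J"
    unfolding J_def
  proof (rule continuous_integral_param)
    show "continuous_on UNIV (\<lambda>(s, x). avg bump_pot s L x * G x)"
      unfolding split_beta by (intro continuous_intros cpot continuous_on_compose_UNIV[OF cG])
    show "avg bump_pot s L x * G x = 0" if "r < norm x" for s x using csupp_zero[OF sG that] by simp
  qed
  have Jb: "\<bar>J s\<bar> \<le> 2 * C / k\<^sup>2 * gap h m" if s: "0 \<le> s" "s \<le> 8 * k" for s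
  proof -
    let ?E = "\<lambda>i j x. partial i (partial j (walk h (Suc m) (H i j))) x"
    have cE: "continuous_on UNIV (?E i j)" for i j
      unfolding partial_walk[OF H1(1)] partial_walk[OF H1(2)] by (rule continuous_walk[OF H1(5)])
    have "laplacian Q = (\<lambda>x. - (\<Sum>i\<in>UNIV. \<Sum>j\<in>UNIV. partial i (partial j (H i j)) x))"
      using lap_Q by (rule ext)
    then have "L = (\<lambda>x. - (\<Sum>i\<in>UNIV. \<Sum>j\<in>UNIV. walk h (Suc m) (partial i (partial j (H i j))) x))"
      unfolding Lw by (simp only: walk_minus walk_sum[OF finite_class.finite_UNIV] H1(5) continuous_on_sum)
    then have L: "L = (\<lambda>x. - (\<Sum>i\<in>UNIV. \<Sum>j\<in>UNIV. ?E i j x))"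
      by (simp only: partial_walk[OF H1(1)] partial_walk[OF H1(2)])
    have "avg bump_pot s L x = - (\<Sum>i\<in>UNIV. \<Sum>j\<in>UNIV. avg bump_pot s (?E i j) x)" for x
      unfolding L avg_minus
      by (simp only: avg_sum[OF bump_pot_csupp] cE continuous_on_sum)
    then have "J s = (\<integral>x. - (\<Sum>i\<in>UNIV. \<Sum>j\<in>UNIV. avg bump_pot s (?E i j) x * G x) \<partial>lborel)"
      unfolding J_def by (simp add: sum_distrib_right)
    also have "\<dots> = - (\<Sum>i\<in>UNIV. \<Sum>j\<in>UNIV. \<integral>x. avg bump_pot s (?E i j) x * G x \<partial>lborel)"
    proof -
      have i: "integrable lborel (\<lambda>x. avg bump_pot s (?E i j) x * G x)" for i j
        by (intro csupp_integrable[OF csupp_mult_left[OF sG]] continuous_avg[OF bump_pot_csupp] cE)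
      show ?thesis
        by (simp only: integral_minus Bochner_Integration.integral_sum Bochner_Integration.integrable_sum i)
    qed
    finally have "\<bar>J s\<bar> \<le> (\<Sum>i\<in>UNIV. \<Sum>j\<in>UNIV. \<bar>\<integral>x. avg bump_pot s (?E i j) x * G x \<partial>lborel\<bar>)"
      by (simp add: order_trans[OF sum_abs sum_mono[OF sum_abs]])
    also have "\<dots> \<le> (\<Sum>i\<in>UNIV. \<Sum>j\<in>UNIV. 2 * C / k\<^sup>2 *
       ((energy h (piece i j) m - energy h (piece i j) (m + 3)) + (energy h base m - energy h base (m + 3))))"
      unfolding G_def k_def by (intro sum_mono second_derivative_pairing[OF C h small]) (use s in \<open>simp_all add: k_def\<close>)
    also have "\<dots> = 2 * C / k\<^sup>2 * gap h m" by (simp only: gap_def sum_distrib_left)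
    finally show ?thesis .
  qed
  have "\<bar>integral {0..8 * k} (\<lambda>s. s * J s)\<bar> \<le> integral {0..8 * k} (\<lambda>s. s * (2 * C / k\<^sup>2 * gap h m))"
  proof -
    have "norm (integral {0..8 * k} (\<lambda>s. s * J s)) \<le> integral {0..8 * k} (\<lambda>s. s * (2 * C / k\<^sup>2 * gap h m))"
    proof (rule integral_norm_bound_integral)
      show "(\<lambda>s. s * J s) integrable_on {0..8 * k}"
        by (intro integrable_continuous_real continuous_intros continuous_on_subset[OF cJ]) simp
      show "(\<lambda>s. s * (2 * C / k\<^sup>2 * gap h m)) integrable_on {0..8 * k}"
        by (intro integrable_continuous_real continuous_intros)
      show "norm (s * J s) \<le> s * (2 * C / k\<^sup>2 * gap h m)" if "s \<in> {0..8 * k}" for s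
      proof -
        have "0 \<le> s" "s \<le> 8 * k" using that by auto
        from mult_left_mono[OF Jb[OF this] this(1)] show ?thesis
          unfolding real_norm_def abs_mult abs_of_nonneg[OF \<open>0 \<le> s\<close>] .
      qed
    qed
    then show ?thesis by simp
  qed
  also have "\<dots> = ((8 * k)\<^sup>2 / 2) * (2 * C / k\<^sup>2 * gap h m)"
    using ident_has_integral[of 0 "8 * k"] k by (simp add: integral_unique)
  also have "\<dots> = 64 * C * gap h m" using k by (simp add: field_simps power2_eq_square)
  finally show ?thesis unfolding diff swap by simp
qed

lemma energy_nonneg: "(\<And>x. 0 \<le> f x) \<Longrightarrow> 0 \<le> energy h f n"
  unfolding energy_def by (intro Bochner_Integration.integral_nonneg bellman_nonneg walk_nonneg)

lemma energy_decreasing: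
  assumes "csupp (4 * R) f" "\<And>x. 0 \<le> f x" "0 \<le> h"
  shows "energy h f (Suc n) \<le> energy h f n"
  unfolding energy_def walk.simps
proof (rule bellman_jensen_step)
  show "csupp (4 * R + h * 8 ^ n / 7) (walk h n f)" by (rule csupp_walk[OF assms(1,3)])
  have "csupp (4 * R) g" by (rule csupp_mono[OF g(2)]) (use R in simp)
  then show "csupp (4 * R + h * 8 ^ n / 7) (walk h n g)" by (rule csupp_walk[OF _ assms(3)])
  show "0 \<le> walk h n f x" for x by (rule walk_nonneg[OF assms(2)])
qed (use assms(3) in simp)

definition total :: real
  where "total = (\<integral>x. bellman (g x) (2 * base x) \<partial>lborel)"

lemma energy_0_le:
  assumes "csupp (4 * R) f" "\<And>x. 0 \<le> f x" "\<And>x. f x \<le> 2 * base x"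
  shows "energy h f 0 \<le> total"
  unfolding energy_def total_def walk.simps
proof (rule integral_mono)
  have g4: "csupp (4 * R) g" by (rule csupp_mono[OF g(2)]) (use R in simp)
  have b2: "csupp (4 * R) (\<lambda>x. 2 * base x)" by (rule csupp_mult_left[OF pieces_csupp(2)]) (rule continuous_on_const)
  show "integrable lborel (\<lambda>x. bellman (g x) (f x))" by (rule csupp_integrable[OF csupp_bellman[OF g4 assms(1)]])
  show "integrable lborel (\<lambda>x. bellman (g x) (2 * base x))" by (rule csupp_integrable[OF csupp_bellman[OF g4 b2]])
  show "bellman (g x) (f x) \<le> bellman (g x) (2 * base x)" for x
    unfolding bellman_def using assms(2,3)[of x] by (intro power_mono real_sqrt_le_mono) auto
qed

text \<open>Each block of three steps costs a drop of the energy. The blocks overlap, so every drop is counted three times.\<close>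

lemma sum_gap_le:
  assumes h: "0 < h"
  shows "(\<Sum>m<M. gap h m) \<le> 54 * total"
proof -
  have h0: "0 \<le> h" using h by simp
  have t: "(\<Sum>m<M. energy h f m - energy h f (m + 3)) \<le> 3 * total"
    if f: "csupp (4 * R) f" "\<And>x. 0 \<le> f x" "\<And>x. f x \<le> 2 * base x" for f
    using sum_triple_telescope[of "energy h f" M, OF energy_nonneg[OF f(2)] energy_decreasing[OF f(1,2) h0]]
      energy_0_le[OF f, of h] by linarith
  have p2: "piece i j x \<le> 2 * base x" for i j x
    unfolding piece_def base_def using H_le[of i j x] cutoff_bounds[of R x]
    using mult_left_mono[of "v x + H i j x" "2 * v x" "cutoff R x"] by (simp add: mult.left_commute)
  have b2: "base x \<le> 2 * base x" for x using pieces_nonneg(2)[of x] by simp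
  have "(\<Sum>m<M. gap h m) = (\<Sum>i\<in>UNIV. \<Sum>j\<in>UNIV. (\<Sum>m<M. energy h (piece i j) m - energy h (piece i j) (m + 3))
      + (\<Sum>m<M. energy h base m - energy h base (m + 3)))"
    unfolding gap_def by (subst sum.swap, intro sum.cong refl, subst sum.swap) (simp add: sum.distrib)
  also have "\<dots> \<le> (\<Sum>i\<in>(UNIV::3 set). \<Sum>j\<in>(UNIV::3 set). 3 * total + 3 * total)"
    by (intro sum_mono add_mono t pieces_csupp pieces_nonneg p2 b2)
  also have "\<dots> = 54 * total" by simp
  finally show ?thesis .
qed

lemma pairing_telescope:
  assumes C: "bilinear_const C" "0 < C" and h: "0 < h" and small: "h * 8 ^ Suc M \<le> R"
  shows "\<bar>pairing h 1 - pairing h (Suc M)\<bar> \<le> 3456 * C * total"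
proof -
  have s: "64 * (h * 8 ^ m) \<le> R" if "m < M" for m
  proof -
    have "(8::real) ^ Suc (Suc m) \<le> 8 ^ Suc M" using that by (intro power_increasing) auto
    then have "h * 8 ^ Suc (Suc m) \<le> h * 8 ^ Suc M" using h by (intro mult_left_mono) auto
    then show ?thesis using small by simp
  qed
  have "pairing h 1 - pairing h (Suc M) = (\<Sum>m<M. pairing h (Suc m) - pairing h (Suc (Suc m)))"
    using sum_lessThan_telescope'[of "\<lambda>m. pairing h (Suc m)" M] by simp
  then have "\<bar>pairing h 1 - pairing h (Suc M)\<bar> \<le> (\<Sum>m<M. \<bar>pairing h (Suc m) - pairing h (Suc (Suc m))\<bar>)"
    by (simp add: sum_abs)
  also have "\<dots> \<le> (\<Sum>m<M. 64 * C * gap h m)"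
    by (intro sum_mono pairing_step C h s) auto
  also have "\<dots> = 64 * C * (\<Sum>m<M. gap h m)" by (simp add: sum_distrib_left)
  also have "\<dots> \<le> 64 * C * (54 * total)" using C(2) by (intro mult_left_mono sum_gap_le h) auto
  finally show ?thesis by simp
qed

text \<open>At the top scale, comparable to \<open>R\<close>, the gradient of the averaged \<open>Q\<close> is controlled
  by moving all derivatives onto the last two kernels.\<close>

definition mass_U :: real where "mass_U = (\<integral>x. cutoff R x * U x \<partial>lborel)"
definition mass_v :: real where "mass_v = (\<integral>x. base x \<partial>lborel)"

lemma averaged_gradient_le:
  assumes K: "\<And>i y. \<bar>partial i bump y\<bar> \<le> K" and h: "0 < h" and top: "h * 8 ^ Suc (Suc n) = R"
    and x: "norm x \<le> 8 * R / 7"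
  shows "\<bar>partial i (walk h (Suc (Suc n)) Q) x\<bar> \<le>
    3 * (8^6 * (64^3 * 4 * bump_mass * K) * K / R^5 * mass_U) + 3 * (8^4 * K / R^4 * mass_v)"
proof -
  define k where "k = h * 8 ^ Suc n"
  define k2 where "k2 = h * 8 ^ n"
  have kR: "k = R / 8" "k2 = R / 64" using top by (simp_all add: k_def k2_def)
  have k: "0 < k" "0 < k2" using R by (simp_all add: kR)
  have step: "walk h (Suc (Suc n)) f = avg bump k (avg bump k2 (walk h n f))" for f by (simp add: k_def k2_def)
  let ?b = "\<lambda>l y. \<bar>partial l bump y\<bar>"
  have cb: "csupp 1 (?b l)" for l by (rule csupp_abs[OF partial_bump_csupp])
  have ccut: "csupp (4 * R) (\<lambda>x. cutoff R x * f x)" if "continuous_on UNIV f" for f by (rule csupp_cutoff_mult[OF R that])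
  have K0: "0 \<le> K" using K[of 1 0] by linarith
  have loc: "walk h m f y = walk h m (\<lambda>x. cutoff R x * f x) y" if "norm y \<le> 10 * R / 7" "m \<le> Suc n" for f y m
  proof (rule walk_cong_ball[OF less_imp_le[OF h] _ that(1)])
    fix z :: "real^3" assume z: "norm z \<le> 10 * R / 7 + h * 8 ^ m / 7"
    have "(8::real) ^ m \<le> 8 ^ Suc n" using that(2) by (intro power_increasing) auto
    then have "h * 8 ^ m \<le> k" unfolding k_def using h by (intro mult_left_mono) auto
    then have "norm z \<le> 2 * R" using z R kR by simp
    then show "f z = cutoff R z * f z" by (simp add: cutoff_inside[OF R])
  qed
  have partH: "\<bar>walk h (Suc (Suc n)) (partial j (H i j)) x\<bar> \<le> 8^4 * K / R^4 * mass_v" for j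
  proof -
    let ?W = "walk h (Suc n) (H i j)" and ?W' = "walk h (Suc n) (\<lambda>x. cutoff R x * H i j x)" and ?V = "walk h (Suc n) base"
    have cW': "continuous_on UNIV ?W'" by (intro continuous_walk csupp_continuous[OF ccut] H1(3))
    have sV: "csupp (4 * R + h * 8 ^ Suc n / 7) ?V" by (rule csupp_walk[OF pieces_csupp(2) less_imp_le[OF h]])
    have "walk h (Suc (Suc n)) (partial j (H i j)) x = avg bump k (partial j ?W) x"
      unfolding partial_walk[OF H1(1)] by (simp add: k_def)
    also have "\<dots> = - (1 / k) * avg (partial j bump) k ?W x"
      by (rule avg_partial_eq_partial_kernel[OF bump_csupp Ck_bump Ck_walk[OF H1(1)] k(1)])
    also have "avg (partial j bump) k ?W x = avg (partial j bump) k ?W' x"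
      by (rule avg_cong_ball[OF partial_bump_csupp less_imp_le[OF k(1)] loc x]) (use R kR in auto)
    finally have "\<bar>walk h (Suc (Suc n)) (partial j (H i j)) x\<bar> = (1 / k) * \<bar>avg (partial j bump) k ?W' x\<bar>"
      using k by (simp add: abs_mult)
    also have "\<bar>avg (partial j bump) k ?W' x\<bar> \<le> avg (?b j) k (\<lambda>x. \<bar>?W' x\<bar>) x" by (rule abs_avg_le)
    also have "avg (?b j) k (\<lambda>x. \<bar>?W' x\<bar>) x \<le> avg (?b j) k ?V x"
    proof (rule avg_mono[OF cb _ continuous_on_rabs[OF cW'] csupp_continuous[OF sV]])
      show "\<bar>?W' y\<bar> \<le> ?V y" for y
        by (rule abs_walk_le[OF csupp_continuous[OF ccut[OF H1(3)]] csupp_continuous[OF pieces_csupp(2)]])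
          (use H_le cutoff_bounds in \<open>auto simp: base_def abs_mult intro!: mult_left_mono\<close>)
    qed simp
    also have "avg (?b j) k ?V x \<le> K / k^3 * (\<integral>x. ?V x \<partial>lborel)"
      by (rule avg_le_integral[OF cb K sV _ k(1)]) (rule walk_nonneg[OF pieces_nonneg(2)])
    also have "(\<integral>x. ?V x \<partial>lborel) = mass_v"
      unfolding mass_v_def by (rule integral_walk[OF pieces_csupp(2) less_imp_le[OF h]])
    finally have "\<bar>walk h (Suc (Suc n)) (partial j (H i j)) x\<bar> \<le> (1 / k) * (K / k^3 * mass_v)"
      using k by (simp add: divide_right_mono)
    also have "\<dots> = 8^4 * K / R^4 * mass_v" unfolding kR using R by (simp add: power_divide power3_eq_cube power4_eq_xxxx field_simps)
    finally show ?thesis .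
  qed
  have partw: "\<bar>walk h (Suc (Suc n)) (partial l (partial l (w i))) x\<bar> \<le> 8^6 * (64^3 * 4 * bump_mass * K) * K / R^5 * mass_U" for l
  proof -
    let ?K1 = "64^3 * 4 * bump_mass * K"
    have w1: "Ck 1 (w i)" using w by (rule Ck_mono) simp
    have w2: "Ck 1 (partial l (w i))" using w[of i] by (simp add: numeral_2_eq_2)
    let ?W = "walk h n (w i)" and ?W' = "walk h n (\<lambda>x. cutoff R x * w i x)" and ?Y = "walk h n (\<lambda>x. cutoff R x * U x)"
    have cc: "continuous_on UNIV (\<lambda>x. cutoff R x * w i x)" by (rule csupp_continuous[OF ccut[OF Ck_continuous[OF w1]]])
    have cW: "continuous_on UNIV ?W" by (rule continuous_walk[OF Ck_continuous[OF w1]])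
    have cW': "continuous_on UNIV ?W'" by (rule continuous_walk[OF cc])
    have sU: "csupp (4 * R) (\<lambda>x. cutoff R x * U x)" by (rule ccut[OF U])
    have U0: "0 \<le> U x" for x using w_le[of 1 x] by linarith
    have sY: "csupp (4 * R + h * 8 ^ n / 7) ?Y" by (rule csupp_walk[OF sU less_imp_le[OF h]])
    have Y0: "0 \<le> ?Y x" for x by (rule walk_nonneg) (simp add: cutoff_bounds U0)
    let ?T = "avg bump (64 * k2) ?Y"
    have sT: "csupp (4 * R + h * 8 ^ n / 7 + 64 * k2) ?T" using csupp_avg_bump[OF sY, of "64 * k2"] k by simp
    have e1: "walk h (Suc n) (partial l (w i)) y = - (1 / k2) * avg (partial l bump) k2 ?W y" for y
    proof -
      have "walk h (Suc n) (partial l (w i)) y = avg bump k2 (partial l ?W) y"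
        unfolding partial_walk[OF w1] by (simp add: k2_def)
      also have "\<dots> = - (1 / k2) * avg (partial l bump) k2 ?W y"
        by (rule avg_partial_eq_partial_kernel[OF bump_csupp Ck_bump Ck_walk[OF w1] k(2)])
      finally show ?thesis .
    qed
    have "walk h (Suc (Suc n)) (partial l (partial l (w i))) x = avg bump k (partial l (walk h (Suc n) (partial l (w i)))) x"
      unfolding partial_walk[OF w2] by (simp add: k_def)
    also have "\<dots> = - (1 / k) * avg (partial l bump) k (walk h (Suc n) (partial l (w i))) x"
      by (rule avg_partial_eq_partial_kernel[OF bump_csupp Ck_bump Ck_walk[OF w2] k(1)])
    also have "walk h (Suc n) (partial l (w i)) = (\<lambda>y. - (1 / k2) * avg (partial l bump) k2 ?W y)"
      using e1 by (rule ext)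
    also have "avg (partial l bump) k (\<lambda>y. - (1 / k2) * avg (partial l bump) k2 ?W y) x
        = - (1 / k2) * avg (partial l bump) k (avg (partial l bump) k2 ?W) x"
      by (rule avg_cmult)
    also have "avg (partial l bump) k (avg (partial l bump) k2 ?W) x = avg (partial l bump) k (avg (partial l bump) k2 ?W') x"
    proof (rule avg_cong_ball[OF partial_bump_csupp less_imp_le[OF k(1)] _ x])
      fix y :: "real^3" assume "norm y \<le> 8 * R / 7 + k * 1"
      then show "avg (partial l bump) k2 ?W y = avg (partial l bump) k2 ?W' y"
        by (intro avg_cong_ball[OF partial_bump_csupp less_imp_le[OF k(2)] loc]) (use R kR in auto)
    qed
    finally have "\<bar>walk h (Suc (Suc n)) (partial l (partial l (w i))) x\<bar> =
        (1 / (k * k2)) * \<bar>avg (partial l bump) k (avg (partial l bump) k2 ?W') x\<bar>"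
      using k by (simp add: abs_mult)
    also have "\<bar>avg (partial l bump) k (avg (partial l bump) k2 ?W') x\<bar> \<le> avg (?b l) k (\<lambda>y. \<bar>avg (partial l bump) k2 ?W' y\<bar>) x"
      by (rule abs_avg_le)
    also have "avg (?b l) k (\<lambda>y. \<bar>avg (partial l bump) k2 ?W' y\<bar>) x \<le> avg (?b l) k (\<lambda>y. ?K1 * ?T y) x"
    proof (rule avg_mono[OF cb])
      show "continuous_on UNIV (\<lambda>y. \<bar>avg (partial l bump) k2 ?W' y\<bar>)"
        by (rule continuous_on_rabs[OF continuous_avg[OF partial_bump_csupp cW']])
      show "continuous_on UNIV (\<lambda>y. ?K1 * ?T y)" by (intro continuous_intros csupp_continuous[OF sT])
      fix y
      have "\<bar>avg (partial l bump) k2 ?W' y\<bar> \<le> avg (?b l) k2 (\<lambda>x. \<bar>?W' x\<bar>) y" by (rule abs_avg_le)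
      also have "\<dots> \<le> avg (?b l) k2 ?Y y"
      proof (rule avg_mono[OF cb _ continuous_on_rabs[OF cW'] csupp_continuous[OF sY]])
        show "\<bar>?W' z\<bar> \<le> ?Y z" for z
          by (rule abs_walk_le[OF cc csupp_continuous[OF sU]])
            (use w_le cutoff_bounds in \<open>auto simp: abs_mult intro!: mult_left_mono\<close>)
      qed simp
      also have "\<dots> \<le> ?K1 * ?T y"
        by (rule avg_le_avg_bump64[OF cb _ K csupp_continuous[OF sY] Y0 k(2)]) (use k in auto)
      finally show "\<bar>avg (partial l bump) k2 ?W' y\<bar> \<le> ?K1 * ?T y" .
    qed simp
    also have "avg (?b l) k (\<lambda>y. ?K1 * ?T y) x = ?K1 * avg (?b l) k ?T x" by (rule avg_cmult)
    also have "avg (?b l) k ?T x \<le> K / k^3 * (\<integral>x. ?T x \<partial>lborel)"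
      by (rule avg_le_integral[OF cb K sT _ k(1)]) (rule avg_nonneg[OF bump_nonneg Y0])
    also have "(\<integral>x. ?T x \<partial>lborel) = mass_U"
      unfolding mass_U_def integral_avg_bump[OF sY] by (rule integral_walk[OF sU less_imp_le[OF h]])
    finally have "\<bar>walk h (Suc (Suc n)) (partial l (partial l (w i))) x\<bar> \<le> (1 / (k * k2)) * (?K1 * (K / k^3 * mass_U))"
      using k K0 bump_mass_pos by (simp add: mult_left_mono divide_right_mono)
    also have "\<dots> = 8^6 * ?K1 * K / R^5 * mass_U" unfolding kR using R by (simp add: power_divide eval_nat_numeral field_simps)
    finally show ?thesis .
  qed
  have cw2: "continuous_on UNIV (partial l (partial l (w i)))" for l
    using w[of i] by (simp add: numeral_2_eq_2)
  have clap: "continuous_on UNIV (laplacian (w i))" unfolding laplacian_def by (intro continuous_intros cw2)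
  have "partial i Q = (\<lambda>x. laplacian (w i) x - (\<Sum>j\<in>UNIV. partial j (H i j) x))" using grad_Q by (rule ext)
  then have "partial i (walk h (Suc (Suc n)) Q) x = walk h (Suc (Suc n)) (\<lambda>x. laplacian (w i) x - (\<Sum>j\<in>UNIV. partial j (H i j) x)) x"
    by (simp only: partial_walk[OF Q1(1)])
  also have "\<dots> = walk h (Suc (Suc n)) (laplacian (w i)) x - walk h (Suc (Suc n)) (\<lambda>x. \<Sum>j\<in>UNIV. partial j (H i j) x) x"
    by (subst walk_diff[OF clap]) (intro continuous_intros H1(4), rule refl)
  also have "walk h (Suc (Suc n)) (laplacian (w i)) x = (\<Sum>l\<in>UNIV. walk h (Suc (Suc n)) (partial l (partial l (w i))) x)"
    unfolding laplacian_def by (subst walk_sum[OF finite_class.finite_UNIV cw2]) (rule refl)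
  also have "walk h (Suc (Suc n)) (\<lambda>x. \<Sum>j\<in>UNIV. partial j (H i j) x) x = (\<Sum>j\<in>UNIV. walk h (Suc (Suc n)) (partial j (H i j)) x)"
    by (subst walk_sum[OF finite_class.finite_UNIV H1(4)]) (rule refl)
  finally have "\<bar>partial i (walk h (Suc (Suc n)) Q) x\<bar> \<le>
     (\<Sum>l\<in>UNIV. \<bar>walk h (Suc (Suc n)) (partial l (partial l (w i))) x\<bar>) + (\<Sum>j\<in>UNIV. \<bar>walk h (Suc (Suc n)) (partial j (H i j)) x\<bar>)"
    by (simp only:) (intro order_trans[OF abs_triangle_ineq4] add_mono sum_abs)
  also have "\<dots> \<le> (\<Sum>l\<in>(UNIV::3 set). 8^6 * (64^3 * 4 * bump_mass * K) * K / R^5 * mass_U) + (\<Sum>j\<in>(UNIV::3 set). 8^4 * K / R^4 * mass_v)"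
    by (intro add_mono sum_mono partH partw)
  finally show ?thesis by simp
qed

text \<open>Since \<open>g\<close> has mean zero, only the oscillation of the averaged \<open>Q\<close> over the ball is felt.\<close>

lemma top_pairing_le:
  assumes h: "0 < h" and top: "h * 8 ^ N = R"
    and B: "\<And>i x. norm x \<le> 8 * R / 7 \<Longrightarrow> \<bar>partial i (walk h N Q) x\<bar> \<le> B"
  shows "\<bar>pairing h N\<bar> \<le> 4 * R * B * (\<integral>x. \<bar>g x\<bar> \<partial>lborel)"
proof -
  let ?q = "walk h N Q" and ?g = "walk h N g"
  have h0: "0 \<le> h" using h by simp
  have q1: "Ck 1 ?q" by (rule Ck_walk[OF Q1(1)])
  have qd: "?q differentiable (at x)" for x using q1 by simp
  have cq: "continuous_on UNIV ?q" by (rule Ck_continuous[OF q1])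
  have sg: "csupp (R + R / 7) ?g" using csupp_walk[OF g(2) h0, of N] top by simp
  have B0: "0 \<le> B" using B[of 0 1] R by simp
  have osc: "\<bar>?q x - ?q 0\<bar> \<le> 4 * R * B" if x: "norm x \<le> 8 * R / 7" for x
  proof -
    have "\<exists>z. 0 < z \<and> z < 1 \<and> ?q (0 + 1 *\<^sub>R x) - ?q (0 + 0 *\<^sub>R x) = (1 - 0) * (\<Sum>i\<in>UNIV. x $ i * partial i ?q (0 + z *\<^sub>R x))"
      by (rule MVT2[OF zero_less_one]) (rule has_real_derivative_along_line[OF qd])
    then obtain z where z: "0 < z" "z < 1" "?q x - ?q 0 = (\<Sum>i\<in>UNIV. x $ i * partial i ?q (z *\<^sub>R x))" by auto
    have nz: "norm (z *\<^sub>R x) \<le> 8 * R / 7"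
      using z x mult_right_mono[of z 1 "norm x"] by simp
    have "\<bar>?q x - ?q 0\<bar> \<le> (\<Sum>i\<in>UNIV. \<bar>x $ i * partial i ?q (z *\<^sub>R x)\<bar>)" unfolding z(3) by (rule sum_abs)
    also have "\<dots> \<le> (\<Sum>i\<in>(UNIV::3 set). (8 * R / 7) * B)"
    proof (rule sum_mono)
      fix i
      have "\<bar>x $ i\<bar> \<le> 8 * R / 7" using component_le_norm_cart[of x i] x by linarith
      then show "\<bar>x $ i * partial i ?q (z *\<^sub>R x)\<bar> \<le> (8 * R / 7) * B"
        unfolding abs_mult using B[OF nz] B0 R by (intro mult_mono) auto
    qed
    also have "\<dots> = (24 / 7) * (R * B)" by simp
    also have "\<dots> \<le> 4 * R * B" using B0 R by (simp add: mult.assoc)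
    finally show ?thesis .
  qed
  have int: "integrable lborel (\<lambda>x. ?q x * ?g x)" "integrable lborel ?g" "integrable lborel (\<lambda>x. (?q x - ?q 0) * ?g x)"
    by (intro csupp_integrable[OF csupp_mult_left[OF sg]] csupp_integrable[OF sg] cq continuous_intros)+
  have "(\<integral>x. (?q x - ?q 0) * ?g x \<partial>lborel) = pairing h N - ?q 0 * (\<integral>x. ?g x \<partial>lborel)"
    unfolding pairing_def left_diff_distrib using int by simp
  then have "pairing h N = (\<integral>x. (?q x - ?q 0) * ?g x \<partial>lborel)"
    using integral_walk[OF g(2) h0, of N] g(3) by simp
  then have "\<bar>pairing h N\<bar> \<le> (\<integral>x. \<bar>(?q x - ?q 0) * ?g x\<bar> \<partial>lborel)" by (simp only: integral_abs_bound)
  also have "\<dots> \<le> (\<integral>x. (4 * R * B) * walk h N (\<lambda>x. \<bar>g x\<bar>) x \<partial>lborel)"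
  proof (rule integral_mono)
    show "integrable lborel (\<lambda>x. \<bar>(?q x - ?q 0) * ?g x\<bar>)" using int(3) by (rule integrable_abs)
    show "integrable lborel (\<lambda>x. (4 * R * B) * walk h N (\<lambda>x. \<bar>g x\<bar>) x)"
      by (intro integrable_mult_right csupp_integrable[OF csupp_walk[OF csupp_abs[OF g(2)] h0]])
    fix x
    have 1: "\<bar>?g x\<bar> \<le> walk h N (\<lambda>x. \<bar>g x\<bar>) x"
      by (rule abs_walk_le[OF g_continuous continuous_on_rabs[OF g_continuous]]) simp
    show "\<bar>(?q x - ?q 0) * ?g x\<bar> \<le> (4 * R * B) * walk h N (\<lambda>x. \<bar>g x\<bar>) x"
    proof (cases "norm x \<le> 8 * R / 7")
      case True
      then show ?thesis unfolding abs_mult using osc[OF True] 1 R B0 by (intro mult_mono) auto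
    next
      case False
      then have "?g x = 0" by (intro csupp_zero[OF sg]) (use R in auto)
      moreover have "0 \<le> walk h N (\<lambda>x. \<bar>g x\<bar>) x" by (rule walk_nonneg) simp
      ultimately show ?thesis using R B0 by simp
    qed
  qed
  also have "\<dots> = 4 * R * B * (\<integral>x. \<bar>g x\<bar> \<partial>lborel)"
    using integral_walk[OF csupp_abs[OF g(2)] h0, of N] by simp
  finally show ?thesis .
qed

lemma pairing_tendsto: "(\<lambda>N. pairing (R / 8 ^ N) 1) \<longlonglongrightarrow> (\<integral>x. Q x * g x \<partial>lborel)"
proof -
  \<comment> \<open>clamping the scale keeps the supports in a fixed ball for all values of the parameter\<close>
  define cl where "cl h = max 0 (min R h)" for h :: real
  have ccl: "continuous_on UNIV cl" unfolding cl_def by (intro continuous_intros)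
  have cl01: "0 \<le> cl h" "cl h \<le> R" for h using R by (auto simp: cl_def)
  define p where "p h = (\<integral>x. avg bump (cl h) Q x * avg bump (cl h) g x \<partial>lborel)" for h
  have "continuous_on UNIV p"
    unfolding p_def
  proof (rule continuous_integral_param)
    have "continuous_on UNIV (\<lambda>q::real \<times> (real^3). (cl (fst q), snd q))"
      by (intro continuous_intros continuous_on_compose_UNIV[OF ccl])
    from continuous_on_compose_UNIV[OF avg_jointly_continuous[OF bump_csupp Q1(2)] this]
      continuous_on_compose_UNIV[OF avg_jointly_continuous[OF bump_csupp g_continuous] this]
    show "continuous_on UNIV (\<lambda>(h, x). avg bump (cl h) Q x * avg bump (cl h) g x)"
      unfolding split_beta by (intro continuous_on_mult) simp_all
    show "avg bump (cl h) Q x * avg bump (cl h) g x = 0" if "2 * R < norm x" for h x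
    proof -
      have "csupp (2 * R) (avg bump (cl h) g)"
        by (rule csupp_mono[OF csupp_avg_bump[OF g(2) cl01(1)]]) (use cl01(2)[of h] in simp)
      from csupp_zero[OF this that] show ?thesis by simp
    qed
  qed
  then have "isCont p 0" by (simp add: continuous_on_eq_continuous_at)
  moreover have "(\<lambda>N. R / 8 ^ N) \<longlonglongrightarrow> 0"
    using tendsto_mult_right_zero[OF LIMSEQ_power_zero[of "1/8 :: real"], of R] by (simp add: power_divide)
  ultimately have "(\<lambda>N. p (R / 8 ^ N)) \<longlonglongrightarrow> p 0" by (rule isCont_tendsto_compose)
  moreover have "p (R / 8 ^ N) = pairing (R / 8 ^ N) 1" for N
  proof -
    have "R / 8 ^ N \<le> R" using R one_le_power[of "8::real" N] by (simp add: divide_le_eq)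
    then have "cl (R / 8 ^ N) = R / 8 ^ N" using R by (simp add: cl_def)
    then show ?thesis by (simp add: p_def pairing_def)
  qed
  moreover have "p 0 = (\<integral>x. Q x * g x \<partial>lborel)"
    using R by (simp add: p_def cl_def avg_zero_scale bump_integral)
  ultimately show ?thesis by simp
qed

text \<open>The bounds do not depend on the number of scales; as it grows, the bottom scale tends to zero.\<close>

lemma pairing_limit_le:
  assumes C: "bilinear_const C" "0 < C" and K: "\<And>i y. \<bar>partial i bump y\<bar> \<le> K"
  shows "\<bar>\<integral>x. Q x * g x \<partial>lborel\<bar> \<le> 3456 * C * total +
     4 * R * (3 * (8^6 * (64^3 * 4 * bump_mass * K) * K / R^5 * mass_U) + 3 * (8^4 * K / R^4 * mass_v))
       * (\<integral>x. \<bar>g x\<bar> \<partial>lborel)"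
    (is "_ \<le> ?bound")
proof (rule LIMSEQ_le_const2[OF tendsto_rabs[OF pairing_tendsto]], intro exI allI impI)
  fix N :: nat assume "2 \<le> N"
  then obtain n where N: "N = Suc (Suc n)" by (metis Suc_le_D numeral_2_eq_2 Suc_le_mono)
  let ?h = "R / 8 ^ N"
  have h: "0 < ?h" "?h * 8 ^ N = R" using R by simp_all
  have "\<bar>pairing ?h 1 - pairing ?h (Suc (Suc n))\<bar> \<le> 3456 * C * total"
    by (rule pairing_telescope[OF C h(1)]) (use h(2) N in simp)
  moreover have "\<bar>pairing ?h N\<bar> \<le> 4 * R * (3 * (8^6 * (64^3 * 4 * bump_mass * K) * K / R^5 * mass_U) + 3 * (8^4 * K / R^4 * mass_v))
       * (\<integral>x. \<bar>g x\<bar> \<partial>lborel)"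
    using h by (intro top_pairing_le) (auto simp only: N intro!: averaged_gradient_le K)
  ultimately show "\<bar>pairing ?h 1\<bar> \<le> ?bound" unfolding N by linarith
qed

end

text \<open>Local and scale invariant substitute for the boundedness of second order Riesz transforms. Replacing \<open>g\<close> by a
  multiple of \<open>g\<close> balances the two sides of the Bellman function, which is not homogeneous.\<close>

theorem pressure_estimate:
  "\<exists>C>0. \<forall>Q v U g w H R. pressure_data Q v U g w H R \<longrightarrow>
    \<bar>\<integral>x. Q x * g x \<partial>lborel\<bar> \<le> C * (\<integral>x. bellman (g x) (2 * (cutoff R x * v x)) \<partial>lborel) +
      C * ((\<integral>x. cutoff R x * U x \<partial>lborel) / R^4 + (\<integral>x. cutoff R x * v x \<partial>lborel) / R^3) * (\<integral>x. \<bar>g x\<bar> \<partial>lborel)"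
proof -
  obtain C where C: "0 < C" "bilinear_const C" using bilinear_const_exists by blast
  obtain K where K: "0 < K" "\<And>i y. \<bar>partial i bump y\<bar> \<le> K" using kernel_bound by metis
  define A where "A = 12 * (8^6 * (64^3 * 4 * bump_mass * K) * K)"
  define B where "B = 12 * (8^4 * K)"
  have AB: "0 < A" "0 < B" using K(1) bump_mass_pos by (simp_all add: A_def B_def)
  show ?thesis
  proof (intro exI conjI allI impI)
    show "0 < 3456 * C + A + B" using C(1) AB by simp
    fix Q v U g :: "real^3 \<Rightarrow> real" and w :: "3 \<Rightarrow> real^3 \<Rightarrow> real" and H :: "3 \<Rightarrow> 3 \<Rightarrow> real^3 \<Rightarrow> real" and R
    assume "pressure_data Q v U g w H R"
    then interpret pressure_data Q v U g w H R .
    have T: "0 \<le> total" unfolding total_def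
      by (intro Bochner_Integration.integral_nonneg bellman_nonneg) (simp add: pieces_nonneg)
    have U0: "0 \<le> U x" for x using w_le[of 1 x] by linarith
    have m: "0 \<le> mass_U" "0 \<le> mass_v" unfolding mass_U_def mass_v_def
      by (intro Bochner_Integration.integral_nonneg; simp add: pieces_nonneg cutoff_bounds U0)+
    have G: "0 \<le> (\<integral>x. \<bar>g x\<bar> \<partial>lborel)" by (intro Bochner_Integration.integral_nonneg) simp
    have "\<bar>\<integral>x. Q x * g x \<partial>lborel\<bar> \<le> 3456 * C * total + (A * (mass_U / R^4) + B * (mass_v / R^3)) * (\<integral>x. \<bar>g x\<bar> \<partial>lborel)"
    proof -
      have "4 * R * (3 * (8^6 * (64^3 * 4 * bump_mass * K) * K / R^5 * mass_U) + 3 * (8^4 * K / R^4 * mass_v))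
        = A * (mass_U / R^4) + B * (mass_v / R^3)"
        unfolding A_def B_def using R by (simp add: field_simps eval_nat_numeral)
      then show ?thesis using pairing_limit_le[OF C(2,1) K(2)] by simp
    qed
    also have "\<dots> \<le> (3456 * C + A + B) * total + ((3456 * C + A + B) * (mass_U / R^4) + (3456 * C + A + B) * (mass_v / R^3)) * (\<integral>x. \<bar>g x\<bar> \<partial>lborel)"
      using C(1) AB R m by (intro add_mono mult_right_mono T G) auto
    finally show "\<bar>\<integral>x. Q x * g x \<partial>lborel\<bar> \<le> (3456 * C + A + B) * (\<integral>x. bellman (g x) (2 * (cutoff R x * v x)) \<partial>lborel) +
      (3456 * C + A + B) * ((\<integral>x. cutoff R x * U x \<partial>lborel) / R^4 + (\<integral>x. cutoff R x * v x \<partial>lborel) / R^3) * (\<integral>x. \<bar>g x\<bar> \<partial>lborel)"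
      unfolding total_def mass_U_def mass_v_def base_def by (simp only: distrib_left)
  qed
qed

section \<open>Local fourth power integrability\<close>

lemma square_integral_le:
  fixes f :: "real \<Rightarrow> real"
  assumes "continuous_on {0..1} f"
  shows "(integral {0..1} f)\<^sup>2 \<le> integral {0..1} (\<lambda>t. (f t)\<^sup>2)"
proof -
  define m where "m = integral {0..1} f"
  have i: "f integrable_on {0..1}" "(\<lambda>t. (f t)\<^sup>2) integrable_on {0..1}"
    using assms by (auto intro!: integrable_continuous_real continuous_intros)
  have "0 \<le> integral {0..1} (\<lambda>t. (f t - m)\<^sup>2)"
    using assms by (intro integral_nonneg integrable_continuous_real continuous_intros) auto
  also have "(\<lambda>t. (f t - m)\<^sup>2) = (\<lambda>t. ((f t)\<^sup>2 - (2 * m) * f t) + m\<^sup>2)"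
    by (rule ext) (simp add: power2_eq_square algebra_simps)
  also have "integral {0..1} \<dots> = integral {0..1} (\<lambda>t. (f t)\<^sup>2) - (2 * m) * m + m\<^sup>2"
  proof (rule integral_unique)
    have c: "((\<lambda>t. m\<^sup>2) has_integral m\<^sup>2) {0..1::real}" using has_integral_const_real[of "m\<^sup>2" 0 1] by simp
    have "(f has_integral m) {0..1}" unfolding m_def by (rule integrable_integral[OF i(1)])
    then show "((\<lambda>t. ((f t)\<^sup>2 - (2 * m) * f t) + m\<^sup>2) has_integral
        integral {0..1} (\<lambda>t. (f t)\<^sup>2) - (2 * m) * m + m\<^sup>2) {0..1}"
      by (intro has_integral_add has_integral_diff has_integral_mult_right integrable_integral i c)
  qed
  finally show ?thesis by (simp add: m_def power2_eq_square)
qed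

lemma fourth_power_integral_le:
  fixes f :: "real \<Rightarrow> real"
  assumes "continuous_on {0..1} f"
  shows "(integral {0..1} f) ^ 4 \<le> integral {0..1} (\<lambda>t. (f t) ^ 4)"
proof -
  have p4: "(a\<^sup>2)\<^sup>2 = a ^ 4" for a :: real by simp
  have "(integral {0..1} f) ^ 4 = ((integral {0..1} f)\<^sup>2)\<^sup>2" by simp
  also have "\<dots> \<le> (integral {0..1} (\<lambda>t. (f t)\<^sup>2))\<^sup>2"
    by (rule power_mono[OF square_integral_le[OF assms]]) simp
  also have "\<dots> \<le> integral {0..1} (\<lambda>t. ((f t)\<^sup>2)\<^sup>2)"
    using assms by (intro square_integral_le continuous_intros)
  finally show ?thesis by (simp only: p4)
qed

definition grad_sq :: "(real^3 \<Rightarrow> real) \<Rightarrow> real^3 \<Rightarrow> real"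
  where "grad_sq f x = (\<Sum>i\<in>UNIV. (partial i f x)\<^sup>2)"

lemma continuous_grad_sq: "Ck 1 f \<Longrightarrow> continuous_on UNIV (grad_sq f)"
  unfolding grad_sq_def by (auto intro!: continuous_intros)

lemma csupp_cutoff: "0 < R \<Longrightarrow> csupp (4 * R) (cutoff R)"
  using csupp_cutoff_mult[of R "\<lambda>_. 1"] by simp

lemma continuous_cutoff: "0 < R \<Longrightarrow> continuous_on UNIV (cutoff R)"
  by (rule csupp_continuous[OF csupp_cutoff])

text \<open>Along the curve \<open>t \<mapsto> x + t\<^sup>4 y\<close> the fourth power of the speed exactly compensates the
  concentration of the averages of the gradient at small scales, so that no singular integral appears.\<close>

lemma oscillation_fourth_power:
  fixes f :: "real^3 \<Rightarrow> real"
  assumes f: "Ck 1 f" and int: "integrable lborel (grad_sq f)" and K: "\<And>y. bump y \<le> K" and R: "0 < R"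
  shows "(\<integral>x. cutoff R x * (avg bump 1 f x - f x) ^ 4 \<partial>lborel) \<le> 2304 * K * (\<integral>x. grad_sq f x \<partial>lborel)\<^sup>2"
proof -
  define k where "k x = (\<Sum>i\<in>UNIV. \<bar>partial i f x\<bar>)" for x
  define k2 where "k2 x = 3 * grad_sq f x" for x
  define N where "N = (\<integral>x. k2 x \<partial>lborel)"
  have cp: "continuous_on UNIV (partial i f)" for i using f by simp
  have ck: "continuous_on UNIV k" unfolding k_def by (intro continuous_intros cp)
  have ck2: "continuous_on UNIV k2" unfolding k2_def by (intro continuous_intros continuous_grad_sq f)
  have k0: "0 \<le> k x" and k20: "0 \<le> k2 x" for x by (simp_all add: k_def k2_def grad_sq_def sum_nonneg)
  have kk2: "(k x)\<^sup>2 \<le> k2 x" for x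
  proof -
    have "(a + b + c)\<^sup>2 \<le> 3 * (a\<^sup>2 + b\<^sup>2 + c\<^sup>2)" for a b c :: real
      using zero_le_power2[of "a - b"] zero_le_power2[of "b - c"] zero_le_power2[of "a - c"]
      by (simp add: power2_eq_square algebra_simps)
    from this[of "\<bar>partial 1 f x\<bar>" "\<bar>partial 2 f x\<bar>" "\<bar>partial 3 f x\<bar>"]
    show ?thesis by (simp add: k_def k2_def grad_sq_def sum_3)
  qed
  have K0: "0 \<le> K" using K[of 0] bump_nonneg[of 0] by linarith
  have ik2: "integrable lborel k2" unfolding k2_def using int by simp
  have N0: "0 \<le> N" unfolding N_def by (intro Bochner_Integration.integral_nonneg k20)
  have sup: "avg bump s k2 x \<le> K / s^3 * N" if s: "0 < s" for s x
  proof -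
    define r where "r = norm x + s + 1"
    have r: "0 < r" using s norm_ge_zero[of x] unfolding r_def by linarith
    have cs: "csupp (4 * r) (\<lambda>x. cutoff r x * k2 x)" by (rule csupp_cutoff_mult[OF r ck2])
    have "avg bump s k2 x = avg bump s (\<lambda>x. cutoff r x * k2 x) x"
    proof (rule avg_cong_ball[OF bump_csupp, of s "norm x"])
      fix y :: "real^3" assume "norm y \<le> norm x + s * 1"
      moreover have "b \<le> 2 * (a + s + 1)" if "b \<le> a + s * 1" "0 \<le> a" for a b :: real using that s by simp
      ultimately have "norm y \<le> 2 * r" unfolding r_def by simp
      then show "k2 y = cutoff r y * k2 y" by (simp add: cutoff_inside[OF r])
    qed (use s in auto)
    also have "\<dots> \<le> K / s^3 * (\<integral>x. cutoff r x * k2 x \<partial>lborel)"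
      by (rule avg_le_integral[OF bump_csupp K cs _ s]) (simp add: cutoff_bounds k20)
    also have "\<dots> \<le> K / s^3 * N"
    proof (rule mult_left_mono)
      show "(\<integral>x. cutoff r x * k2 x \<partial>lborel) \<le> N" unfolding N_def
      proof (rule integral_mono[OF csupp_integrable[OF cs] ik2])
        show "cutoff r x * k2 x \<le> k2 x" for x using cutoff_bounds[of r x] k20[of x] by (simp add: mult_left_le_one_le)
      qed
    qed (use K0 s in simp)
    finally show ?thesis .
  qed
  have sq: "(avg bump s k x)\<^sup>2 \<le> avg bump s k2 x" for s x
  proof -
    interpret averaging "\<lambda>f. avg bump s f x" by (rule averaging_avg_bump)
    have "(avg bump s (\<lambda>x. k x * 1) x)\<^sup>2 \<le> avg bump s (\<lambda>x. (k x)\<^sup>2) x * avg bump s (\<lambda>x. 1\<^sup>2) x"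
      by (rule E_Cauchy_Schwarz) (auto intro!: continuous_intros ck)
    also have "\<dots> = avg bump s (\<lambda>x. (k x)\<^sup>2) x" using E_one by simp
    also have "\<dots> \<le> avg bump s k2 x" by (rule E_mono) (auto intro!: continuous_intros ck ck2 kk2)
    finally show ?thesis by simp
  qed
  \<comment> \<open>\<open>4 t\<^sup>3\<close> is the speed of the curve; its fourth power \<open>256 t\<^sup>1\<^sup>2\<close> cancels the factor \<open>(t\<^sup>4)\<^sup>3\<close> in the bound \<open>sup\<close>\<close>
  define \<phi> where "\<phi> x t = 4 * t^3 * avg bump (t^4) k x" for x and t :: real
  have cav: "continuous_on UNIV (\<lambda>t. avg bump (t^4) F x)" if "continuous_on UNIV F" for F x
    by (rule continuous_on_compose_UNIV[OF continuous_avg_scale[OF bump_csupp that]]) (intro continuous_intros)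
  have c\<phi>: "continuous_on UNIV (\<phi> x)" for x unfolding \<phi>_def by (intro continuous_intros cav ck)
  have diff: "\<bar>avg bump 1 f x - f x\<bar> \<le> integral {0..1} (\<phi> x)" for x
  proof -
    let ?D = "\<lambda>t. (\<Sum>i\<in>UNIV. avg (\<lambda>y. y $ i * bump y) (t^4) (partial i f) x) * (4 * t^3)"
    have csi: "csupp 1 (\<lambda>y. y $ i * bump y)" for i
      by (rule csupp_mult_left[OF bump_csupp]) (intro continuous_intros)
    have d: "((\<lambda>t. avg bump (t^4) f x) has_real_derivative ?D t) (at t)" for t
    proof (rule DERIV_chain2[OF DERIV_avg[OF bump_csupp f]])
      show "((\<lambda>t::real. t^4) has_real_derivative 4 * t^3) (at t)" using DERIV_pow[of 4 t] by simp
    qed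
    have hi: "(?D has_integral (avg bump (1^4) f x - avg bump (0^4) f x)) {0..1}"
      by (rule fundamental_theorem_of_calculus)
        (use d in \<open>auto simp: has_real_derivative_iff_has_vector_derivative intro: has_vector_derivative_at_within\<close>)
    have "norm (integral {0..1} ?D) \<le> integral {0..1} (\<phi> x)"
    proof (rule integral_norm_bound_integral)
      show "?D integrable_on {0..1}" using hi by blast
      show "\<phi> x integrable_on {0..1}" by (intro integrable_continuous_real continuous_on_subset[OF c\<phi>]) simp
      fix t :: real assume t: "t \<in> {0..1}"
      have "\<bar>avg (\<lambda>y. y $ i * bump y) (t^4) (partial i f) x\<bar> \<le> avg bump (t^4) (\<lambda>x. \<bar>partial i f x\<bar>) x" for i
      proof -
        have "\<bar>avg (\<lambda>y. y $ i * bump y) (t^4) (partial i f) x\<bar> \<le> avg (\<lambda>y. \<bar>y $ i * bump y\<bar>) (t^4) (\<lambda>x. \<bar>partial i f x\<bar>) x"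
          by (rule abs_avg_le)
        also have "\<dots> \<le> avg bump (t^4) (\<lambda>x. \<bar>partial i f x\<bar>) x"
        proof (rule avg_kernel_mono[OF csupp_abs[OF csi] bump_csupp _ continuous_on_rabs[OF cp]])
          show "\<bar>y $ i * bump y\<bar> \<le> bump y" for y
          proof (cases "norm y \<le> 1")
            case True
            then have "\<bar>y $ i\<bar> \<le> 1" using component_le_norm_cart[of y i] by linarith
            then show ?thesis using bump_nonneg[of y] by (simp add: abs_mult mult_left_le_one_le)
          qed (use csupp_zero[OF bump_csupp] in auto)
        qed simp
        finally show ?thesis .
      qed
      then have "\<bar>\<Sum>i\<in>UNIV. avg (\<lambda>y. y $ i * bump y) (t^4) (partial i f) x\<bar> \<le> (\<Sum>i\<in>UNIV. avg bump (t^4) (\<lambda>x. \<bar>partial i f x\<bar>) x)"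
        by (intro order_trans[OF sum_abs] sum_mono)
      also have "\<dots> = avg bump (t^4) k x" unfolding k_def
        by (rule avg_sum[OF bump_csupp, symmetric]) (intro continuous_on_rabs cp)
      finally show "norm (?D t) \<le> \<phi> x t"
        using t unfolding \<phi>_def by (simp add: abs_mult mult.commute mult_left_mono)
    qed
    then show ?thesis using integral_unique[OF hi] by (simp add: avg_zero_scale bump_integral)
  qed
  have point: "(avg bump 1 f x - f x) ^ 4 \<le> 256 * K * N * integral {0..1} (\<lambda>t. avg bump (t^4) k2 x)" for x
  proof -
    have "(avg bump 1 f x - f x) ^ 4 = \<bar>avg bump 1 f x - f x\<bar> ^ 4" by simp
    also have "\<dots> \<le> (integral {0..1} (\<phi> x)) ^ 4" by (rule power_mono[OF diff]) simp
    also have "\<dots> \<le> integral {0..1} (\<lambda>t. (\<phi> x t) ^ 4)"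
      by (rule fourth_power_integral_le) (rule continuous_on_subset[OF c\<phi>], simp)
    also have "\<dots> \<le> integral {0..1} (\<lambda>t. 256 * K * N * avg bump (t^4) k2 x)"
    proof (rule integral_le)
      show "(\<lambda>t. (\<phi> x t) ^ 4) integrable_on {0..1}"
        by (intro integrable_continuous_real continuous_intros continuous_on_subset[OF c\<phi>]) simp
      show "(\<lambda>t. 256 * K * N * avg bump (t^4) k2 x) integrable_on {0..1}"
        by (intro integrable_continuous_real continuous_intros continuous_on_subset[OF cav[OF ck2]]) simp
      fix t :: real assume t: "t \<in> {0..1}"
      let ?a = "avg bump (t^4) k2 x"
      have a0: "0 \<le> ?a" by (intro avg_nonneg bump_nonneg k20)
      have ta: "t^12 * ?a \<le> K * N"
      proof (cases "t = 0")
        case False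
        then have "0 < t^4" using t by simp
        from sup[OF this, of x] have "?a \<le> K / (t^4)^3 * N" .
        also have "(t^4)^3 = t^12" by simp
        finally have "t^12 * ?a \<le> t^12 * (K / t^12 * N)" using t by (intro mult_left_mono) auto
        then show ?thesis using False by simp
      qed (use K0 N0 in simp)
      have "(\<phi> x t) ^ 4 = 256 * (t^12 * ((avg bump (t^4) k x)\<^sup>2)\<^sup>2)"
        unfolding \<phi>_def by (simp add: power_mult_distrib flip: power_mult)
      also have "\<dots> \<le> 256 * (t^12 * ?a\<^sup>2)"
        using t sq[of "t^4" x] by (intro mult_left_mono power_mono) auto
      also have "\<dots> = 256 * ((t^12 * ?a) * ?a)" by (simp add: power2_eq_square)
      also have "\<dots> \<le> 256 * ((K * N) * ?a)" using ta a0 by (intro mult_left_mono mult_right_mono) auto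
      finally show "(\<phi> x t) ^ 4 \<le> 256 * K * N * ?a" by simp
    qed
    finally show ?thesis by simp
  qed
  have cj: "continuous_on UNIV (\<lambda>(t, x). cutoff R x * avg bump (t^4) k2 x)"
  proof -
    have "continuous_on UNIV (\<lambda>p::real \<times> (real^3). (fst p ^ 4, snd p))" by (intro continuous_intros)
    from continuous_on_compose_UNIV[OF avg_jointly_continuous[OF bump_csupp ck2] this]
    have "continuous_on UNIV (\<lambda>p. avg bump (fst p ^ 4) k2 (snd p))" by simp
    then show ?thesis unfolding split_beta
      by (intro continuous_intros continuous_on_compose_UNIV[OF continuous_cutoff[OF R]])
  qed
  have cz: "cutoff R x * avg bump (t^4) k2 x = 0" if "4 * R < norm x" for t x
    using csupp_zero[OF csupp_cutoff[OF R] that] by simp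
  have inner: "(\<integral>x. cutoff R x * avg bump s k2 x \<partial>lborel) \<le> N" for s
  proof -
    have "(\<integral>x. cutoff R x * avg bump s k2 x \<partial>lborel) = (\<integral>x. k2 x * avg bump s (cutoff R) x \<partial>lborel)"
      using integral_avg_mult[OF bump_csupp bump_even ck2 csupp_cutoff[OF R]] by (simp add: mult.commute)
    also have "\<dots> \<le> N" unfolding N_def
    proof (rule integral_mono'[OF ik2 _ k20])
      fix x
      have "avg bump s (cutoff R) x \<le> avg bump s (\<lambda>_. 1) x"
        by (rule avg_mono[OF bump_csupp bump_nonneg continuous_cutoff[OF R]]) (auto simp: cutoff_bounds)
      then have "avg bump s (cutoff R) x \<le> 1" by (simp add: avg_const bump_integral)
      then show "k2 x * avg bump s (cutoff R) x \<le> k2 x" using k20[of x] by (simp add: mult_left_le)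
    qed
    finally show ?thesis .
  qed
  have cI: "continuous_on UNIV (\<lambda>x. integral {0..1} (\<lambda>t. avg bump (t^4) k2 x))"
  proof -
    have "continuous_on UNIV (\<lambda>p::(real^3) \<times> real. (snd p ^ 4, fst p))" by (intro continuous_intros)
    from continuous_on_compose_UNIV[OF avg_jointly_continuous[OF bump_csupp ck2] this]
    have "continuous_on UNIV (\<lambda>(x, t). avg bump (t ^ 4) k2 x)" by (simp add: split_beta)
    then have "continuous_on UNIV (\<lambda>x. integral (cbox 0 1) (\<lambda>t. avg bump (t^4) k2 x))"
      by (intro integral_continuous_on_param[where f = "\<lambda>x t. avg bump (t^4) k2 x"]) (rule continuous_on_subset, auto)
    then show ?thesis by simp
  qed
  have "(\<integral>x. cutoff R x * (avg bump 1 f x - f x) ^ 4 \<partial>lborel)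
      \<le> (\<integral>x. (256 * K * N) * (cutoff R x * integral {0..1} (\<lambda>t. avg bump (t^4) k2 x)) \<partial>lborel)"
  proof (rule integral_mono)
    show "integrable lborel (\<lambda>x. cutoff R x * (avg bump 1 f x - f x) ^ 4)"
      by (intro csupp_integrable[OF csupp_mult_right[OF csupp_cutoff[OF R]]] continuous_intros continuous_avg_bump Ck_continuous[OF f])
    show "integrable lborel (\<lambda>x. (256 * K * N) * (cutoff R x * integral {0..1} (\<lambda>t. avg bump (t^4) k2 x)))"
      by (intro integrable_mult_right csupp_integrable[OF csupp_mult_right[OF csupp_cutoff[OF R]]] cI)
    show "cutoff R x * (avg bump 1 f x - f x) ^ 4 \<le> (256 * K * N) * (cutoff R x * integral {0..1} (\<lambda>t. avg bump (t^4) k2 x))" for x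
      using mult_left_mono[OF point[of x] cutoff_bounds(1)[of R x]] by (simp add: mult_ac)
  qed
  also have "\<dots> = (256 * K * N) * (\<integral>x. integral {0..1} (\<lambda>t. cutoff R x * avg bump (t^4) k2 x) \<partial>lborel)"
    by (simp only: integral_mult_right integral_mult_right_zero)
  also have "(\<integral>x. integral {0..1} (\<lambda>t. cutoff R x * avg bump (t^4) k2 x) \<partial>lborel) =
      integral {0..1} (\<lambda>t. \<integral>x. cutoff R x * avg bump (t^4) k2 x \<partial>lborel)"
    by (rule integral_swap_csupp[OF cj cz])
  also have "\<dots> \<le> integral {0..1} (\<lambda>t::real. N)"
  proof (rule integral_le)
    have "continuous_on UNIV (\<lambda>t. \<integral>x. cutoff R x * avg bump (t^4) k2 x \<partial>lborel)"
      by (rule continuous_integral_param[OF cj cz])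
    then show "(\<lambda>t. \<integral>x. cutoff R x * avg bump (t^4) k2 x \<partial>lborel) integrable_on {0..1}"
      by (intro integrable_continuous_real) (rule continuous_on_subset, auto)
  qed (use inner in auto)
  finally have "(\<integral>x. cutoff R x * (avg bump 1 f x - f x) ^ 4 \<partial>lborel) \<le> (256 * K * N) * N"
    using K0 N0 by (simp add: mult_left_mono)
  then show ?thesis unfolding N_def k2_def by (simp add: power2_eq_square)
qed

text \<open>The oscillation at scale one is bounded by the gradient alone; the average at scale one is bounded pointwise and in
  \<open>L\<^sup>3\<close> by the growth of cubes.\<close>

lemma fourth_power_growth:
  fixes f :: "real^3 \<Rightarrow> real"
  assumes f: "Ck 1 f" and int: "integrable lborel (grad_sq f)"
    and S: "\<And>R. 1 \<le> R \<Longrightarrow> (\<integral>x. cutoff R x * \<bar>f x\<bar>^3 \<partial>lborel) \<le> S * R"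
  shows "\<exists>C\<ge>0. \<forall>R\<ge>1. (\<integral>x. cutoff R x * (f x)^4 \<partial>lborel) \<le> C * R\<^sup>2"
proof -
  obtain K where K: "0 < K" "\<And>y. bump y \<le> K" using kernel_bound by metis
  define N where "N = (\<integral>x. grad_sq f x \<partial>lborel)"
  have cf: "continuous_on UNIV f" by (rule Ck_continuous[OF f])
  have S0: "0 \<le> S"
  proof -
    have "0 \<le> (\<integral>x. cutoff 1 x * \<bar>f x\<bar>^3 \<partial>lborel)"
      by (intro Bochner_Integration.integral_nonneg) (simp add: cutoff_bounds)
    then show ?thesis using S[of 1] by simp
  qed
  define C where "C = 8 * (2304 * K * N\<^sup>2) + 8 * ((1 + 4 * K * S) * (4 * S))"
  have C0: "0 \<le> C" unfolding C_def using K(1) S0 by (intro add_nonneg_nonneg mult_nonneg_nonneg) auto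
  have main: "(\<integral>x. cutoff R x * (f x)^4 \<partial>lborel) \<le> C * R\<^sup>2" if R: "1 \<le> R" for R
  proof -
    have R0: "0 < R" "0 < 4 * R" using R by auto
    let ?a = "avg bump 1 f" and ?g = "\<lambda>x. cutoff (4 * R) x * \<bar>f x\<bar>^3"
    have c3: "continuous_on UNIV (\<lambda>x. \<bar>f x\<bar>^3)" by (intro continuous_intros cf)
    have sg: "csupp (4 * (4 * R)) ?g" by (rule csupp_cutoff_mult[OF R0(2) c3])
    have sG: "csupp (4 * (4 * R) + 1) (avg bump 1 ?g)" using csupp_avg_bump[OF sg, of 1] by simp
    have ca: "continuous_on UNIV ?a" by (rule continuous_avg_bump[OF cf])
    have g0: "0 \<le> ?g x" for x by (simp add: cutoff_bounds)
    have IS: "(\<integral>x. ?g x \<partial>lborel) \<le> 4 * S * R" using S[of "4 * R"] R by simp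
    have cube: "\<bar>?a x\<bar>^3 \<le> avg bump 1 (\<lambda>x. \<bar>f x\<bar>^3) x" for x
    proof -
      interpret averaging "\<lambda>f. avg bump 1 f x" by (rule averaging_avg_bump)
      define m where "m = avg bump 1 (\<lambda>x. \<bar>f x\<bar>) x"
      have m0: "0 \<le> m" unfolding m_def by (intro avg_nonneg bump_nonneg) simp
      have tangent: "m^3 + 3 * m\<^sup>2 * (b - m) \<le> b^3" if "0 \<le> b" for b
      proof -
        have "0 \<le> (b - m)\<^sup>2 * (b + 2 * m)" using m0 that by simp
        then show ?thesis by (simp add: power2_eq_square power3_eq_cube algebra_simps)
      qed
      have "m^3 = avg bump 1 (\<lambda>x. m^3 + (3 * m\<^sup>2) * (\<bar>f x\<bar> - m)) x"
      proof -
        have "avg bump 1 (\<lambda>x. m^3 + (3 * m\<^sup>2) * (\<bar>f x\<bar> - m)) x = m^3 + (3 * m\<^sup>2) * (avg bump 1 (\<lambda>x. \<bar>f x\<bar>) x - m)"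
          by (simp only: E_add E_cmult E_diff E_const continuous_intros cf)
        then show ?thesis by (simp add: m_def)
      qed
      also have "\<dots> \<le> avg bump 1 (\<lambda>x. \<bar>f x\<bar>^3) x"
        by (rule E_mono) (use tangent in \<open>auto intro!: continuous_intros cf\<close>)
      finally have "m^3 \<le> avg bump 1 (\<lambda>x. \<bar>f x\<bar>^3) x" .
      moreover have "\<bar>?a x\<bar> \<le> m"
        using abs_avg_le[of bump 1 f x] bump_nonneg unfolding m_def by simp
      ultimately show ?thesis using power_mono[of "\<bar>?a x\<bar>" m 3] by linarith
    qed
    have a4: "cutoff R x * (?a x)^4 \<le> (1 + 4 * K * S * R) * avg bump 1 ?g x" for x
    proof (cases "norm x \<le> 4 * R")
      case True
      have eq: "avg bump 1 (\<lambda>x. \<bar>f x\<bar>^3) x = avg bump 1 ?g x"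
      proof (rule avg_cong_ball[OF bump_csupp _ _ True])
        fix y :: "real^3" assume "norm y \<le> 4 * R + 1 * 1"
        then have "norm y \<le> 2 * (4 * R)" using R by linarith
        then show "\<bar>f y\<bar>^3 = ?g y" by (simp add: cutoff_inside[OF R0(2)])
      qed simp
      have le: "avg bump 1 ?g x \<le> 4 * K * S * R"
      proof -
        have "avg bump 1 ?g x \<le> K / 1^3 * (\<integral>x. ?g x \<partial>lborel)"
          by (rule avg_le_integral[OF bump_csupp K(2) sg g0]) simp
        also have "\<dots> \<le> K * (4 * S * R)" using K(1) IS by simp
        finally show ?thesis by simp
      qed
      define b where "b = \<bar>?a x\<bar>"
      have b: "0 \<le> b" "b^3 \<le> avg bump 1 ?g x" using cube[of x] eq by (simp_all add: b_def)
      have "b \<le> 1 + b^3"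
      proof (cases "b \<le> 1")
        case False
        then have "b * 1 \<le> b * b\<^sup>2" by (intro mult_left_mono) (auto simp: one_le_power)
        then show ?thesis by (simp add: power2_eq_square power3_eq_cube)
      qed (use b(1) in \<open>simp add: add_increasing2\<close>)
      then have b1: "b \<le> 1 + 4 * K * S * R" using b(2) le by linarith
      have "cutoff R x * (?a x)^4 \<le> (?a x)^4" using cutoff_bounds[of R x] by (simp add: mult_left_le_one_le)
      also have "(?a x)^4 = \<bar>?a x\<bar>^4" by simp
      also have "\<bar>?a x\<bar>^4 = b * b^3" unfolding b_def by (simp add: eval_nat_numeral)
      also have "\<dots> \<le> (1 + 4 * K * S * R) * avg bump 1 ?g x"
        using b b1 by (intro mult_mono) auto
      finally show ?thesis .
    next
      case False
      have "0 \<le> (1 + 4 * K * S * R) * avg bump 1 ?g x"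
        using K(1) S0 R by (intro mult_nonneg_nonneg add_nonneg_nonneg avg_nonneg bump_nonneg g0) auto
      then show ?thesis using False csupp_zero[OF csupp_cutoff[OF R0(1)], of x] by simp
    qed
    have i1: "integrable lborel (\<lambda>x. cutoff R x * (?a x - f x)^4)"
      and i2: "integrable lborel (\<lambda>x. cutoff R x * (?a x)^4)"
      and i3: "integrable lborel (\<lambda>x. cutoff R x * (f x)^4)"
      by (intro csupp_integrable[OF csupp_mult_right[OF csupp_cutoff[OF R0(1)]]] continuous_intros ca cf)+
    have I2: "(\<integral>x. cutoff R x * (?a x)^4 \<partial>lborel) \<le> ((1 + 4 * K * S) * (4 * S)) * R\<^sup>2"
    proof -
      have "(\<integral>x. cutoff R x * (?a x)^4 \<partial>lborel) \<le> (\<integral>x. (1 + 4 * K * S * R) * avg bump 1 ?g x \<partial>lborel)"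
        by (rule integral_mono[OF i2 _ a4]) (intro integrable_mult_right csupp_integrable[OF sG])
      also have "\<dots> = (1 + 4 * K * S * R) * (\<integral>x. ?g x \<partial>lborel)"
        using integral_avg_bump[OF sg, of 1] by simp
      also have "\<dots> \<le> ((1 + 4 * K * S) * R) * (4 * S * R)"
        using IS K(1) S0 R by (intro mult_mono Bochner_Integration.integral_nonneg g0) (auto simp: algebra_simps)
      finally show ?thesis by (simp add: power2_eq_square mult_ac)
    qed
    have "(\<integral>x. cutoff R x * (f x)^4 \<partial>lborel) \<le> (\<integral>x. 8 * (cutoff R x * (?a x - f x)^4) + 8 * (cutoff R x * (?a x)^4) \<partial>lborel)"
    proof (rule integral_mono[OF i3])
      show "integrable lborel (\<lambda>x. 8 * (cutoff R x * (?a x - f x)^4) + 8 * (cutoff R x * (?a x)^4))"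
        using i1 i2 by simp
      fix x
      have sq2: "(c - d)\<^sup>2 \<le> 2 * c\<^sup>2 + 2 * d\<^sup>2" for c d :: real
        using zero_le_power2[of "c + d"] by (simp add: power2_eq_square algebra_simps)
      have "(d - c)^4 \<le> 8 * c^4 + 8 * d^4" for c d :: real
      proof -
        have "((d - c)\<^sup>2)\<^sup>2 \<le> (2 * d\<^sup>2 + 2 * c\<^sup>2)\<^sup>2" by (rule power_mono[OF sq2]) simp
        also have "\<dots> = (2 * d\<^sup>2 - - (2 * c\<^sup>2))\<^sup>2" by simp
        also have "\<dots> \<le> 2 * (2 * d\<^sup>2)\<^sup>2 + 2 * (- (2 * c\<^sup>2))\<^sup>2" by (rule sq2)
        finally show ?thesis by (simp add: power_mult_distrib)
      qed
      from this[of "?a x" "?a x - f x"] have "(f x)^4 \<le> 8 * (?a x - f x)^4 + 8 * (?a x)^4" by simp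
      from mult_left_mono[OF this cutoff_bounds(1)[of R x]]
      show "cutoff R x * (f x)^4 \<le> 8 * (cutoff R x * (?a x - f x)^4) + 8 * (cutoff R x * (?a x)^4)"
        by (simp add: algebra_simps)
    qed
    also have "\<dots> = 8 * (\<integral>x. cutoff R x * (?a x - f x)^4 \<partial>lborel) + 8 * (\<integral>x. cutoff R x * (?a x)^4 \<partial>lborel)"
      using i1 i2 by simp
    also have "\<dots> \<le> 8 * ((2304 * K * N\<^sup>2) * R\<^sup>2) + 8 * (((1 + 4 * K * S) * (4 * S)) * R\<^sup>2)"
    proof -
      have "1 \<le> R\<^sup>2" using R by (simp add: one_le_power)
      then have "2304 * K * N\<^sup>2 * 1 \<le> 2304 * K * N\<^sup>2 * R\<^sup>2" using K(1) by (intro mult_left_mono) auto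
      then show ?thesis using I2 oscillation_fourth_power[OF f int K(2) R0(1)] unfolding N_def by linarith
    qed
    finally show ?thesis unfolding C_def by (simp only: distrib_right mult.assoc)
  qed
  show ?thesis using C0 main by blast
qed

section \<open>The local energy identity\<close>

lemma curl_components:
  "curl v x $ 1 = partial 2 (\<lambda>y. v y $ 3) x - partial 3 (\<lambda>y. v y $ 2) x"
  "curl v x $ 2 = partial 3 (\<lambda>y. v y $ 1) x - partial 1 (\<lambda>y. v y $ 3) x"
  "curl v x $ 3 = partial 1 (\<lambda>y. v y $ 2) x - partial 2 (\<lambda>y. v y $ 1) x"
  by (simp_all add: curl_def)

lemma cross_component:
  "cross3 a b $ 1 = a $ 2 * b $ 3 - a $ 3 * b $ 2"
  "cross3 a b $ 2 = a $ 3 * b $ 1 - a $ 1 * b $ 3"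
  "cross3 a b $ 3 = a $ 1 * b $ 2 - a $ 2 * b $ 1"
  by (simp_all add: cross3_def)

definition C1_field :: "(real^3 \<Rightarrow> real^3) \<Rightarrow> bool"
  where "C1_field v \<longleftrightarrow> (\<forall>i. Ck 1 (\<lambda>x. v x $ i))"

lemma C1_field_differentiable: "C1_field v \<Longrightarrow> (\<lambda>y. v y $ i) differentiable (at x)"
  by (simp add: C1_field_def)

lemma C1_field_cross:
  assumes "C1_field v" "C1_field w"
  shows "C1_field (\<lambda>x. cross3 (v x) (w x))"
  using assms unfolding C1_field_def forall_3 cross_component
  by (intro conjI Ck_diff Ck_mult) blast+

lemma divg_cross:
  assumes v: "C1_field v" and w: "C1_field w"
  shows "divg (\<lambda>y. cross3 (v y) (w y)) x = w x \<bullet> curl v x - v x \<bullet> curl w x"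
proof -
  note d = C1_field_differentiable[OF v, where x = x] C1_field_differentiable[OF w, where x = x]
  show ?thesis
    unfolding divg_def sum_3 cross_component inner_vec_def curl_components
    by (simp add: partial_diff partial_mult d algebra_simps)
qed

lemma divg_scaleR:
  assumes s: "s differentiable (at x)" and v: "C1_field v"
  shows "divg (\<lambda>y. s y *\<^sub>R v y) x = s x * divg v x + v x \<bullet> grad s x"
  unfolding divg_def grad_def inner_vec_def
  by (simp add: partial_mult s C1_field_differentiable[OF v] sum.distrib sum_distrib_left mult_ac)

lemma divg_add:
  assumes "C1_field v" "C1_field w"
  shows "divg (\<lambda>y. v y + w y) x = divg v x + divg w x"
  unfolding divg_def using C1_field_differentiable[OF assms(1)] C1_field_differentiable[OF assms(2)]
  by (simp add: partial_add sum.distrib)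

lemma divg_tensor_component:
  assumes v: "C1_field v" and w: "C1_field w"
  shows "divg_matrix (\<lambda>y. tensor (v y) (w y)) x $ i = (\<Sum>j\<in>UNIV. partial j (\<lambda>y. v y $ i * w y $ j) x)"
  by (simp add: divg_matrix_def divg_def tensor_def)

locale hall_mhd =
  fixes u B :: "real^3 \<Rightarrow> real^3" and P :: "real^3 \<Rightarrow> real"
  assumes smooth_u: "smooth u" and smooth_B: "smooth B" and smooth_P: "smooth P"
    and solution: "hall_mhd_solution u B P"
begin

lemma Ck_u: "Ck k (\<lambda>x. u x $ i)" and Ck_B: "Ck k (\<lambda>x. B x $ i)" and Ck_P: "Ck k P"
  using smooth_u smooth_B smooth_P by (simp_all add: Ck_vec_component smooth_Ck)

lemma Ck_partial_u: "Ck k (partial j (\<lambda>x. u x $ i))" and Ck_partial_B: "Ck k (partial j (\<lambda>x. B x $ i))"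
  using Ck_u[of "Suc k" i] Ck_B[of "Suc k" i] by simp_all

lemma fields: "C1_field u" "C1_field B"
  by (simp_all only: C1_field_def Ck_u Ck_B simp_thms)

lemma curl_B_field: "C1_field (curl B)"
  unfolding C1_field_def forall_3 curl_components by (intro conjI Ck_diff Ck_partial_B)

lemma differentiable_fields:
  "(\<lambda>x. u x $ i) differentiable (at x)" "(\<lambda>x. B x $ i) differentiable (at x)" "P differentiable (at x)"
  "partial j (\<lambda>x. u x $ i) differentiable (at x)" "partial j (\<lambda>x. B x $ i) differentiable (at x)"
  using Ck_differentiable[OF Ck_u[of 1 i]] Ck_differentiable[OF Ck_B[of 1 i]] Ck_differentiable[OF Ck_P[of 1]]
    Ck_differentiable[OF Ck_partial_u[of 1 j i]] Ck_differentiable[OF Ck_partial_B[of 1 j i]] by simp_all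

lemma laplacian_component:
  fixes v :: "real^3 \<Rightarrow> real^3"
  assumes "smooth v"
  shows "laplacian v x $ i = laplacian (\<lambda>y. v y $ i) x"
proof -
  have v: "Ck 2 v" using assms by (rule smooth_Ck)
  have d: "v differentiable (at y)" "partial j v differentiable (at y)" for y j
    using v by (simp_all add: numeral_2_eq_2)
  have "(\<lambda>y. partial j v y $ i) = partial j (\<lambda>y. v y $ i)" for j
    by (rule ext) (rule partial_vec_component[OF d(1)])
  then show ?thesis
    by (simp add: laplacian_def partial_vec_component[OF d(2)])
qed

lemma momentum:
  "laplacian (\<lambda>y. u y $ i) x = (\<Sum>j\<in>UNIV. partial j (\<lambda>y. u y $ i * u y $ j) x) + partial i P x
     - cross3 (curl B x) (B x) $ i"
proof -
  have "- laplacian u x + divg_matrix (\<lambda>y. tensor (u y) (u y)) x + grad P x - cross3 (curl B x) (B x) = 0"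
    using solution by (simp add: hall_mhd_solution_def)
  then have "(- laplacian u x + divg_matrix (\<lambda>y. tensor (u y) (u y)) x + grad P x - cross3 (curl B x) (B x)) $ i = 0"
    by simp
  then show ?thesis
    unfolding vector_minus_component vector_add_component vector_uminus_component
      laplacian_component[OF smooth_u] divg_tensor_component[OF fields(1) fields(1)]
    by (simp add: grad_def)
qed

lemma induction_eq:
  "laplacian (\<lambda>y. B y $ i) x = curl (\<lambda>y. cross3 (B y) (u y)) x $ i + curl (\<lambda>y. cross3 (curl B y) (B y)) x $ i"
proof -
  have "- laplacian B x + curl (\<lambda>y. cross3 (B y) (u y)) x + curl (\<lambda>y. cross3 (curl B y) (B y)) x = 0"
    using solution by (simp add: hall_mhd_solution_def)
  then have "(- laplacian B x + curl (\<lambda>y. cross3 (B y) (u y)) x + curl (\<lambda>y. cross3 (curl B y) (B y)) x) $ i = 0"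
    by simp
  then show ?thesis
    unfolding vector_minus_component vector_add_component vector_uminus_component
      laplacian_component[OF smooth_B] by simp
qed

lemma divergence_free: "divg u x = 0" "divg B x = 0"
  using solution by (simp_all add: hall_mhd_solution_def)

definition total_pressure :: "real^3 \<Rightarrow> real"
  where "total_pressure x = P x + (B x \<bullet> B x) / 2"

definition stress :: "3 \<Rightarrow> 3 \<Rightarrow> real^3 \<Rightarrow> real"
  where "stress i j x = u x $ i * u x $ j - B x $ i * B x $ j"

lemma Ck_half_inner:
  fixes v :: "real^3 \<Rightarrow> real^3"
  assumes "\<And>i. Ck k (\<lambda>x. v x $ i)"
  shows "Ck k (\<lambda>x. (v x \<bullet> v x) / 2)"
proof -
  have "Ck k (\<lambda>x. (1/2) * (\<Sum>i\<in>UNIV. v x $ i * v x $ i))"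
    by (intro Ck_cmult Ck_sum Ck_mult assms)
  then show ?thesis by (simp add: inner_vec_def)
qed

lemma Ck_total_pressure: "Ck k total_pressure"
  unfolding total_pressure_def[abs_def] by (intro Ck_add Ck_P Ck_half_inner Ck_B)

lemma Ck_stress: "Ck k (stress i j)"
  unfolding stress_def[abs_def] by (intro Ck_diff Ck_mult Ck_u Ck_B)

lemma partial_half_inner:
  assumes "C1_field v"
  shows "partial j (\<lambda>x. (v x \<bullet> v x) / 2) x = (\<Sum>i\<in>UNIV. v x $ i * partial j (\<lambda>y. v y $ i) x)"
proof -
  note d = C1_field_differentiable[OF assms]
  have ds: "(\<lambda>x. \<Sum>i\<in>UNIV. v x $ i * v x $ i) differentiable (at x)" using d by simp
  have "partial j (\<lambda>x. \<Sum>i\<in>UNIV. v x $ i * v x $ i) x = 2 * (\<Sum>i\<in>UNIV. v x $ i * partial j (\<lambda>y. v y $ i) x)"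
    by (simp add: partial_sum partial_mult d sum_distrib_left)
  then have "partial j (\<lambda>x. (1/2) * (\<Sum>i\<in>UNIV. v x $ i * v x $ i)) x = (\<Sum>i\<in>UNIV. v x $ i * partial j (\<lambda>y. v y $ i) x)"
    unfolding partial_cmult[OF ds] by simp
  then show ?thesis by (simp add: inner_vec_def)
qed

text \<open>The Lorentz force is the divergence of \<open>B \<otimes> B\<close> minus the gradient of the magnetic pressure.\<close>

lemma lorentz_force:
  "cross3 (curl B x) (B x) $ i = (\<Sum>j\<in>UNIV. partial j (\<lambda>y. B y $ i * B y $ j) x) - partial i (\<lambda>x. (B x \<bullet> B x) / 2) x"
proof -
  have "\<forall>i. cross3 (curl B x) (B x) $ i = (\<Sum>j\<in>UNIV. B x $ j * partial j (\<lambda>y. B y $ i) x) - (\<Sum>j\<in>UNIV. B x $ j * partial i (\<lambda>y. B y $ j) x)"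
    unfolding forall_3 cross_component curl_components sum_3 by (simp add: algebra_simps)
  moreover have "(\<Sum>j\<in>UNIV. partial j (\<lambda>y. B y $ i * B y $ j) x) = B x $ i * divg B x + (\<Sum>j\<in>UNIV. B x $ j * partial j (\<lambda>y. B y $ i) x)"
    unfolding divg_def by (simp add: partial_mult differentiable_fields sum.distrib sum_distrib_left mult_ac)
  ultimately show ?thesis by (simp add: partial_half_inner[OF fields(2)] divergence_free)
qed

text \<open>With the magnetic pressure absorbed, every force is the divergence of the stress.\<close>

lemma grad_total_pressure:
  "partial i total_pressure x = laplacian (\<lambda>y. u y $ i) x - (\<Sum>j\<in>UNIV. partial j (stress i j) x)"
proof -
  have hB: "(\<lambda>x. (B x \<bullet> B x) / 2) differentiable (at x)"
    using Ck_half_inner[of 1 B] Ck_B by simp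
  have "partial i total_pressure x = partial i P x + partial i (\<lambda>x. (B x \<bullet> B x) / 2) x"
    unfolding total_pressure_def[abs_def] by (rule partial_add[OF differentiable_fields(3) hB])
  moreover have "(\<Sum>j\<in>UNIV. partial j (stress i j) x) =
      (\<Sum>j\<in>UNIV. partial j (\<lambda>y. u y $ i * u y $ j) x) - (\<Sum>j\<in>UNIV. partial j (\<lambda>y. B y $ i * B y $ j) x)"
    unfolding stress_def[abs_def] by (simp add: partial_diff differentiable_fields sum_subtractf)
  ultimately show ?thesis by (simp add: momentum lorentz_force)
qed

text \<open>The viscous force drops out because \<open>u\<close> is divergence free.\<close>

lemma laplacian_total_pressure:
  "laplacian total_pressure x = - (\<Sum>i\<in>UNIV. \<Sum>j\<in>UNIV. partial i (partial j (stress i j)) x)"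
proof -
  let ?u = "\<lambda>i y. u y $ i"
  have sd: "partial j (stress i j) differentiable (at x)" for i j x
    using Ck_stress[of 2 i j] by (simp add: numeral_2_eq_2)
  have ud: "partial k (partial k (?u i)) differentiable (at x)" for i k x
    using Ck_u[of 3 i] by (simp add: numeral_3_eq_3)
  have ld: "laplacian (?u i) differentiable (at x)" for i x
    unfolding laplacian_def[abs_def] using ud by simp
  have eq: "partial i total_pressure = (\<lambda>x. laplacian (?u i) x - (\<Sum>j\<in>UNIV. partial j (stress i j) x))" for i
    using grad_total_pressure by (rule ext)
  have "laplacian total_pressure x = (\<Sum>i\<in>UNIV. partial i (laplacian (?u i)) x) - (\<Sum>i\<in>UNIV. \<Sum>j\<in>UNIV. partial i (partial j (stress i j)) x)"
    unfolding laplacian_def[of total_pressure] eq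
    by (simp add: partial_diff ld sd partial_sum sum_subtractf)
  moreover have "(\<Sum>i\<in>UNIV. partial i (laplacian (?u i)) x) = 0"
  proof -
    have C2: "Ck 2 (?u i)" "Ck 2 (partial k (?u i))" for i k using Ck_u Ck_partial_u by blast+
    have sw: "partial i (partial k (partial k (?u i))) x = partial k (partial k (partial i (?u i))) x" for i k
    proof -
      have "partial i (partial k (?u i)) = partial k (partial i (?u i))"
        by (rule ext) (rule partial_commute[OF C2(1)])
      then show ?thesis using partial_commute[OF C2(2), of i k k i x] by simp
    qed
    have "(\<Sum>i\<in>UNIV. partial i (laplacian (?u i)) x) = (\<Sum>i\<in>UNIV. \<Sum>k\<in>UNIV. partial k (partial k (partial i (?u i))) x)"
      unfolding laplacian_def[abs_def] by (simp add: partial_sum ud) (intro sum.cong refl sw)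
    also have "\<dots> = (\<Sum>k\<in>UNIV. \<Sum>i\<in>UNIV. partial k (partial k (partial i (?u i))) x)" by (rule sum.swap)
    also have "\<dots> = (\<Sum>k\<in>UNIV. partial k (partial k (divg u)) x)"
    proof (rule sum.cong[OF refl])
      fix k
      have d1: "partial i (?u i) differentiable (at y)" "partial k (partial i (?u i)) differentiable (at y)" for i y
        using Ck_partial_u[of 2 i i] by (simp_all add: numeral_2_eq_2)
      have "partial k (divg u) = (\<lambda>y. \<Sum>i\<in>UNIV. partial k (partial i (?u i)) y)"
        unfolding divg_def[abs_def] by (rule ext) (simp add: partial_sum d1)
      then show "(\<Sum>i\<in>UNIV. partial k (partial k (partial i (?u i))) x) = partial k (partial k (divg u)) x"
        by (simp add: partial_sum d1)
    qed
    also have "divg u = (\<lambda>x. 0)" using divergence_free(1) by (rule ext)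
    also have "(\<Sum>k\<in>UNIV. partial k (partial k (\<lambda>x::real^3. 0::real)) x) = 0"
    proof -
      have "partial k (\<lambda>x::real^3. 0::real) = (\<lambda>x. 0)" for k by (rule ext) simp
      then show ?thesis by simp
    qed
    finally show ?thesis .
  qed
  ultimately show ?thesis by simp
qed

definition energy_density :: "real^3 \<Rightarrow> real"
  where "energy_density x = (u x \<bullet> u x) / 2 + (B x \<bullet> B x) / 2"

text \<open>The energy flux without its pressure part.\<close>

definition flux :: "real^3 \<Rightarrow> real^3"
  where "flux x = ((u x \<bullet> u x) / 2 - (B x \<bullet> B x) / 2) *\<^sub>R u x
    + (cross3 (cross3 (B x) (u x)) (B x) + cross3 (cross3 (curl B x) (B x)) (B x))"

definition dissipation :: "real^3 \<Rightarrow> real"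
  where "dissipation x = (\<Sum>j\<in>UNIV. \<Sum>i\<in>UNIV. (partial j (\<lambda>y. u y $ i) x)\<^sup>2 + (partial j (\<lambda>y. B y $ i) x)\<^sup>2)"

lemma Ck_energy_density: "Ck k energy_density"
  unfolding energy_density_def[abs_def] by (intro Ck_add Ck_half_inner Ck_u Ck_B)

lemma C1_field_scaleR: "Ck 1 s \<Longrightarrow> C1_field v \<Longrightarrow> C1_field (\<lambda>x. s x *\<^sub>R v x)"
  by (auto simp: C1_field_def simp del: One_nat_def Ck.simps intro!: Ck_mult)

lemma C1_field_add: "C1_field v \<Longrightarrow> C1_field w \<Longrightarrow> C1_field (\<lambda>x. v x + w x)"
  by (auto simp: C1_field_def simp del: One_nat_def Ck.simps intro!: Ck_add)

lemma flux_field: "C1_field flux"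
  unfolding flux_def[abs_def]
  by (intro C1_field_add C1_field_scaleR C1_field_cross Ck_diff Ck_half_inner Ck_u Ck_B fields curl_B_field)

lemma pressure_flux_field: "C1_field (\<lambda>x. total_pressure x *\<^sub>R u x)"
  by (intro C1_field_scaleR Ck_total_pressure fields)

lemma partial_energy_density:
  "partial j energy_density x = (\<Sum>i\<in>UNIV. u x $ i * partial j (\<lambda>y. u y $ i) x) + (\<Sum>i\<in>UNIV. B x $ i * partial j (\<lambda>y. B y $ i) x)"
proof -
  have d: "(\<lambda>x. (u x \<bullet> u x) / 2) differentiable (at x)" "(\<lambda>x. (B x \<bullet> B x) / 2) differentiable (at x)"
    using Ck_half_inner[of 1 u] Ck_half_inner[of 1 B] Ck_u Ck_B by simp_all
  show ?thesis unfolding energy_density_def[abs_def]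
    by (simp only: partial_add[OF d] partial_half_inner[OF fields(1)] partial_half_inner[OF fields(2)])
qed

lemma laplacian_energy_density:
  "laplacian energy_density x = dissipation x
     + (\<Sum>i\<in>UNIV. u x $ i * laplacian (\<lambda>y. u y $ i) x) + (\<Sum>i\<in>UNIV. B x $ i * laplacian (\<lambda>y. B y $ i) x)"
proof -
  have eq: "partial j energy_density = (\<lambda>x. (\<Sum>i\<in>UNIV. u x $ i * partial j (\<lambda>y. u y $ i) x) + (\<Sum>i\<in>UNIV. B x $ i * partial j (\<lambda>y. B y $ i) x))" for j
    using partial_energy_density by (rule ext)
  have "partial j (partial j energy_density) x =
      (\<Sum>i\<in>UNIV. u x $ i * partial j (partial j (\<lambda>y. u y $ i)) x) + (\<Sum>i\<in>UNIV. B x $ i * partial j (partial j (\<lambda>y. B y $ i)) x)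
      + (\<Sum>i\<in>UNIV. (partial j (\<lambda>y. u y $ i) x)\<^sup>2 + (partial j (\<lambda>y. B y $ i) x)\<^sup>2)" for j
    unfolding eq by (simp add: partial_add partial_sum partial_mult differentiable_fields sum.distrib power2_eq_square)
  then show ?thesis
    unfolding laplacian_def dissipation_def
    by (simp add: sum.distrib sum_distrib_left sum.swap[of "\<lambda>i j. u x $ i * partial j (partial j (\<lambda>y. u y $ i)) x"]
        sum.swap[of "\<lambda>i j. B x $ i * partial j (partial j (\<lambda>y. B y $ i)) x"])
qed

text \<open>The Hall term does no work: \<open>curl B \<times> B\<close> is orthogonal to \<open>curl B\<close>, and the work of the
  Lorentz force on the fluid cancels against the induction term.\<close>

lemma local_energy_identity:
  "dissipation x = laplacian energy_density x - divg (\<lambda>y. total_pressure y *\<^sub>R u y) x - divg flux x"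
proof -
  let ?J = "curl B x"
  have hu: "(\<lambda>x. (u x \<bullet> u x) / 2) differentiable (at x)" and hB: "(\<lambda>x. (B x \<bullet> B x) / 2) differentiable (at x)"
    using Ck_half_inner[of 1 u] Ck_half_inner[of 1 B] Ck_u Ck_B by simp_all
  have Qd: "total_pressure differentiable (at x)" using Ck_total_pressure[of 1] by simp
  have "u x \<bullet> grad (\<lambda>x. (u x \<bullet> u x) / 2) x = (\<Sum>i\<in>UNIV. u x $ i * (\<Sum>j\<in>UNIV. partial j (\<lambda>y. u y $ i * u y $ j) x))"
  proof -
    have "(\<Sum>j\<in>UNIV. partial j (\<lambda>y. u y $ i * u y $ j) x) = u x $ i * divg u x + (\<Sum>j\<in>UNIV. u x $ j * partial j (\<lambda>y. u y $ i) x)" for i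
      unfolding divg_def by (simp add: partial_mult differentiable_fields sum.distrib sum_distrib_left mult_ac)
    then show ?thesis
      unfolding grad_def inner_vec_def[of "u x" "\<chi> i. _ i"]
      by (simp add: partial_half_inner[OF fields(1)] divergence_free sum_3 algebra_simps)
  qed
  then have A: "divg (\<lambda>y. ((u y \<bullet> u y) / 2 - (B y \<bullet> B y) / 2) *\<^sub>R u y) x =
      (\<Sum>i\<in>UNIV. u x $ i * (\<Sum>j\<in>UNIV. partial j (\<lambda>y. u y $ i * u y $ j) x)) - u x \<bullet> grad (\<lambda>x. (B x \<bullet> B x) / 2) x"
    by (subst divg_scaleR[OF _ fields(1)])
      (simp_all add: hu hB divergence_free grad_def partial_diff[OF hu hB] inner_vec_def[of "u x" "\<chi> i. _ i"] right_diff_distrib sum_subtractf)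
  have Bq: "divg (\<lambda>y. total_pressure y *\<^sub>R u y) x = u x \<bullet> grad P x + u x \<bullet> grad (\<lambda>x. (B x \<bullet> B x) / 2) x"
  proof -
    have "grad total_pressure x = grad P x + grad (\<lambda>x. (B x \<bullet> B x) / 2) x"
      unfolding grad_def total_pressure_def[abs_def] by (simp add: vec_eq_iff partial_add[OF differentiable_fields(3) hB])
    then show ?thesis by (simp add: divg_scaleR[OF Qd fields(1)] divergence_free inner_add_right)
  qed
  have C: "divg (\<lambda>y. cross3 (cross3 (B y) (u y)) (B y)) x = B x \<bullet> curl (\<lambda>y. cross3 (B y) (u y)) x - cross3 (B x) (u x) \<bullet> ?J"
    by (rule divg_cross[OF C1_field_cross[OF fields(2,1)] fields(2)])
  have D: "divg (\<lambda>y. cross3 (cross3 (curl B y) (B y)) (B y)) x = B x \<bullet> curl (\<lambda>y. cross3 (curl B y) (B y)) x - cross3 ?J (B x) \<bullet> ?J"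
    by (rule divg_cross[OF C1_field_cross[OF curl_B_field fields(2)] fields(2)])
  have triple: "cross3 (B x) (u x) \<bullet> ?J = u x \<bullet> cross3 ?J (B x)" "cross3 ?J (B x) \<bullet> ?J = 0"
    by (simp_all add: inner_vec_def sum_3 cross_component algebra_simps)
  have "divg flux x = divg (\<lambda>y. ((u y \<bullet> u y) / 2 - (B y \<bullet> B y) / 2) *\<^sub>R u y) x +
      (divg (\<lambda>y. cross3 (cross3 (B y) (u y)) (B y)) x + divg (\<lambda>y. cross3 (cross3 (curl B y) (B y)) (B y)) x)"
    unfolding flux_def[abs_def]
    by (subst divg_add; (subst divg_add)?)
      (intro C1_field_add C1_field_scaleR C1_field_cross Ck_diff Ck_half_inner Ck_u Ck_B fields curl_B_field | rule refl)+
  then have fluxd: "divg flux x + divg (\<lambda>y. total_pressure y *\<^sub>R u y) x =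
      (\<Sum>i\<in>UNIV. u x $ i * (\<Sum>j\<in>UNIV. partial j (\<lambda>y. u y $ i * u y $ j) x)) + u x \<bullet> grad P x
      - u x \<bullet> cross3 ?J (B x)
      + B x \<bullet> curl (\<lambda>y. cross3 (B y) (u y)) x + B x \<bullet> curl (\<lambda>y. cross3 (curl B y) (B y)) x"
    unfolding A Bq C D triple by simp
  have "(\<Sum>i\<in>UNIV. u x $ i * laplacian (\<lambda>y. u y $ i) x) =
      (\<Sum>i\<in>UNIV. u x $ i * (\<Sum>j\<in>UNIV. partial j (\<lambda>y. u y $ i * u y $ j) x)) + u x \<bullet> grad P x - u x \<bullet> cross3 ?J (B x)"
    unfolding momentum by (simp add: inner_vec_def grad_def algebra_simps sum.distrib sum_subtractf)
  moreover have "(\<Sum>i\<in>UNIV. B x $ i * laplacian (\<lambda>y. B y $ i) x) =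
      B x \<bullet> curl (\<lambda>y. cross3 (B y) (u y)) x + B x \<bullet> curl (\<lambda>y. cross3 (curl B y) (B y)) x"
    unfolding induction_eq by (simp add: inner_vec_def algebra_simps sum.distrib)
  ultimately show ?thesis using laplacian_energy_density[of x] fluxd by linarith
qed

end

section \<open>Growth of cubes in local Morrey spaces\<close>

definition annulus :: "real \<Rightarrow> (real^3) set"
  where "annulus R = {x. R / 2 \<le> norm x \<and> norm x \<le> R}"

lemma compact_annulus: "compact (annulus R)"
proof -
  have "annulus R = cball 0 R - ball 0 (R / 2)" by (auto simp: annulus_def)
  then show ?thesis by (simp add: compact_diff)
qed

lemma annulus_borel [measurable]: "annulus R \<in> sets borel"
  by (rule borel_compact[OF compact_annulus])

lemma integrable_indicator_mult:
  fixes f :: "real^3 \<Rightarrow> real"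
  assumes "continuous_on UNIV f" "S \<in> sets borel" "bounded S"
  shows "integrable lborel (\<lambda>x. indicator S x * f x)"
proof -
  obtain r where "\<forall>x\<in>S. norm x \<le> r" using assms(3) unfolding bounded_iff by blast
  then have r: "S \<subseteq> cball 0 r" by auto
  have "set_integrable lborel (cball 0 r) f"
    unfolding set_integrable_def by (rule borel_integrable_compact) (auto intro: continuous_on_subset[OF assms(1)])
  then have "set_integrable lborel S f" by (rule set_integrable_subset) (use assms r in auto)
  then show ?thesis by (simp add: set_integrable_def)
qed

lemma set_integral_lebesgue_eq:
  fixes f :: "real^3 \<Rightarrow> real"
  assumes "continuous_on UNIV f" "S \<in> sets borel"
  shows "(LINT x:S|lebesgue. f x) = (\<integral>x. indicator S x * f x \<partial>lborel)"
proof -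
  have [measurable]: "f \<in> borel_measurable borel" by (rule borel_measurable_continuous_onI[OF assms(1)])
  have [measurable]: "S \<in> sets borel" by (rule assms(2))
  have "(\<lambda>x. indicator S x *\<^sub>R f x) \<in> borel_measurable lborel" by measurable
  from integral_completion[OF this] show ?thesis by (simp add: set_lebesgue_integral_def)
qed

lemma continuous_abs_powr:
  fixes f :: "real^3 \<Rightarrow> real"
  assumes "continuous_on UNIV f" "0 < p"
  shows "continuous_on UNIV (\<lambda>x. \<bar>f x\<bar> powr p)"
  using assms by (intro continuous_on_powr' continuous_intros) auto

lemma cube_le_powr:
  fixes a k p :: real
  assumes "0 \<le> a" "0 < k" "3 \<le> p"
  shows "a ^ 3 \<le> k ^ 3 + k powr (3 - p) * a powr p"
proof (cases "a \<le> k")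
  case True
  then have "a ^ 3 \<le> k ^ 3" using assms by (intro power_mono) auto
  then show ?thesis by (simp add: add_increasing2)
next
  case False
  then have a: "0 < a" "k \<le> a" using assms by auto
  have "a ^ 3 = a powr (3 - p) * a powr p" using a by (simp flip: powr_add powr_numeral)
  also have "\<dots> \<le> k powr (3 - p) * a powr p"
    using a assms by (intro mult_right_mono powr_mono2') auto
  finally show ?thesis using assms by (simp add: add_increasing)
qed

lemma measure_lborel_ball: "measure lborel (ball (0::real^3) r) = r ^ 3 * measure lborel (ball (0::real^3) 1)" if "0 \<le> r"
  using content_ball_conv_unit_ball[OF that, of "0::real^3"] by simp

context
  fixes p \<gamma> :: real
  assumes p: "3 \<le> p" and \<gamma>: "\<gamma> = 3 - 2 * p / 3"
begin

text \<open>Young's inequality at the amplitude \<open>d R powr (- 2 / 3)\<close>, the natural one for the exponents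
  with vanishing \<open>\<eta>\<close>: whatever \<open>p\<close> is, cubes grow at most linearly.\<close>

lemma integral_cube_le:
  fixes f :: "real^3 \<Rightarrow> real"
  assumes f: "continuous_on UNIV f" and S: "S \<in> sets borel" "S \<subseteq> ball 0 (2 * R)" and R: "0 < R" and d: "0 < d"
  shows "(\<integral>x. indicator S x * \<bar>f x\<bar>^3 \<partial>lborel) \<le>
    R * (8 * measure lborel (ball (0::real^3) 1) * d ^ 3
      + d powr (3 - p) * (R powr (- \<gamma>) * (\<integral>x. indicator S x * \<bar>f x\<bar> powr p \<partial>lborel)))"
proof -
  let ?k = "d * R powr (- 2 / 3)"
  have k: "0 < ?k" using R d by simp
  have cp: "continuous_on UNIV (\<lambda>x. \<bar>f x\<bar> powr p)" using p by (intro continuous_abs_powr f) simp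
  have bS: "bounded S" using S(2) bounded_ball bounded_subset by blast
  have ip: "integrable lborel (\<lambda>x. indicator S x * \<bar>f x\<bar> powr p)" by (rule integrable_indicator_mult[OF cp S(1) bS])
  have i1: "integrable lborel (\<lambda>x. indicator S x * ?k ^ 3)" by (rule integrable_indicator_mult[OF continuous_on_const S(1) bS])
  have "(\<integral>x. indicator S x * \<bar>f x\<bar>^3 \<partial>lborel) \<le>
    (\<integral>x. indicator S x * ?k ^ 3 + ?k powr (3 - p) * (indicator S x * \<bar>f x\<bar> powr p) \<partial>lborel)"
  proof (rule integral_mono)
    show "integrable lborel (\<lambda>x. indicator S x * \<bar>f x\<bar>^3)"
      by (rule integrable_indicator_mult[OF _ S(1) bS]) (intro continuous_intros f)
    show "integrable lborel (\<lambda>x. indicator S x * ?k ^ 3 + ?k powr (3 - p) * (indicator S x * \<bar>f x\<bar> powr p))"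
      using i1 ip by simp
    show "indicator S x * \<bar>f x\<bar>^3 \<le> indicator S x * ?k ^ 3 + ?k powr (3 - p) * (indicator S x * \<bar>f x\<bar> powr p)" for x
      using cube_le_powr[OF abs_ge_zero k p, of "f x"] by (simp add: indicator_def)
  qed
  also have "\<dots> = ?k ^ 3 * measure lborel S + ?k powr (3 - p) * (\<integral>x. indicator S x * \<bar>f x\<bar> powr p \<partial>lborel)"
    using i1 ip S(1) by (simp add: mult.commute)
  also have "\<dots> \<le> ?k ^ 3 * (8 * R ^ 3 * measure lborel (ball (0::real^3) 1)) + ?k powr (3 - p) * (\<integral>x. indicator S x * \<bar>f x\<bar> powr p \<partial>lborel)"
  proof -
    have "measure lborel S \<le> measure lborel (ball (0::real^3) (2 * R))"
      using emeasure_lborel_ball_finite[of "0::real^3" "2 * R"] S(1)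
      by (intro measure_mono_fmeasurable[OF S(2)]) (auto simp: fmeasurable_def top.not_eq_extremum)
    also have "\<dots> = 8 * R ^ 3 * measure lborel (ball (0::real^3) 1)"
      using measure_lborel_ball[of "2 * R"] R by (simp add: power_mult_distrib)
    finally show ?thesis using k by (intro add_right_mono mult_left_mono) auto
  qed
  also have "?k ^ 3 * (8 * R ^ 3 * measure lborel (ball (0::real^3) 1)) = R * (8 * measure lborel (ball (0::real^3) 1) * d ^ 3)"
  proof -
    have "(R powr (- 2 / 3)) ^ 3 = R powr (- 2)" using R by (simp add: powr_powr flip: powr_numeral)
    also have "\<dots> * R ^ 3 = R" using R by (simp add: powr_minus_divide eval_nat_numeral)
    finally have "(R powr (- 2 / 3)) ^ 3 * R ^ 3 = R" by simp
    then show ?thesis by (simp add: power_mult_distrib mult_ac)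
  qed
  also have "?k powr (3 - p) = R * (d powr (3 - p) * R powr (- \<gamma>))"
  proof -
    have "(- 2 / 3) * (3 - p) = 1 + - \<gamma>" unfolding \<gamma> by (simp add: field_simps)
    then have "(R powr (- 2 / 3)) powr (3 - p) = R powr (1 + - \<gamma>)" unfolding powr_powr by (rule arg_cong)
    also have "\<dots> = R * R powr (- \<gamma>)" using R unfolding powr_add by simp
    finally show ?thesis using d R by (simp add: powr_mult mult_ac)
  qed
  finally show ?thesis by (simp add: algebra_simps)
qed

lemma morrey_bound:
  fixes f :: "real^3 \<Rightarrow> real"
  assumes f: "continuous_on UNIV f" "f \<in> morrey p \<gamma>"
  shows "\<exists>M\<ge>0. \<forall>R\<ge>1. R powr (- \<gamma>) * (\<integral>x. indicator (ball 0 R) x * \<bar>f x\<bar> powr p \<partial>lborel) \<le> M"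
proof -
  have p0: "0 < p" using p by simp
  define I where "I R = R powr (- \<gamma>) * (\<integral>x. indicator (ball 0 R) x * \<bar>f x\<bar> powr p \<partial>lborel)" for R
  have I0: "0 \<le> I R" for R
    unfolding I_def by (intro mult_nonneg_nonneg Bochner_Integration.integral_nonneg) auto
  have "(SUP R\<in>{1..}. ennreal ((I R) powr (1 / p))) < \<infinity>"
    using f(2) set_integral_lebesgue_eq[OF continuous_abs_powr[OF f(1) p0], of "ball 0 R" for R]
    unfolding morrey_def morrey_norm_def I_def by simp
  then obtain m where m: "(SUP R\<in>{1..}. ennreal ((I R) powr (1 / p))) = ennreal m" "0 \<le> m"
    by (metis ennreal_cases infinity_ennreal_def less_irrefl)
  have "I R \<le> m powr p" if "1 \<le> R" for R
  proof -
    have "ennreal ((I R) powr (1 / p)) \<le> ennreal m"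
      unfolding m(1)[symmetric] using that by (intro SUP_upper) auto
    then have "(I R) powr (1 / p) \<le> m" using m(2) by simp
    then have "((I R) powr (1 / p)) powr p \<le> m powr p" using p0 by (intro powr_mono2) auto
    then show ?thesis using p0 I0[of R] by (simp add: powr_powr)
  qed
  then show ?thesis unfolding I_def by (intro exI[of _ "m powr p"]) auto
qed

lemma morrey_cube_growth:
  fixes f :: "real^3 \<Rightarrow> real"
  assumes f: "continuous_on UNIV f" "f \<in> morrey p \<gamma>"
  shows "\<exists>S\<ge>0. \<forall>R\<ge>1. (\<integral>x. cutoff R x * \<bar>f x\<bar>^3 \<partial>lborel) \<le> S * R"
proof -
  obtain M where M: "0 \<le> M"
    "\<And>R. 1 \<le> R \<Longrightarrow> R powr (- \<gamma>) * (\<integral>x. indicator (ball 0 R) x * \<bar>f x\<bar> powr p \<partial>lborel) \<le> M"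
    using morrey_bound[OF f] by blast
  define S where "S = 5 * (8 * measure lborel (ball (0::real^3) 1) + M)"
  have "(\<integral>x. cutoff R x * \<bar>f x\<bar>^3 \<partial>lborel) \<le> S * R" if R: "1 \<le> R" for R
  proof -
    let ?r = "5 * R"
    have R0: "0 < R" "0 < ?r" using R by auto
    have c3: "continuous_on UNIV (\<lambda>x. \<bar>f x\<bar>^3)" by (intro continuous_intros f)
    have sub: "ball 0 ?r \<subseteq> ball (0::real^3) (2 * ?r)" using R0 by (intro subset_ball) simp
    have "(\<integral>x. cutoff R x * \<bar>f x\<bar>^3 \<partial>lborel) \<le> (\<integral>x. indicator (ball 0 ?r) x * \<bar>f x\<bar>^3 \<partial>lborel)"
    proof (rule integral_mono)
      show "integrable lborel (\<lambda>x. cutoff R x * \<bar>f x\<bar>^3)" by (rule csupp_integrable[OF csupp_cutoff_mult[OF R0(1) c3]])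
      show "integrable lborel (\<lambda>x. indicator (ball 0 ?r) x * \<bar>f x\<bar>^3)" by (rule integrable_indicator_mult[OF c3]) auto
      show "cutoff R x * \<bar>f x\<bar>^3 \<le> indicator (ball 0 ?r) x * \<bar>f x\<bar>^3" for x
      proof (cases "norm x < ?r")
        case True
        then show ?thesis using cutoff_bounds[of R x] by (simp add: mult_left_le_one_le)
      next
        case False
        then have "cutoff R x = 0" using R0 by (intro csupp_zero[OF csupp_cutoff]) auto
        then show ?thesis by simp
      qed
    qed
    also have "\<dots> \<le> ?r * (8 * measure lborel (ball (0::real^3) 1) * 1 ^ 3
      + 1 powr (3 - p) * (?r powr (- \<gamma>) * (\<integral>x. indicator (ball 0 ?r) x * \<bar>f x\<bar> powr p \<partial>lborel)))"
      by (rule integral_cube_le[OF f(1) _ sub R0(2)]) auto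
    also have "\<dots> \<le> ?r * (8 * measure lborel (ball (0::real^3) 1) * 1 ^ 3 + 1 powr (3 - p) * M)"
      using R0 M(2)[of ?r] R by (intro mult_left_mono add_left_mono) auto
    finally show ?thesis unfolding S_def by (simp add: algebra_simps)
  qed
  moreover have "0 \<le> S" unfolding S_def using M(1) by simp
  ultimately show ?thesis by blast
qed

text \<open>A small amplitude \<open>d\<close> makes the volume term small; for fixed \<open>d\<close> the other term tends to zero by hypothesis.\<close>

lemma morrey0_annulus_cube:
  fixes f :: "real^3 \<Rightarrow> real"
  assumes f: "continuous_on UNIV f" "f \<in> morrey0 p \<gamma>"
  shows "((\<lambda>R. (1 / R) * (\<integral>x. indicator (annulus R) x * \<bar>f x\<bar>^3 \<partial>lborel)) \<longlongrightarrow> 0) at_top"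
proof -
  have p0: "0 < p" using p by simp
  define I where "I R = R powr (- \<gamma>) * (\<integral>x. indicator (annulus R) x * \<bar>f x\<bar> powr p \<partial>lborel)" for R
  have I0: "0 \<le> I R" for R
    unfolding I_def by (intro mult_nonneg_nonneg Bochner_Integration.integral_nonneg) auto
  have "((\<lambda>R. (I R) powr (1 / p)) \<longlongrightarrow> 0) at_top"
    using f(2) set_integral_lebesgue_eq[OF continuous_abs_powr[OF f(1) p0] annulus_borel]
    unfolding morrey0_def I_def annulus_def by simp
  then have "((\<lambda>R. ((I R) powr (1 / p)) powr p) \<longlongrightarrow> 0 powr p) at_top"
    by (rule tendsto_powr') (use p0 in auto)
  then have lim: "(I \<longlongrightarrow> 0) at_top" using p0 I0 by (simp add: powr_powr)
  define c where "c = 8 * measure lborel (ball (0::real^3) 1) + 1"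
  have c: "0 < c" unfolding c_def by (simp add: add_nonneg_pos)
  show ?thesis
  proof (rule tendstoI)
    fix e :: real assume e: "0 < e"
    define d where "d = min 1 (e / (2 * c))"
    have d: "0 < d" "d \<le> 1" "d \<le> e / (2 * c)" using e c by (auto simp: d_def)
    have "0 < (e / 2) / d powr (3 - p)" using e d by simp
    from order_tendstoD(2)[OF lim this]
    have "\<forall>\<^sub>F R in at_top. I R < (e / 2) / d powr (3 - p)" .
    then show "\<forall>\<^sub>F R in at_top. dist ((1 / R) * (\<integral>x. indicator (annulus R) x * \<bar>f x\<bar>^3 \<partial>lborel)) 0 < e"
      using eventually_gt_at_top[of 0]
    proof eventually_elim
      case (elim R)
      have sub: "annulus R \<subseteq> ball 0 (2 * R)" using elim by (auto simp: annulus_def)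
      have pos: "0 \<le> (\<integral>x. indicator (annulus R) x * \<bar>f x\<bar>^3 \<partial>lborel)"
        by (intro Bochner_Integration.integral_nonneg) auto
      have "(\<integral>x. indicator (annulus R) x * \<bar>f x\<bar>^3 \<partial>lborel) \<le> R * (8 * measure lborel (ball (0::real^3) 1) * d ^ 3 + d powr (3 - p) * I R)"
        unfolding I_def by (rule integral_cube_le[OF f(1) annulus_borel sub elim(2) d(1)])
      also have "\<dots> < R * e"
      proof (rule mult_strict_left_mono[OF _ elim(2)])
        have "d ^ 3 \<le> d" using d power_decreasing[of 1 3 d] by simp
        then have "8 * measure lborel (ball (0::real^3) 1) * d ^ 3 \<le> c * (e / (2 * c))"
          using d c unfolding c_def by (intro mult_mono) auto
        also have "\<dots> = e / 2" using c by simp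
        finally have "8 * measure lborel (ball (0::real^3) 1) * d ^ 3 \<le> e / 2" .
        moreover have "d powr (3 - p) * I R < e / 2" using elim(1) d by (simp add: less_divide_eq mult.commute)
        ultimately show "8 * measure lborel (ball (0::real^3) 1) * d ^ 3 + d powr (3 - p) * I R < e" by linarith
      qed
      finally show ?case using pos elim(2) by (simp add: dist_real_def divide_less_eq mult.commute)
    qed
  qed
qed

end

section \<open>Cutoff functions and the integrated energy identity\<close>

text \<open>Cubes of positive parts make this function twice continuously differentiable. It is one for \<open>|x| \<le> 1/2\<close>: there the inner
  cube is at least \<open>27/64\<close>, and the outer positive part vanishes.\<close>

definition plateau :: "real^3 \<Rightarrow> real"
  where "plateau x = 1 - (max 0 (1 - (64/27) * (max 0 (1 - (norm x)\<^sup>2)) ^ 3)) ^ 3"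

lemma Ck_pos_part_cube: "Ck 2 f \<Longrightarrow> Ck 2 (\<lambda>x. (max 0 (f x)) ^ 3)" for f :: "real^3 \<Rightarrow> real"
proof -
  assume f: "Ck 2 f"
  let ?h = "\<lambda>j::nat. if j = 0 then (\<lambda>t::real. (max 0 t)^3) else if j = 1 then (\<lambda>t. 3 * (max 0 t)^2) else (\<lambda>t. 6 * max 0 t)"
  have "Ck 2 (\<lambda>x. ?h 0 (f x))"
  proof (rule Ck_compose_real[where h = "?h" and k = 2])
    fix j :: nat and t :: real assume "j < 2"
    then consider "j = 0" | "j = 1" by linarith
    then show "(?h j has_real_derivative ?h (Suc j) t) (at t)"
    proof cases
      case 1
      then show ?thesis using has_derivative_pos_part_power[of 2 t] by (simp add: numeral_3_eq_3)
    next
      case 2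
      then show ?thesis using DERIV_cmult[OF has_derivative_pos_part_power[of 1 t], of 3] by (simp add: numeral_2_eq_2)
    qed
  qed (use f in \<open>auto intro!: continuous_intros\<close>)
  then show ?thesis by simp
qed

lemma Ck_plateau: "Ck 2 plateau"
  unfolding plateau_def[abs_def]
  by (intro Ck_diff Ck_const Ck_pos_part_cube Ck_cmult Ck_norm_sq)

lemma plateau_bounds: "0 \<le> plateau x" "plateau x \<le> 1"
proof -
  let ?m = "max 0 (1 - (64/27) * (max 0 (1 - (norm x)\<^sup>2)) ^ 3)"
  have "0 \<le> ?m" "?m \<le> 1" by simp_all
  then have "0 \<le> ?m ^ 3" "?m ^ 3 \<le> 1" by (simp_all add: power_le_one)
  then show "0 \<le> plateau x" "plateau x \<le> 1" by (simp_all add: plateau_def)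
qed

lemma plateau_inside: "plateau x = 1" if "norm x \<le> 1/2"
proof -
  have "(norm x)\<^sup>2 \<le> (1/2)\<^sup>2" using that by (intro power_mono) auto
  then have n: "(norm x)\<^sup>2 \<le> 1/4" by (simp add: power_divide)
  then have "3/4 \<le> max 0 (1 - (norm x)\<^sup>2)" by (simp add: le_max_iff_disj)
  then have "(3/4)^3 \<le> (max 0 (1 - (norm x)\<^sup>2)) ^ 3" by (rule power_mono) simp
  then have "1 \<le> (64/27) * (max 0 (1 - (norm x)\<^sup>2)) ^ 3" by (simp only: power_divide) simp
  then show ?thesis by (simp add: plateau_def max_def)
qed

lemma plateau_outside: "plateau x = 0" if "1 \<le> norm x"
proof -
  have "1 \<le> (norm x)\<^sup>2" using that by (simp add: one_le_power)
  then have "max 0 (1 - (norm x)\<^sup>2) = 0" by simp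
  then show ?thesis by (simp add: plateau_def)
qed

definition scaled_plateau :: "real \<Rightarrow> real^3 \<Rightarrow> real"
  where "scaled_plateau R x = plateau (0 + (1 / R) *\<^sub>R x)"

lemma Ck_scaled_plateau: "Ck 2 (scaled_plateau R)"
  unfolding scaled_plateau_def[abs_def] by (rule Ck_affine[OF Ck_plateau])

lemma Ck1_scaled_plateau: "Ck 1 (scaled_plateau R)" "Ck 1 (partial i (scaled_plateau R))"
proof -
  show "Ck 1 (scaled_plateau R)" using Ck_scaled_plateau by (rule Ck_mono) simp
  show "Ck 1 (partial i (scaled_plateau R))" using Ck_scaled_plateau[of R] by (simp add: numeral_2_eq_2)
qed

lemma scaled_plateau_bounds: "0 \<le> scaled_plateau R x" "scaled_plateau R x \<le> 1"
  by (simp_all add: scaled_plateau_def plateau_bounds)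

lemma scaled_plateau_inside: "0 < R \<Longrightarrow> norm x \<le> R / 2 \<Longrightarrow> scaled_plateau R x = 1"
  unfolding scaled_plateau_def by (rule plateau_inside) (simp add: field_simps)

lemma csupp_scaled_plateau: "0 < R \<Longrightarrow> csupp R (scaled_plateau R)"
proof -
  assume R: "0 < R"
  have "scaled_plateau R x = 0" if "R < norm x" for x
    unfolding scaled_plateau_def using R that by (intro plateau_outside) (simp add: field_simps)
  then show ?thesis using Ck_continuous[OF Ck_scaled_plateau] by (simp add: csupp_def)
qed

lemma csupp_partial_scaled_plateau: "0 < R \<Longrightarrow> csupp R (partial i (scaled_plateau R))"
  and csupp_partial2_scaled_plateau: "0 < R \<Longrightarrow> csupp R (partial j (partial i (scaled_plateau R)))"
  by (intro csupp_partial Ck1_scaled_plateau csupp_scaled_plateau; assumption)+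

lemma partial_scaled_plateau_inside:
  assumes R: "0 < R" and x: "norm x < R / 2"
  shows "partial i (scaled_plateau R) x = 0"
proof -
  have "((\<lambda>y. 1) has_derivative (\<lambda>y. 0)) (at x)" by simp
  then have "(scaled_plateau R has_derivative (\<lambda>y. 0)) (at x)"
  proof (rule has_derivative_transform_within_open)
    show "open (ball (0::real^3) (R / 2))" by simp
  qed (use x R scaled_plateau_inside[OF R] in auto)
  from partial_eqI[OF this] show ?thesis by simp
qed

lemma scaled_plateau_derivative_bounds:
  obtains D where "0 < D"
    "\<And>R i x. 0 < R \<Longrightarrow> \<bar>partial i (scaled_plateau R) x\<bar> \<le> D / R * indicator (annulus R) x"
    "\<And>R i x. 0 < R \<Longrightarrow> \<bar>partial i (partial i (scaled_plateau R)) x\<bar> \<le> D / R\<^sup>2"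
proof -
  have P1: "Ck 1 plateau" using Ck_plateau by (rule Ck_mono) simp
  have P2: "Ck 1 (partial i plateau)" for i using Ck_plateau by (simp add: numeral_2_eq_2)
  have sp: "csupp 1 plateau" using plateau_outside Ck_continuous[OF Ck_plateau] by (simp add: csupp_def)
  have "\<forall>i. \<exists>C\<ge>0. \<forall>x. \<bar>partial i plateau x\<bar> \<le> C"
    using csupp_bounded[OF csupp_partial[OF P1 sp]] by metis
  then obtain C where C: "\<And>i. 0 \<le> C i" "\<And>i x. \<bar>partial i plateau x\<bar> \<le> C i" by metis
  have "\<forall>i. \<exists>C\<ge>0. \<forall>x. \<bar>partial i (partial i plateau) x\<bar> \<le> C"
    using csupp_bounded[OF csupp_partial[OF P2 csupp_partial[OF P1 sp]]] by metis
  then obtain E where E: "\<And>i. 0 \<le> E i" "\<And>i x. \<bar>partial i (partial i plateau) x\<bar> \<le> E i" by metis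
  define D where "D = 1 + (\<Sum>i\<in>UNIV. C i) + (\<Sum>i\<in>UNIV. E i)"
  have CD: "C i \<le> D" "E i \<le> D" for i
    using member_le_sum[of i UNIV C] member_le_sum[of i UNIV E] C(1) E(1) sum_nonneg[of UNIV C] sum_nonneg[of UNIV E]
    unfolding D_def by (simp_all add: add_increasing add_increasing2)
  have D: "0 < D" unfolding D_def using C(1) E(1) by (intro add_pos_nonneg sum_nonneg) auto
  have dP: "plateau differentiable (at x)" "partial i plateau differentiable (at x)" for x i using P1 P2[of i] by simp_all
  have p1: "partial i (scaled_plateau R) = (\<lambda>x. (1 / R) * partial i plateau (0 + (1 / R) *\<^sub>R x))" for i R
    unfolding scaled_plateau_def[abs_def] by (rule ext) (rule partial_affine[OF dP(1)])
  show ?thesis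
  proof (rule that[OF D])
    fix R :: real and i x assume R: "0 < R"
    show "\<bar>partial i (scaled_plateau R) x\<bar> \<le> D / R * indicator (annulus R) x"
    proof (cases "x \<in> annulus R")
      case True
      have "\<bar>partial i plateau (0 + (1 / R) *\<^sub>R x)\<bar> \<le> D" using C(2) CD(1) order_trans by blast
      then show ?thesis using True R unfolding p1 by (simp add: abs_mult divide_right_mono)
    next
      case False
      then have "norm x < R / 2 \<or> R < norm x" by (auto simp: annulus_def)
      then have "partial i (scaled_plateau R) x = 0"
        using partial_scaled_plateau_inside[OF R] csupp_zero[OF csupp_partial_scaled_plateau[OF R]] by blast
      then show ?thesis using False by simp
    qed
    have "partial i (partial i (scaled_plateau R)) x = (1 / R) * ((1 / R) * partial i (partial i plateau) (0 + (1 / R) *\<^sub>R x))"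
    proof -
      have "(\<lambda>x. partial i plateau (0 + (1 / R) *\<^sub>R x)) differentiable (at x)"
        using Ck_affine[OF P2, where x = 0 and c = "1 / R"] by simp
      then have "partial i (\<lambda>x. (1 / R) * partial i plateau (0 + (1 / R) *\<^sub>R x)) x = (1 / R) * partial i (\<lambda>x. partial i plateau (0 + (1 / R) *\<^sub>R x)) x"
        by (rule partial_cmult)
      then show ?thesis unfolding p1 by (simp only: partial_affine[OF dP(2)])
    qed
    moreover have "\<bar>partial i (partial i plateau) (0 + (1 / R) *\<^sub>R x)\<bar> \<le> D" using E(2) CD(2) order_trans by blast
    ultimately show "\<bar>partial i (partial i (scaled_plateau R)) x\<bar> \<le> D / R\<^sup>2"
      using R by (simp add: abs_mult power2_eq_square divide_right_mono)
  qed
qed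

lemma integral_divg_mult:
  assumes v: "C1_field v" and f: "Ck 1 f" "csupp r f"
  shows "(\<integral>x. f x * divg v x \<partial>lborel) = - (\<integral>x. v x \<bullet> grad f x \<partial>lborel)"
proof -
  have vi: "Ck 1 (\<lambda>x. v x $ i)" for i using v by (simp only: C1_field_def)
  have cvi: "continuous_on UNIV (\<lambda>x. v x $ i)" "continuous_on UNIV (partial i (\<lambda>x. v x $ i))" for i
    using Ck_continuous[OF vi] vi[of i] by simp_all
  have i1: "integrable lborel (\<lambda>x. partial i (\<lambda>y. v y $ i) x * f x)" and i2: "integrable lborel (\<lambda>x. v x $ i * partial i f x)" for i
    by (rule csupp_integrable[OF csupp_mult_left[OF f(2) cvi(2)]])
      (rule csupp_integrable[OF csupp_mult_left[OF csupp_partial[OF f] cvi(1)]])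
  have "(\<integral>x. f x * divg v x \<partial>lborel) = (\<integral>x. (\<Sum>i\<in>UNIV. partial i (\<lambda>y. v y $ i) x * f x) \<partial>lborel)"
    unfolding divg_def by (simp add: sum_distrib_left mult.commute)
  also have "\<dots> = (\<Sum>i\<in>UNIV. \<integral>x. partial i (\<lambda>y. v y $ i) x * f x \<partial>lborel)"
    by (rule Bochner_Integration.integral_sum) (rule i1)
  also have "\<dots> = (\<Sum>i\<in>UNIV. - (\<integral>x. v x $ i * partial i f x \<partial>lborel))"
    by (simp only: integration_by_parts[OF vi f])
  also have "\<dots> = - (\<integral>x. (\<Sum>i\<in>UNIV. v x $ i * partial i f x) \<partial>lborel)"
    by (simp add: sum_negf Bochner_Integration.integral_sum i2)
  finally show ?thesis by (simp add: inner_vec_def grad_def)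
qed

lemma integral_laplacian_mult:
  fixes e :: "real^3 \<Rightarrow> real"
  assumes e: "Ck 2 e" and f: "Ck 2 f" "csupp r f"
  shows "(\<integral>x. f x * laplacian e x \<partial>lborel) = (\<integral>x. e x * laplacian f x \<partial>lborel)"
proof -
  have e1: "Ck 1 e" "Ck 1 (partial i e)" for i using Ck_mono[OF e, of 1] e by (simp_all add: numeral_2_eq_2)
  have f1: "Ck 1 f" "Ck 1 (partial i f)" for i using Ck_mono[OF f(1), of 1] f(1) by (simp_all add: numeral_2_eq_2)
  have ce: "continuous_on UNIV e" "continuous_on UNIV (partial i (partial i e))" for i
    using Ck_continuous[OF e] e1(2)[of i] by simp_all
  have sf: "csupp r (partial i f)" "csupp r (partial i (partial i f))" for i
    by (intro csupp_partial f1 f)+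
  have i1: "integrable lborel (\<lambda>x. partial i (partial i e) x * f x)" and i2: "integrable lborel (\<lambda>x. e x * partial i (partial i f) x)" for i
    by (rule csupp_integrable[OF csupp_mult_left[OF f(2) ce(2)]])
      (rule csupp_integrable[OF csupp_mult_left[OF sf(2) ce(1)]])
  have "(\<integral>x. f x * laplacian e x \<partial>lborel) = (\<integral>x. (\<Sum>i\<in>UNIV. partial i (partial i e) x * f x) \<partial>lborel)"
    unfolding laplacian_def by (simp add: sum_distrib_left mult.commute)
  also have "\<dots> = (\<Sum>i\<in>UNIV. \<integral>x. partial i (partial i e) x * f x \<partial>lborel)"
    by (rule Bochner_Integration.integral_sum) (rule i1)
  also have "\<dots> = (\<Sum>i\<in>UNIV. \<integral>x. e x * partial i (partial i f) x \<partial>lborel)"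
    by (simp only: integration_by_parts[OF e1(2) f1(1) f(2)] integration_by_parts[OF e1(1) f1(2) sf(1)] minus_minus)
  also have "\<dots> = (\<integral>x. (\<Sum>i\<in>UNIV. e x * partial i (partial i f) x) \<partial>lborel)"
    by (rule Bochner_Integration.integral_sum[symmetric]) (rule i2)
  finally show ?thesis by (simp add: laplacian_def sum_distrib_left)
qed

context hall_mhd
begin

lemma continuous_dissipation: "continuous_on UNIV dissipation"
  unfolding dissipation_def by (intro continuous_intros Ck_continuous[OF Ck_partial_u] Ck_continuous[OF Ck_partial_B])

lemma continuous_fields: "continuous_on UNIV u" "continuous_on UNIV B" "continuous_on UNIV (curl B)" "continuous_on UNIV flux"
proof -
  show "continuous_on UNIV u" "continuous_on UNIV B" using smooth_Ck[OF smooth_u] smooth_Ck[OF smooth_B] Ck_continuous by blast+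
  have "continuous_on UNIV v" if "C1_field v" for v
  proof -
    have "Ck 1 (\<lambda>x. v x $ i)" for i using that by (simp only: C1_field_def)
    then have "continuous_on UNIV (\<lambda>x. v x $ i)" for i by (rule Ck_continuous)
    then have "continuous_on UNIV (\<lambda>x. \<chi> i. v x $ i)" by (intro continuous_on_vec_lambda)
    then show ?thesis by simp
  qed
  then show "continuous_on UNIV (curl B)" "continuous_on UNIV flux" using curl_B_field flux_field by blast+
qed

text \<open>The function against which the pressure acts in the integrated energy identity.\<close>

definition test_function :: "real \<Rightarrow> real^3 \<Rightarrow> real"
  where "test_function R x = u x \<bullet> grad (scaled_plateau R) x"

lemma integrated_energy:
  assumes R: "0 < R"
  shows "(\<integral>x. scaled_plateau R x * dissipation x \<partial>lborel) =
    (\<integral>x. energy_density x * laplacian (scaled_plateau R) x \<partial>lborel) + (\<integral>x. total_pressure x * test_function R x \<partial>lborel)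
    + (\<integral>x. flux x \<bullet> grad (scaled_plateau R) x \<partial>lborel)"
proof -
  note b = Ck1_scaled_plateau(1)[of R] csupp_scaled_plateau[OF R]
  have cl: "continuous_on UNIV (laplacian energy_density)"
  proof -
    have "Ck 2 energy_density" by (rule Ck_energy_density)
    then have "continuous_on UNIV (partial i (partial i energy_density))" for i by (simp add: numeral_2_eq_2)
    then show ?thesis unfolding laplacian_def by (intro continuous_intros)
  qed
  have cdiv: "continuous_on UNIV (divg v)" if "C1_field v" for v
  proof -
    have "Ck 1 (\<lambda>x. v x $ i)" for i using that by (simp only: C1_field_def)
    then have "continuous_on UNIV (partial i (\<lambda>x. v x $ i))" for i by simp
    then show ?thesis unfolding divg_def by (intro continuous_intros)
  qed
  have i: "integrable lborel (\<lambda>x. scaled_plateau R x * f x)" if "continuous_on UNIV f" for f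
    by (rule csupp_integrable[OF csupp_mult_right[OF b(2) that]])
  let ?a = "\<lambda>x. scaled_plateau R x * laplacian energy_density x" and ?b = "\<lambda>x. scaled_plateau R x * divg (\<lambda>y. total_pressure y *\<^sub>R u y) x"
    and ?c = "\<lambda>x. scaled_plateau R x * divg flux x"
  have ia: "integrable lborel ?a" "integrable lborel ?b" "integrable lborel ?c"
    by (intro i cl cdiv pressure_flux_field flux_field)+
  have "(\<integral>x. scaled_plateau R x * dissipation x \<partial>lborel) = (\<integral>x. ?a x - ?b x - ?c x \<partial>lborel)"
    unfolding local_energy_identity by (simp only: right_diff_distrib)
  also have "\<dots> = (\<integral>x. ?a x \<partial>lborel) - (\<integral>x. ?b x \<partial>lborel) - (\<integral>x. ?c x \<partial>lborel)"
    using ia by simp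
  also have "(\<integral>x. ?a x \<partial>lborel) = (\<integral>x. energy_density x * laplacian (scaled_plateau R) x \<partial>lborel)"
    by (rule integral_laplacian_mult[OF Ck_energy_density Ck_scaled_plateau b(2)])
  also have "(\<integral>x. ?b x \<partial>lborel) = - (\<integral>x. total_pressure x * test_function R x \<partial>lborel)"
    using integral_divg_mult[OF pressure_flux_field b] by (simp add: test_function_def)
  also have "(\<integral>x. ?c x \<partial>lborel) = - (\<integral>x. flux x \<bullet> grad (scaled_plateau R) x \<partial>lborel)"
    by (rule integral_divg_mult[OF flux_field b])
  finally show ?thesis by simp
qed

lemma test_properties:
  assumes R: "0 < R"
  shows "Ck 1 (test_function R)" "csupp R (test_function R)" "(\<integral>x. test_function R x \<partial>lborel) = 0"
proof -
  have eq: "test_function R = (\<lambda>x. \<Sum>i\<in>UNIV. u x $ i * partial i (scaled_plateau R) x)"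
    by (rule ext) (simp add: test_function_def inner_vec_def grad_def)
  show 1: "Ck 1 (test_function R)" unfolding eq by (intro Ck_sum Ck_mult Ck_u Ck1_scaled_plateau)
  have "test_function R x = 0" if "R < norm x" for x
    unfolding eq using csupp_zero[OF csupp_partial_scaled_plateau[OF R] that] by simp
  then show "csupp R (test_function R)" using Ck_continuous[OF 1] by (simp add: csupp_def)
  have "(\<integral>x. scaled_plateau R x * divg u x \<partial>lborel) = - (\<integral>x. test_function R x \<partial>lborel)"
    unfolding test_function_def by (rule integral_divg_mult[OF fields(1) Ck1_scaled_plateau(1) csupp_scaled_plateau[OF R]])
  then show "(\<integral>x. test_function R x \<partial>lborel) = 0" by (simp add: divergence_free)
qed

lemma pressure_data_test:
  assumes R: "0 < R"
  shows "pressure_data total_pressure (\<lambda>x. (norm (u x))\<^sup>2 + (norm (B x))\<^sup>2) (\<lambda>x. norm (u x)) (\<lambda>x. l * test_function R x) (\<lambda>i x. u x $ i) stress R"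
proof
  show "continuous_on UNIV (\<lambda>x. (norm (u x))\<^sup>2 + (norm (B x))\<^sup>2)" "continuous_on UNIV (\<lambda>x. norm (u x))"
    by (intro continuous_intros continuous_fields)+
  show "\<bar>stress i j x\<bar> \<le> (norm (u x))\<^sup>2 + (norm (B x))\<^sup>2" for i j x
  proof -
    have "\<bar>v $ i * v $ j\<bar> \<le> (norm v)\<^sup>2" for v :: "real^3"
      unfolding abs_mult power2_eq_square by (intro mult_mono component_le_norm_cart) auto
    from this[of "u x"] this[of "B x"] show ?thesis unfolding stress_def by linarith
  qed
  show "\<bar>u x $ i\<bar> \<le> norm (u x)" for i x by (rule component_le_norm_cart)
  show "Ck 1 (\<lambda>x. l * test_function R x)" by (intro Ck_cmult test_properties R)
  show "csupp R (\<lambda>x. l * test_function R x)" by (intro csupp_mult_left test_properties R continuous_on_const)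
  show "(\<integral>x. l * test_function R x \<partial>lborel) = 0" using test_properties(3)[OF R] by simp
qed (use R Ck_total_pressure Ck_stress Ck_u grad_total_pressure laplacian_total_pressure in auto)

end

section \<open>Vanishing of the dissipation\<close>

lemma abs_integral_le:
  fixes f h :: "'a::euclidean_space \<Rightarrow> real"
  assumes "integrable lborel f" "integrable lborel h" "\<And>x. \<bar>f x\<bar> \<le> h x"
  shows "\<bar>\<integral>x. f x \<partial>lborel\<bar> \<le> (\<integral>x. h x \<partial>lborel)"
  using assms by (intro order_trans[OF integral_abs_bound] integral_mono) auto

lemma cube_sum3_le:
  fixes a b c :: real
  assumes "0 \<le> a" "0 \<le> b" "0 \<le> c"
  shows "(a + b + c) ^ 3 \<le> 9 * (a ^ 3 + b ^ 3 + c ^ 3)"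
proof -
  define m where "m = (a + b + c) / 3"
  have m: "0 \<le> m" using assms by (simp add: m_def)
  have t: "m ^ 3 + 3 * m\<^sup>2 * (x - m) \<le> x ^ 3" if "0 \<le> x" for x
  proof -
    have "0 \<le> (x - m)\<^sup>2 * (x + 2 * m)" using m that by simp
    then show ?thesis by (simp add: power2_eq_square power3_eq_cube algebra_simps)
  qed
  have "3 * m ^ 3 + 3 * m\<^sup>2 * (a + b + c - 3 * m) \<le> a ^ 3 + b ^ 3 + c ^ 3"
    using t[OF assms(1)] t[OF assms(2)] t[OF assms(3)] by (simp add: algebra_simps)
  moreover have "a + b + c - 3 * m = 0" by (simp add: m_def)
  ultimately have "27 * m ^ 3 \<le> 9 * (a ^ 3 + b ^ 3 + c ^ 3)" by simp
  moreover have "27 * m ^ 3 = (a + b + c) ^ 3" unfolding m_def by (simp add: power_divide)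
  ultimately show ?thesis by simp
qed

lemma cube_sum2_le:
  fixes a b :: real
  assumes "0 \<le> a" "0 \<le> b"
  shows "(a + b) ^ 3 \<le> 4 * (a ^ 3 + b ^ 3)"
proof -
  have "0 \<le> 3 * (a + b) * (a - b)\<^sup>2" using assms by simp
  then show ?thesis by (simp add: power2_eq_square power3_eq_cube algebra_simps)
qed

lemma norm_le_sum3: "norm (v::real^3) \<le> \<bar>v $ 1\<bar> + \<bar>v $ 2\<bar> + \<bar>v $ 3\<bar>"
  using norm_le_l1_cart[of v] by (simp add: sum_3)

lemma norm_cube_le: "norm (v::real^3) ^ 3 \<le> 9 * (\<Sum>i\<in>UNIV. \<bar>v $ i\<bar> ^ 3)"
proof -
  have "norm v ^ 3 \<le> (\<bar>v $ 1\<bar> + \<bar>v $ 2\<bar> + \<bar>v $ 3\<bar>) ^ 3" by (rule power_mono[OF norm_le_sum3]) simp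
  also have "\<dots> \<le> 9 * (\<bar>v $ 1\<bar> ^ 3 + \<bar>v $ 2\<bar> ^ 3 + \<bar>v $ 3\<bar> ^ 3)" by (rule cube_sum3_le) auto
  finally show ?thesis by (simp add: sum_3)
qed

lemma norm_fourth_le: "norm (v::real^3) ^ 4 \<le> 3 * (\<Sum>i\<in>UNIV. (v $ i) ^ 4)"
proof -
  have p4: "(x\<^sup>2)\<^sup>2 = x ^ 4" for x :: real by simp
  have "(a + b + c)\<^sup>2 \<le> 3 * (a\<^sup>2 + b\<^sup>2 + c\<^sup>2)" for a b c :: real
    using zero_le_power2[of "a - b"] zero_le_power2[of "b - c"] zero_le_power2[of "a - c"]
    by (simp add: power2_eq_square algebra_simps)
  from this[of "(v $ 1)\<^sup>2" "(v $ 2)\<^sup>2" "(v $ 3)\<^sup>2"]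
  have "((norm v)\<^sup>2)\<^sup>2 \<le> 3 * (\<Sum>i\<in>UNIV. ((v $ i)\<^sup>2)\<^sup>2)" unfolding norm_sq_sum sum_3 .
  then show ?thesis by (simp only: p4)
qed

lemma norm_cross_le: "norm (cross3 a b) \<le> norm a * norm b"
proof (rule power2_le_imp_le)
  show "(norm (cross3 a b))\<^sup>2 \<le> (norm a * norm b)\<^sup>2"
    using norm_cross_dot[of a b] zero_le_power2[of "a \<bullet> b"] by linarith
qed simp

lemma integral_cutoff_le:
  assumes R: "0 < R"
  shows "(\<integral>x. cutoff R x \<partial>lborel) \<le> 125 * measure lborel (ball (0::real^3) 1) * R ^ 3"
proof -
  have "(\<integral>x. cutoff R x \<partial>lborel) \<le> (\<integral>x. indicator (ball (0::real^3) (5 * R)) x * 1 \<partial>lborel)"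
  proof (rule integral_mono)
    show "integrable lborel (cutoff R)" by (rule csupp_integrable[OF csupp_cutoff[OF R]])
    show "integrable lborel (\<lambda>x. indicator (ball (0::real^3) (5 * R)) x * (1::real))"
      by (rule integrable_indicator_mult) (auto intro: continuous_on_const)
    show "cutoff R x \<le> indicator (ball 0 (5 * R)) x * 1" for x
    proof (cases "norm x < 5 * R")
      case False
      then have "cutoff R x = 0" using R by (intro csupp_zero[OF csupp_cutoff[OF R]]) auto
      then show ?thesis by simp
    qed (simp add: cutoff_bounds)
  qed
  also have "\<dots> = 125 * measure lborel (ball (0::real^3) 1) * R ^ 3"
    using measure_lborel_ball[of "5 * R"] R by (simp add: power_mult_distrib)
  finally show ?thesis .
qed

lemma indicator_annulus_le_cutoff: "0 < R \<Longrightarrow> indicator (annulus R) x \<le> cutoff R x"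
  by (cases "x \<in> annulus R") (auto simp: annulus_def cutoff_inside cutoff_bounds)

text \<open>Moments below the third, by Young's inequality at the amplitude \<open>k\<close>.\<close>

lemma first_le_cube: "a \<le> k + a ^ 3 / k\<^sup>2" and square_le_cube: "a\<^sup>2 \<le> k\<^sup>2 + a ^ 3 / k"
  if "0 \<le> a" "0 < k" for a k :: real
proof -
  have alt: "a \<le> k \<or> (a \<le> a ^ 3 / k\<^sup>2 \<and> a\<^sup>2 \<le> a ^ 3 / k)"
  proof (cases "a \<le> k")
    case False
    then have "k\<^sup>2 \<le> a\<^sup>2" using that by (intro power_mono) auto
    then have "a * k\<^sup>2 \<le> a * a\<^sup>2" using that by (intro mult_left_mono) auto
    moreover have "a\<^sup>2 * k \<le> a\<^sup>2 * a" using False by (intro mult_left_mono) auto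
    ultimately show ?thesis using that by (simp add: le_divide_eq power2_eq_square power3_eq_cube mult.assoc)
  qed simp
  have nn: "0 \<le> a ^ 3 / k\<^sup>2" "0 \<le> a ^ 3 / k" using that by auto
  have sq: "a\<^sup>2 \<le> k\<^sup>2" if "a \<le> k" using that \<open>0 \<le> a\<close> by (intro power_mono) auto
  show "a \<le> k + a ^ 3 / k\<^sup>2" using alt nn that(2) by (elim disjE) linarith+
  show "a\<^sup>2 \<le> k\<^sup>2 + a ^ 3 / k"
  proof (cases "a \<le> k")
    case True
    then show ?thesis using sq nn(2) by linarith
  next
    case False
    then show ?thesis using alt zero_le_power2[of k] by linarith
  qed
qed

lemma moments_le:
  fixes a :: "real^3 \<Rightarrow> real"
  assumes a: "continuous_on UNIV a" "\<And>x. 0 \<le> a x" and R: "0 < R"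
    and S: "(\<integral>x. cutoff R x * a x ^ 3 \<partial>lborel) \<le> S * R"
  defines "c \<equiv> 125 * measure lborel (ball (0::real^3) 1)"
  shows "(\<integral>x. cutoff R x * a x \<partial>lborel) \<le> (c + S) * R powr (7/3)"
    and "(\<integral>x. cutoff R x * (a x)\<^sup>2 \<partial>lborel) \<le> (c + S) * R powr (5/3)"
proof -
  let ?k = "R powr (- 2/3)"
  have k: "0 < ?k" using R by simp
  have i: "integrable lborel (\<lambda>x. cutoff R x * f x)" if "continuous_on UNIV f" for f
    by (rule csupp_integrable[OF csupp_cutoff_mult[OF R that]])
  have ic: "integrable lborel (cutoff R)" by (rule csupp_integrable[OF csupp_cutoff[OF R]])
  have i1: "integrable lborel (\<lambda>x. cutoff R x * a x)" and i2: "integrable lborel (\<lambda>x. cutoff R x * (a x)\<^sup>2)"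
    and i3: "integrable lborel (\<lambda>x. cutoff R x * a x ^ 3)"
    by (intro i continuous_intros a)+
  note vol = integral_cutoff_le[OF R, folded c_def]
  have RR: "R ^ 3 = R powr 3" "R = R powr 1" using R by simp_all
  have "(\<integral>x. cutoff R x * a x \<partial>lborel) \<le> (\<integral>x. ?k * cutoff R x + (1 / ?k\<^sup>2) * (cutoff R x * a x ^ 3) \<partial>lborel)"
  proof (rule integral_mono[OF i1])
    show "integrable lborel (\<lambda>x. ?k * cutoff R x + (1 / ?k\<^sup>2) * (cutoff R x * a x ^ 3))"
      by (intro Bochner_Integration.integrable_add integrable_mult_right ic i3)
    show "cutoff R x * a x \<le> ?k * cutoff R x + (1 / ?k\<^sup>2) * (cutoff R x * a x ^ 3)" for x
      using mult_left_mono[OF first_le_cube[OF a(2) k, of x] cutoff_bounds(1)[of R x]] by (simp add: algebra_simps)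
  qed
  also have "\<dots> = ?k * (\<integral>x. cutoff R x \<partial>lborel) + (1 / ?k\<^sup>2) * (\<integral>x. cutoff R x * a x ^ 3 \<partial>lborel)"
    using ic i3 by (subst Bochner_Integration.integral_add) auto
  also have "\<dots> \<le> ?k * (c * R ^ 3) + (1 / ?k\<^sup>2) * (S * R)"
    using k vol S by (intro add_mono mult_left_mono) auto
  also have "?k * (c * R ^ 3) = c * R powr (7/3)"
  proof -
    have "?k * R ^ 3 = R powr (7/3)" unfolding RR(1) powr_add[symmetric] by simp
    then show ?thesis by (simp add: mult.left_commute)
  qed
  also have "(1 / ?k\<^sup>2) * (S * R) = S * R powr (7/3)"
  proof -
    have "?k\<^sup>2 = R powr (- 4/3)" using R by (simp add: powr_powr flip: powr_numeral)
    then have "1 / ?k\<^sup>2 = R powr (4/3)" by (simp add: powr_minus_divide)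
    then have "(1 / ?k\<^sup>2) * R = R powr (4/3) * R powr 1" using R by simp
    also have "\<dots> = R powr (7/3)" unfolding powr_add[symmetric] by simp
    finally show ?thesis by (simp add: mult.left_commute)
  qed
  finally show "(\<integral>x. cutoff R x * a x \<partial>lborel) \<le> (c + S) * R powr (7/3)" by (simp add: distrib_right)
  have "(\<integral>x. cutoff R x * (a x)\<^sup>2 \<partial>lborel) \<le> (\<integral>x. ?k\<^sup>2 * cutoff R x + (1 / ?k) * (cutoff R x * a x ^ 3) \<partial>lborel)"
  proof (rule integral_mono[OF i2])
    show "integrable lborel (\<lambda>x. ?k\<^sup>2 * cutoff R x + (1 / ?k) * (cutoff R x * a x ^ 3))"
      by (intro Bochner_Integration.integrable_add integrable_mult_right ic i3)
    show "cutoff R x * (a x)\<^sup>2 \<le> ?k\<^sup>2 * cutoff R x + (1 / ?k) * (cutoff R x * a x ^ 3)" for x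
      using mult_left_mono[OF square_le_cube[OF a(2) k, of x] cutoff_bounds(1)[of R x]] by (simp add: algebra_simps)
  qed
  also have "\<dots> = ?k\<^sup>2 * (\<integral>x. cutoff R x \<partial>lborel) + (1 / ?k) * (\<integral>x. cutoff R x * a x ^ 3 \<partial>lborel)"
    using ic i3 by (subst Bochner_Integration.integral_add) auto
  also have "\<dots> \<le> ?k\<^sup>2 * (c * R ^ 3) + (1 / ?k) * (S * R)"
    using k vol S by (intro add_mono mult_left_mono) auto
  also have "?k\<^sup>2 * (c * R ^ 3) = c * R powr (5/3)"
  proof -
    have "?k\<^sup>2 = R powr (- 4/3)" using R by (simp add: powr_powr flip: powr_numeral)
    then have "?k\<^sup>2 * R ^ 3 = R powr (5/3)" unfolding RR(1) by (simp flip: powr_add)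
    then show ?thesis by (simp add: mult.left_commute)
  qed
  also have "(1 / ?k) * (S * R) = S * R powr (5/3)"
  proof -
    have "1 / ?k = R powr (2/3)" using R by (simp add: powr_minus_divide)
    then have "(1 / ?k) * R = R powr (2/3) * R powr 1" using R by simp
    also have "\<dots> = R powr (5/3)" unfolding powr_add[symmetric] by simp
    finally show ?thesis by (simp add: mult.left_commute)
  qed
  finally show "(\<integral>x. cutoff R x * (a x)\<^sup>2 \<partial>lborel) \<le> (c + S) * R powr (5/3)" by (simp add: distrib_right)
qed

lemma bellman_le_cubes:
  assumes "0 \<le> w" "w \<le> 1" "0 \<le> a" "0 \<le> b"
  shows "bellman q (2 * (w * (a\<^sup>2 + b\<^sup>2))) \<le> 4 * \<bar>q\<bar> ^ 3 + 48 * (w * (a ^ 3 + b ^ 3))"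
proof -
  let ?p = "2 * (w * (a\<^sup>2 + b\<^sup>2))"
  have p0: "0 \<le> ?p" using assms by simp
  have "?p \<le> 2 * (w * (a + b)\<^sup>2)" using assms by (intro mult_left_mono) (auto simp: power2_sum)
  then have "sqrt ?p \<le> sqrt (2 * (w * (a + b)\<^sup>2))" by simp
  also have "\<dots> = sqrt 2 * sqrt w * (a + b)" using assms by (simp add: real_sqrt_mult)
  finally have "sqrt ?p ^ 3 \<le> (sqrt 2 * sqrt w * (a + b)) ^ 3" using p0 by (intro power_mono) auto
  also have "\<dots> = (sqrt 2 ^ 3) * (sqrt w ^ 3) * (a + b) ^ 3" by (simp add: power_mult_distrib)
  also have "\<dots> \<le> 3 * w * (4 * (a ^ 3 + b ^ 3))"
  proof -
    have s2: "sqrt 2 ^ 3 \<le> (3::real)"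
    proof -
      have "sqrt 2 ^ 3 = 2 * sqrt (2::real)" by (simp add: power3_eq_cube)
      moreover have "sqrt 2 \<le> (3/2 :: real)" by (rule real_le_lsqrt) (auto simp: power2_eq_square)
      ultimately show ?thesis by simp
    qed
    have sw: "sqrt w ^ 3 \<le> w"
    proof -
      have "sqrt w ^ 3 = w * sqrt w" using assms by (simp add: power3_eq_cube)
      also have "\<dots> \<le> w * 1" using assms by (intro mult_left_mono) auto
      finally show ?thesis by simp
    qed
    show ?thesis using assms by (intro mult_mono s2 sw cube_sum2_le) auto
  qed
  finally have sp: "sqrt ?p ^ 3 \<le> 12 * (w * (a ^ 3 + b ^ 3))" by (simp add: algebra_simps)
  have "sqrt (q\<^sup>2 + ?p) \<le> \<bar>q\<bar> + sqrt ?p" using sqrt_add_le_add_sqrt[of "q\<^sup>2" ?p] p0 by simp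
  then have "bellman q ?p \<le> (\<bar>q\<bar> + sqrt ?p) ^ 3" unfolding bellman_def using p0 by (intro power_mono) auto
  also have "\<dots> \<le> 4 * (\<bar>q\<bar> ^ 3 + sqrt ?p ^ 3)" using p0 by (intro cube_sum2_le) auto
  finally show ?thesis using sp by (simp add: distrib_left)
qed

text \<open>All that the vanishing of the dissipation needs to know about the size of the fields: linear growth of cubes, quadratic growth of \<open>|B|\<^sup>4\<close>, square integrability of
  \<open>\<nabla>B\<close>, and decay of the cubes of \<open>u\<close> on annuli relative to \<open>R\<close>.\<close>

locale hall_mhd_growth = hall_mhd +
  fixes S C4 :: real
  assumes S0: "0 \<le> S" and C40: "0 \<le> C4"
    and growth_u: "\<And>R. 1 \<le> R \<Longrightarrow> (\<integral>x. cutoff R x * norm (u x) ^ 3 \<partial>lborel) \<le> S * R"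
    and growth_B: "\<And>R. 1 \<le> R \<Longrightarrow> (\<integral>x. cutoff R x * norm (B x) ^ 3 \<partial>lborel) \<le> S * R"
    and growth_B4: "\<And>R. 1 \<le> R \<Longrightarrow> (\<integral>x. cutoff R x * norm (B x) ^ 4 \<partial>lborel) \<le> C4 * R\<^sup>2"
    and grad_B: "\<And>i. integrable lborel (grad_sq (\<lambda>x. B x $ i))"
    and annulus_u: "((\<lambda>R. (1 / R) * (\<integral>x. indicator (annulus R) x * norm (u x) ^ 3 \<partial>lborel)) \<longlongrightarrow> 0) at_top"
begin

definition ball_const :: real where "ball_const = 125 * measure lborel (ball (0::real^3) 1)"

lemma ball_const_nonneg: "0 \<le> ball_const"
  by (simp add: ball_const_def)

definition shell :: "real \<Rightarrow> real"
  where "shell R = (1 / R) * (\<integral>x. indicator (annulus R) x * norm (u x) ^ 3 \<partial>lborel)"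

definition grad_B_sq :: "real^3 \<Rightarrow> real"
  where "grad_B_sq x = (\<Sum>i\<in>UNIV. grad_sq (\<lambda>x. B x $ i) x)"

definition tail :: "real \<Rightarrow> real"
  where "tail R = (\<integral>x. indicator (annulus R) x * grad_B_sq x \<partial>lborel)"

lemma continuous_grad_B_sq: "continuous_on UNIV grad_B_sq"
  unfolding grad_B_sq_def by (intro continuous_intros continuous_grad_sq Ck_B)

lemma grad_B_sq_nonneg: "0 \<le> grad_B_sq x"
  by (simp add: grad_B_sq_def grad_sq_def sum_nonneg)

lemma norms_continuous: "continuous_on UNIV (\<lambda>x. norm (u x))" "continuous_on UNIV (\<lambda>x. norm (B x))"
  "continuous_on UNIV (\<lambda>x. norm (curl B x))" "continuous_on UNIV (\<lambda>x. norm (flux x))"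
  by (intro continuous_on_norm continuous_fields)+

lemma ann_integrable: "continuous_on UNIV f \<Longrightarrow> integrable lborel (\<lambda>x. indicator (annulus R) x * f x)"
  for f :: "real^3 \<Rightarrow> real"
  by (rule integrable_indicator_mult[OF _ annulus_borel compact_imp_bounded[OF compact_annulus]])

lemma shell_nonneg: "0 < R \<Longrightarrow> 0 \<le> shell R" and tail_nonneg: "0 \<le> tail R"
  unfolding shell_def tail_def
  by (intro mult_nonneg_nonneg Bochner_Integration.integral_nonneg; simp add: grad_B_sq_nonneg)+

lemma shell_integral: "0 < R \<Longrightarrow> (\<integral>x. indicator (annulus R) x * norm (u x) ^ 3 \<partial>lborel) = R * shell R"
  by (simp add: shell_def)

lemma ann_le_cutoff:
  fixes f :: "real^3 \<Rightarrow> real"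
  assumes f: "continuous_on UNIV f" "\<And>x. 0 \<le> f x" and R: "0 < R"
  shows "(\<integral>x. indicator (annulus R) x * f x \<partial>lborel) \<le> (\<integral>x. cutoff R x * f x \<partial>lborel)"
  by (intro integral_mono ann_integrable f csupp_integrable[OF csupp_cutoff_mult[OF R f(1)]] mult_right_mono
      indicator_annulus_le_cutoff R)

context
  fixes D :: real
  assumes D: "0 < D"
    and D1: "\<And>R i x. 0 < R \<Longrightarrow> \<bar>partial i (scaled_plateau R) x\<bar> \<le> D / R * indicator (annulus R) x"
    and D2: "\<And>R i x. 0 < R \<Longrightarrow> \<bar>partial i (partial i (scaled_plateau R)) x\<bar> \<le> D / R\<^sup>2"
begin

lemma grad_scaled_plateau_le: "0 < R \<Longrightarrow> norm (grad (scaled_plateau R) x) \<le> 3 * D / R * indicator (annulus R) x"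
proof -
  assume R: "0 < R"
  show ?thesis using norm_le_sum3[of "grad (scaled_plateau R) x"] D1[OF R, of 1 x] D1[OF R, of 2 x] D1[OF R, of 3 x]
    by (simp add: grad_def)
qed

lemma test_le: "0 < R \<Longrightarrow> \<bar>test_function R x\<bar> \<le> 3 * D / R * (indicator (annulus R) x * norm (u x))"
proof -
  assume R: "0 < R"
  have "\<bar>test_function R x\<bar> \<le> norm (u x) * norm (grad (scaled_plateau R) x)" unfolding test_function_def by (rule Cauchy_Schwarz_ineq2)
  also have "\<dots> \<le> norm (u x) * (3 * D / R * indicator (annulus R) x)" by (intro mult_left_mono grad_scaled_plateau_le R) simp
  finally show ?thesis by (simp add: mult_ac)
qed

lemma viscous_term_le:
  assumes R: "1 \<le> R"
  shows "\<bar>\<integral>x. energy_density x * laplacian (scaled_plateau R) x \<partial>lborel\<bar> \<le> 3 * D * (ball_const + S) * R powr (- 1/3)"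
proof -
  have R0: "0 < R" using R by simp
  have lap: "\<bar>laplacian (scaled_plateau R) x\<bar> \<le> 3 * D / R\<^sup>2 * cutoff R x" for x
  proof (cases "norm x \<le> R")
    case True
    have "\<bar>laplacian (scaled_plateau R) x\<bar> \<le> (\<Sum>j\<in>UNIV. \<bar>partial j (partial j (scaled_plateau R)) x\<bar>)" unfolding laplacian_def by (rule sum_abs)
    also have "\<dots> \<le> (\<Sum>j\<in>(UNIV::3 set). D / R\<^sup>2)" by (intro sum_mono D2 R0)
    finally show ?thesis using True R0 by (simp add: cutoff_inside)
  next
    case False
    then have "laplacian (scaled_plateau R) x = 0" unfolding laplacian_def using csupp_zero[OF csupp_partial2_scaled_plateau[OF R0]] by simp
    then show ?thesis using D cutoff_bounds[of R x] by simp
  qed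
  have cl: "csupp R (laplacian (scaled_plateau R))"
    using csupp_partial2_scaled_plateau[OF R0] by (auto simp: csupp_def laplacian_def intro!: continuous_intros)
  have ce: "continuous_on UNIV energy_density" by (rule Ck_continuous[OF Ck_energy_density])
  have i: "integrable lborel (\<lambda>x. cutoff R x * (norm (u x))\<^sup>2)" "integrable lborel (\<lambda>x. cutoff R x * (norm (B x))\<^sup>2)"
    by (intro csupp_integrable[OF csupp_cutoff_mult[OF R0]] continuous_intros norms_continuous)+
  have "\<bar>\<integral>x. energy_density x * laplacian (scaled_plateau R) x \<partial>lborel\<bar> \<le>
      (\<integral>x. (3 * D / R\<^sup>2 / 2) * (cutoff R x * (norm (u x))\<^sup>2 + cutoff R x * (norm (B x))\<^sup>2) \<partial>lborel)"
  proof (rule abs_integral_le)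
    show "integrable lborel (\<lambda>x. energy_density x * laplacian (scaled_plateau R) x)" by (rule csupp_integrable[OF csupp_mult_left[OF cl ce]])
    show "integrable lborel (\<lambda>x. (3 * D / R\<^sup>2 / 2) * (cutoff R x * (norm (u x))\<^sup>2 + cutoff R x * (norm (B x))\<^sup>2))"
      using i by (intro integrable_mult_right) simp
    fix x
    have e0: "0 \<le> energy_density x" unfolding energy_density_def by simp
    have "\<bar>energy_density x * laplacian (scaled_plateau R) x\<bar> \<le> energy_density x * (3 * D / R\<^sup>2 * cutoff R x)"
      unfolding abs_mult using e0 lap[of x] by (intro mult_mono) auto
    also have "\<dots> = (3 * D / R\<^sup>2 / 2) * (cutoff R x * (norm (u x))\<^sup>2 + cutoff R x * (norm (B x))\<^sup>2)"
      unfolding energy_density_def dot_square_norm by (simp add: field_simps)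
    finally show "\<bar>energy_density x * laplacian (scaled_plateau R) x\<bar> \<le> (3 * D / R\<^sup>2 / 2) * (cutoff R x * (norm (u x))\<^sup>2 + cutoff R x * (norm (B x))\<^sup>2)" .
  qed
  also have "\<dots> = (3 * D / R\<^sup>2 / 2) * ((\<integral>x. cutoff R x * (norm (u x))\<^sup>2 \<partial>lborel) + (\<integral>x. cutoff R x * (norm (B x))\<^sup>2 \<partial>lborel))"
    using i by simp
  also have "\<dots> \<le> (3 * D / R\<^sup>2 / 2) * ((ball_const + S) * R powr (5/3) + (ball_const + S) * R powr (5/3))"
    unfolding ball_const_def using D R0
    by (intro mult_left_mono add_mono moments_le(2) norms_continuous growth_u growth_B R) auto
  also have "\<dots> = 3 * D * (ball_const + S) * (R powr (5/3) / R\<^sup>2)"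
  proof -
    have "(3 * D / R\<^sup>2 / 2) * (y + y) = 3 * D * (y / R\<^sup>2)" for y by simp
    then show ?thesis by (simp only:) simp
  qed
  also have "R powr (5/3) / R\<^sup>2 = R powr (- 1/3)"
  proof -
    have "R\<^sup>2 = R powr 2" using R0 by simp
    then show ?thesis by (simp flip: powr_diff)
  qed
  finally show ?thesis .
qed

text \<open>The parameter \<open>s\<close> trades the quantities that tend to zero, namely the cubes of \<open>u\<close> on the annulus and the tail of
  \<open>|\<nabla>B|\<^sup>2\<close>, against the bounded ones, which receive the small factor \<open>1 / s\<close>.\<close>

lemma flux_le:
  assumes R: "0 < R" and s: "0 < s"
  shows "(1 / R) * norm (flux x) \<le> (1 / R) * (1 + 2 * s\<^sup>2) * norm (u x) ^ 3 + (2 / (s * R)) * norm (B x) ^ 3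
    + 2 * s * grad_B_sq x + (1 / (s * R\<^sup>2)) * norm (B x) ^ 4"
proof -
  let ?a = "norm (u x)" and ?b = "norm (B x)" and ?j = "norm (curl B x)"
  have j2: "?j\<^sup>2 \<le> 2 * grad_B_sq x"
  proof -
    have sq: "(p - q)\<^sup>2 \<le> 2 * p\<^sup>2 + 2 * q\<^sup>2" for p q :: real
      using zero_le_power2[of "p + q"] by (simp add: power2_eq_square algebra_simps)
    have "?j\<^sup>2 \<le> (2 * (partial 2 (\<lambda>y. B y $ 3) x)\<^sup>2 + 2 * (partial 3 (\<lambda>y. B y $ 2) x)\<^sup>2)
      + (2 * (partial 3 (\<lambda>y. B y $ 1) x)\<^sup>2 + 2 * (partial 1 (\<lambda>y. B y $ 3) x)\<^sup>2)
      + (2 * (partial 1 (\<lambda>y. B y $ 2) x)\<^sup>2 + 2 * (partial 2 (\<lambda>y. B y $ 1) x)\<^sup>2)"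
      unfolding norm_sq_sum sum_3 curl_components by (intro add_mono sq)
    also have "\<dots> \<le> 2 * grad_B_sq x" by (simp add: grad_B_sq_def grad_sq_def sum_3)
    finally show ?thesis .
  qed
  have "norm (flux x) \<le> \<bar>?a\<^sup>2 / 2 - ?b\<^sup>2 / 2\<bar> * ?a + (norm (cross3 (cross3 (B x) (u x)) (B x)) + norm (cross3 (cross3 (curl B x) (B x)) (B x)))"
    unfolding flux_def dot_square_norm by (intro order_trans[OF norm_triangle_ineq] add_mono norm_triangle_ineq) simp
  also have "\<dots> \<le> (?a\<^sup>2 / 2 + ?b\<^sup>2 / 2) * ?a + (?b * ?a * ?b + ?j * ?b * ?b)"
  proof (intro add_mono mult_right_mono)
    show "\<bar>?a\<^sup>2 / 2 - ?b\<^sup>2 / 2\<bar> \<le> ?a\<^sup>2 / 2 + ?b\<^sup>2 / 2" using zero_le_power2[of ?a] zero_le_power2[of ?b] by linarith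
    have cc: "norm (cross3 (cross3 v w) (B x)) \<le> norm v * norm w * ?b" for v w
      using norm_cross_le[of "cross3 v w" "B x"] mult_right_mono[OF norm_cross_le[of v w], of ?b] by simp
    show "norm (cross3 (cross3 (B x) (u x)) (B x)) \<le> ?b * ?a * ?b" by (rule cc)
    show "norm (cross3 (cross3 (curl B x) (B x)) (B x)) \<le> ?j * ?b * ?b" by (rule cc)
  qed auto
  also have "\<dots> = ?a ^ 3 / 2 + (3/2) * (?a * ?b\<^sup>2) + ?j * ?b\<^sup>2"
    by (simp add: power2_eq_square power3_eq_cube field_simps)
  also have "\<dots> \<le> ?a ^ 3 + 2 * (?a * ?b\<^sup>2) + ?j * ?b\<^sup>2"
  proof -
    have "0 \<le> ?a ^ 3" "0 \<le> ?a * ?b\<^sup>2" by simp_all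
    then show ?thesis by linarith
  qed
  finally have f: "norm (flux x) \<le> ?a ^ 3 + 2 * (?a * ?b\<^sup>2) + ?j * ?b\<^sup>2" .
  have ab: "?a * ?b\<^sup>2 \<le> ?b ^ 3 / s + s\<^sup>2 * ?a ^ 3"
  proof (cases "s * ?a \<le> ?b")
    case True
    then have "?a \<le> ?b / s" using s by (simp add: le_divide_eq mult.commute)
    then have "?a * ?b\<^sup>2 \<le> (?b / s) * ?b\<^sup>2" by (intro mult_right_mono) auto
    then show ?thesis by (simp add: power2_eq_square power3_eq_cube add_increasing2)
  next
    case False
    then have "?b\<^sup>2 \<le> (s * ?a)\<^sup>2" by (intro power_mono) auto
    then have "?a * ?b\<^sup>2 \<le> ?a * (s * ?a)\<^sup>2" by (intro mult_left_mono) auto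
    moreover have "?a * (s * ?a)\<^sup>2 = s\<^sup>2 * ?a ^ 3" by (simp add: power2_eq_square power3_eq_cube mult_ac)
    moreover have "0 \<le> ?b ^ 3 / s" using s by simp
    ultimately show ?thesis by linarith
  qed
  have jb: "?j * (?b\<^sup>2 / R) \<le> s * ?j\<^sup>2 + (?b\<^sup>2 / R)\<^sup>2 / s"
  proof -
    define y where "y = ?b\<^sup>2 / R"
    have y: "0 \<le> y" using R by (simp add: y_def)
    have "0 \<le> (s * ?j - y)\<^sup>2 + s * ?j * y" using s y by simp
    then have "s * (?j * y) \<le> s * (s * ?j\<^sup>2 + y\<^sup>2 / s)" using s by (simp add: power2_eq_square algebra_simps)
    then show ?thesis unfolding y_def using mult_left_le_imp_le[OF _ s] by blast
  qed
  have "(1 / R) * norm (flux x) \<le> (1 / R) * (?a ^ 3 + 2 * (?b ^ 3 / s + s\<^sup>2 * ?a ^ 3)) + ?j * (?b\<^sup>2 / R)"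
  proof -
    have "(1 / R) * norm (flux x) \<le> (1 / R) * ((?a ^ 3 + 2 * (?b ^ 3 / s + s\<^sup>2 * ?a ^ 3)) + ?j * ?b\<^sup>2)"
      using f ab R by (intro mult_left_mono) auto
    then show ?thesis by (simp add: distrib_left)
  qed
  also have "\<dots> \<le> (1 / R) * (?a ^ 3 + 2 * (?b ^ 3 / s + s\<^sup>2 * ?a ^ 3)) + (s * (2 * grad_B_sq x) + (?b\<^sup>2 / R)\<^sup>2 / s)"
    using jb mult_left_mono[OF j2, of s] s by linarith
  also have "\<dots> = (1 / R) * (1 + 2 * s\<^sup>2) * ?a ^ 3 + (2 / (s * R)) * ?b ^ 3 + 2 * s * grad_B_sq x + (1 / (s * R\<^sup>2)) * ?b ^ 4"
    using R s by (simp add: field_simps power_divide flip: power_mult)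
  finally show ?thesis .
qed

lemma flux_term_le:
  assumes R: "1 \<le> R" and s: "1 \<le> s"
  shows "\<bar>\<integral>x. flux x \<bullet> grad (scaled_plateau R) x \<partial>lborel\<bar> \<le>
    3 * D * ((1 + 2 * s\<^sup>2) * shell R + 2 * s * tail R + (2 * S + C4) / s)"
proof -
  have R0: "0 < R" and s0: "0 < s" using R s by auto
  let ?I = "\<lambda>x. indicator (annulus R) x :: real"
  let ?F = "\<lambda>x. ((1 / R) * (1 + 2 * s\<^sup>2)) * (?I x * norm (u x) ^ 3) + (2 / (s * R)) * (?I x * norm (B x) ^ 3)
    + (2 * s) * (?I x * grad_B_sq x) + (1 / (s * R\<^sup>2)) * (?I x * norm (B x) ^ 4)"
  have i: "integrable lborel (\<lambda>x. ?I x * norm (u x) ^ 3)" "integrable lborel (\<lambda>x. ?I x * norm (B x) ^ 3)"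
    "integrable lborel (\<lambda>x. ?I x * grad_B_sq x)" "integrable lborel (\<lambda>x. ?I x * norm (B x) ^ 4)"
    by (intro ann_integrable continuous_intros norms_continuous continuous_grad_B_sq)+
  have cg: "csupp R (\<lambda>x. flux x \<bullet> grad (scaled_plateau R) x)"
  proof -
    have "continuous_on UNIV (partial i (scaled_plateau R))" for i by (rule csupp_continuous[OF csupp_partial_scaled_plateau[OF R0]])
    then have "continuous_on UNIV (\<lambda>x. flux x \<bullet> grad (scaled_plateau R) x)"
      unfolding grad_def by (intro continuous_intros continuous_fields)
    moreover have "flux x \<bullet> grad (scaled_plateau R) x = 0" if "R < norm x" for x
      using csupp_zero[OF csupp_partial_scaled_plateau[OF R0] that] by (simp add: grad_def inner_vec_def)
    ultimately show ?thesis by (simp add: csupp_def)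
  qed
  have "\<bar>\<integral>x. flux x \<bullet> grad (scaled_plateau R) x \<partial>lborel\<bar> \<le> (\<integral>x. 3 * D * ?F x \<partial>lborel)"
  proof (rule abs_integral_le[OF csupp_integrable[OF cg]])
    show "integrable lborel (\<lambda>x. 3 * D * ?F x)"
      by (intro integrable_mult_right Bochner_Integration.integrable_add i)
    fix x
    have "\<bar>flux x \<bullet> grad (scaled_plateau R) x\<bar> \<le> norm (flux x) * norm (grad (scaled_plateau R) x)" by (rule Cauchy_Schwarz_ineq2)
    also have "\<dots> \<le> norm (flux x) * (3 * D / R * ?I x)" by (intro mult_left_mono grad_scaled_plateau_le R0) simp
    also have "\<dots> = (3 * D * ?I x) * ((1 / R) * norm (flux x))" by simp
    also have "\<dots> \<le> (3 * D * ?I x) * ((1 / R) * (1 + 2 * s\<^sup>2) * norm (u x) ^ 3 + (2 / (s * R)) * norm (B x) ^ 3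
      + 2 * s * grad_B_sq x + (1 / (s * R\<^sup>2)) * norm (B x) ^ 4)"
      using D by (intro mult_left_mono flux_le R0 s0) auto
    also have "\<dots> = 3 * D * ?F x" by (simp only: distrib_left mult_ac)
    finally show "\<bar>flux x \<bullet> grad (scaled_plateau R) x\<bar> \<le> 3 * D * ?F x" .
  qed
  also have "\<dots> = 3 * D * (\<integral>x. ?F x \<partial>lborel)" by (rule integral_mult_right_zero)
  also have "(\<integral>x. ?F x \<partial>lborel) = ((1 / R) * (1 + 2 * s\<^sup>2)) * (\<integral>x. ?I x * norm (u x) ^ 3 \<partial>lborel)
     + (2 / (s * R)) * (\<integral>x. ?I x * norm (B x) ^ 3 \<partial>lborel) + (2 * s) * (\<integral>x. ?I x * grad_B_sq x \<partial>lborel)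
     + (1 / (s * R\<^sup>2)) * (\<integral>x. ?I x * norm (B x) ^ 4 \<partial>lborel)"
    by (simp only: Bochner_Integration.integral_add Bochner_Integration.integrable_add integrable_mult_right i integral_mult_right_zero)
  also have "3 * D * \<dots> \<le> 3 * D * (((1 / R) * (1 + 2 * s\<^sup>2)) * (R * shell R) + (2 / (s * R)) * (S * R) + (2 * s) * tail R + (1 / (s * R\<^sup>2)) * (C4 * R\<^sup>2))"
  proof -
    have b3: "(\<integral>x. ?I x * norm (B x) ^ 3 \<partial>lborel) \<le> S * R"
      by (rule order_trans[OF ann_le_cutoff growth_B[OF R]]) (use R0 in \<open>auto intro!: continuous_intros norms_continuous\<close>)
    have b4: "(\<integral>x. ?I x * norm (B x) ^ 4 \<partial>lborel) \<le> C4 * R\<^sup>2"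
      by (rule order_trans[OF ann_le_cutoff growth_B4[OF R]]) (use R0 in \<open>auto intro!: continuous_intros norms_continuous\<close>)
    show ?thesis unfolding shell_integral[OF R0] tail_def[symmetric]
      using D R0 s0 b3 b4 by (intro mult_left_mono add_mono order_refl) auto
  qed
  also have "\<dots> = 3 * D * ((1 + 2 * s\<^sup>2) * shell R + 2 * s * tail R + (2 * S + C4) / s)"
  proof -
    have "((1 / R) * (1 + 2 * s\<^sup>2)) * (R * shell R) = (1 + 2 * s\<^sup>2) * shell R"
      "(2 / (s * R)) * (S * R) = 2 * S / s" "(1 / (s * R\<^sup>2)) * (C4 * R\<^sup>2) = C4 / s"
      using R0 s0 by simp_all
    then show ?thesis by (simp only: add_divide_distrib add_ac)
  qed
  finally show ?thesis .
qed

text \<open>Young's inequality at the amplitude \<open>R powr (- 2 / 3) / s\<close> leaves the volume term with a factor \<open>1 / s\<close>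
  and pays for it with \<open>s\<^sup>2\<close> in front of the small quantity \<open>shell R\<close>.\<close>

lemma integral_test_le:
  assumes R: "1 \<le> R" and s: "1 \<le> s"
  shows "(\<integral>x. \<bar>test_function R x\<bar> \<partial>lborel) \<le> 3 * D * R powr (4/3) * (ball_const / s + s\<^sup>2 * shell R)"
proof -
  have R0: "0 < R" and s0: "0 < s" using R s by auto
  let ?I = "\<lambda>x. indicator (annulus R) x :: real"
  let ?k = "R powr (- 2/3) / s"
  have k: "0 < ?k" using R0 s0 by simp
  have iu: "integrable lborel (\<lambda>x. ?I x * norm (u x))" "integrable lborel (\<lambda>x. ?I x * norm (u x) ^ 3)" "integrable lborel (\<lambda>x. ?I x * 1)"
    by (intro ann_integrable continuous_intros norms_continuous)+
  have "(\<integral>x. \<bar>test_function R x\<bar> \<partial>lborel) \<le> (\<integral>x. 3 * D / R * (?I x * norm (u x)) \<partial>lborel)"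
    by (intro integral_mono integrable_abs csupp_integrable[OF test_properties(2)] integrable_mult_right iu test_le R0)
  also have "\<dots> = 3 * D / R * (\<integral>x. ?I x * norm (u x) \<partial>lborel)" by (rule integral_mult_right_zero)
  also have "(\<integral>x. ?I x * norm (u x) \<partial>lborel) \<le> (\<integral>x. ?k * (?I x * 1) + (1 / ?k\<^sup>2) * (?I x * norm (u x) ^ 3) \<partial>lborel)"
  proof (rule integral_mono[OF iu(1)])
    show "integrable lborel (\<lambda>x. ?k * (?I x * 1) + (1 / ?k\<^sup>2) * (?I x * norm (u x) ^ 3))"
      by (intro Bochner_Integration.integrable_add integrable_mult_right iu)
    show "?I x * norm (u x) \<le> ?k * (?I x * 1) + (1 / ?k\<^sup>2) * (?I x * norm (u x) ^ 3)" for x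
      using first_le_cube[OF norm_ge_zero k, of "u x"] by (simp add: indicator_def)
  qed
  also have "\<dots> = ?k * (\<integral>x. ?I x * 1 \<partial>lborel) + (1 / ?k\<^sup>2) * (R * shell R)"
    unfolding shell_integral[OF R0, symmetric]
    by (simp only: Bochner_Integration.integral_add integrable_mult_right iu integral_mult_right_zero)
  also have "\<dots> \<le> ?k * (ball_const * R ^ 3) + (1 / ?k\<^sup>2) * (R * shell R)"
  proof -
    have "(\<integral>x. ?I x * 1 \<partial>lborel) \<le> (\<integral>x. cutoff R x * 1 \<partial>lborel)"
      by (rule ann_le_cutoff) (use R0 in \<open>auto intro: continuous_on_const\<close>)
    also have "\<dots> \<le> ball_const * R ^ 3" using integral_cutoff_le[OF R0] by (simp add: ball_const_def)
    finally show ?thesis using k by (intro add_right_mono mult_left_mono) auto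
  qed
  also have "\<dots> = R powr (7/3) * (ball_const / s + s\<^sup>2 * shell R)"
  proof -
    have a: "R powr (- 2/3) * R ^ 3 = R powr (7/3)" using R0 by (simp flip: powr_add powr_numeral)
    have "(R powr (- 2/3))\<^sup>2 = R powr (- 4/3)" using R0 by (simp add: powr_powr flip: powr_numeral)
    then have "(1 / ?k\<^sup>2) * R = s\<^sup>2 * (R powr (4/3) * R powr 1)"
      using R0 s0 by (simp add: power_divide powr_minus_divide power_mult_distrib)
    also have "\<dots> = s\<^sup>2 * R powr (7/3)" unfolding powr_add[symmetric] by simp
    finally have b: "(1 / ?k\<^sup>2) * R = s\<^sup>2 * R powr (7/3)" .
    have "?k * (ball_const * R ^ 3) = (R powr (- 2/3) * R ^ 3) * (ball_const / s)" by simp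
    moreover have "(1 / ?k\<^sup>2) * (R * shell R) = ((1 / ?k\<^sup>2) * R) * shell R" by simp
    ultimately show ?thesis unfolding a b by (simp add: algebra_simps)
  qed
  finally have "(\<integral>x. \<bar>test_function R x\<bar> \<partial>lborel) \<le> 3 * D / R * (R powr (7/3) * (ball_const / s + s\<^sup>2 * shell R))"
    using D R0 by (simp add: mult_left_mono divide_right_mono)
  also have "\<dots> = 3 * D * (R powr (7/3) / R) * (ball_const / s + s\<^sup>2 * shell R)" by simp
  also have "R powr (7/3) / R = R powr (4/3)"
  proof -
    have "R powr (7/3) / R = R powr (7/3) / R powr 1" using R0 by simp
    also have "\<dots> = R powr (4/3)" unfolding powr_diff[symmetric] by simp
    finally show ?thesis .
  qed
  finally show ?thesis .
qed

text \<open>The pressure estimate is applied to the multiple \<open>s R\<close> of the test function. The factor \<open>R\<close> makes both arguments of the Bellman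
  function scale alike; \<open>s\<close> plays the same role as in the estimate of the flux.\<close>

lemma pressure_term_le:
  assumes Cp: "0 < Cp" "\<forall>Q v U g w H R. pressure_data Q v U g w H R \<longrightarrow>
    \<bar>\<integral>x. Q x * g x \<partial>lborel\<bar> \<le> Cp * (\<integral>x. bellman (g x) (2 * (cutoff R x * v x)) \<partial>lborel) +
      Cp * ((\<integral>x. cutoff R x * U x \<partial>lborel) / R^4 + (\<integral>x. cutoff R x * v x \<partial>lborel) / R^3) * (\<integral>x. \<bar>g x\<bar> \<partial>lborel)"
    and R: "1 \<le> R" and s: "1 \<le> s"
  shows "\<bar>\<integral>x. total_pressure x * test_function R x \<partial>lborel\<bar> \<le>
    Cp * (108 * D ^ 3 * s\<^sup>2 * shell R + 96 * S / s) + Cp * (9 * D * (ball_const + S)) * (ball_const / s + s\<^sup>2 * shell R)"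
proof -
  have R0: "0 < R" and s0: "0 < s" using R s by auto
  let ?l = "s * R"
  let ?v = "\<lambda>x. (norm (u x))\<^sup>2 + (norm (B x))\<^sup>2"
  let ?I = "\<lambda>x. indicator (annulus R) x :: real"
  have l: "0 < ?l" using R0 s0 by simp
  have iv: "integrable lborel (\<lambda>x. cutoff R x * (norm (u x))\<^sup>2)" "integrable lborel (\<lambda>x. cutoff R x * (norm (B x))\<^sup>2)"
    and ic: "integrable lborel (\<lambda>x. cutoff R x * norm (u x) ^ 3)" "integrable lborel (\<lambda>x. cutoff R x * norm (B x) ^ 3)"
    by (intro csupp_integrable[OF csupp_cutoff_mult[OF R0]] continuous_intros norms_continuous)+
  have iI: "integrable lborel (\<lambda>x. ?I x * norm (u x) ^ 3)" by (intro ann_integrable continuous_intros norms_continuous)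
  define Bm where "Bm = (\<integral>x. bellman (?l * test_function R x) (2 * (cutoff R x * ?v x)) \<partial>lborel)"
  define mU where "mU = (\<integral>x. cutoff R x * norm (u x) \<partial>lborel)"
  define mv where "mv = (\<integral>x. cutoff R x * ?v x \<partial>lborel)"
  define T where "T = (\<integral>x. \<bar>test_function R x\<bar> \<partial>lborel)"
  have T0: "0 \<le> T" unfolding T_def by (intro Bochner_Integration.integral_nonneg) simp
  have est: "?l * \<bar>\<integral>x. total_pressure x * test_function R x \<partial>lborel\<bar> \<le> Cp * Bm + Cp * (mU / R^4 + mv / R^3) * (?l * T)"
  proof -
    have "(\<integral>x. total_pressure x * (?l * test_function R x) \<partial>lborel) = ?l * (\<integral>x. total_pressure x * test_function R x \<partial>lborel)"
      by (simp add: mult.left_commute flip: integral_mult_right_zero)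
    moreover have "(\<integral>x. \<bar>?l * test_function R x\<bar> \<partial>lborel) = ?l * T"
      using l R0 s0 unfolding T_def abs_mult by simp
    ultimately show ?thesis
      using Cp(2)[rule_format, OF pressure_data_test[OF R0, of ?l]] l R0 s0 unfolding Bm_def mU_def mv_def
      by (simp add: abs_mult)
  qed
  have Bm: "Bm \<le> 108 * D ^ 3 * s ^ 3 * (R * shell R) + 96 * S * R"
  proof -
    have "Bm \<le> (\<integral>x. (108 * D ^ 3 * s ^ 3) * (?I x * norm (u x) ^ 3) + 48 * (cutoff R x * norm (u x) ^ 3 + cutoff R x * norm (B x) ^ 3) \<partial>lborel)"
      unfolding Bm_def
    proof (rule integral_mono)
      have t4: "csupp (4 * R) (\<lambda>x. ?l * test_function R x)"
        by (rule csupp_mono[OF csupp_mult_left[OF test_properties(2)[OF R0] continuous_on_const]]) (use R0 in simp)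
      have v4: "csupp (4 * R) (\<lambda>x. 2 * (cutoff R x * ?v x))"
        by (intro csupp_mult_left[OF csupp_cutoff_mult[OF R0]] continuous_on_const) (intro continuous_intros norms_continuous)
      show "integrable lborel (\<lambda>x. bellman (?l * test_function R x) (2 * (cutoff R x * ?v x)))"
        by (rule csupp_integrable[OF csupp_bellman[OF t4 v4]])
      show "integrable lborel (\<lambda>x. (108 * D ^ 3 * s ^ 3) * (?I x * norm (u x) ^ 3) + 48 * (cutoff R x * norm (u x) ^ 3 + cutoff R x * norm (B x) ^ 3))"
        by (intro Bochner_Integration.integrable_add integrable_mult_right iI ic)
      fix x
      have "\<bar>?l * test_function R x\<bar> \<le> ?l * (3 * D / R * (?I x * norm (u x)))"
        unfolding abs_mult using s0 R0 test_le[OF R0, of x] by (intro mult_mono) auto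
      also have "\<dots> = 3 * D * s * (?I x * norm (u x))" using R0 by simp
      finally have "\<bar>?l * test_function R x\<bar> ^ 3 \<le> (3 * D * s * (?I x * norm (u x))) ^ 3" by (intro power_mono) auto
      also have "\<dots> = 27 * D ^ 3 * s ^ 3 * (?I x * norm (u x) ^ 3)"
        by (simp add: power_mult_distrib indicator_def)
      finally have "\<bar>?l * test_function R x\<bar> ^ 3 \<le> 27 * D ^ 3 * s ^ 3 * (?I x * norm (u x) ^ 3)" .
      moreover have "bellman (?l * test_function R x) (2 * (cutoff R x * ?v x)) \<le> 4 * \<bar>?l * test_function R x\<bar> ^ 3 + 48 * (cutoff R x * (norm (u x) ^ 3 + norm (B x) ^ 3))"
        by (rule bellman_le_cubes) (simp_all add: cutoff_bounds)
      ultimately show "bellman (?l * test_function R x) (2 * (cutoff R x * ?v x)) \<le>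
         (108 * D ^ 3 * s ^ 3) * (?I x * norm (u x) ^ 3) + 48 * (cutoff R x * norm (u x) ^ 3 + cutoff R x * norm (B x) ^ 3)"
        unfolding distrib_left by linarith
    qed
    also have "\<dots> = (108 * D ^ 3 * s ^ 3) * (\<integral>x. ?I x * norm (u x) ^ 3 \<partial>lborel)
        + 48 * ((\<integral>x. cutoff R x * norm (u x) ^ 3 \<partial>lborel) + (\<integral>x. cutoff R x * norm (B x) ^ 3 \<partial>lborel))"
      by (simp only: Bochner_Integration.integral_add Bochner_Integration.integrable_add integrable_mult_right iI ic integral_mult_right_zero)
    also have "\<dots> \<le> (108 * D ^ 3 * s ^ 3) * (R * shell R) + 48 * (S * R + S * R)"
      unfolding shell_integral[OF R0] using D R0 s0 by (intro add_mono mult_left_mono growth_u growth_B R) auto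
    finally show ?thesis by (simp add: algebra_simps)
  qed
  have m: "mU / R^4 + mv / R^3 \<le> 3 * (ball_const + S) * R powr (- 4/3)"
  proof -
    let ?c = "ball_const + S"
    have c0: "0 \<le> ?c" using ball_const_nonneg S0 by simp
    have "mU \<le> ?c * R powr (7/3)" unfolding mU_def ball_const_def
      by (intro moments_le(1) norms_continuous growth_u R R0) auto
    then have "mU / R^4 \<le> ?c * R powr (7/3) / R^4" using R0 by (intro divide_right_mono) auto
    also have "\<dots> = ?c * R powr (- 5/3)"
    proof -
      have "R powr (7/3) / R^4 = R powr (- 5/3)" using R0 by (simp flip: powr_diff powr_numeral)
      then show ?thesis by (simp only: flip: times_divide_eq_right)
    qed
    also have "\<dots> \<le> ?c * R powr (- 4/3)" using c0 R by (intro mult_left_mono powr_mono) auto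
    finally have 1: "mU / R^4 \<le> ?c * R powr (- 4/3)" .
    have "mv = (\<integral>x. cutoff R x * (norm (u x))\<^sup>2 \<partial>lborel) + (\<integral>x. cutoff R x * (norm (B x))\<^sup>2 \<partial>lborel)"
      unfolding mv_def distrib_left using iv by simp
    also have "\<dots> \<le> ?c * R powr (5/3) + ?c * R powr (5/3)" unfolding ball_const_def
      by (intro add_mono moments_le(2) norms_continuous growth_u growth_B R R0) auto
    finally have "mv \<le> (2 * ?c) * R powr (5/3)" by (simp only: mult_2 distrib_right)
    then have "mv / R^3 \<le> (2 * ?c) * R powr (5/3) / R^3"
      by (rule divide_right_mono) (use R0 in simp)
    also have "\<dots> = (2 * ?c) * R powr (- 4/3)"
    proof -
      have "R powr (5/3) / R^3 = R powr (- 4/3)" using R0 by (simp flip: powr_diff powr_numeral)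
      then show ?thesis by (simp only: flip: times_divide_eq_right)
    qed
    finally have 2: "mv / R^3 \<le> (2 * ?c) * R powr (- 4/3)" .
    show ?thesis using 1 2 by (simp add: algebra_simps)
  qed
  have lower: "(mU / R^4 + mv / R^3) * T \<le> 9 * D * (ball_const + S) * (ball_const / s + s\<^sup>2 * shell R)"
  proof -
    have "(mU / R^4 + mv / R^3) * T \<le> (3 * (ball_const + S) * R powr (- 4/3)) * (3 * D * R powr (4/3) * (ball_const / s + s\<^sup>2 * shell R))"
    proof (rule mult_mono[OF m _ _ T0])
      show "T \<le> 3 * D * R powr (4/3) * (ball_const / s + s\<^sup>2 * shell R)" unfolding T_def by (rule integral_test_le[OF R s])
      show "0 \<le> 3 * (ball_const + S) * R powr (- 4/3)" using ball_const_nonneg S0 by simp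
    qed
    also have "\<dots> = 9 * D * (ball_const + S) * (R powr (- 4/3) * R powr (4/3)) * (ball_const / s + s\<^sup>2 * shell R)"
    proof -
      have "(3 * a * b) * (3 * d * c * e) = 9 * d * a * (b * c) * e" for a b c d e :: real by simp
      then show ?thesis .
    qed
    also have "R powr (- 4/3) * R powr (4/3) = 1" using R0 by (simp flip: powr_add)
    finally show ?thesis by simp
  qed
  have "?l * \<bar>\<integral>x. total_pressure x * test_function R x \<partial>lborel\<bar> \<le>
      Cp * (108 * D ^ 3 * s ^ 3 * (R * shell R) + 96 * S * R) + Cp * (?l * (9 * D * (ball_const + S) * (ball_const / s + s\<^sup>2 * shell R)))"
  proof (rule order_trans[OF est add_mono])
    show "Cp * Bm \<le> Cp * (108 * D ^ 3 * s ^ 3 * (R * shell R) + 96 * S * R)" using Cp(1) Bm by simp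
    have "Cp * (?l * ((mU / R^4 + mv / R^3) * T)) \<le> Cp * (?l * (9 * D * (ball_const + S) * (ball_const / s + s\<^sup>2 * shell R)))"
      using Cp(1) l lower by (intro mult_left_mono) auto
    then show "Cp * (mU / R^4 + mv / R^3) * (?l * T) \<le> Cp * (?l * (9 * D * (ball_const + S) * (ball_const / s + s\<^sup>2 * shell R)))"
      by (simp only: mult_ac)
  qed
  also have "\<dots> = ?l * (Cp * (108 * D ^ 3 * s\<^sup>2 * shell R + 96 * S / s) + Cp * (9 * D * (ball_const + S)) * (ball_const / s + s\<^sup>2 * shell R))"
  proof -
    have "108 * D ^ 3 * s ^ 3 * (R * shell R) + 96 * S * R = ?l * (108 * D ^ 3 * s\<^sup>2 * shell R + 96 * S / s)"
      using s0 by (simp add: power2_eq_square power3_eq_cube distrib_left)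
    then show ?thesis by (simp only: distrib_left mult_ac)
  qed
  finally show ?thesis using l by (simp only: mult_le_cancel_left_pos)
qed

end

lemma dissipation_bound:
  "\<exists>C\<ge>0. \<forall>R\<ge>1. \<forall>s\<ge>1. (\<integral>x. scaled_plateau R x * dissipation x \<partial>lborel) \<le>
     C * (R powr (- 1/3) + (1 + s\<^sup>2) * shell R + s * tail R + 1 / s)"
proof -
  obtain D where D: "0 < D"
    "\<And>R i x. 0 < R \<Longrightarrow> \<bar>partial i (scaled_plateau R) x\<bar> \<le> D / R * indicator (annulus R) x"
    "\<And>R i x. 0 < R \<Longrightarrow> \<bar>partial i (partial i (scaled_plateau R)) x\<bar> \<le> D / R\<^sup>2"
    using scaled_plateau_derivative_bounds by blast
  obtain Cp where Cp: "0 < Cp" "\<forall>Q v U g w H R. pressure_data Q v U g w H R \<longrightarrow>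
    \<bar>\<integral>x. Q x * g x \<partial>lborel\<bar> \<le> Cp * (\<integral>x. bellman (g x) (2 * (cutoff R x * v x)) \<partial>lborel) +
      Cp * ((\<integral>x. cutoff R x * U x \<partial>lborel) / R^4 + (\<integral>x. cutoff R x * v x \<partial>lborel) / R^3) * (\<integral>x. \<bar>g x\<bar> \<partial>lborel)"
    using pressure_estimate by blast
  define A1 where "A1 = 3 * D * (ball_const + S)"
  define A2 where "A2 = 6 * D + Cp * (108 * D ^ 3) + Cp * (9 * D * (ball_const + S))"
  define A3 where "A3 = 3 * D * (2 * S + C4) + Cp * (96 * S) + Cp * (9 * D * (ball_const + S)) * ball_const"
  have A: "0 \<le> A1" "0 \<le> A2" "0 \<le> A3" "6 * D \<le> A2"
    unfolding A1_def A2_def A3_def using D(1) Cp(1) ball_const_nonneg S0 C40 by simp_all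
  show ?thesis
  proof (intro exI conjI allI impI)
    show "0 \<le> A1 + A2 + A3" using A by simp
    fix R s :: real assume R: "1 \<le> R" and s: "1 \<le> s"
    have e0: "0 \<le> shell R" "0 \<le> tail R" using shell_nonneg[of R] tail_nonneg[of R] R by auto
    have "(\<integral>x. scaled_plateau R x * dissipation x \<partial>lborel) =
      (\<integral>x. energy_density x * laplacian (scaled_plateau R) x \<partial>lborel) + (\<integral>x. total_pressure x * test_function R x \<partial>lborel)
      + (\<integral>x. flux x \<bullet> grad (scaled_plateau R) x \<partial>lborel)"
      by (rule integrated_energy) (use R in simp)
    also have "\<dots> \<le> A1 * R powr (- 1/3)
      + (Cp * (108 * D ^ 3 * s\<^sup>2 * shell R + 96 * S / s) + Cp * (9 * D * (ball_const + S)) * (ball_const / s + s\<^sup>2 * shell R))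
      + 3 * D * ((1 + 2 * s\<^sup>2) * shell R + 2 * s * tail R + (2 * S + C4) / s)"
      unfolding A1_def
      by (intro add_mono abs_le_D1[OF viscous_term_le[OF D R]] abs_le_D1[OF pressure_term_le[OF D Cp R s]]
          abs_le_D1[OF flux_term_le[OF D R s]])
    also have "\<dots> = A1 * R powr (- 1/3) + (3 * D * shell R + A2 * (s\<^sup>2 * shell R)) + 6 * D * (s * tail R) + A3 * (1 / s)"
    proof -
      define L where "L = 9 * D * (ball_const + S)"
      define D3 where "D3 = D ^ 3"
      define q where "q = 1 / s"
      have q: "96 * S / s = 96 * S * q" "ball_const / s = ball_const * q" "(2 * S + C4) / s = (2 * S + C4) * q"
        by (simp_all add: q_def)
      show ?thesis
        unfolding A2_def A3_def L_def[symmetric] q q_def[symmetric] D3_def[symmetric] by algebra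
    qed
    also have "\<dots> \<le> A1 * R powr (- 1/3) + A2 * ((1 + s\<^sup>2) * shell R) + A2 * (s * tail R) + A3 * (1 / s)"
    proof -
      have "3 * D * shell R \<le> A2 * shell R" using e0 A(4) D(1) by (intro mult_right_mono) auto
      moreover have "6 * D * (s * tail R) \<le> A2 * (s * tail R)" using e0 A(4) s by (intro mult_right_mono) auto
      ultimately show ?thesis by (simp add: algebra_simps)
    qed
    also have "\<dots> \<le> (A1 + A2 + A3) * R powr (- 1/3) + (A1 + A2 + A3) * ((1 + s\<^sup>2) * shell R) + (A1 + A2 + A3) * (s * tail R) + (A1 + A2 + A3) * (1 / s)"
      using A e0 s by (intro add_mono mult_right_mono) auto
    finally show "(\<integral>x. scaled_plateau R x * dissipation x \<partial>lborel) \<le> (A1 + A2 + A3) * (R powr (- 1/3) + (1 + s\<^sup>2) * shell R + s * tail R + 1 / s)"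
      by (simp only: distrib_left)
  qed
qed

lemma tail_tendsto: "(tail \<longlongrightarrow> 0) at_top"
proof -
  have "((\<lambda>R. \<integral>x. indicator (annulus R) x * grad_B_sq x \<partial>lborel) \<longlongrightarrow> (\<integral>x. 0 \<partial>(lborel :: (real^3) measure))) at_top"
  proof (rule integral_dominated_convergence_at_top)
    have [measurable]: "grad_B_sq \<in> borel_measurable borel"
      by (rule borel_measurable_continuous_onI[OF continuous_grad_B_sq])
    show "(\<lambda>x. indicator (annulus R) x * grad_B_sq x) \<in> borel_measurable lborel" for R by measurable
    show "integrable lborel grad_B_sq" unfolding grad_B_sq_def by (intro Bochner_Integration.integrable_sum grad_B)
    show "\<forall>\<^sub>F R in at_top. AE x in lborel. norm (indicator (annulus R) x * grad_B_sq x) \<le> grad_B_sq x"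
      by (intro always_eventually allI AE_I2) (simp add: grad_B_sq_nonneg indicator_def)
    show "AE x in lborel. ((\<lambda>R. indicator (annulus R) x * grad_B_sq x) \<longlongrightarrow> 0) at_top"
    proof (intro AE_I2 tendsto_eventually)
      fix x :: "real^3"
      show "\<forall>\<^sub>F R in at_top. indicator (annulus R) x * grad_B_sq x = 0"
        using eventually_gt_at_top[of "2 * norm x"] by eventually_elim (simp add: annulus_def indicator_def)
    qed
  qed simp
  then show ?thesis unfolding tail_def[abs_def] by simp
qed

lemma dissipation_nonneg: "0 \<le> dissipation x"
  by (simp add: dissipation_def sum_nonneg)

text \<open>First \<open>R\<close> tends to infinity at fixed \<open>s\<close>, then \<open>s\<close> tends to infinity.\<close>

lemma dissipation_integral_zero:
  assumes r: "1 \<le> r"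
  shows "(\<integral>x. scaled_plateau r x * dissipation x \<partial>lborel) \<le> 0"
proof -
  obtain C where C: "0 \<le> C" "\<And>R s. 1 \<le> R \<Longrightarrow> 1 \<le> s \<Longrightarrow> (\<integral>x. scaled_plateau R x * dissipation x \<partial>lborel) \<le>
     C * (R powr (- 1/3) + (1 + s\<^sup>2) * shell R + s * tail R + 1 / s)"
    using dissipation_bound by blast
  let ?A = "\<integral>x. scaled_plateau r x * dissipation x \<partial>lborel"
  have bs: "?A \<le> C * (1 / s)" if s: "1 \<le> s" for s
  proof (rule tendsto_lowerbound)
    have p: "((\<lambda>R::real. R powr (- 1/3)) \<longlongrightarrow> 0) at_top"
      by (rule tendsto_neg_powr[OF _ filterlim_ident]) simp
    have sh: "(shell \<longlongrightarrow> 0) at_top" using annulus_u unfolding shell_def[abs_def] .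
    have "((\<lambda>R. C * (R powr (- 1/3) + (1 + s\<^sup>2) * shell R + s * tail R + 1 / s)) \<longlongrightarrow> C * (0 + (1 + s\<^sup>2) * 0 + s * 0 + 1 / s)) at_top"
      by (intro tendsto_intros p sh tail_tendsto)
    then show "((\<lambda>R. C * (R powr (- 1/3) + (1 + s\<^sup>2) * shell R + s * tail R + 1 / s)) \<longlongrightarrow> C * (1 / s)) at_top" by simp
    show "\<forall>\<^sub>F R in at_top. ?A \<le> C * (R powr (- 1/3) + (1 + s\<^sup>2) * shell R + s * tail R + 1 / s)"
      using eventually_ge_at_top[of "2 * r"]
    proof eventually_elim
      case (elim R)
      have R: "1 \<le> R" "0 < R" "0 < r" using elim r by auto
      have "?A \<le> (\<integral>x. scaled_plateau R x * dissipation x \<partial>lborel)"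
      proof (intro integral_mono csupp_integrable[OF csupp_mult_right[OF csupp_scaled_plateau continuous_dissipation]] mult_right_mono dissipation_nonneg R)
        show "scaled_plateau r x \<le> scaled_plateau R x" for x
        proof (cases "norm x \<le> r")
          case True
          then show ?thesis using elim scaled_plateau_bounds[of r x] R by (simp add: scaled_plateau_inside)
        next
          case False
          then show ?thesis using csupp_zero[OF csupp_scaled_plateau[OF R(3)], of x] scaled_plateau_bounds[of R x] by simp
        qed
      qed
      then show ?case using C(2)[OF R(1) s] by linarith
    qed
  qed simp
  have "((\<lambda>s::real. 1 / s) \<longlongrightarrow> 0) at_top"
    using tendsto_inverse_0_at_top[OF filterlim_ident] by (simp add: inverse_eq_divide)
  then have lim: "((\<lambda>s::real. C * (1 / s)) \<longlongrightarrow> 0) at_top" by (rule tendsto_mult_right_zero)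
  have "\<forall>\<^sub>F s in at_top. ?A \<le> C * (1 / s)"
    using eventually_ge_at_top[of "1::real"] by eventually_elim (rule bs)
  from tendsto_lowerbound[OF lim this] show ?thesis by simp
qed

lemma dissipation_zero: "dissipation x = 0"
proof (rule ccontr)
  assume "dissipation x \<noteq> 0"
  then have pos: "0 < dissipation x" using dissipation_nonneg[of x] by linarith
  define r where "r = 2 * norm x + 2"
  have r: "1 \<le> r" "0 < r" unfolding r_def using norm_ge_zero[of x] by linarith+
  let ?f = "\<lambda>x. scaled_plateau r x * dissipation x"
  have cs: "csupp r ?f" by (rule csupp_mult_right[OF csupp_scaled_plateau[OF r(2)] continuous_dissipation])
  have fx: "?f x = dissipation x" using scaled_plateau_inside[OF r(2), of x] by (simp add: r_def)
  have "isCont ?f x" using csupp_continuous[OF cs] by (simp add: continuous_on_eq_continuous_at)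
  then obtain d where d: "0 < d" "\<And>y. dist y x < d \<Longrightarrow> dist (?f y) (?f x) < dissipation x / 2"
    using pos unfolding continuous_at_eps_delta by (metis half_gt_zero)
  have low: "indicator (ball x d) y * (dissipation x / 2) \<le> ?f y" for y
  proof (cases "y \<in> ball x d")
    case True
    then have "dist (?f y) (?f x) < dissipation x / 2" by (intro d(2)) (simp add: dist_commute)
    then have "dissipation x / 2 \<le> ?f y" unfolding fx dist_real_def by arith
    then show ?thesis using True by simp
  next
    case False
    then show ?thesis using scaled_plateau_bounds dissipation_nonneg by simp
  qed
  have fin: "emeasure lborel (ball x d) < \<infinity>"
    using emeasure_lborel_ball_finite[of x d] by (simp add: top.not_eq_extremum)
  have "0 < measure lborel (ball x d) * (dissipation x / 2)"
    using content_ball_pos[OF d(1), of x] pos by simp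
  also have "\<dots> = (\<integral>y. indicator (ball x d) y * (dissipation x / 2) \<partial>lborel)" by simp
  also have "\<dots> \<le> (\<integral>y. ?f y \<partial>lborel)"
  proof (rule integral_mono[OF _ csupp_integrable[OF cs] low])
    show "integrable lborel (\<lambda>y. indicator (ball x d) y * (dissipation x / 2))"
      using fin by (intro integrable_mult_left integrable_real_indicator) auto
  qed
  finally show False using dissipation_integral_zero[OF r(1)] by simp
qed

lemma constant_if_gradient_zero:
  fixes f :: "real^3 \<Rightarrow> real"
  assumes "Ck 1 f" "\<And>i x. partial i f x = 0"
  shows "f x = f 0"
proof -
  have fd: "f differentiable (at z)" for z using assms(1) by simp
  have "\<exists>z. 0 < z \<and> z < 1 \<and> f (0 + 1 *\<^sub>R x) - f (0 + 0 *\<^sub>R x) = (1 - 0) * (\<Sum>i\<in>UNIV. x $ i * partial i f (0 + z *\<^sub>R x))"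
    by (rule MVT2[OF zero_less_one]) (rule has_real_derivative_along_line[OF fd])
  then show ?thesis using assms(2) by auto
qed

lemma solution_constant: "u x = u 0" "B x = B 0"
proof -
  have z: "(partial j (\<lambda>y. u y $ i) x)\<^sup>2 + (partial j (\<lambda>y. B y $ i) x)\<^sup>2 = 0" for i j x
  proof -
    have "(\<Sum>i\<in>UNIV. (partial j (\<lambda>y. u y $ i) x)\<^sup>2 + (partial j (\<lambda>y. B y $ i) x)\<^sup>2) = 0"
      using dissipation_zero[of x] unfolding dissipation_def by (subst (asm) sum_nonneg_eq_0_iff) (auto simp: sum_nonneg)
    then show ?thesis by (subst (asm) sum_nonneg_eq_0_iff) auto
  qed
  have "partial j (\<lambda>y. u y $ i) x = 0" "partial j (\<lambda>y. B y $ i) x = 0" for i j x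
    using z[of j i x] by (simp_all add: sum_power2_eq_zero_iff)
  then show "u x = u 0" "B x = B 0"
    using constant_if_gradient_zero[OF Ck_u] constant_if_gradient_zero[OF Ck_B] by (simp_all add: vec_eq_iff)
qed

lemma constant_zero_if_growth:
  fixes c :: real
  assumes c: "0 \<le> c" and S: "\<And>R. 1 \<le> R \<Longrightarrow> (\<integral>x. cutoff R x * c ^ 3 \<partial>lborel) \<le> S * R"
  shows "c = 0"
proof (rule ccontr)
  assume "c \<noteq> 0"
  then have c3: "0 < c ^ 3" using c by simp
  define m where "m = measure lborel (ball (0::real^3) 1)"
  have m: "0 < m" unfolding m_def using content_ball_pos[of 1 "0::real^3"] by simp
  have le: "m * c ^ 3 * R\<^sup>2 \<le> S" if R: "1 \<le> R" for R
  proof -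
    have R0: "0 < R" using R by simp
    have fin: "emeasure lborel (ball (0::real^3) R) < \<infinity>"
      using emeasure_lborel_ball_finite[of "0::real^3" R] by (simp add: top.not_eq_extremum)
    have "R ^ 3 * m * c ^ 3 = (\<integral>x. indicator (ball (0::real^3) R) x * c ^ 3 \<partial>lborel)"
      using measure_lborel_ball[of R] R0 by (simp add: m_def)
    also have "\<dots> \<le> (\<integral>x. cutoff R x * c ^ 3 \<partial>lborel)"
    proof (rule integral_mono)
      show "integrable lborel (\<lambda>x. indicator (ball (0::real^3) R) x * c ^ 3)"
        using fin by (intro integrable_mult_left integrable_real_indicator) auto
      show "integrable lborel (\<lambda>x. cutoff R x * c ^ 3)" by (rule csupp_integrable[OF csupp_cutoff_mult[OF R0 continuous_on_const]])
      show "indicator (ball 0 R) x * c ^ 3 \<le> cutoff R x * c ^ 3" for x :: "real^3"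
        using c R0 cutoff_bounds[of R x] by (intro mult_right_mono) (auto simp: indicator_def cutoff_inside)
    qed
    also have "\<dots> \<le> S * R" by (rule S[OF R])
    finally have "(m * c ^ 3 * R\<^sup>2) * R \<le> S * R" by (simp add: power2_eq_square power3_eq_cube mult_ac)
    then show ?thesis using R0 by (simp only: mult_le_cancel_right_pos)
  qed
  define R where "R = 1 + \<bar>S\<bar> / (m * c ^ 3)"
  have mc: "0 < m * c ^ 3" using m c3 by simp
  have R1: "1 \<le> R" unfolding R_def using mc by simp
  have "R \<le> R\<^sup>2" using R1 by (simp add: power2_eq_square)
  then have "m * c ^ 3 * R \<le> m * c ^ 3 * R\<^sup>2" using mc by (intro mult_left_mono) auto
  moreover have "m * c ^ 3 * R = m * c ^ 3 + \<bar>S\<bar>"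
  proof -
    have "q * (1 + t / q) = q + t" if "0 < q" for q t :: real using that by (simp add: distrib_left)
    from this[OF mc] show ?thesis unfolding R_def .
  qed
  ultimately show False using le[OF R1] mc by linarith
qed

lemma solution_zero: "u x = 0" "B x = 0"
proof -
  have cu: "(\<lambda>x. cutoff R x * norm (u x) ^ 3) = (\<lambda>x. cutoff R x * norm (u 0) ^ 3)"
    and cB: "(\<lambda>x. cutoff R x * norm (B x) ^ 3) = (\<lambda>x. cutoff R x * norm (B 0) ^ 3)" for R
    by (rule ext, rule arg_cong[OF solution_constant(1), of "\<lambda>v. cutoff R _ * norm v ^ 3"])
      (rule ext, rule arg_cong[OF solution_constant(2), of "\<lambda>v. cutoff R _ * norm v ^ 3"])
  have "norm (u 0) = 0" by (rule constant_zero_if_growth[OF norm_ge_zero growth_u[unfolded cu]])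
  moreover have "norm (B 0) = 0" by (rule constant_zero_if_growth[OF norm_ge_zero growth_B[unfolded cB]])
  ultimately show "u x = 0" "B x = 0" using solution_constant(1)[of x] solution_constant(2)[of x] by simp_all
qed

end

section \<open>The Liouville theorem\<close>

lemma components_growth:
  fixes v :: "real^3 \<Rightarrow> real^3"
  assumes v: "\<And>i. continuous_on UNIV (\<lambda>x. v x $ i)"
    and S: "\<And>i. \<exists>S\<ge>0. \<forall>R\<ge>1. (\<integral>x. cutoff R x * \<bar>v x $ i\<bar> ^ 3 \<partial>lborel) \<le> S * R"
  shows "\<exists>S\<ge>0. \<forall>R\<ge>1. (\<integral>x. cutoff R x * norm (v x) ^ 3 \<partial>lborel) \<le> S * R"
proof -
  obtain T where T: "\<And>i. 0 \<le> T i" "\<And>i R. 1 \<le> R \<Longrightarrow> (\<integral>x. cutoff R x * \<bar>v x $ i\<bar> ^ 3 \<partial>lborel) \<le> T i * R"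
  proof -
    have "\<forall>i. \<exists>S. 0 \<le> S \<and> (\<forall>R\<ge>1. (\<integral>x. cutoff R x * \<bar>v x $ i\<bar> ^ 3 \<partial>lborel) \<le> S * R)"
      using S by simp
    from choice[OF this] show ?thesis using that by blast
  qed
  have cv: "continuous_on UNIV (\<lambda>x. norm (v x))"
    unfolding norm_vec_def L2_set_def by (intro continuous_intros v)
  have "(\<integral>x. cutoff R x * norm (v x) ^ 3 \<partial>lborel) \<le> (9 * (\<Sum>i\<in>UNIV. T i)) * R" if R: "1 \<le> R" for R
  proof -
    have R0: "0 < R" using R by simp
    have i: "integrable lborel (\<lambda>x. cutoff R x * \<bar>v x $ i\<bar> ^ 3)" for i
      by (intro csupp_integrable[OF csupp_cutoff_mult[OF R0]] continuous_intros v)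
    have "(\<integral>x. cutoff R x * norm (v x) ^ 3 \<partial>lborel) \<le> (\<integral>x. 9 * (\<Sum>i\<in>UNIV. cutoff R x * \<bar>v x $ i\<bar> ^ 3) \<partial>lborel)"
    proof (rule integral_mono)
      show "integrable lborel (\<lambda>x. cutoff R x * norm (v x) ^ 3)"
        by (intro csupp_integrable[OF csupp_cutoff_mult[OF R0]] continuous_intros cv)
      show "integrable lborel (\<lambda>x. 9 * (\<Sum>i\<in>UNIV. cutoff R x * \<bar>v x $ i\<bar> ^ 3))"
        by (intro integrable_mult_right Bochner_Integration.integrable_sum i)
      show "cutoff R x * norm (v x) ^ 3 \<le> 9 * (\<Sum>i\<in>UNIV. cutoff R x * \<bar>v x $ i\<bar> ^ 3)" for x
        using mult_left_mono[OF norm_cube_le[of "v x"] cutoff_bounds(1)[of R x]] by (simp add: sum_distrib_left mult_ac)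
    qed
    also have "\<dots> = 9 * (\<Sum>i\<in>UNIV. \<integral>x. cutoff R x * \<bar>v x $ i\<bar> ^ 3 \<partial>lborel)"
      by (simp add: i Bochner_Integration.integral_sum)
    also have "\<dots> \<le> 9 * (\<Sum>i\<in>UNIV. T i * R)" by (intro mult_left_mono sum_mono T R) auto
    finally show ?thesis by (simp only: mult.assoc sum_distrib_right)
  qed
  moreover have "0 \<le> 9 * (\<Sum>i\<in>UNIV. T i)" using T(1) by (simp add: sum_nonneg)
  ultimately show ?thesis by blast
qed

theorem theorem2:
  fixes u B :: "real^3 \<Rightarrow> real^3" and P :: "real^3 \<Rightarrow> real" and p \<gamma> :: real
  assumes "0 < \<gamma>" and "\<gamma> < 3" and "3 \<le> p"
    and "smooth u" and "smooth B" and "smooth P"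
    and "hall_mhd_solution u B P"
    and "\<And>j. vec_in (partial j B) (Lp 2)"
    and "vec_in u (morrey0 p \<gamma>)"
    and "vec_in B (morrey p \<gamma>)"
    and "\<eta> p \<gamma> = 0"
  shows "\<forall>x. u x = 0 \<and> B x = 0"
proof -
  have "\<gamma> + 2 * p / 3 - 3 = \<eta> p \<gamma> * p" using assms(3) by (simp add: \<eta>_def field_simps)
  then have g: "\<gamma> = 3 - 2 * p / 3" using assms(11) by simp
  interpret hall_mhd u B P using assms(4-7) by unfold_locales
  have cu: "continuous_on UNIV (\<lambda>x. u x $ i)" and cB: "continuous_on UNIV (\<lambda>x. B x $ i)" for i
    using Ck_continuous[OF Ck_u] Ck_continuous[OF Ck_B] by blast+
  have uM0: "(\<lambda>x. u x $ i) \<in> morrey0 p \<gamma>" and BM: "(\<lambda>x. B x $ i) \<in> morrey p \<gamma>" for i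
    using assms(9,10) by (simp_all add: vec_in_def)
  then have uM: "(\<lambda>x. u x $ i) \<in> morrey p \<gamma>" for i by (simp add: morrey0_def)
  obtain Su where Su: "0 \<le> Su" "\<And>R. 1 \<le> R \<Longrightarrow> (\<integral>x. cutoff R x * norm (u x) ^ 3 \<partial>lborel) \<le> Su * R"
    using components_growth[OF cu morrey_cube_growth[OF assms(3) g cu uM]] by blast
  obtain SB where SB: "0 \<le> SB" "\<And>R. 1 \<le> R \<Longrightarrow> (\<integral>x. cutoff R x * norm (B x) ^ 3 \<partial>lborel) \<le> SB * R"
    using components_growth[OF cB morrey_cube_growth[OF assms(3) g cB BM]] by blast
  have gB: "integrable lborel (grad_sq (\<lambda>x. B x $ i))" for i
    unfolding grad_sq_def
  proof (rule Bochner_Integration.integrable_sum)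
    fix j
    have Bd: "B differentiable (at x)" for x using smooth_Ck[OF smooth_B, of 1] by simp
    have eq: "(\<lambda>x. partial j B x $ i) = partial j (\<lambda>y. B y $ i)"
      by (rule ext) (rule partial_vec_component[OF Bd])
    have "(\<lambda>x. partial j B x $ i) \<in> Lp 2" using assms(8) by (simp add: vec_in_def)
    then have "integrable lebesgue (\<lambda>x. \<bar>partial j (\<lambda>y. B y $ i) x\<bar> powr 2)" unfolding eq Lp_def by simp
    then have int: "integrable lebesgue (\<lambda>x. (partial j (\<lambda>y. B y $ i) x)\<^sup>2)" by simp
    have "(\<lambda>x. (partial j (\<lambda>y. B y $ i) x)\<^sup>2) \<in> borel_measurable lborel"
      by (simp add: borel_measurable_continuous_onI continuous_on_power Ck_continuous[OF Ck_partial_B])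
    from integrable_completion[OF this] int show "integrable lborel (\<lambda>x. (partial j (\<lambda>y. B y $ i) x)\<^sup>2)" by simp
  qed
  have B4: "\<exists>C\<ge>0. \<forall>R\<ge>1. (\<integral>x. cutoff R x * (B x $ i) ^ 4 \<partial>lborel) \<le> C * R\<^sup>2" for i
  proof -
    obtain S where "\<And>R. 1 \<le> R \<Longrightarrow> (\<integral>x. cutoff R x * \<bar>B x $ i\<bar> ^ 3 \<partial>lborel) \<le> S * R"
      using morrey_cube_growth[OF assms(3) g cB BM] by blast
    then show ?thesis by (rule fourth_power_growth[OF Ck_B gB])
  qed
  obtain c4 where c4: "\<And>i. 0 \<le> c4 i" "\<And>i R. 1 \<le> R \<Longrightarrow> (\<integral>x. cutoff R x * (B x $ i) ^ 4 \<partial>lborel) \<le> c4 i * R\<^sup>2"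
  proof -
    have "\<forall>i. \<exists>C. 0 \<le> C \<and> (\<forall>R\<ge>1. (\<integral>x. cutoff R x * (B x $ i) ^ 4 \<partial>lborel) \<le> C * R\<^sup>2)"
      using B4 by simp
    from choice[OF this] show ?thesis using that by blast
  qed
  interpret hall_mhd_growth u B P "Su + SB" "3 * (\<Sum>i\<in>UNIV. c4 i)"
  proof unfold_locales
    show "0 \<le> Su + SB" using Su SB by simp
    show "0 \<le> 3 * (\<Sum>i\<in>UNIV. c4 i)" using c4 by (simp add: sum_nonneg)
    show "(\<integral>x. cutoff R x * norm (u x) ^ 3 \<partial>lborel) \<le> (Su + SB) * R"
      "(\<integral>x. cutoff R x * norm (B x) ^ 3 \<partial>lborel) \<le> (Su + SB) * R" if "1 \<le> R" for R
      using Su(2)[OF that] SB(2)[OF that] mult_nonneg_nonneg[OF Su(1), of R] mult_nonneg_nonneg[OF SB(1), of R] that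
      unfolding distrib_right by linarith+
    show "(\<integral>x. cutoff R x * norm (B x) ^ 4 \<partial>lborel) \<le> 3 * (\<Sum>i\<in>UNIV. c4 i) * R\<^sup>2" if R: "1 \<le> R" for R
    proof -
      have R0: "0 < R" using R by simp
      have i: "integrable lborel (\<lambda>x. cutoff R x * (B x $ i) ^ 4)" for i
        by (intro csupp_integrable[OF csupp_cutoff_mult[OF R0]] continuous_intros cB)
      have "(\<integral>x. cutoff R x * norm (B x) ^ 4 \<partial>lborel) \<le> (\<integral>x. 3 * (\<Sum>i\<in>UNIV. cutoff R x * (B x $ i) ^ 4) \<partial>lborel)"
      proof (rule integral_mono)
        show "integrable lborel (\<lambda>x. cutoff R x * norm (B x) ^ 4)"
          by (intro csupp_integrable[OF csupp_cutoff_mult[OF R0]] continuous_intros continuous_fields)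
        show "integrable lborel (\<lambda>x. 3 * (\<Sum>i\<in>UNIV. cutoff R x * (B x $ i) ^ 4))"
          by (intro integrable_mult_right Bochner_Integration.integrable_sum i)
        show "cutoff R x * norm (B x) ^ 4 \<le> 3 * (\<Sum>i\<in>UNIV. cutoff R x * (B x $ i) ^ 4)" for x
          using mult_left_mono[OF norm_fourth_le[of "B x"] cutoff_bounds(1)[of R x]] by (simp add: sum_distrib_left mult_ac)
      qed
      also have "\<dots> = 3 * (\<Sum>i\<in>UNIV. \<integral>x. cutoff R x * (B x $ i) ^ 4 \<partial>lborel)"
        by (simp add: i Bochner_Integration.integral_sum)
      also have "\<dots> \<le> 3 * (\<Sum>i\<in>UNIV. c4 i * R\<^sup>2)" by (intro mult_left_mono sum_mono c4 R) auto
      finally show ?thesis by (simp only: mult.assoc sum_distrib_right)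
    qed
    show "integrable lborel (grad_sq (\<lambda>x. B x $ i))" for i by (rule gB)
    have "((\<lambda>R. 9 * (\<Sum>i\<in>UNIV. (1 / R) * (\<integral>x. indicator (annulus R) x * \<bar>u x $ i\<bar>^3 \<partial>lborel))) \<longlongrightarrow> 9 * (\<Sum>i\<in>(UNIV::3 set). 0)) at_top"
      by (intro tendsto_intros morrey0_annulus_cube[OF assms(3) g cu uM0])
    then have lim: "((\<lambda>R. 9 * (\<Sum>i\<in>UNIV. (1 / R) * (\<integral>x. indicator (annulus R) x * \<bar>u x $ i\<bar>^3 \<partial>lborel))) \<longlongrightarrow> 0) at_top" by simp
    show "((\<lambda>R. (1 / R) * (\<integral>x. indicator (annulus R) x * norm (u x) ^ 3 \<partial>lborel)) \<longlongrightarrow> 0) at_top"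
    proof (rule Lim_null_comparison[OF _ lim])
      show "\<forall>\<^sub>F R in at_top. norm ((1 / R) * (\<integral>x. indicator (annulus R) x * norm (u x) ^ 3 \<partial>lborel)) \<le>
          9 * (\<Sum>i\<in>UNIV. (1 / R) * (\<integral>x. indicator (annulus R) x * \<bar>u x $ i\<bar>^3 \<partial>lborel))"
        using eventually_gt_at_top[of 0]
      proof eventually_elim
        case (elim R)
        have i: "integrable lborel (\<lambda>x. indicator (annulus R) x * \<bar>u x $ i\<bar>^3)" for i
          by (intro integrable_indicator_mult annulus_borel compact_imp_bounded compact_annulus continuous_intros cu)
        have "(\<integral>x. indicator (annulus R) x * norm (u x) ^ 3 \<partial>lborel) \<le> (\<integral>x. 9 * (\<Sum>i\<in>UNIV. indicator (annulus R) x * \<bar>u x $ i\<bar>^3) \<partial>lborel)"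
        proof (rule integral_mono)
          show "integrable lborel (\<lambda>x. indicator (annulus R) x * norm (u x) ^ 3)"
            by (intro integrable_indicator_mult annulus_borel compact_imp_bounded compact_annulus continuous_intros continuous_fields)
          show "integrable lborel (\<lambda>x. 9 * (\<Sum>i\<in>UNIV. indicator (annulus R) x * \<bar>u x $ i\<bar>^3))"
            by (intro integrable_mult_right Bochner_Integration.integrable_sum i)
          show "indicator (annulus R) x * norm (u x) ^ 3 \<le> 9 * (\<Sum>i\<in>UNIV. indicator (annulus R) x * \<bar>u x $ i\<bar>^3)" for x
            using norm_cube_le[of "u x"] by (simp add: indicator_def)
        qed
        also have "\<dots> = 9 * (\<Sum>i\<in>UNIV. \<integral>x. indicator (annulus R) x * \<bar>u x $ i\<bar>^3 \<partial>lborel)"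
          by (simp only: integral_mult_right_zero Bochner_Integration.integral_sum i)
        finally have "(1 / R) * (\<integral>x. indicator (annulus R) x * norm (u x) ^ 3 \<partial>lborel) \<le>
            (1 / R) * (9 * (\<Sum>i\<in>UNIV. \<integral>x. indicator (annulus R) x * \<bar>u x $ i\<bar>^3 \<partial>lborel))"
          using elim by (intro mult_left_mono) auto
        moreover have "0 \<le> (1 / R) * (\<integral>x. indicator (annulus R) x * norm (u x) ^ 3 \<partial>lborel)"
          using elim by (intro mult_nonneg_nonneg Bochner_Integration.integral_nonneg) auto
        moreover have "(1 / R) * (9 * (\<Sum>i\<in>UNIV. \<integral>x. indicator (annulus R) x * \<bar>u x $ i\<bar>^3 \<partial>lborel)) =
            9 * (\<Sum>i\<in>UNIV. (1 / R) * (\<integral>x. indicator (annulus R) x * \<bar>u x $ i\<bar>^3 \<partial>lborel))"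
          by (simp only: sum_distrib_left mult.left_commute)
        ultimately show ?case unfolding real_norm_def by (simp only: abs_of_nonneg)
      qed
    qed
  qed
  show ?thesis using solution_zero by blast
qed

end
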